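(* Let $\Gamma$ be the graph of an Ammann--Beenker tiling of $\mathbb{R}^2$ (as defined in the context), with integrated density of states $k_\Gamma$, and let $k_\Gamma(E\pm)$ denote the one-sided limits of $k_\Gamma$ at $E$. Then $$k_\Gamma(4+)-k_\Gamma(4-)\ \ge\ 1270-898\sqrt2,\qquad k_\Gamma(6+)-k_\Gamma(6-)\ \ge\ 116-82\sqrt2.$$
   Context: **Graphs, Laplacian, IDS.** The graph $\Gamma=(\mathcal{V},\mathcal{E})$ of a tiling of $\mathbb{R}^2$ by polygons has one vertex per tile; two vertices are joined ($u\sim v$) iff the corresponding (distinct) tiles share at least one edge. The Laplacian on $\ell^2(\mathcal{V})$ is $[\Delta_\Gamma\psi](v)=\sum_{u\sim v}(\psi(v)-\psi(u))$; the same formula defines the Laplacian of a finite graph. Let $\mathcal{V}_n\subseteq\mathcal{V}$ be the finite set of tiles meeting the closed ball of radius $n$ about the origin, $\Gamma_n$ the subgraph induced on $\mathcal{V}_n$, $\Delta_n$ its Laplacian, and $\nu_n(B)=\frac{1}{\#\mathcal{V}_n}\mathrm{Tr}\,\chi_B(\Delta_n)$ for Borel $B\subseteq\mathbb{R}$. For the tilings below it is known that $\nu_n$ converges weak-$*$ to a probability measure $\nu_\Gamma$ (the density of states measure), independent of the choice of suitable exhaustion. The integrated density of states is $k_\Gamma(E)=\nu_\Gamma((-\infty,E])$. **Ammann--Beenker tilings.** Let $s=1+\sqrt2$. Consider rhombi $R(A,B,C,D)$ with side length 1 and angle $45^\circ$ at $A$ and $C$ (vertices in cyclic order), and half-squares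 $T(V,S,W)$: right isosceles triangles with right angle at $S$ and legs $|VS|=|SW|=1$, with ordered vertices; both orientations are allowed. The substitution enlarges by the factor $s$ and dissects as follows (written before enlarging). $R(A,B,C,D)$, with $u=(B-A)/s$ and $v=(D-A)/s$, becomes the rhombi $R(A,A+u,A+u+v,A+v)$, $R(C,C-u,C-u-v,C-v)$, $R(B,A+u+v,D,C-u-v)$ and the half-squares $T(B,A+u+v,A+u)$, $T(D,A+u+v,A+v)$, $T(B,C-u-v,C-v)$, $T(D,C-u-v,C-u)$. $T(V,S,W)$, with $p=(S-V)/s$, $q=(W-S)/s$, $r=(p+q)/\sqrt2$ and $c=V+p+q+r$, becomes the rhombi $R(V,V+p,V+p+r,V+r)$, $R(S,S+q,c,V+p+r)$ and the half-squares $T(c,V+p+r,V+r)$, $T(S,V+p+r,V+p)$, $T(W,c,S+q)$. A tiling of $\mathbb{R}^2$ by such rhombi and half-squares is associated with this substitution if each of its finite patches occurs, up to rotation and translation, in some iterate of the substitution applied to a single tile. In such a tiling each half-square $T(V,S,W)$ shares its hypotenuse $VW$ with its mirror image in the hypotenuse; replacing each such pair by its union (a unit square) gives a tiling by rhombi and squares, called an Ammann--Beenker tiling. *)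

theory Defs
  imports "HOL-Probability.Probability"
begin

section \<open>Rhombi, half-squares and the substitution\<close>

text \<open>
  The plane is the type \<^typ>\<open>complex\<close>. The rhombus \<open>R(A,B,C,D)\<close> is the same tile as
  \<open>R(C,D,A,B)\<close>, \<open>R(A,D,C,B)\<close> and \<open>R(C,B,A,D)\<close>, so it is recorded as the pair of the set \<open>{A,C}\<close> of its
  acute and the set \<open>{B,D}\<close> of its obtuse vertices. A half-square is an ordered triple: \<open>T(V,S,W)\<close> and
  \<open>T(W,S,V)\<close> are the same triangle but are dissected differently, hence they are different tiles.
\<close>

datatype tile = Rhombus "complex set" "complex set" | HalfSquare complex complex complex

definition rhombus :: "complex \<Rightarrow> complex \<Rightarrow> complex \<Rightarrow> complex \<Rightarrow> tile" where
  "rhombus A B C D = Rhombus {A, C} {B, D}"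

definition is_rhombus :: "complex \<Rightarrow> complex \<Rightarrow> complex \<Rightarrow> complex \<Rightarrow> bool" where
  "is_rhombus A B C D \<longleftrightarrow>
     B - A = C - D \<and> dist A B = 1 \<and> dist A D = 1 \<and> (B - A) \<bullet> (D - A) = cos (pi / 4)"

definition is_half_square :: "complex \<Rightarrow> complex \<Rightarrow> complex \<Rightarrow> bool" where
  "is_half_square V S W \<longleftrightarrow> dist V S = 1 \<and> dist S W = 1 \<and> (V - S) \<bullet> (W - S) = 0"

definition tiles :: "tile set" where
  "tiles = {rhombus A B C D |A B C D. is_rhombus A B C D}
         \<union> {HalfSquare V S W |V S W. is_half_square V S W}"

fun support :: "tile \<Rightarrow> complex set" where
  "support (Rhombus P Q) = convex hull (P \<union> Q)"
| "support (HalfSquare V S W) = convex hull {V, S, W}"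

fun map_tile :: "(complex \<Rightarrow> complex) \<Rightarrow> tile \<Rightarrow> tile" where
  "map_tile f (Rhombus P Q) = Rhombus (f ` P) (f ` Q)"
| "map_tile f (HalfSquare V S W) = HalfSquare (f V) (f S) (f W)"

definition silver :: real where
  "silver = 1 + sqrt 2"

definition rhombus_pieces :: "complex \<Rightarrow> complex \<Rightarrow> complex \<Rightarrow> complex \<Rightarrow> tile set" where
  "rhombus_pieces A B C D =
     (let u = (B - A) /\<^sub>R silver; v = (D - A) /\<^sub>R silver in
      {rhombus A (A + u) (A + u + v) (A + v),
       rhombus C (C - u) (C - u - v) (C - v),
       rhombus B (A + u + v) D (C - u - v),
       HalfSquare B (A + u + v) (A + u),
       HalfSquare D (A + u + v) (A + v),
       HalfSquare B (C - u - v) (C - v),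
       HalfSquare D (C - u - v) (C - u)})"

definition half_square_pieces :: "complex \<Rightarrow> complex \<Rightarrow> complex \<Rightarrow> tile set" where
  "half_square_pieces V S W =
     (let p = (S - V) /\<^sub>R silver; q = (W - S) /\<^sub>R silver; r = (p + q) /\<^sub>R sqrt 2;
          c = V + p + q + r in
      {rhombus V (V + p) (V + p + r) (V + r),
       rhombus S (S + q) c (V + p + r),
       HalfSquare c (V + p + r) (V + r),
       HalfSquare S (V + p + r) (V + p),
       HalfSquare W c (S + q)})"

text \<open>
  The union in the first equation runs over the namings \<open>R(A,B,C,D)\<close> of one rhombus; they all
  yield the same seven pieces (lemma \<open>dissect_rhombus\<close>).
\<close>

fun dissect :: "tile \<Rightarrow> tile set" where
  "dissect (Rhombus P Q) =
     \<Union> {rhombus_pieces A B C D |A B C D. Rhombus P Q = rhombus A B C D}"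
| "dissect (HalfSquare V S W) = half_square_pieces V S W"

lemma rhombus_relabel:
  "rhombus A D C B = rhombus A B C D" "rhombus C B A D = rhombus A B C D"
  by (simp_all add: rhombus_def insert_commute)

lemma rhombus_pieces_swap_obtuse: "rhombus_pieces A D C B = rhombus_pieces A B C D"
proof -
  define u v where "u = (B - A) /\<^sub>R silver" and "v = (D - A) /\<^sub>R silver"
  have *: "A + v + u = A + u + v" "C - v - u = C - u - v"
    by simp_all
  show ?thesis
    unfolding rhombus_pieces_def Let_def u_def[symmetric] v_def[symmetric] *
      rhombus_relabel(1)[of A "A + v"] rhombus_relabel(1)[of C "C - v"]
      rhombus_relabel(2)[of D "A + u + v" B]
    by blast
qed

lemma rhombus_pieces_swap_acute:
  assumes "B - A = C - D"
  shows "rhombus_pieces C B A D = rhombus_pieces A B C D"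
proof -
  define u v where "u = (B - A) /\<^sub>R silver" and "v = (D - A) /\<^sub>R silver"
  have "B - C = - (D - A)" "D - C = - (B - A)"
    using assms by (simp_all add: algebra_simps)
  then have uv: "(B - C) /\<^sub>R silver = - v" "(D - C) /\<^sub>R silver = - u"
    unfolding u_def v_def by (metis scaleR_minus_right)+
  have *: "C - v + - u = C - u - v" "A + v - - u = A + u + v" "C + - v = C - v"
    "C + - u = C - u" "A - - v = A + v" "A - - u = A + u"
    by simp_all
  show ?thesis
    unfolding rhombus_pieces_def Let_def uv u_def[symmetric] v_def[symmetric] *
      rhombus_relabel(1)[of A "A + v"] rhombus_relabel(1)[of C "C - v"]
      rhombus_relabel(1)[of B "C - u - v"]
    by blast
qed

lemma dissect_rhombus:
  assumes "is_rhombus A B C D"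
  shows "dissect (rhombus A B C D) = rhombus_pieces A B C D"
proof -
  have par: "B - A = C - D"
    using assms by (simp add: is_rhombus_def)
  have eq: "rhombus_pieces A' B' C' D' = rhombus_pieces A B C D"
    if "rhombus A B C D = rhombus A' B' C' D'" for A' B' C' D'
  proof -
    from that consider
        "A' = A" "C' = C" "B' = B" "D' = D" | "A' = C" "C' = A" "B' = B" "D' = D"
      | "A' = A" "C' = C" "B' = D" "D' = B" | "A' = C" "C' = A" "B' = D" "D' = B"
      by (auto simp: rhombus_def doubleton_eq_iff)
    then show ?thesis
      using rhombus_pieces_swap_acute[OF par] rhombus_pieces_swap_obtuse
      by cases simp_all
  qed
  have "dissect (rhombus A B C D) =
      \<Union> {rhombus_pieces A' B' C' D' |A' B' C' D'. rhombus A B C D = rhombus A' B' C' D'}"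
    by (simp add: rhombus_def)
  also have "\<dots> = \<Union> {rhombus_pieces A B C D}"
    by (rule arg_cong[where f = Union]) (use eq in blast)
  finally show ?thesis by simp
qed

definition substitution :: "tile set \<Rightarrow> tile set" where
  "substitution X = map_tile (\<lambda>z. silver *\<^sub>R z) ` (\<Union>t\<in>X. dissect t)"


section \<open>Ammann--Beenker tilings\<close>

definition tiles_plane :: "tile set \<Rightarrow> bool" where
  "tiles_plane X \<longleftrightarrow> X \<subseteq> tiles \<and> (\<Union>t\<in>X. support t) = UNIV \<and>
     (\<forall>t\<in>X. \<forall>t'\<in>X. t \<noteq> t' \<longrightarrow> interior (support t) \<inter> interior (support t') = {})"

text \<open>The maps \<open>z \<mapsto> a z + b\<close> with \<open>|a| = 1\<close> are the rotations followed by translations.\<close>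

definition occurs_in :: "tile set \<Rightarrow> tile set \<Rightarrow> bool" where
  "occurs_in P X \<longleftrightarrow> (\<exists>a b. cmod a = 1 \<and> map_tile (\<lambda>z. a * z + b) ` P \<subseteq> X)"

definition associated_tiling :: "tile set \<Rightarrow> bool" where
  "associated_tiling X \<longleftrightarrow> tiles_plane X \<and>
     (\<forall>P. finite P \<and> P \<subseteq> X \<longrightarrow>
        (\<exists>t\<in>tiles. \<exists>n. occurs_in P ((substitution ^^ n) {t})))"

text \<open>
  The reflection in the line \<open>VW\<close> sends the right-angled vertex \<open>S\<close> of \<open>T(V,S,W)\<close> to \<open>V + W - S\<close>.
  In an associated tiling every half-square occurs together with this mirror image, so no tile is lost.
\<close>

definition merge_half_squares :: "tile set \<Rightarrow> complex set set" where
  "merge_half_squares X =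
     {support (rhombus A B C D) |A B C D. rhombus A B C D \<in> X}
   \<union> {support (HalfSquare V S W) \<union> support (HalfSquare V (V + W - S) W) |V S W.
        HalfSquare V S W \<in> X \<and> HalfSquare V (V + W - S) W \<in> X}"

definition ammann_beenker_tiling :: "complex set set \<Rightarrow> bool" where
  "ammann_beenker_tiling \<T> \<longleftrightarrow> (\<exists>X. associated_tiling X \<and> \<T> = merge_half_squares X)"


section \<open>Graph, Laplacian and density of states\<close>

definition tile_adjacent :: "complex set \<Rightarrow> complex set \<Rightarrow> bool" where
  "tile_adjacent P Q \<longleftrightarrow> P \<noteq> Q \<and> (\<exists>e. e edge_of P \<and> e edge_of Q)"

definition graph_laplacian :: "'v set \<Rightarrow> ('v \<Rightarrow> 'v \<Rightarrow> bool) \<Rightarrow> ('v \<Rightarrow> real) \<Rightarrow> 'v \<Rightarrow> real" where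
  "graph_laplacian V adj \<psi> v = (\<Sum>u | u \<in> V \<and> adj u v. \<psi> v - \<psi> u)"

text \<open>
  Functional calculus of a self-adjoint operator \<open>A\<close> on \<open>\<ell>\<^sup>2(V)\<close>, \<open>V\<close> finite: \<open>f(A)\<close> is the operator that
  acts on each eigenspace \<open>ker (A - x)\<close> as multiplication by \<open>f(x)\<close>. This determines \<open>f(A)\<close> because
  the eigenspaces span. The result is given by its matrix in the basis of unit vectors,
  with zero entries outside \<open>V \<times> V\<close>.
\<close>

definition functional_calculus ::
    "'v set \<Rightarrow> (('v \<Rightarrow> real) \<Rightarrow> 'v \<Rightarrow> real) \<Rightarrow> (real \<Rightarrow> real) \<Rightarrow> 'v \<Rightarrow> 'v \<Rightarrow> real" where
  "functional_calculus V A f =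
     (THE F. (\<forall>v w. v \<notin> V \<or> w \<notin> V \<longrightarrow> F v w = 0) \<and>
             (\<forall>x \<psi>. (\<forall>v\<in>V. A \<psi> v = x * \<psi> v) \<longrightarrow>
                    (\<forall>v\<in>V. (\<Sum>w\<in>V. F v w * \<psi> w) = f x * \<psi> v)))"

definition spectral_trace :: "'v set \<Rightarrow> ('v \<Rightarrow> 'v \<Rightarrow> bool) \<Rightarrow> real set \<Rightarrow> real" where
  "spectral_trace V adj B =
     (\<Sum>v\<in>V. functional_calculus V (graph_laplacian V adj) (indicator B) v v)"

definition exhaustion :: "complex set set \<Rightarrow> nat \<Rightarrow> complex set set" where
  "exhaustion \<T> n = {t \<in> \<T>. t \<inter> cball 0 (real n) \<noteq> {}}"

definition eigenvalue_measure :: "complex set set \<Rightarrow> nat \<Rightarrow> real measure" where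
  "eigenvalue_measure \<T> n = measure_of UNIV (sets borel)
     (\<lambda>B. ennreal (spectral_trace (exhaustion \<T> n) tile_adjacent B / card (exhaustion \<T> n)))"

definition density_of_states :: "complex set set \<Rightarrow> real measure \<Rightarrow> bool" where
  "density_of_states \<T> \<nu> \<longleftrightarrow> real_distribution \<nu> \<and> weak_conv_m (eigenvalue_measure \<T>) \<nu>"

text \<open>\<^term>\<open>cdf \<nu> E\<close> is \<open>\<nu> {..E}\<close>, the integrated density of states when \<open>\<nu>\<close> is the density of states.\<close>

abbreviation right_limit :: "(real \<Rightarrow> real) \<Rightarrow> real \<Rightarrow> real" where
  "right_limit k E \<equiv> Lim (at_right E) k"

abbreviation left_limit :: "(real \<Rightarrow> real) \<Rightarrow> real \<Rightarrow> real" where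
  "left_limit k E \<equiv> Lim (at_left E) k"

end

theory Submission
  imports Defs
begin

text \<open>
  Both energies have eigenfunctions of finite support. Write \<open>s\<close> for the silver mean and call a point a
  vertex of level \<open>j\<close> if it is \<open>s\<^sup>j\<close> times a vertex of the tiling by tiles that the \<open>j\<close>-fold
  substitution expands, so that it is a vertex of the supertiles of level \<open>j\<close>. Near every vertex of level
  two or more the tiling looks the same up to a radius that grows with the level: the eight
  sectors meeting there are filled in the same way. Hence a function on the cells near such a vertex
  that is invariant, up to a sign, under the rotation by 45 degrees can be described once and copied to all vertices of
  that level. If its neighbour sums are \<open>\<lambda>\<close> times its values, and it lives on quadrilaterals, it is an
  eigenfunction of the Laplacian for \<open>4 - \<lambda>\<close>. Such functions are: the alternating function on the eight squares
  (energy 4) and on the eight rhombi (energy 6) around a vertex of level 2, one function of each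
  energy at level 3, and two more functions of energy 4 at level 4.

  A vertex of level \<open>j\<close> has frequency \<open>s\<^sup>-\<^sup>2\<^sup>j\<close> per polygon of the tiling, so energy 4 gains
  \<open>s\<^sup>-\<^sup>4 + s\<^sup>-\<^sup>6 + 2 s\<^sup>-\<^sup>8 = 1270 - 898 \<surd>2\<close> and energy 6 gains \<open>s\<^sup>-\<^sup>4 + s\<^sup>-\<^sup>6 = 116 - 82 \<surd>2\<close>,
  once all copies are known to be linearly independent. Independence is triangular: each copy has a pivot cell at which
  it does not vanish while all other copies of its own kind or of an earlier kind do
  (\<open>triangular_family\<close>, \<open>triangular_eigenfunctions_le_trace\<close>). Copies of one kind cannot reach each other's pivots
  because vertices of level \<open>j\<close> are at least \<open>s\<^sup>j / \<surd>2\<close> apart; copies of different kinds are kept apart by the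
  choice of the pivots and because a vertex of level two or more is met only by acute corners of rhombi.

  Combinatorics is done on the lattice of the integers with an eighth root of unity adjoined, where every tile is a cell
  with integer coordinates and all local claims are finite checks. The transfer rests on three facts:
  every patch of the tiling lies in a supertile (\<open>patch_in_supertile\<close>), a vertex inside a supertile is surrounded by
  tiles (\<open>interior_vertex_star\<close>), and two polygons share an edge in the sense of convex geometry iff
  the cells have opposite sides (\<open>placed_adjacent\<close>). Vertices are counted through corner sectors of 45
  degrees, of which every rhombus and square has eight and every interior vertex has eight
  (\<open>vertex_frequency\<close>). Finally, eigenvalue counts of the finite graphs pass to the limit measure as jumps
  (\<open>jump_ge_of_eigenvalue_frequency\<close>).
\<close>

section \<open>Lattice cells in integer coordinates\<close>

text \<open>
  The quadruple \<open>(a, b, c, d)\<close> stands for \<open>a + b \<zeta> + c \<zeta>\<^sup>2 + d \<zeta>\<^sup>3\<close> with \<open>\<zeta>\<close> the primitive eighth root of unity. Then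
  \<open>rot\<close>, \<open>rt2\<close> and \<open>sil\<close> are the multiplications by \<open>\<zeta>\<close>, by \<open>\<surd>2 = \<zeta> - \<zeta>\<^sup>3\<close> and by the silver mean, and \<open>dirs\<close>
  are the eight unit directions.
\<close>

type_synonym pt = "int \<times> int \<times> int \<times> int"

fun rot :: "pt \<Rightarrow> pt" where "rot (a, b, c, d) = (- d, a, b, c)"

definition rt2 :: "pt \<Rightarrow> pt" where "rt2 p = rot p - rot (rot (rot p))"

definition sil :: "pt \<Rightarrow> pt" where "sil p = p + rt2 p"

definition dirs :: "pt list" where
  "dirs = [(1,0,0,0), (0,1,0,0), (0,0,1,0), (0,0,0,1), (-1,0,0,0), (0,-1,0,0), (0,0,-1,0), (0,0,0,-1)]"

text \<open>
  \<open>Rh p u\<close> has the acute corner \<open>p\<close> and sides \<open>u\<close>, \<open>rot u\<close>. \<open>Hs p u b\<close> is the half-square with first vertex \<open>p\<close> and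
  right angle at \<open>p + u\<close>; \<open>b\<close> is its orientation: the third vertex is reached by a left turn iff \<open>b\<close>. \<open>Sq p u\<close> is a
  square, the union of a half-square and its mirror image.
\<close>

datatype cell = Rh pt pt | Hs pt pt bool | Sq pt pt

text \<open>
  A rhombus has two acute corners and a square has four corners, so a cell has several names.
  \<open>upper\<close> and \<open>rightish\<close> select one, and \<open>rh\<close>, \<open>sqr\<close> produce the selected name; equality of cells is then equality of
  tiles.
\<close>

fun upper :: "pt \<Rightarrow> bool" where "upper (a, b, c, d) \<longleftrightarrow> a + b + c + d > 0"

fun rightish :: "pt \<Rightarrow> bool" where "rightish (a, b, c, d) \<longleftrightarrow> a + b > 0"

definition rh :: "pt \<Rightarrow> pt \<Rightarrow> cell" where
  "rh p u = (if upper u then Rh p u else Rh (p + u + rot u) (- u))"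

definition sqr :: "pt \<Rightarrow> pt \<Rightarrow> cell" where
  "sqr p u = (let w = rot (rot u) in
     if upper u then (if rightish u then Sq p u else Sq (p + w) (- w))
     else (if rightish w then Sq (p + u) w else Sq (p + u + w) (- u)))"

fun inflate_cell :: "cell \<Rightarrow> cell list" where
  "inflate_cell (Rh p u) = (let v = rot u; w = rot v; x = rot w;
      A = sil p; B = A + sil u; D = A + sil v; C = B + sil v in
      [rh A u, rh C (- u), rh B w, Hs B x True, Hs D (- w) False, Hs B w False, Hs D (- x) True])"
| "inflate_cell (Hs p u b) = (let v = rot u; w = rot v; x = rot w; V = sil p; S = V + sil u in
     if b then let W = S + sil w; c = V + u + w + v in
      [rh V u, rh S w, Hs c (- w) False, Hs S x True, Hs W (- v) True]
     else let W = S - sil w; c = V + u - w - x in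
      [rh V (- x), rh S (- v), Hs c w True, Hs S (- v) False, Hs W x False])"
| "inflate_cell (Sq p u) = []"

fun sides :: "cell \<Rightarrow> (pt \<times> pt) list" where
  "sides (Rh p u) = (let v = rot u in [(p, u), (p + u, v), (p + u + v, - u), (p + v, - v)])"
| "sides (Sq p u) = (let w = rot (rot u) in [(p, u), (p + u, w), (p + u + w, - u), (p + w, - w)])"
| "sides (Hs p u b) = []"

fun rev_side :: "pt \<times> pt \<Rightarrow> pt \<times> pt" where
  "rev_side (p, u) = (p + u, - u)"

fun rot_cell :: "cell \<Rightarrow> cell" where
  "rot_cell (Rh p u) = rh (rot p) (rot u)"
| "rot_cell (Sq p u) = sqr (rot p) (rot u)"
| "rot_cell (Hs p u b) = Hs (rot p) (rot u) b"

fun shift :: "pt \<Rightarrow> cell \<Rightarrow> cell" where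
  "shift z (Rh p u) = Rh (p + z) u"
| "shift z (Sq p u) = Sq (p + z) u"
| "shift z (Hs p u b) = Hs (p + z) u b"

text \<open>
  A finitely supported function that is multiplied by a sign \<open>e\<close> under the rotation by 45 degrees is recorded by one
  cell per orbit: the cell, the value there, and for each of its four sides the neighbour across this side, given as the
  index of its orbit and the number of rotations. Cells of value zero are listed if they have a neighbour in the support,
  because the neighbour sum has to be checked there too.
\<close>

type_synonym entry = "cell \<times> int \<times> (nat \<times> nat) list"

definition local_eigen :: "int \<Rightarrow> int \<Rightarrow> entry list \<Rightarrow> bool" where
  "local_eigen lam e L \<longleftrightarrow>
     (\<forall>(c, x, ns) \<in> set L. x \<noteq> 0 \<longrightarrow> length ns = 4 \<and>
        (\<forall>(s, i, j) \<in> set (zip (sides c) ns). i < length L \<and>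
           rev_side s \<in> set (sides ((rot_cell ^^ j) (fst (L ! i)))))) \<and>
     (\<forall>i \<in> set [0..<length L].
        sum_list (map (\<lambda>(c, x, ns). sum_list (map (\<lambda>(i', j). if i' = i then e ^ j * x else 0) ns)) L)
          = lam * fst (snd (L ! i)))"

text \<open>
  Legs (\<open>LF\<close>, \<open>LB\<close>) and hypotenuses (\<open>HF\<close>, \<open>HB\<close>) are subdivided asymmetrically by the substitution, so edges
  carry an orientation, forward or backward relative to the direction of travel.
\<close>

datatype etype = LF | LB | HF | HB

fun flip :: "etype \<Rightarrow> etype" where
  "flip LF = LB" | "flip LB = LF" | "flip HF = HB" | "flip HB = HF"

type_synonym edge = "pt \<times> pt \<times> etype"

fun rev_edge :: "edge \<Rightarrow> edge" where
  "rev_edge (p, u, t) = (p + (if t = LF \<or> t = LB then u else rt2 u), - u, flip t)"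

fun subdiv :: "edge \<Rightarrow> edge list" where
  "subdiv (p, u, LF) = (let q = sil p in [(q, u, LF), (q + u, u, HB)])"
| "subdiv (p, u, LB) = (let q = sil p in [(q, u, HF), (q + rt2 u, u, LB)])"
| "subdiv (p, u, HF) = (let q = sil p in [(q, u, LF), (q + u, u, HB), (q + u + rt2 u, u, LB)])"
| "subdiv (p, u, HB) = (let q = sil p in [(q, u, LF), (q + u, u, HF), (q + u + rt2 u, u, LB)])"

fun boundary :: "cell \<Rightarrow> edge list" where
  "boundary (Rh p u) = (let v = rot u in [(p, u, LF), (p + u, v, LB), (p + u + v, - u, LF), (p + v, - v, LB)])"
| "boundary (Hs p u b) = (let v = rot u; w = rot v; x = rot w in
     if b then [(p, u, LF), (p + u, w, LF), (p + u + w, - v, HB)]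
     else [(p, - x, HF), (p + u - w, w, LB), (p + u, - u, LB)])"
| "boundary (Sq p u) = (let w = rot (rot u) in [(p, u, LF), (p + u, w, LF), (p + u + w, - u, LF), (p + w, - w, LF)])"

text \<open>
  A flag \<open>(y, k)\<close> of a cell is a corner \<open>y\<close> together with a sector of 45 degrees inside the cell, bounded by the directions
  \<open>k\<close> and \<open>rot k\<close>. All angles are multiples of 45 degrees, so the flags of a tiling at an interior vertex are the eight
  directions.
\<close>

fun flags :: "cell \<Rightarrow> (pt \<times> pt) list" where
  "flags (Rh p u) = (let v = rot u; w = rot v; x = rot w in
     [(p, u), (p + u, v), (p + u, w), (p + u, x), (p + u + v, - u), (p + v, - v), (p + v, - w), (p + v, - x)])"
| "flags (Hs p u b) = (let v = rot u; w = rot v; x = rot w in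
     if b then [(p, u), (p + u, w), (p + u, x), (p + u + w, - v)]
     else [(p, - x), (p + u - w, w), (p + u, - u), (p + u, - v)])"
| "flags (Sq p u) = (let v = rot u; w = rot v; x = rot w in
     [(p, u), (p, v), (p + u, w), (p + u, x), (p + u + w, - u), (p + u + w, - v), (p + w, - w), (p + w, - x)])"

fun mirror :: "cell \<Rightarrow> cell" where
  "mirror (Hs p u b) = (if b then Hs p (rot (rot u)) False else Hs p (- rot (rot u)) True)"
| "mirror c = c"

fun merge :: "cell \<Rightarrow> cell" where
  "merge (Hs p u b) = (if b then sqr p u else sqr p (- rot (rot u)))"
| "merge c = c"

text \<open>
  \<open>cross u v\<close> is \<open>\<surd>2 Im (cnj u * v)\<close> in the form \<open>(x, y)\<close> for \<open>x + y \<surd>2\<close>, and \<open>nonneg_rt2\<close> decides \<open>x + y \<surd>2 \<ge> 0\<close>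
  by comparing squares. All geometric checks reduce to these two.
\<close>

fun cross :: "pt \<Rightarrow> pt \<Rightarrow> int \<times> int" where
  "cross (a, b, c, d) (a', b', c', d') =
     (a * b' - b * a' + b * c' - c * b' + c * d' - d * c' + a * d' - d * a', a * c' - c * a' + b * d' - d * b')"

fun nonneg_rt2 :: "int \<times> int \<Rightarrow> bool" where
  "nonneg_rt2 (x, y) \<longleftrightarrow> (0 \<le> x \<and> (0 \<le> y \<or> 2 * y * y \<le> x * x)) \<or> (0 \<le> y \<and> x * x \<le> 2 * y * y)"

definition seeds :: "cell list" where
  "seeds = map (Rh 0) (filter upper dirs) @ map (\<lambda>u. Hs 0 u True) dirs @ map (\<lambda>u. Hs 0 u False) dirs"

definition corners :: "cell \<Rightarrow> pt list" where "corners c = map fst (boundary c)"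

definition pieces_inside :: "cell \<Rightarrow> bool" where
  "pieces_inside c \<longleftrightarrow> (\<forall>s \<in> set (inflate_cell c). \<forall>z \<in> set (corners s). \<forall>(p, u, _) \<in> set (boundary c). nonneg_rt2 (cross u (z - sil p)))"

definition separated :: "cell \<Rightarrow> cell \<Rightarrow> bool" where
  "separated c c' \<longleftrightarrow> (\<exists>(p, u, _) \<in> set (boundary c). \<forall>z \<in> set (corners c'). nonneg_rt2 (cross u (p - z)))"

fun pairwise_separated :: "cell list \<Rightarrow> bool" where
  "pairwise_separated [] = True"
| "pairwise_separated (c # cs) = ((\<forall>c' \<in> set cs. c \<noteq> c' \<and> (separated c c' \<or> separated c' c)) \<and> pairwise_separated cs)"

text \<open>
  For a flag and the line through an edge of the same cell: either the corner is on the line and the sector points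
  inwards, or the corner is at distance at least \<open>\<surd>2 / 2\<close> from the line. The last condition says that the point \<open>y + (k + rot k) / 4\<close>
  in the middle of the sector is strictly inside.
\<close>

definition flags_ok :: "cell \<Rightarrow> bool" where
  "flags_ok c \<longleftrightarrow> (\<forall>(y, k) \<in> set (flags c).
     (\<forall>(p, u, _) \<in> set (boundary c). (let (m, n) = cross u (y - p) in
        (m = 0 \<and> n = 0 \<and> nonneg_rt2 (cross u k) \<and> nonneg_rt2 (cross u (rot k))) \<or> nonneg_rt2 (m - 1, n)) \<and>
        \<not> nonneg_rt2 (cross u (p + p + p + p - y - y - y - y - k - rot k))))"

fun cancels :: "edge list \<Rightarrow> bool" where
  "cancels [] = True"
| "cancels (e # es) = (rev_edge e \<in> set es \<and> cancels (remove1 (rev_edge e) es))"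

text \<open>
  The boundaries of the pieces add up to the subdivided boundary of the expanded cell: all other edges occur in both
  directions and cancel.
\<close>

definition chain_ok :: "cell \<Rightarrow> bool" where
  "chain_ok c \<longleftrightarrow> cancels (concat (map boundary (inflate_cell c)) @ map rev_edge (concat (map subdiv (boundary c))))"

text \<open>
  Turning by 45 degrees about a corner, one either stays in the cell or crosses one of its edges.
\<close>

definition turn_ok :: "cell \<Rightarrow> bool" where
  "turn_ok c \<longleftrightarrow> (\<forall>(p, u, _) \<in> set (boundary c). (p, u) \<in> set (flags c)) \<and>
     (\<forall>(y, k) \<in> set (flags c). (y, rot k) \<in> set (flags c) \<or>
        (\<exists>e \<in> set (boundary c). let (p, u, _) = rev_edge e in p = y \<and> u = rot k))"

text \<open>
  The part of the substituted half-square near its first vertex. At a vertex of a twice substituted tiling every sector is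
  filled by this list of cells, whatever tile the sector belongs to (\<open>star_ok\<close>); this is why all vertices of level two have the
  same surroundings.
\<close>

definition wedge :: "pt \<Rightarrow> cell list" where "wedge u = take 4 (inflate_cell (Hs 0 u True))"

definition inflate_cells :: "cell list \<Rightarrow> cell list" where "inflate_cells cs = concat (map inflate_cell cs)"

definition star_ok :: "cell \<Rightarrow> bool" where
  "star_ok c \<longleftrightarrow> (let A = inflate_cells (inflate_cell c) in
     \<forall>(y, k) \<in> set (flags c). \<forall>t \<in> set (wedge k). shift (sil (sil y)) t \<in> set A)"

text \<open>
  A square counts as present if both of its halves are, for one of its two diagonals.
\<close>

fun present :: "cell list \<Rightarrow> cell \<Rightarrow> bool" where
  "present T (Rh p u) \<longleftrightarrow> Rh p u \<in> set T"
| "present T (Hs p u b) \<longleftrightarrow> False"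
| "present T (Sq p u) \<longleftrightarrow> (\<exists>(V, k) \<in> set (sides (Sq p u)). Hs V k True \<in> set T \<and> Hs V (rot (rot k)) False \<in> set T)"

definition all_present :: "cell list \<Rightarrow> entry list \<Rightarrow> bool" where
  "all_present T L \<longleftrightarrow> (\<forall>(c, _) \<in> set L. present T c)"

fun pos :: "cell \<Rightarrow> pt" where "pos (Rh p u) = p" | "pos (Hs p u b) = p" | "pos (Sq p u) = p"

text \<open>
  All translation vectors that move some rotated cell of the support to \<open>v\<close>.
\<close>

definition occurrences :: "cell \<Rightarrow> entry list \<Rightarrow> pt list" where
  "occurrences v L = concat (map (\<lambda>(c, x, _). if x = 0 then [] else
     concat (map (\<lambda>j. let c' = (rot_cell ^^ j) c; z = pos v - pos c' in if shift z c' = v then [z] else []) [0..<8])) L)"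

definition val_at :: "int \<Rightarrow> entry list \<Rightarrow> cell \<Rightarrow> int" where
  "val_at e L v = sum_list (map (\<lambda>(c, x, _). if x = 0 then 0 else
     sum_list (map (\<lambda>j. if (rot_cell ^^ j) c = v then e ^ j * x else 0) [0..<8])) L)"

fun sqnorm :: "pt \<Rightarrow> int \<times> int" where
  "sqnorm (a, b, c, d) = (a * a + b * b + c * c + d * d, a * b + b * c + c * d - d * a)"

text \<open>
  \<open>2 * |z|\<^sup>2 < m\<close>, which excludes \<open>z\<close> as a difference of vertices of level \<open>j\<close> if \<open>m = silver ^ (2 * j)\<close>.
\<close>

definition near :: "int \<times> int \<Rightarrow> pt \<Rightarrow> bool" where
  "near m z \<longleftrightarrow> (case (m, sqnorm z) of ((x, y), (a, b)) \<Rightarrow> \<not> nonneg_rt2 (2 * a - x, 2 * b - y))"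

definition inside :: "pt \<Rightarrow> cell \<Rightarrow> bool" where
  "inside z c \<longleftrightarrow> (\<forall>(p, u, _) \<in> set (boundary c). nonneg_rt2 (cross u (z - p)))"

text \<open>
  A vertex of level two or three at \<open>z\<close> would be met by acute corners of rhombi only; the witness is a cell that contains \<open>z\<close> without being
  one of these rhombi.
\<close>

definition refuted :: "(nat \<times> cell) list \<Rightarrow> pt \<Rightarrow> bool" where
  "refuted W z \<longleftrightarrow> (\<exists>(j, t) \<in> set W. let c = (rot_cell ^^ j) t in inside z c \<and> (\<forall>k \<in> set dirs. c \<noteq> rh z k))"

section \<open>Six finitely supported functions\<close>

definition f4_data :: "entry list" where
  "f4_data =
    [(Sq (0,1,0,0) (1,0,0,0),1,[(1,0), (2,0), (2,1), (1,1)]), (Rh (0,0,0,0) (1,0,0,0),0,[]), (Rh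
     (1,1,0,-1) (0,0,1,0),0,[])]"

definition f6_data :: "entry list" where
  "f6_data =
    [(Rh (0,0,0,0) (1,0,0,0),1,[(0,7), (1,7), (1,0), (0,1)]), (Sq (0,1,0,0) (1,0,0,0),0,[])]"

definition h4_data :: "entry list" where
  "h4_data =
    [(Sq (1,1,0,-1) (1,0,0,0),1,[(1,7), (2,0), (9,0), (8,0)]), (Sq (1,1,1,-1) (0,1,0,0),-1,[(9,0),
     (3,0), (0,1), (8,0)]), (Rh (2,1,0,-1) (0,1,0,0),-1,[(10,7), (4,0), (9,0), (0,0)]), (Rh
     (2,2,1,-1) (0,0,0,1),1,[(5,0), (10,0), (1,0), (9,0)]), (Sq (2,2,0,-1) (1,0,0,0),-1,[(6,0),
     (12,0), (11,0), (2,0)]), (Sq (2,2,1,-1) (0,1,0,0),1,[(11,0), (13,0), (7,0), (3,0)]), (Rh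
     (3,2,0,-2) (0,0,0,1),1,[(12,0), (4,0), (10,7), (7,7)]), (Rh (2,2,1,0) (0,1,0,0),-1,[(5,0),
     (13,0), (6,1), (10,0)]), (Rh (1,1,0,-1) (0,0,1,0),0,[]), (Rh (1,1,1,-1) (1,0,0,0),0,[]), (Sq
     (1,2,1,0) (1,0,0,0),0,[]), (Rh (2,2,1,-1) (1,0,0,0),0,[]), (Rh (3,2,0,-2) (0,0,1,0),0,[]), (Rh
     (2,3,1,-1) (0,0,1,0),0,[])]"

definition h6_data :: "entry list" where
  "h6_data =
    [(Sq (1,1,0,-1) (1,0,0,0),1,[(1,7), (2,0), (9,0), (8,0)]), (Sq (1,1,1,-1) (0,1,0,0),-1,[(9,0),
     (3,0), (0,1), (8,0)]), (Rh (2,1,0,-1) (0,1,0,0),-1,[(10,7), (4,0), (9,0), (0,0)]), (Rh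
     (2,2,1,-1) (0,0,0,1),1,[(5,0), (10,0), (1,0), (9,0)]), (Sq (2,2,0,-1) (1,0,0,0),1,[(6,0),
     (12,0), (11,0), (2,0)]), (Sq (2,2,1,-1) (0,1,0,0),-1,[(11,0), (13,0), (7,0), (3,0)]), (Rh
     (3,2,0,-2) (0,0,0,1),-1,[(12,0), (4,0), (10,7), (7,7)]), (Rh (2,2,1,0) (0,1,0,0),1,[(5,0),
     (13,0), (6,1), (10,0)]), (Rh (1,1,0,-1) (0,0,1,0),0,[]), (Rh (1,1,1,-1) (1,0,0,0),0,[]), (Sq
     (1,2,1,0) (1,0,0,0),0,[]), (Rh (2,2,1,-1) (1,0,0,0),0,[]), (Rh (3,2,0,-2) (0,0,1,0),0,[]), (Rh
     (2,3,1,-1) (0,0,1,0),0,[])]"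

definition p_data :: "entry list" where
  "p_data =
    [(Sq (1,2,1,0) (1,0,0,0),1,[(14,0), (16,0), (15,1), (13,1)]), (Sq (2,2,0,-1) (1,0,0,0),1,[(15,0),
     (18,0), (17,0), (13,0)]), (Sq (2,2,1,-1) (0,1,0,0),-1,[(17,0), (19,0), (16,0), (14,0)]), (Rh
     (3,2,0,-2) (0,1,0,0),-1,[(22,0), (24,0), (20,0), (18,0)]), (Rh (3,3,2,-1) (0,0,0,1),1,[(25,0),
     (23,0), (19,0), (21,0)]), (Rh (4,3,1,-2) (0,0,0,1),1,[(27,0), (26,0), (20,0), (24,0)]), (Rh
     (3,3,1,-1) (0,1,0,0),-1,[(26,0), (28,0), (25,0), (21,0)]), (Sq (2,4,2,0) (1,0,0,0),-1,[(23,0),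
     (30,0), (29,1), (22,1)]), (Sq (4,3,1,-3) (0,1,0,0),-1,[(31,0), (35,0), (27,0), (29,0)]), (Sq
     (3,4,2,-1) (1,0,0,0),1,[(28,0), (36,0), (32,0), (30,0)]), (Sq (4,4,0,-3) (1,0,0,0),1,[(33,0),
     (37,0), (35,0), (31,0)]), (Sq (4,4,3,-1) (0,1,0,0),-1,[(36,0), (38,0), (34,0), (32,0)]), (Sq
     (3,5,3,0) (1,0,0,0),1,[(34,0), (38,0), (37,1), (33,1)]), (Rh (2,1,0,-1) (0,1,0,0),0,[]), (Rh
     (2,2,1,-1) (0,0,0,1),0,[]), (Rh (3,2,0,-2) (0,0,0,1),0,[]), (Rh (2,2,1,0) (0,1,0,0),0,[]), (Rh
     (2,2,1,-1) (1,0,0,0),0,[]), (Rh (3,2,0,-2) (0,0,1,0),0,[]), (Rh (2,3,1,-1) (0,0,1,0),0,[]), (Sq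
     (3,2,1,-2) (0,1,0,0),0,[]), (Sq (2,3,1,-1) (1,0,0,0),0,[]), (Rh (3,2,0,-2) (1,0,0,0),0,[]), (Rh
     (2,3,2,0) (1,0,0,0),0,[]), (Sq (3,3,0,-2) (1,0,0,0),0,[]), (Sq (3,3,2,-1) (0,1,0,0),0,[]), (Rh
     (3,3,1,-1) (1,0,0,0),0,[]), (Sq (4,3,1,-2) (0,1,0,0),0,[]), (Sq (3,4,1,-1) (1,0,0,0),0,[]), (Rh
     (4,3,0,-3) (0,0,1,0),0,[]), (Rh (3,4,2,-1) (0,0,1,0),0,[]), (Rh (4,3,0,-3) (0,1,0,0),0,[]), (Rh
     (4,4,3,-1) (0,0,0,1),0,[]), (Rh (4,3,0,-3) (1,0,0,0),0,[]), (Rh (3,4,3,0) (1,0,0,0),0,[]), (Rh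
     (5,4,1,-3) (0,0,0,1),0,[]), (Rh (4,4,2,-1) (0,1,0,0),0,[]), (Rh (5,4,0,-4) (0,0,1,0),0,[]), (Rh
     (4,5,3,-1) (0,0,1,0),0,[])]"

definition q_data :: "entry list" where
  "q_data =
    [(Rh (3,2,0,-2) (1,0,0,0),1,[(1,7), (46,7), (2,0), (41,0)]), (Rh (2,3,2,0) (1,0,0,0),-1,[(42,0),
     (3,0), (46,0), (0,1)]), (Sq (3,3,0,-2) (1,0,0,0),-1,[(0,0), (6,0), (43,0), (41,0)]), (Sq
     (3,3,2,-1) (0,1,0,0),1,[(44,0), (7,0), (1,0), (42,0)]), (Sq (4,3,1,-2) (0,1,0,0),1,[(47,0),
     (49,0), (45,0), (43,0)]), (Sq (3,4,1,-1) (1,0,0,0),-1,[(45,0), (49,0), (48,0), (44,0)]), (Rh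
     (4,3,0,-3) (0,0,1,0),-1,[(8,0), (47,0), (2,0), (46,7)]), (Rh (3,4,2,-1) (0,0,1,0),1,[(48,0),
     (9,0), (46,0), (3,0)]), (Rh (4,3,0,-3) (0,1,0,0),1,[(50,0), (12,0), (47,0), (6,0)]), (Rh
     (4,4,3,-1) (0,0,0,1),-1,[(13,0), (51,0), (7,0), (48,0)]), (Rh (5,4,1,-3) (0,0,0,1),-1,[(17,0),
     (52,0), (47,0), (12,0)]), (Rh (4,4,2,-1) (0,1,0,0),1,[(53,0), (18,0), (13,0), (48,0)]), (Sq
     (4,4,0,-3) (1,0,0,0),1,[(50,0), (55,0), (10,0), (8,0)]), (Sq (4,4,3,-1) (0,1,0,0),-1,[(11,0),
     (56,0), (51,0), (9,0)]), (Sq (3,5,3,0) (1,0,0,0),2,[(51,0), (56,0), (55,1), (50,1)]), (Rh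
     (5,4,1,-2) (0,1,0,0),1,[(17,0), (19,0), (54,0), (52,0)]), (Rh (5,5,2,-2) (0,0,0,1),-1,[(20,0),
     (18,0), (53,0), (54,0)]), (Sq (5,4,1,-3) (0,1,0,0),-1,[(23,0), (19,0), (15,0), (10,0)]), (Sq
     (4,5,2,-1) (1,0,0,0),1,[(16,0), (20,0), (24,0), (11,0)]), (Rh (5,5,1,-3) (0,0,1,0),1,[(27,0),
     (25,0), (15,0), (17,0)]), (Rh (5,5,2,-2) (0,0,1,0),-1,[(26,0), (28,0), (18,0), (16,0)]), (Rh
     (6,4,1,-4) (0,0,0,1),1,[(29,0), (23,0), (55,0), (57,0)]), (Rh (4,5,3,-1) (0,1,0,0),-1,[(24,0),
     (30,0), (58,0), (56,0)]), (Rh (5,4,1,-3) (1,0,0,0),-1,[(21,0), (29,0), (27,0), (17,0)]), (Rh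
     (4,5,3,-1) (1,0,0,0),1,[(18,0), (28,0), (30,0), (22,0)]), (Rh (6,5,2,-3) (0,0,0,1),1,[(60,0),
     (59,0), (19,0), (27,0)]), (Rh (5,5,2,-2) (0,1,0,0),-1,[(59,0), (61,0), (28,0), (20,0)]), (Sq
     (5,5,1,-3) (1,0,0,0),-1,[(23,0), (33,0), (25,0), (19,0)]), (Sq (5,5,3,-2) (0,1,0,0),1,[(26,0),
     (34,0), (24,0), (20,0)]), (Sq (6,4,1,-4) (0,1,0,0),1,[(31,0), (35,0), (23,0), (21,0)]), (Sq
     (4,6,3,-1) (1,0,0,0),-1,[(24,0), (36,0), (32,0), (22,0)]), (Rh (6,4,0,-4) (0,1,0,0),-1,[(62,7),
     (37,0), (29,0), (57,0)]), (Rh (5,6,4,-1) (0,0,0,1),1,[(38,0), (62,0), (58,0), (30,0)]), (Rh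
     (6,5,1,-3) (0,1,0,0),-1,[(35,0), (63,0), (60,0), (27,0)]), (Rh (6,6,3,-2) (0,0,0,1),1,[(64,0),
     (36,0), (28,0), (61,0)]), (Sq (6,5,1,-4) (0,1,0,0),1,[(65,0), (63,0), (33,0), (29,0)]), (Sq
     (5,6,3,-1) (1,0,0,0),-1,[(34,0), (64,0), (66,0), (30,0)]), (Sq (6,5,0,-4) (1,0,0,0),-1,[(39,0),
     (67,0), (65,0), (31,0)]), (Sq (5,6,4,-1) (0,1,0,0),1,[(66,0), (68,0), (40,0), (32,0)]), (Rh
     (7,5,0,-5) (0,0,0,1),1,[(67,0), (37,0), (62,7), (40,7)]), (Rh (5,6,4,0) (0,1,0,0),-1,[(38,0),
     (68,0), (39,1), (62,0)]), (Rh (3,2,0,-2) (0,1,0,0),0,[]), (Rh (3,3,2,-1) (0,0,0,1),0,[]), (Rh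
     (4,3,1,-2) (0,0,0,1),0,[]), (Rh (3,3,1,-1) (0,1,0,0),0,[]), (Rh (3,3,1,-1) (1,0,0,0),0,[]), (Sq
     (2,4,2,0) (1,0,0,0),0,[]), (Sq (4,3,1,-3) (0,1,0,0),0,[]), (Sq (3,4,2,-1) (1,0,0,0),0,[]), (Rh
     (4,4,1,-2) (0,0,1,0),0,[]), (Rh (4,3,0,-3) (1,0,0,0),0,[]), (Rh (3,4,3,0) (1,0,0,0),0,[]), (Sq
     (4,4,1,-2) (1,0,0,0),0,[]), (Sq (4,4,2,-2) (0,1,0,0),0,[]), (Rh (4,4,2,-2) (1,0,0,0),0,[]), (Rh
     (5,4,0,-4) (0,0,1,0),0,[]), (Rh (4,5,3,-1) (0,0,1,0),0,[]), (Sq (5,4,0,-4) (1,0,0,0),0,[]), (Sq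
     (4,5,4,-1) (0,1,0,0),0,[]), (Rh (5,5,2,-2) (1,0,0,0),0,[]), (Sq (6,5,2,-3) (0,1,0,0),0,[]), (Sq
     (5,6,2,-2) (1,0,0,0),0,[]), (Sq (4,6,4,0) (1,0,0,0),0,[]), (Rh (6,6,1,-4) (0,0,1,0),0,[]), (Rh
     (6,6,3,-2) (0,0,1,0),0,[]), (Rh (6,5,1,-4) (1,0,0,0),0,[]), (Rh (5,6,4,-1) (1,0,0,0),0,[]), (Rh
     (7,5,0,-5) (0,0,1,0),0,[]), (Rh (5,7,4,-1) (0,0,1,0),0,[])]"

text \<open>
  Cells near a vertex of level 4, each with a number of rotations, that exclude vertices of lower level at the positions
  where a function of lower level would overlap the pivots of \<open>p_data\<close> and \<open>q_data\<close>.
\<close>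

definition witnesses :: "(nat \<times> cell) list" where
  "witnesses =
    [(1,Hs (6,5,1,-4) (0,0,0,1) True), (0,Hs (4,4,2,-1) (-1,0,0,0) True), (0,Hs (5,6,4,-1) (0,0,-1,0)
     True), (1,Hs (4,4,1,-2) (0,-1,0,0) True), (7,Rh (2,2,1,0) (0,1,0,0)), (7,Rh (4,4,2,-2)
     (1,0,0,0)), (7,Rh (2,2,1,-1) (1,0,0,0)), (7,Rh (4,5,3,-1) (1,0,0,0)), (0,Hs (4,6,4,0) (1,0,0,0)
     True), (0,Hs (4,4,1,-2) (0,0,0,1) True), (0,Hs (3,3,1,-1) (0,0,1,0) True), (0,Hs (6,5,1,-4)
     (0,1,0,0) True), (0,Hs (6,6,2,-3) (0,0,0,1) True), (0,Hs (4,5,3,-1) (0,0,0,1) True), (1,Hs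
     (3,3,1,-1) (0,0,1,0) True), (1,Hs (6,6,2,-3) (0,0,0,1) True), (1,Hs (7,6,1,-4) (0,0,1,0) True),
     (1,Hs (4,4,2,-1) (0,0,1,0) True), (1,Hs (5,4,1,-3) (0,1,0,0) True), (1,Hs (4,3,0,-3) (0,0,0,1)
     True), (0,Hs (6,7,4,-1) (0,-1,0,0) True), (0,Hs (6,6,3,-2) (0,0,0,-1) True)]"

section \<open>Spectral theorem for symmetric matrices\<close>

definition inner_on :: "'v set \<Rightarrow> ('v \<Rightarrow> real) \<Rightarrow> ('v \<Rightarrow> real) \<Rightarrow> real" where
  "inner_on V f g = (\<Sum>v\<in>V. f v * g v)"

definition mat_apply :: "'v set \<Rightarrow> ('v \<Rightarrow> 'v \<Rightarrow> real) \<Rightarrow> ('v \<Rightarrow> real) \<Rightarrow> 'v \<Rightarrow> real" where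
  "mat_apply V M f v = (\<Sum>u\<in>V. M v u * f u)"

lemma inner_on_commute: "inner_on V f g = inner_on V g f"
  by (simp add: inner_on_def mult.commute)

lemma inner_on_add_left: "inner_on V (\<lambda>v. f v + g v) h = inner_on V f h + inner_on V g h"
  by (simp add: inner_on_def distrib_right sum.distrib)

lemma inner_on_scale_left: "inner_on V (\<lambda>v. c * f v) h = c * inner_on V f h"
  by (simp add: inner_on_def sum_distrib_left mult.assoc)

lemma inner_on_lin_left: "inner_on V (\<lambda>v. f v + t * g v) h = inner_on V f h + t * inner_on V g h"
  by (simp add: inner_on_add_left inner_on_scale_left)

lemma inner_on_lin_right: "inner_on V h (\<lambda>v. f v + t * g v) = inner_on V h f + t * inner_on V h g"
  by (metis inner_on_commute inner_on_lin_left)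

lemma inner_on_sum_left: "inner_on V (\<lambda>v. \<Sum>j\<in>J. c j * g j v) h = (\<Sum>j\<in>J. c j * inner_on V (g j) h)"
proof -
  have "inner_on V (\<lambda>v. \<Sum>j\<in>J. c j * g j v) h = (\<Sum>v\<in>V. \<Sum>j\<in>J. c j * g j v * h v)"
    by (simp add: inner_on_def sum_distrib_right)
  also have "\<dots> = (\<Sum>j\<in>J. \<Sum>v\<in>V. c j * g j v * h v)"
    by (rule sum.swap)
  finally show ?thesis
    by (simp add: inner_on_def sum_distrib_left mult.assoc)
qed

lemma inner_on_self_nonneg: "0 \<le> inner_on V f f"
  by (simp add: inner_on_def sum_nonneg)

lemma inner_on_self_eq_0: "finite V \<Longrightarrow> inner_on V f f = 0 \<longleftrightarrow> (\<forall>v\<in>V. f v = 0)"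
  by (simp add: inner_on_def sum_nonneg_eq_0_iff)

lemma mat_apply_lin: "mat_apply V M (\<lambda>v. f v + t * g v) w = mat_apply V M f w + t * mat_apply V M g w"
  by (simp add: mat_apply_def distrib_left sum.distrib sum_distrib_left mult.left_commute)

lemma mat_apply_sym:
  assumes "\<And>u v. u \<in> V \<Longrightarrow> v \<in> V \<Longrightarrow> M u v = M v u"
  shows "inner_on V (mat_apply V M f) g = inner_on V f (mat_apply V M g)"
proof -
  have "inner_on V (mat_apply V M f) g = (\<Sum>v\<in>V. \<Sum>u\<in>V. M v u * f u * g v)"
    by (simp add: inner_on_def mat_apply_def sum_distrib_right)
  also have "\<dots> = (\<Sum>u\<in>V. \<Sum>v\<in>V. M v u * f u * g v)"
    by (rule sum.swap)
  also have "\<dots> = (\<Sum>u\<in>V. \<Sum>v\<in>V. f u * (M u v * g v))"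
    by (intro sum.cong refl) (simp add: assms)
  finally show ?thesis
    by (simp add: inner_on_def mat_apply_def sum_distrib_left)
qed

definition orthonormal :: "'v set \<Rightarrow> nat set \<Rightarrow> (nat \<Rightarrow> 'v \<Rightarrow> real) \<Rightarrow> bool" where
  "orthonormal V J \<phi> \<longleftrightarrow> (\<forall>i\<in>J. \<forall>j\<in>J. inner_on V (\<phi> i) (\<phi> j) = (if i = j then 1 else 0))"

lemma inner_on_delta: "finite V \<Longrightarrow> v \<in> V \<Longrightarrow> inner_on V (\<lambda>w. if w = v then 1 else 0) f = f v"
proof -
  assume "finite V" "v \<in> V"
  have "inner_on V (\<lambda>w. if w = v then 1 else 0) f = (\<Sum>w\<in>V. if w = v then f w else 0)"
    unfolding inner_on_def by (intro sum.cong) auto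
  also have "\<dots> = f v" using \<open>finite V\<close> \<open>v \<in> V\<close> by simp
  finally show ?thesis .
qed

text \<open>
  The unit vector at \<open>v\<close> minus its orthogonal projection to the span of the \<open>\<phi> j\<close>.
\<close>

lemma residual_norm:
  assumes fin: "finite V" "finite J" and on: "orthonormal V J \<phi>" and v: "v \<in> V"
  defines "\<psi> \<equiv> \<lambda>w. (if w = v then 1 else 0) + (- 1) * (\<Sum>j\<in>J. \<phi> j v * \<phi> j w)"
  shows "\<And>i. i \<in> J \<Longrightarrow> inner_on V (\<phi> i) \<psi> = 0" and "inner_on V \<psi> \<psi> = 1 - (\<Sum>j\<in>J. \<phi> j v ^ 2)"
proof -
  have s: "inner_on V (\<lambda>w. \<Sum>j\<in>J. \<phi> j v * \<phi> j w) (\<phi> i) = \<phi> i v" if "i \<in> J" for i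
  proof -
    have "inner_on V (\<lambda>w. \<Sum>j\<in>J. \<phi> j v * \<phi> j w) (\<phi> i) = (\<Sum>j\<in>J. \<phi> j v * (if j = i then 1 else 0))"
      unfolding inner_on_sum_left using on that by (intro sum.cong) (auto simp: orthonormal_def)
    also have "\<dots> = (\<Sum>j\<in>J. if j = i then \<phi> j v else 0)" by (intro sum.cong) auto
    finally show ?thesis using that fin by simp
  qed
  show o: "inner_on V (\<phi> i) \<psi> = 0" if "i \<in> J" for i
    using s[OF that] inner_on_delta[OF fin(1) v, of "\<phi> i"]
    unfolding \<psi>_def inner_on_lin_right by (simp add: inner_on_commute)
  have "inner_on V \<psi> \<psi> = inner_on V (\<lambda>w. if w = v then 1 else 0) \<psi> + (-1) * inner_on V (\<lambda>w. \<Sum>j\<in>J. \<phi> j v * \<phi> j w) \<psi>"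
    unfolding \<psi>_def by (rule inner_on_lin_left)
  also have "\<dots> = \<psi> v"
    using o by (simp add: inner_on_delta[OF fin(1) v] inner_on_sum_left)
  finally show "inner_on V \<psi> \<psi> = 1 - (\<Sum>j\<in>J. \<phi> j v ^ 2)"
    by (simp add: \<psi>_def power2_eq_square)
qed

lemma sum_orthonormal_squares:
  assumes "finite J" and on: "orthonormal V J \<phi>"
  shows "(\<Sum>v\<in>V. \<Sum>j\<in>J. \<phi> j v ^ 2) = card J"
proof -
  have "(\<Sum>v\<in>V. \<Sum>j\<in>J. \<phi> j v ^ 2) = (\<Sum>j\<in>J. \<Sum>v\<in>V. \<phi> j v ^ 2)" by (rule sum.swap)
  also have "\<dots> = (\<Sum>j\<in>J. inner_on V (\<phi> j) (\<phi> j))" by (simp add: inner_on_def power2_eq_square)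
  also have "\<dots> = (\<Sum>j\<in>J. 1)" using on by (intro sum.cong) (auto simp: orthonormal_def)
  finally show ?thesis by simp
qed

text \<open>
  Fewer than \<open>card V\<close> orthonormal vectors cannot have \<open>\<Sum>j. \<phi> j v ^ 2 = 1\<close> at every \<open>v\<close>, because the
  double sum equals their number; at a deficient \<open>v\<close> the residual of the unit vector is nonzero.
\<close>

lemma orthonormal_not_full:
  assumes fin: "finite V" "finite J" and on: "orthonormal V J \<phi>" and less: "card J < card V"
  shows "\<exists>\<psi>. (\<forall>v. v \<notin> V \<longrightarrow> \<psi> v = 0) \<and> inner_on V \<psi> \<psi> = 1 \<and> (\<forall>j\<in>J. inner_on V (\<phi> j) \<psi> = 0)"
proof -
  have "\<exists>v\<in>V. (\<Sum>j\<in>J. \<phi> j v ^ 2) < 1"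
  proof (rule ccontr)
    assume "\<not> ?thesis"
    then have "(\<Sum>v\<in>V. 1) \<le> (\<Sum>v\<in>V. \<Sum>j\<in>J. \<phi> j v ^ 2)"
      by (intro sum_mono) (auto simp: not_less)
    then show False using less sum_orthonormal_squares[OF fin(2) on] by simp
  qed
  then obtain v where v: "v \<in> V" "(\<Sum>j\<in>J. \<phi> j v ^ 2) < 1" by blast
  define \<psi> where "\<psi> = (\<lambda>w. (if w = v then 1 else 0) + (- 1) * (\<Sum>j\<in>J. \<phi> j v * \<phi> j w))"
  define n where "n = inner_on V \<psi> \<psi>"
  have n: "n > 0" using residual_norm(2)[OF fin on v(1)] v(2) by (simp add: n_def \<psi>_def)
  define \<xi> where "\<xi> = (\<lambda>w. if w \<in> V then (1 / sqrt n) * \<psi> w else 0)"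
  have c: "inner_on V \<xi> f = (1 / sqrt n) * inner_on V \<psi> f" for f
    unfolding inner_on_scale_left[symmetric] by (simp add: inner_on_def \<xi>_def)
  have "inner_on V \<xi> \<xi> = (1 / sqrt n) * ((1 / sqrt n) * n)"
    using c[of \<xi>] c[of \<psi>] by (simp add: inner_on_commute n_def)
  then have "inner_on V \<xi> \<xi> = 1" using n by simp
  moreover have "inner_on V (\<phi> j) \<xi> = 0" if "j \<in> J" for j
    using c[of "\<phi> j"] residual_norm(1)[OF fin on v(1) that] by (simp add: inner_on_commute \<psi>_def)
  ultimately show ?thesis by (intro exI[of _ \<xi>]) (auto simp: \<xi>_def)
qed

text \<open>
  Rayleigh's principle: the quadratic form attains its maximum on the unit sphere of the orthogonal complement of the
  eigenvectors found so far, and a maximiser is an eigenvector. Functions vanish outside \<open>V\<close>, so the sphere is a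
  closed subset of a compact product of intervals.
\<close>

lemma eigenvector_extend:
  assumes fin: "finite V" "finite J" and sym: "\<And>u v. u \<in> V \<Longrightarrow> v \<in> V \<Longrightarrow> M u v = M v u"
    and on: "orthonormal V J \<phi>" and ev: "\<And>j v. j \<in> J \<Longrightarrow> v \<in> V \<Longrightarrow> mat_apply V M (\<phi> j) v = \<mu> j * \<phi> j v"
    and less: "card J < card V"
  shows "\<exists>\<psi> x. inner_on V \<psi> \<psi> = 1 \<and> (\<forall>j\<in>J. inner_on V (\<phi> j) \<psi> = 0) \<and> (\<forall>v\<in>V. mat_apply V M \<psi> v = x * \<psi> v)"
proof -
  define U where "U = {\<psi>. (\<forall>v. v \<notin> V \<longrightarrow> \<psi> v = 0) \<and> inner_on V \<psi> \<psi> = 1 \<and> (\<forall>j\<in>J. inner_on V (\<phi> j) \<psi> = 0)}"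
  have ne: "U \<noteq> {}"
    using orthonormal_not_full[OF fin on less] by (auto simp: U_def)
  have cont: "continuous_on S (\<lambda>\<psi>::'a \<Rightarrow> real. \<psi> v)" for S v
    by (intro continuous_on_product_coordinates continuous_on_subset[OF _ subset_UNIV])
  have cip: "continuous_on UNIV (\<lambda>\<psi>. inner_on V (\<phi> j) \<psi>)" for j
    unfolding inner_on_def by (intro continuous_intros cont)
  have cq: "continuous_on UNIV (\<lambda>\<psi>. inner_on V \<psi> \<psi>)"
    unfolding inner_on_def by (intro continuous_intros cont)
  have cr: "continuous_on UNIV (\<lambda>\<psi>. inner_on V (mat_apply V M \<psi>) \<psi>)"
    unfolding inner_on_def mat_apply_def by (intro continuous_intros cont)
  have "U \<subseteq> (\<Pi>\<^sub>E v\<in>UNIV. {-1..1})"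
  proof
    fix \<psi> assume u: "\<psi> \<in> U"
    have "\<bar>\<psi> v\<bar> \<le> 1" for v
    proof (cases "v \<in> V")
      case True
      have "\<psi> v ^ 2 \<le> (\<Sum>w\<in>V. \<psi> w ^ 2)"
        using True fin by (intro member_le_sum) auto
      also have "\<dots> = 1" using u by (simp add: U_def inner_on_def power2_eq_square)
      finally show ?thesis by (simp add: abs_square_le_1)
    qed (use u in \<open>auto simp: U_def\<close>)
    then show "\<psi> \<in> (\<Pi>\<^sub>E v\<in>UNIV. {-1..1})" by (auto simp: abs_le_iff minus_le_iff)
  qed
  moreover have "compact (\<Pi>\<^sub>E v\<in>(UNIV::'a set). {-1..1::real})"
  proof -
    have "compactin (product_topology (\<lambda>_. euclidean) UNIV) (\<Pi>\<^sub>E v\<in>(UNIV::'a set). {-1..1::real})"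
      unfolding compactin_PiE by simp
    then show ?thesis by (simp add: euclidean_product_topology)
  qed
  moreover have "closed U"
  proof -
    have "U = (\<Inter>v\<in>-V. {\<psi>. \<psi> v = 0}) \<inter> {\<psi>. inner_on V \<psi> \<psi> = 1} \<inter> (\<Inter>j\<in>J. {\<psi>. inner_on V (\<phi> j) \<psi> = 0})"
      by (auto simp: U_def)
    moreover have "closed \<dots>"
      by (intro closed_Int closed_INT ballI closed_Collect_eq cq cip cont continuous_on_const)
    ultimately show ?thesis by simp
  qed
  ultimately have "compact U"
    by (metis compact_Int_closed inf.absorb_iff2)
  then obtain \<psi> where \<psi>: "\<psi> \<in> U" and mx: "\<And>f. f \<in> U \<Longrightarrow> inner_on V (mat_apply V M f) f \<le> inner_on V (mat_apply V M \<psi>) \<psi>"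
    using continuous_attains_sup[OF _ ne continuous_on_subset[OF cr subset_UNIV]] by blast
  define x where "x = inner_on V (mat_apply V M \<psi>) \<psi>"
  have n1: "inner_on V \<psi> \<psi> = 1" and o1: "\<And>j. j \<in> J \<Longrightarrow> inner_on V (\<phi> j) \<psi> = 0" using \<psi> by (auto simp: U_def)
  have bound: "inner_on V (mat_apply V M f) f \<le> x * inner_on V f f" if o: "\<And>j. j \<in> J \<Longrightarrow> inner_on V (\<phi> j) f = 0" for f
  proof (cases "inner_on V f f = 0")
    case True
    then have "\<forall>v\<in>V. f v = 0" using inner_on_self_eq_0[OF fin(1)] by blast
    then show ?thesis by (simp add: inner_on_def)
  next
    case False
    define n where "n = inner_on V f f"
    have n: "n > 0" using False inner_on_self_nonneg[of V f] by (simp add: n_def)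
    define g where "g = (\<lambda>w. if w \<in> V then (1 / sqrt n) * f w else 0)"
    have g: "inner_on V g h = (1 / sqrt n) * inner_on V f h" for h
      unfolding inner_on_scale_left[symmetric] by (simp add: inner_on_def g_def)
    have "inner_on V g g = (1 / sqrt n) * ((1 / sqrt n) * n)"
      using g[of g] g[of f] by (simp only: inner_on_commute[of V f g] n_def)
    then have gg: "inner_on V g g = 1" using n by simp
    have go: "inner_on V (\<phi> j) g = 0" if "j \<in> J" for j
      using g[of "\<phi> j"] o[OF that] by (simp only: inner_on_commute[of V g] inner_on_commute[of V f] mult_zero_right)
    have "g \<in> U"
      unfolding U_def mem_Collect_eq using gg go by (simp add: g_def)
    have Ag: "mat_apply V M g v = (1 / sqrt n) * mat_apply V M f v" for v
      by (simp add: mat_apply_def g_def sum_distrib_left mult.left_commute)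
    then have "inner_on V (mat_apply V M g) g = (1 / sqrt n) * ((1 / sqrt n) * inner_on V (mat_apply V M f) f)"
      unfolding Ag[abs_def] inner_on_scale_left using g[of "mat_apply V M f"] by (simp only: inner_on_commute[of V _ g] inner_on_commute[of V _ f])
    also have "\<dots> = inner_on V (mat_apply V M f) f / n" using n by (simp add: field_simps)
    finally have "inner_on V (mat_apply V M f) f / n \<le> x"
      using mx[OF \<open>g \<in> U\<close>] by (simp add: x_def)
    then show ?thesis using n by (simp add: n_def divide_le_eq)
  qed
  define \<eta> where "\<eta> = (\<lambda>v. mat_apply V M \<psi> v + (- x) * \<psi> v)"
  define a where "a = inner_on V \<eta> \<eta>"
  define b where "b = inner_on V (mat_apply V M \<eta>) \<eta> - x * a"
  have oA: "inner_on V (\<phi> j) (mat_apply V M \<psi>) = 0" if "j \<in> J" for j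
  proof -
    have "inner_on V (\<phi> j) (mat_apply V M \<psi>) = inner_on V (mat_apply V M (\<phi> j)) \<psi>" 
      by (rule mat_apply_sym[OF sym, symmetric])
    also have "\<dots> = inner_on V (\<lambda>v. \<mu> j * \<phi> j v) \<psi>" unfolding inner_on_def using ev[OF that] by simp
    finally show ?thesis using o1[OF that] by (simp add: inner_on_scale_left)
  qed
  have o\<eta>: "inner_on V (\<phi> j) \<eta> = 0" if "j \<in> J" for j
    unfolding \<eta>_def inner_on_lin_right using oA o1 that by simp
  have \<psi>\<eta>: "inner_on V \<psi> \<eta> = 0"
    unfolding \<eta>_def inner_on_lin_right using n1 by (simp add: x_def inner_on_commute)
  have A\<eta>: "inner_on V (mat_apply V M \<psi>) \<eta> = a"
  proof -
    have "a = inner_on V (mat_apply V M \<psi>) \<eta> + (- x) * inner_on V \<psi> \<eta>"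
      unfolding a_def by (subst (1) \<eta>_def) (rule inner_on_lin_left)
    then show ?thesis using \<psi>\<eta> by simp
  qed
  \<comment> \<open>First variation of the Rayleigh quotient in the direction \<open>\<eta>\<close>, the residual of the eigenvalue equation.\<close>
  have quad: "2 * t * a + t\<^sup>2 * b \<le> 0" for t
  proof -
    define f where "f = (\<lambda>v. \<psi> v + t * \<eta> v)"
    have "inner_on V (mat_apply V M f) f \<le> x * inner_on V f f"
      by (rule bound) (simp add: f_def inner_on_lin_right o1 o\<eta>)
    moreover have "inner_on V f f = 1 + t\<^sup>2 * a"
      unfolding f_def inner_on_lin_left inner_on_lin_right using n1 \<psi>\<eta>
      by (simp add: inner_on_commute a_def power2_eq_square)
    moreover have "inner_on V (mat_apply V M f) f = x + 2 * t * a + t\<^sup>2 * inner_on V (mat_apply V M \<eta>) \<eta>"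
    proof -
      have "mat_apply V M f = (\<lambda>v. mat_apply V M \<psi> v + t * mat_apply V M \<eta> v)"
        unfolding f_def mat_apply_lin ..
      moreover have "inner_on V (mat_apply V M \<eta>) \<psi> = a"
        using A\<eta> mat_apply_sym[of V M \<eta> \<psi>] sym by (simp add: inner_on_commute)
      ultimately show ?thesis
        by (simp add: f_def inner_on_lin_left inner_on_lin_right A\<eta> x_def power2_eq_square algebra_simps)
    qed
    ultimately show ?thesis by (simp add: b_def algebra_simps)
  qed
  have "a \<le> 0"
  proof (rule ccontr)
    assume "\<not> a \<le> 0"
    then have a: "a > 0" by simp
    define t where "t = a / (\<bar>b\<bar> + 1)"
    have t: "t > 0" using a by (simp add: t_def)
    have "t * \<bar>b\<bar> \<le> a" using a by (simp add: t_def divide_le_eq field_simps)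
    moreover have "- (t * b) \<le> t * \<bar>b\<bar>" using t mult_left_mono[of "- b" "\<bar>b\<bar>" t] by simp
    ultimately have "2 * a + t * b > 0" using a by linarith
    then have "t * (2 * a + t * b) > 0" using t by simp
    then show False using quad[of t] by (simp add: algebra_simps power2_eq_square)
  qed
  then have "\<forall>v\<in>V. \<eta> v = 0"
    using inner_on_self_eq_0[OF fin(1), of \<eta>] inner_on_self_nonneg[of V \<eta>] by (simp add: a_def)
  then show ?thesis using n1 o1
    by (intro exI[of _ \<psi>] exI[of _ x]) (simp add: \<eta>_def)
qed

theorem symmetric_eigenbasis:
  assumes fin: "finite V" and sym: "\<And>u v. u \<in> V \<Longrightarrow> v \<in> V \<Longrightarrow> M u v = M v u"
  obtains \<phi> \<mu> where "orthonormal V {..<card V} \<phi>"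
    "\<And>i v. i < card V \<Longrightarrow> v \<in> V \<Longrightarrow> mat_apply V M (\<phi> i) v = \<mu> i * \<phi> i v"
proof -
  have "m \<le> card V \<Longrightarrow> \<exists>\<phi> \<mu>. orthonormal V {..<m} \<phi> \<and> (\<forall>i<m. \<forall>v\<in>V. mat_apply V M (\<phi> i) v = \<mu> i * \<phi> i v)" for m
  proof (induction m)
    case 0
    show ?case by (simp add: orthonormal_def)
  next
    case (Suc m)
    then obtain \<phi> \<mu> where on: "orthonormal V {..<m} \<phi>"
      and ev: "\<forall>i<m. \<forall>v\<in>V. mat_apply V M (\<phi> i) v = \<mu> i * \<phi> i v" by auto
    obtain \<psi> x where \<psi>: "inner_on V \<psi> \<psi> = 1" "\<forall>j\<in>{..<m}. inner_on V (\<phi> j) \<psi> = 0" "\<forall>v\<in>V. mat_apply V M \<psi> v = x * \<psi> v"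
      using eigenvector_extend[of V "{..<m}" M \<phi> \<mu>] fin sym on ev Suc.prems by auto
    have "orthonormal V {..<Suc m} (\<phi>(m := \<psi>))"
      using on \<psi> by (auto simp: orthonormal_def less_Suc_eq inner_on_commute)
    moreover have "\<forall>i<Suc m. \<forall>v\<in>V. mat_apply V M ((\<phi>(m := \<psi>)) i) v = (\<mu>(m := x)) i * (\<phi>(m := \<psi>)) i v"
      using ev \<psi> by (auto simp: less_Suc_eq)
    ultimately show ?case by blast
  qed
  from this[of "card V"] show ?thesis using that by blast
qed

lemma orthonormal_complete:
  assumes fin: "finite V" and on: "orthonormal V {..<card V} \<phi>" and "v \<in> V" "w \<in> V"
  shows "(\<Sum>i<card V. \<phi> i v * \<phi> i w) = (if v = w then 1 else 0)"
proof -
  define r where "r = (\<lambda>v w. (if w = v then 1 else 0) + (- 1) * (\<Sum>j<card V. \<phi> j v * \<phi> j w))"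
  have rr: "inner_on V (r u) (r u) = 1 - (\<Sum>j<card V. \<phi> j u ^ 2)" if "u \<in> V" for u
    using residual_norm(2)[OF fin _ on that] by (simp add: r_def)
  have "(\<Sum>u\<in>V. inner_on V (r u) (r u)) = 0"
    using sum_orthonormal_squares[OF _ on] by (simp add: rr sum_subtractf)
  then have "inner_on V (r v) (r v) = 0"
    using assms by (subst (asm) sum_nonneg_eq_0_iff) (auto simp: inner_on_self_nonneg)
  then have "r v w = 0" using inner_on_self_eq_0[OF fin] assms by blast
  then show ?thesis by (auto simp: r_def split: if_splits)
qed

lemma expand_in_basis:
  assumes fin: "finite V" and on: "orthonormal V {..<card V} \<phi>" and v: "v \<in> V"
  shows "\<psi> v = (\<Sum>i<card V. inner_on V (\<phi> i) \<psi> * \<phi> i v)"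
proof -
  have "(\<Sum>i<card V. inner_on V (\<phi> i) \<psi> * \<phi> i v) = (\<Sum>i<card V. \<Sum>w\<in>V. \<phi> i w * \<psi> w * \<phi> i v)"
    by (simp add: inner_on_def sum_distrib_right)
  also have "\<dots> = (\<Sum>w\<in>V. \<Sum>i<card V. \<phi> i w * \<psi> w * \<phi> i v)" by (rule sum.swap)
  also have "\<dots> = (\<Sum>w\<in>V. \<psi> w * (\<Sum>i<card V. \<phi> i w * \<phi> i v))"
    by (simp add: sum_distrib_left algebra_simps)
  also have "\<dots> = (\<Sum>w\<in>V. if w = v then \<psi> w else 0)"
    using orthonormal_complete[OF fin on] v by (intro sum.cong) auto
  finally show ?thesis using fin v by simp
qed

section \<open>Spectral trace and jumps of the density of states\<close>

text \<open>
  A homogeneous linear system with more unknowns than equations has a nontrivial solution, by elimination of one unknown.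
\<close>

lemma underdetermined_system:
  fixes c :: "'i \<Rightarrow> 'k \<Rightarrow> real"
  assumes "finite K" "finite I" "card K < card I"
  shows "\<exists>d. (\<exists>i\<in>I. d i \<noteq> 0) \<and> (\<forall>k\<in>K. (\<Sum>i\<in>I. d i * c i k) = 0)"
  using assms
proof (induction K arbitrary: I c rule: finite_induct)
  case empty
  then obtain i where "i \<in> I" by fastforce
  then show ?case by (intro exI[of _ "\<lambda>_. 1"]) auto
next
  case (insert k K)
  show ?case
  proof (cases "\<forall>i\<in>I. c i k = 0")
    case True
    have "card K < card I" using insert by simp
    from insert.IH[OF insert.prems(1) this, of c] True show ?thesis by (auto intro!: sum.neutral)
  next
    case False
    then obtain i0 where i0: "i0 \<in> I" "c i0 k \<noteq> 0" by blast
    define I' where "I' = I - {i0}"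
    have "finite I'" "card K < card I'" using insert i0 by (auto simp: I'_def)
    from insert.IH[OF this, of "\<lambda>i k'. c i k' - c i k / c i0 k * c i0 k'"]
    obtain d where d: "\<exists>i\<in>I'. d i \<noteq> 0" "\<forall>k'\<in>K. (\<Sum>i\<in>I'. d i * (c i k' - c i k / c i0 k * c i0 k')) = 0"
      by blast
    define s where "s = (\<Sum>i\<in>I'. d i * c i k)"
    \<comment> \<open>The unknown \<open>i0\<close> is recovered from equation \<open>k\<close>.\<close>
    define d' where "d' = d(i0 := - s / c i0 k)"
    have split: "(\<Sum>i\<in>I. d' i * c i k') = - s / c i0 k * c i0 k' + (\<Sum>i\<in>I'. d i * c i k')" for k'
    proof -
      have "(\<Sum>i\<in>I. d' i * c i k') = d' i0 * c i0 k' + (\<Sum>i\<in>I'. d' i * c i k')"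
        unfolding I'_def using i0 insert.prems by (simp add: sum.remove)
      moreover have "(\<Sum>i\<in>I'. d' i * c i k') = (\<Sum>i\<in>I'. d i * c i k')"
        by (intro sum.cong) (auto simp: d'_def I'_def)
      ultimately show ?thesis by (simp add: d'_def)
    qed
    have "(\<Sum>i\<in>I. d' i * c i k') = 0" if "k' \<in> insert k K" for k'
    proof (cases "k' = k")
      case True
      then show ?thesis using i0 by (simp add: split s_def)
    next
      case False
      then have "0 = (\<Sum>i\<in>I'. d i * c i k' - d i * c i k * (c i0 k' / c i0 k))"
        using d(2) that by (simp add: algebra_simps)
      also have "\<dots> = (\<Sum>i\<in>I'. d i * c i k') - s * (c i0 k' / c i0 k)"
        by (simp add: sum_subtractf s_def sum_distrib_right sum_divide_distrib)
      finally show ?thesis by (simp add: split)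
    qed
    moreover have "\<exists>i\<in>I. d' i \<noteq> 0" using d(1) by (auto simp: d'_def I'_def)
    ultimately show ?thesis by blast
  qed
qed

definition laplacian_matrix :: "'v set \<Rightarrow> ('v \<Rightarrow> 'v \<Rightarrow> bool) \<Rightarrow> 'v \<Rightarrow> 'v \<Rightarrow> real" where
  "laplacian_matrix V adj v u =
     (if u = v then real (card {w \<in> V. adj w v}) else 0) - (if adj u v then 1 else 0)"

lemma graph_laplacian_mat_apply:
  assumes "finite V" "v \<in> V"
  shows "graph_laplacian V adj \<psi> v = mat_apply V (laplacian_matrix V adj) \<psi> v"
proof -
  have "mat_apply V (laplacian_matrix V adj) \<psi> v =
      (\<Sum>u\<in>V. (if u = v then real (card {w \<in> V. adj w v}) * \<psi> v else 0) - (if adj u v then \<psi> u else 0))"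
    unfolding mat_apply_def laplacian_matrix_def by (intro sum.cong) (auto simp: algebra_simps)
  also have "\<dots> = real (card {w \<in> V. adj w v}) * \<psi> v - (\<Sum>u\<in>V. if adj u v then \<psi> u else 0)"
    using assms by (simp add: sum_subtractf)
  also have "(\<Sum>u\<in>V. if adj u v then \<psi> u else 0) = (\<Sum>u | u \<in> V \<and> adj u v. \<psi> u)"
    using assms(1) by (simp add: sum.inter_filter)
  finally show ?thesis by (simp add: graph_laplacian_def sum_subtractf)
qed

locale finite_graph =
  fixes V :: "'v set" and adj :: "'v \<Rightarrow> 'v \<Rightarrow> bool"
  assumes fin: "finite V" and sym: "\<And>u v. adj u v \<Longrightarrow> adj v u"
begin

abbreviation "M \<equiv> laplacian_matrix V adj"

lemma M_sym: "M u v = M v u"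
  using sym by (auto simp: laplacian_matrix_def)

definition eigenbasis :: "(nat \<Rightarrow> 'v \<Rightarrow> real) \<Rightarrow> (nat \<Rightarrow> real) \<Rightarrow> bool" where
  "eigenbasis \<phi> \<mu> \<longleftrightarrow> orthonormal V {..<card V} \<phi> \<and> (\<forall>i<card V. \<forall>v\<in>V. mat_apply V M (\<phi> i) v = \<mu> i * \<phi> i v)"

lemma ex_eigenbasis: "\<exists>\<phi> \<mu>. eigenbasis \<phi> \<mu>"
  by (rule symmetric_eigenbasis[OF fin, of M], rule M_sym) (auto simp: eigenbasis_def)

lemma eigen_orthogonal:
  assumes b: "eigenbasis \<phi> \<mu>" and i: "i < card V" and \<psi>: "\<And>v. v \<in> V \<Longrightarrow> mat_apply V M \<psi> v = x * \<psi> v"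
    and "\<mu> i \<noteq> x"
  shows "inner_on V (\<phi> i) \<psi> = 0"
proof -
  have "\<mu> i * inner_on V (\<phi> i) \<psi> = inner_on V (mat_apply V M (\<phi> i)) \<psi>"
    using b i unfolding inner_on_scale_left[symmetric] by (auto simp: inner_on_def eigenbasis_def intro!: sum.cong)
  also have "\<dots> = inner_on V (\<phi> i) (mat_apply V M \<psi>)" by (rule mat_apply_sym) (rule M_sym)
  also have "\<dots> = x * inner_on V (\<phi> i) \<psi>"
    using \<psi> by (simp add: inner_on_def sum_distrib_left mult.left_commute)
  finally show ?thesis using assms(4) by simp
qed

text \<open>
  Uniqueness in the defining description holds because the eigenvectors of the basis determine a matrix, existence because
  eigenvectors for different eigenvalues are orthogonal.
\<close>

lemma functional_calculus_eq:
  assumes b: "eigenbasis \<phi> \<mu>"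
  shows "functional_calculus V (graph_laplacian V adj) f =
    (\<lambda>v w. if v \<in> V \<and> w \<in> V then \<Sum>i<card V. f (\<mu> i) * \<phi> i v * \<phi> i w else 0)" (is "_ = ?F")
  unfolding functional_calculus_def
proof (rule the_equality)
  have on: "orthonormal V {..<card V} \<phi>" using b by (simp add: eigenbasis_def)
  have "(\<Sum>w\<in>V. ?F v w * \<psi> w) = f x * \<psi> v"
    if e: "\<forall>v\<in>V. graph_laplacian V adj \<psi> v = x * \<psi> v" and v: "v \<in> V" for x \<psi> v
  proof -
    have e': "\<And>v. v \<in> V \<Longrightarrow> mat_apply V M \<psi> v = x * \<psi> v" using e graph_laplacian_mat_apply[OF fin, of _ adj \<psi>] by simp
    have "(\<Sum>w\<in>V. ?F v w * \<psi> w) = (\<Sum>w\<in>V. \<Sum>i<card V. f (\<mu> i) * \<phi> i v * (\<phi> i w * \<psi> w))"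
      using v by (simp add: sum_distrib_right mult.assoc)
    also have "\<dots> = (\<Sum>i<card V. f (\<mu> i) * \<phi> i v * inner_on V (\<phi> i) \<psi>)"
      by (subst sum.swap) (simp add: inner_on_def sum_distrib_left)
    also have "\<dots> = (\<Sum>i<card V. f x * (inner_on V (\<phi> i) \<psi> * \<phi> i v))"
    proof (rule sum.cong)
      fix i assume "i \<in> {..<card V}"
      then show "f (\<mu> i) * \<phi> i v * inner_on V (\<phi> i) \<psi> = f x * (inner_on V (\<phi> i) \<psi> * \<phi> i v)"
        using eigen_orthogonal[OF b _ e', of i] by (cases "\<mu> i = x") auto
    qed simp
    also have "\<dots> = f x * \<psi> v"
      unfolding sum_distrib_left[symmetric] expand_in_basis[OF fin on v, of \<psi>] ..
    finally show ?thesis .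
  qed
  then show "(\<forall>v w. v \<notin> V \<or> w \<notin> V \<longrightarrow> ?F v w = 0) \<and>
      (\<forall>x \<psi>. (\<forall>v\<in>V. graph_laplacian V adj \<psi> v = x * \<psi> v) \<longrightarrow> (\<forall>v\<in>V. (\<Sum>w\<in>V. ?F v w * \<psi> w) = f x * \<psi> v))"
    by auto
  fix G assume G: "(\<forall>v w. v \<notin> V \<or> w \<notin> V \<longrightarrow> G v w = 0) \<and>
      (\<forall>x \<psi>. (\<forall>v\<in>V. graph_laplacian V adj \<psi> v = x * \<psi> v) \<longrightarrow> (\<forall>v\<in>V. (\<Sum>w\<in>V. G v w * \<psi> w) = f x * \<psi> v))"
  have "G v u = ?F v u" for v u
  proof (cases "v \<in> V \<and> u \<in> V")
    case True
    have "G v u = (\<Sum>w\<in>V. G v w * (\<Sum>i<card V. \<phi> i w * \<phi> i u))"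
      using True fin by (simp add: orthonormal_complete[OF fin on] if_distrib cong: if_cong sum.cong)
    also have "\<dots> = (\<Sum>w\<in>V. \<Sum>i<card V. \<phi> i u * (G v w * \<phi> i w))"
      by (simp add: sum_distrib_left mult_ac)
    also have "\<dots> = (\<Sum>i<card V. \<phi> i u * (\<Sum>w\<in>V. G v w * \<phi> i w))"
      by (subst sum.swap) (simp add: sum_distrib_left)
    also have "\<dots> = (\<Sum>i<card V. \<phi> i u * (f (\<mu> i) * \<phi> i v))"
    proof (rule sum.cong)
      fix i assume "i \<in> {..<card V}"
      then have "\<forall>v\<in>V. graph_laplacian V adj (\<phi> i) v = \<mu> i * \<phi> i v"
        using b by (simp add: eigenbasis_def graph_laplacian_mat_apply[OF fin])
      then show "\<phi> i u * (\<Sum>w\<in>V. G v w * \<phi> i w) = \<phi> i u * (f (\<mu> i) * \<phi> i v)"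
        using G True by simp
    qed simp
    finally show ?thesis using True by (simp add: mult_ac)
  qed (use G in auto)
  then show "G = ?F" by blast
qed

lemma spectral_trace_eq_card:
  assumes b: "eigenbasis \<phi> \<mu>"
  shows "spectral_trace V adj B = card {i. i < card V \<and> \<mu> i \<in> B}"
proof -
  have "spectral_trace V adj B = (\<Sum>v\<in>V. \<Sum>i<card V. indicator B (\<mu> i) * (\<phi> i v * \<phi> i v))"
    unfolding spectral_trace_def functional_calculus_eq[OF b] by (simp add: mult.assoc)
  also have "\<dots> = (\<Sum>i<card V. indicator B (\<mu> i) * inner_on V (\<phi> i) (\<phi> i))"
    by (subst sum.swap) (simp add: inner_on_def sum_distrib_left)
  also have "\<dots> = (\<Sum>i<card V. indicator B (\<mu> i))"
    using b by (intro sum.cong) (auto simp: eigenbasis_def orthonormal_def)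
  also have "\<dots> = (\<Sum>i\<in>{i. i < card V \<and> \<mu> i \<in> B}. 1)"
    by (intro sum.mono_neutral_cong_right) (auto simp: indicator_def)
  finally show ?thesis by simp
qed

text \<open>
  The index set cannot be larger than the dimension of the eigenspace: otherwise some nontrivial combination of the \<open>\<psi> i\<close>
  vanishes, and evaluating it at the pivot of an index of maximal rank with nonzero coefficient isolates that coefficient.
\<close>

lemma triangular_eigenfunctions_le_trace:
  fixes \<psi> :: "'i \<Rightarrow> 'v \<Rightarrow> real" and rank :: "'i \<Rightarrow> nat"
  assumes "finite I"
    and eigen: "\<And>i v. i \<in> I \<Longrightarrow> v \<in> V \<Longrightarrow> graph_laplacian V adj (\<psi> i) v = E * \<psi> i v"
    and pivot: "\<And>i. i \<in> I \<Longrightarrow> pivot i \<in> V \<and> \<psi> i (pivot i) \<noteq> 0"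
    and triangular: "\<And>i j. i \<in> I \<Longrightarrow> j \<in> I \<Longrightarrow> i \<noteq> j \<Longrightarrow> rank j \<le> rank i \<Longrightarrow> \<psi> j (pivot i) = 0"
  shows "card I \<le> spectral_trace V adj {E}"
proof (rule ccontr)
  obtain \<phi> \<mu> where b: "eigenbasis \<phi> \<mu>" using ex_eigenbasis by blast
  define K where "K = {i. i < card V \<and> \<mu> i \<in> {E}}"
  assume "\<not> ?thesis"
  then have "card K < card I" by (simp add: spectral_trace_eq_card[OF b] K_def)
  from underdetermined_system[OF _ \<open>finite I\<close> this, of "\<lambda>i k. inner_on V (\<phi> k) (\<psi> i)"]
  obtain d where d: "\<exists>i\<in>I. d i \<noteq> 0" and z: "\<forall>k\<in>K. (\<Sum>i\<in>I. d i * inner_on V (\<phi> k) (\<psi> i)) = 0"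
    by (auto simp: K_def)
  have zero: "(\<Sum>i\<in>I. d i * \<psi> i v) = 0" if "v \<in> V" for v
  proof -
    have on: "orthonormal V {..<card V} \<phi>" using b by (simp add: eigenbasis_def)
    have "\<psi> i v = (\<Sum>k\<in>K. inner_on V (\<phi> k) (\<psi> i) * \<phi> k v)" if i: "i \<in> I" for i
    proof -
      have "\<psi> i v = (\<Sum>k<card V. inner_on V (\<phi> k) (\<psi> i) * \<phi> k v)" by (rule expand_in_basis[OF fin on \<open>v \<in> V\<close>])
      also have "\<dots> = (\<Sum>k\<in>K. inner_on V (\<phi> k) (\<psi> i) * \<phi> k v)"
        using eigen_orthogonal[OF b, of _ "\<psi> i" E] eigen[OF i] graph_laplacian_mat_apply[OF fin, of _ adj "\<psi> i"]
        by (intro sum.mono_neutral_right) (auto simp: K_def)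
      finally show ?thesis .
    qed
    then have "(\<Sum>i\<in>I. d i * \<psi> i v) = (\<Sum>i\<in>I. \<Sum>k\<in>K. d i * inner_on V (\<phi> k) (\<psi> i) * \<phi> k v)"
      by (simp add: sum_distrib_left mult.assoc)
    also have "\<dots> = (\<Sum>k\<in>K. (\<Sum>i\<in>I. d i * inner_on V (\<phi> k) (\<psi> i)) * \<phi> k v)"
      by (subst sum.swap) (simp add: sum_distrib_right)
    also have "\<dots> = 0" using z by simp
    finally show ?thesis .
  qed
  define J where "J = {i \<in> I. d i \<noteq> 0}"
  have "finite J" "J \<noteq> {}" using d \<open>finite I\<close> by (auto simp: J_def)
  then have "Max (rank ` J) \<in> rank ` J" by simp
  then obtain i where i: "i \<in> J" "rank i = Max (rank ` J)" by auto
  have top: "rank j \<le> rank i" if "j \<in> J" for j using i that \<open>finite J\<close> by simp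
  have "(\<Sum>j\<in>I. d j * \<psi> j (pivot i)) = (\<Sum>j\<in>{i}. d j * \<psi> j (pivot i))"
  proof (rule sum.mono_neutral_right)
    show "\<forall>j\<in>I - {i}. d j * \<psi> j (pivot i) = 0"
    proof
      fix j assume j: "j \<in> I - {i}"
      show "d j * \<psi> j (pivot i) = 0"
      proof (cases "d j = 0")
        case False
        then have "rank j \<le> rank i" using top[of j] j by (simp add: J_def)
        then show ?thesis using triangular[of i j] i(1) j by (auto simp: J_def)
      qed simp
    qed
  qed (use \<open>finite I\<close> i(1) in \<open>auto simp: J_def\<close>)
  then have "d i * \<psi> i (pivot i) = 0" using zero pivot i by (simp add: J_def)
  then show False using i pivot by (auto simp: J_def)
qed

end

lemma tile_adjacent_sym: "tile_adjacent P Q \<Longrightarrow> tile_adjacent Q P"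
  by (auto simp: tile_adjacent_def)

lemma cdf_eigenvalue_measure_jump:
  assumes fin: "finite (exhaustion \<T> n)" and ne: "exhaustion \<T> n \<noteq> {}" and "x < E" "E < y"
  shows "spectral_trace (exhaustion \<T> n) tile_adjacent {E} / card (exhaustion \<T> n)
    \<le> cdf (eigenvalue_measure \<T> n) y - cdf (eigenvalue_measure \<T> n) x"
proof -
  define V where "V = exhaustion \<T> n"
  interpret finite_graph V tile_adjacent
    using fin by unfold_locales (auto simp: V_def tile_adjacent_sym)
  obtain \<phi> \<mu> where b: "eigenbasis \<phi> \<mu>" using ex_eigenbasis by blast
  have N: "card V > 0" using fin ne by (simp add: V_def card_gt_0_iff)
  define D where "D = distr (uniform_count_measure {..<card V}) borel \<mu>"
  have mu: "\<mu> \<in> uniform_count_measure {..<card V} \<rightarrow>\<^sub>M borel"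
    by (simp add: uniform_count_measure_def point_measure_def)
  have emD: "emeasure D B = ennreal (spectral_trace V tile_adjacent B / card V)" if "B \<in> sets borel" for B
  proof -
    have "emeasure D B = emeasure (uniform_count_measure {..<card V}) (\<mu> -` B \<inter> {..<card V})"
      using that mu by (simp add: D_def emeasure_distr space_uniform_count_measure)
    also have "\<dots> = ennreal (card (\<mu> -` B \<inter> {..<card V}) / card V)"
      by (simp add: emeasure_uniform_count_measure)
    also have "\<mu> -` B \<inter> {..<card V} = {i. i < card V \<and> \<mu> i \<in> B}" by auto
    finally show ?thesis by (simp add: spectral_trace_eq_card[OF b])
  qed
  have "eigenvalue_measure \<T> n = measure_of UNIV (sets borel) (emeasure D)"
    unfolding eigenvalue_measure_def V_def[symmetric]
    by (rule measure_of_eq) (auto simp: emD sets.sigma_sets_eq[of "borel :: real measure", simplified])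
  also have "\<dots> = D"
    using measure_of_of_measure[of D] by (simp add: D_def)
  finally have eq: "eigenvalue_measure \<T> n = D" .
  have m: "cdf D z = card {i. i < card V \<and> \<mu> i \<le> z} / card V" for z
    unfolding cdf_def measure_def using emD[of "{..z}"] by (simp add: spectral_trace_eq_card[OF b])
  have "{i. i < card V \<and> \<mu> i \<in> {E}} \<union> {i. i < card V \<and> \<mu> i \<le> x} \<subseteq> {i. i < card V \<and> \<mu> i \<le> y}"
    using assms by auto
  then have "card ({i. i < card V \<and> \<mu> i \<in> {E}} \<union> {i. i < card V \<and> \<mu> i \<le> x}) \<le> card {i. i < card V \<and> \<mu> i \<le> y}"
    by (intro card_mono) auto
  moreover have "card ({i. i < card V \<and> \<mu> i \<in> {E}} \<union> {i. i < card V \<and> \<mu> i \<le> x}) =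
      card {i. i < card V \<and> \<mu> i \<in> {E}} + card {i. i < card V \<and> \<mu> i \<le> x}"
    using assms by (intro card_Un_disjoint) auto
  ultimately have "real (card {i. i < card V \<and> \<mu> i \<in> {E}}) + card {i. i < card V \<and> \<mu> i \<le> x}
      \<le> card {i. i < card V \<and> \<mu> i \<le> y}" by linarith
  then have "spectral_trace V tile_adjacent {E} \<le>
      real (card {i. i < card V \<and> \<mu> i \<le> y}) - card {i. i < card V \<and> \<mu> i \<le> x}"
    by (simp add: spectral_trace_eq_card[OF b])
  then show ?thesis
    unfolding eq m V_def[symmetric] using N by (simp add: divide_right_mono flip: diff_divide_distrib)
qed

text \<open>
  Continuity points of the limit are dense, and between two of them on either side of \<open>E\<close> the distribution functions of the
  finite graphs rise by the multiplicity of \<open>E\<close>; let the points tend to \<open>E\<close>.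
\<close>

lemma jump_ge_of_eigenvalue_frequency:
  fixes c E :: real
  assumes dos: "density_of_states \<T> \<nu>"
    and freq: "\<And>\<epsilon>. \<epsilon> > 0 \<Longrightarrow> eventually (\<lambda>n. finite (exhaustion \<T> n) \<and> exhaustion \<T> n \<noteq> {} \<and>
      (c - \<epsilon>) * card (exhaustion \<T> n) \<le> spectral_trace (exhaustion \<T> n) tile_adjacent {E}) sequentially"
  shows "c \<le> right_limit (cdf \<nu>) E - left_limit (cdf \<nu>) E"
proof -
  interpret real_distribution \<nu> using dos by (simp add: density_of_states_def)
  have conv: "isCont (cdf \<nu>) x \<Longrightarrow> (\<lambda>n. cdf (eigenvalue_measure \<T> n) x) \<longlonglongrightarrow> cdf \<nu> x" for x
    using dos by (simp add: density_of_states_def weak_conv_m_def weak_conv_def)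
  have ge: "c \<le> cdf \<nu> y - cdf \<nu> x" if x: "x < E" "isCont (cdf \<nu>) x" and y: "E < y" "isCont (cdf \<nu>) y" for x y
  proof (rule field_le_epsilon)
    fix \<epsilon> :: real assume "\<epsilon> > 0"
    have "eventually (\<lambda>n. c - \<epsilon> \<le> cdf (eigenvalue_measure \<T> n) y - cdf (eigenvalue_measure \<T> n) x) sequentially"
      using freq[OF \<open>\<epsilon> > 0\<close>]
    proof eventually_elim
      case (elim n)
      then have "c - \<epsilon> \<le> spectral_trace (exhaustion \<T> n) tile_adjacent {E} / card (exhaustion \<T> n)"
        by (simp add: le_divide_eq card_gt_0_iff)
      also have "\<dots> \<le> cdf (eigenvalue_measure \<T> n) y - cdf (eigenvalue_measure \<T> n) x"
        using elim x y by (intro cdf_eigenvalue_measure_jump) auto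
      finally show ?case .
    qed
    then have "c - \<epsilon> \<le> cdf \<nu> y - cdf \<nu> x"
      by (intro tendsto_lowerbound[OF tendsto_diff[OF conv[OF y(2)] conv[OF x(2)]]]) auto
    then show "c \<le> cdf \<nu> y - cdf \<nu> x + \<epsilon>" by simp
  qed
  have right: "(cdf \<nu> \<longlongrightarrow> cdf \<nu> E) (at_right E)"
    using cdf_is_right_cont[of E] by (simp add: continuous_within)
  have left: "(cdf \<nu> \<longlongrightarrow> measure \<nu> {..<E}) (at_left E)" by (rule cdf_at_left)
  have countable: "countable {a. \<not> isCont (cdf \<nu>) a}"
    by (rule mono_ctble_discont) (auto simp: mono_def cdf_nondecreasing)
  have "c \<le> cdf \<nu> E - measure \<nu> {..<E}"
  proof (rule field_le_epsilon)
    fix \<epsilon> :: real assume e: "\<epsilon> > 0"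
    have "eventually (\<lambda>y. cdf \<nu> y < cdf \<nu> E + \<epsilon> / 2) (at_right E)"
      using right e by (intro order_tendstoD) auto
    then obtain b where b: "E < b" "\<And>y. E < y \<Longrightarrow> y < b \<Longrightarrow> cdf \<nu> y < cdf \<nu> E + \<epsilon> / 2"
      by (auto simp: eventually_at_right_field)
    have "eventually (\<lambda>x. cdf \<nu> x > measure \<nu> {..<E} - \<epsilon> / 2) (at_left E)"
      using left e by (intro order_tendstoD) auto
    then obtain a where a: "a < E" "\<And>x. a < x \<Longrightarrow> x < E \<Longrightarrow> cdf \<nu> x > measure \<nu> {..<E} - \<epsilon> / 2"
      by (auto simp: eventually_at_left_field)
    obtain x where x: "a < x" "x < E" "isCont (cdf \<nu>) x"
      using real_interval_avoid_countable_set[OF a(1) countable] by auto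
    obtain y where y: "E < y" "y < b" "isCont (cdf \<nu>) y"
      using real_interval_avoid_countable_set[OF b(1) countable] by auto
    show "c \<le> cdf \<nu> E - measure \<nu> {..<E} + \<epsilon>"
      using ge[of x y] x y a(2)[of x] b(2)[of y] by linarith
  qed
  moreover have "right_limit (cdf \<nu>) E = cdf \<nu> E"
    using right by (intro tendsto_Lim) auto
  moreover have "left_limit (cdf \<nu>) E = measure \<nu> {..<E}"
    using left by (intro tendsto_Lim) auto
  ultimately show ?thesis by simp
qed

section \<open>The lattice in the plane\<close>

definition emb :: "pt \<Rightarrow> complex" where
  "emb = (\<lambda>(a, b, c, d). Complex (a + (b - d) * (sqrt 2 / 2)) (c + (b + d) * (sqrt 2 / 2)))"

definition zeta :: complex where "zeta = Complex (sqrt 2 / 2) (sqrt 2 / 2)"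

lemma emb_add: "emb (p + q) = emb p + emb q"
  by (cases p; cases q) (simp add: emb_def complex_eq_iff field_simps)

lemma emb_uminus: "emb (- p) = - emb p"
  by (cases p) (simp add: emb_def complex_eq_iff field_simps)

lemma emb_diff: "emb (p - q) = emb p - emb q"
  by (metis emb_add emb_uminus diff_conv_add_uminus)

lemma emb_0: "emb 0 = 0"
  by (simp add: emb_def zero_prod_def complex_eq_iff)

lemma emb_rot: "emb (rot p) = zeta * emb p"
  by (cases p) (simp add: emb_def zeta_def complex_eq_iff field_simps)

lemma emb_rot_rot: "emb (rot (rot p)) = \<i> * emb p"
proof -
  have "zeta * zeta = \<i>" by (simp add: zeta_def complex_eq_iff)
  then show ?thesis by (simp add: emb_rot flip: mult.assoc)
qed

lemma emb_rt2: "emb (rt2 p) = sqrt 2 * emb p"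
proof -
  have "zeta - \<i> * zeta = complex_of_real (sqrt 2)" by (simp add: zeta_def complex_eq_iff)
  moreover have "emb (rt2 p) = (zeta - \<i> * zeta) * emb p"
    by (simp only: rt2_def emb_diff emb_rot_rot) (simp add: emb_rot algebra_simps)
  ultimately show ?thesis by simp
qed

lemma emb_sil: "emb (sil p) = silver *\<^sub>R emb p"
  by (simp add: sil_def emb_add emb_rt2 silver_def scaleR_conv_of_real algebra_simps)

lemma silver_gt: "silver > 2"
  using sqrt2_less_2 by (simp add: silver_def) 

lemma sqrt2_irrational: "sqrt 2 \<notin> \<rat>"
proof
  assume "sqrt 2 \<in> \<rat>"
  then obtain m n :: nat where n: "n \<noteq> 0" and "\<bar>sqrt 2\<bar> = m / n" and co: "coprime m n"
    by (rule Rats_abs_nat_div_natE)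
  then have "(real m)\<^sup>2 = (sqrt 2)\<^sup>2 * (real n)\<^sup>2" by (simp add: power_divide)
  then have "real (m\<^sup>2) = real (2 * n\<^sup>2)" by simp
  then have eq: "m\<^sup>2 = 2 * n\<^sup>2" by linarith
  then have "even m" by (metis dvd_triv_left even_power)
  then obtain k where "m = 2 * k" by blast
  then have "n\<^sup>2 = 2 * k\<^sup>2" using eq by (simp add: power2_eq_square)
  then have "even n" by (metis dvd_triv_left even_power)
  then show False using co \<open>even m\<close> by (metis coprime_common_divisor_nat dvd_refl odd_one)
qed

lemma sqrt2_int:
  fixes x y :: int
  shows "x + y * sqrt 2 = 0 \<longleftrightarrow> x = 0 \<and> y = 0"
proof
  assume *: "real_of_int x + real_of_int y * sqrt 2 = 0"
  have "y = 0"
  proof (rule ccontr)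
    assume "y \<noteq> 0"
    then have "sqrt 2 = - real_of_int x / real_of_int y" using * by (simp add: field_simps)
    also have "\<dots> \<in> \<rat>" by simp
    finally show False using sqrt2_irrational by simp
  qed
  then show "x = 0 \<and> y = 0" using * by simp
qed simp

text \<open>
  \<open>1, \<zeta>, \<zeta>\<^sup>2, \<zeta>\<^sup>3\<close> are linearly independent over the rationals because \<open>\<surd>2\<close> is irrational.
\<close>

lemma emb_inj: "emb p = emb q \<longleftrightarrow> p = q"
proof -
  have "emb p = 0 \<Longrightarrow> p = 0" for p
  proof (cases p)
    case (fields a b c d)
    assume "emb p = 0"
    then have "2 * a + (b - d) * sqrt 2 = 0" "2 * c + (b + d) * sqrt 2 = 0"
      using fields by (auto simp: emb_def complex_eq_iff)
    then have "2 * a = 0 \<and> b - d = 0" "2 * c = 0 \<and> b + d = 0"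
      using sqrt2_int[of "2 * a" "b - d"] sqrt2_int[of "2 * c" "b + d"] by simp_all
    then show "p = 0" using fields by (simp add: zero_prod_def)
  qed
  from this[of "p - q"] show ?thesis by (auto simp: emb_diff)
qed

lemma half_sqrt2:
  defines "s \<equiv> sqrt 2 / 2"
  shows "sqrt 2 = 2 * s" "s * s = 1 / 2" "s * (s * t) = t / 2"
    "emb (a, b, c, d) = Complex (a + (b - d) * s) (c + (b + d) * s)"
  by (simp_all add: s_def emb_def)

lemma cross_emb': "sqrt 2 * Im (cnj (emb u) * emb v) = fst (cross u v) + snd (cross u v) * sqrt 2"
proof -
  define s :: real where "s = sqrt 2 / 2"
  note h = half_sqrt2[folded s_def]
  show ?thesis unfolding h(1)
    by (cases u; cases v) (simp add: h(2-4) algebra_simps)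
qed

lemma cross_emb: "cross u v = (x, y) \<Longrightarrow> sqrt 2 * Im (cnj (emb u) * emb v) = x + y * sqrt 2"
  by (simp only: cross_emb' fst_conv snd_conv)

lemma nonneg_rt2_iff: "nonneg_rt2 (x, y) \<longleftrightarrow> 0 \<le> real_of_int x + y * sqrt 2"
proof -
  have sq: "(real_of_int y * sqrt 2)\<^sup>2 = real_of_int (2 * y * y)" by (simp add: power_mult_distrib power2_eq_square)
  have A: "2 * y * y \<le> x * x \<longleftrightarrow> \<bar>y * sqrt 2\<bar> \<le> \<bar>real_of_int x\<bar>"
    unfolding abs_le_square_iff sq by (simp add: power2_eq_square flip: of_int_mult)
  have B: "x * x \<le> 2 * y * y \<longleftrightarrow> \<bar>real_of_int x\<bar> \<le> \<bar>y * sqrt 2\<bar>"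
    unfolding abs_le_square_iff sq by (simp add: power2_eq_square flip: of_int_mult)
  have s: "0 \<le> y \<longleftrightarrow> 0 \<le> y * sqrt 2" by (simp add: zero_le_mult_iff)
  have t: "0 \<le> x \<longleftrightarrow> 0 \<le> real_of_int x" by simp
  show ?thesis unfolding nonneg_rt2.simps A B s t by linarith
qed

lemma nonneg_rt2_cross: "nonneg_rt2 (cross u v) \<longleftrightarrow> 0 \<le> Im (cnj (emb u) * emb v)"
proof (cases "cross u v")
  case (Pair x y)
  have "nonneg_rt2 (cross u v) \<longleftrightarrow> 0 \<le> sqrt 2 * Im (cnj (emb u) * emb v)"
    unfolding cross_emb[OF Pair] Pair nonneg_rt2_iff ..
  then show ?thesis by (simp add: zero_le_mult_iff)
qed

lemma sqnorm_emb: "sqnorm z = (a, b) \<Longrightarrow> (cmod (emb z))\<^sup>2 = a + b * sqrt 2"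
proof -
  define s :: real where "s = sqrt 2 / 2"
  note h = half_sqrt2[folded s_def]
  have "(cmod (emb z))\<^sup>2 = fst (sqnorm z) + snd (sqnorm z) * sqrt 2" unfolding h(1)
    by (cases z) (simp add: h(4) cmod_power2, simp add: h(2,3) power2_eq_square algebra_simps)
  moreover assume "sqnorm z = (a, b)"
  ultimately show ?thesis by simp
qed

lemma dirs_induct: "u \<in> set dirs \<longleftrightarrow> u \<in> {(1,0,0,0), (0,1,0,0), (0,0,1,0), (0,0,0,1), (-1,0,0,0), (0,-1,0,0), (0,0,-1,0), (0,0,0,-1)}"
  by (simp add: dirs_def)

lemma dirs_rot: "u \<in> set dirs \<Longrightarrow> rot u \<in> set dirs" "u \<in> set dirs \<Longrightarrow> - u \<in> set dirs"
  by (auto simp: dirs_def)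

lemma emb_dir: "u \<in> set dirs \<Longrightarrow> cmod (emb u) = 1"
proof -
  assume "u \<in> set dirs"
  then have "sqnorm u = (1, 0)" by (auto simp: dirs_def)
  then have "(cmod (emb u))\<^sup>2 = 1" using sqnorm_emb by fastforce
  then show ?thesis by (metis norm_ge_zero power2_eq_1_iff zero_le_one order_antisym_conv neg_0_le_iff_le one_neq_zero not_one_le_zero)
qed

section \<open>Translations\<close>

lemma rot_add: "rot (p + q) = rot p + rot q" "rot (- p) = - rot p" "rot (p - q) = rot p - rot q" "rot 0 = 0"
  by (cases p; cases q; simp)+ (simp add: zero_prod_def)

lemma rt2_add: "rt2 (p + q) = rt2 p + rt2 q" "rt2 0 = 0"
  by (simp_all add: rt2_def rot_add)

lemma sil_add: "sil (p + q) = sil p + sil q" "sil 0 = 0"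
  by (simp_all add: sil_def rt2_add)

lemma rot8: "rot (rot (rot (rot p))) = - p"
  by (cases p) simp

lemma shift_rh: "shift z (rh p u) = rh (p + z) u"
  by (simp add: rh_def algebra_simps)

lemma shift_sqr: "shift z (sqr p u) = sqr (p + z) u"
  by (simp add: sqr_def Let_def algebra_simps)

lemma inflate_cell_shift: "inflate_cell (shift z c) = map (shift (sil z)) (inflate_cell c)"
  by (cases c) (simp_all add: Let_def shift_rh sil_add algebra_simps)

lemma boundary_shift: "boundary (shift z c) = map (\<lambda>(p, u, t). (p + z, u, t)) (boundary c)"
  by (cases c) (simp_all add: Let_def algebra_simps)

lemma flags_shift: "flags (shift z c) = map (\<lambda>(p, u). (p + z, u)) (flags c)"
  by (cases c) (simp_all add: Let_def algebra_simps)

lemma sides_shift: "sides (shift z c) = map (\<lambda>(p, u). (p + z, u)) (sides c)"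
  by (cases c) (simp_all add: Let_def algebra_simps)

lemma corners_shift: "corners (shift z c) = map (\<lambda>p. p + z) (corners c)"
  by (simp add: corners_def boundary_shift comp_def case_prod_unfold)

lemma mirror_shift: "mirror (shift z c) = shift z (mirror c)"
  by (cases c) simp_all

lemma merge_shift: "merge (shift z c) = shift z (merge c)"
  by (cases c) (simp_all add: shift_sqr)

lemma shift_shift: "shift z (shift y c) = shift (y + z) c"
  by (cases c) (simp_all add: add.assoc)

lemma shift_0: "shift 0 c = c"
  by (cases c) simp_all

lemma shift_inj: "shift z c = shift z c' \<longleftrightarrow> c = c'"
  by (cases c; cases c') auto

text \<open>
  Every property of cells below is translation invariant, so it need only be checked for the finitely many cells \<open>seeds\<close> at the
  origin.
\<close>

definition tile_cell :: "cell \<Rightarrow> bool" where "tile_cell c \<longleftrightarrow> (\<exists>z. \<exists>s\<in>set seeds. c = shift z s)"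

lemma seeds_iff: "s \<in> set seeds \<longleftrightarrow> (\<exists>u\<in>set dirs. (upper u \<and> s = Rh 0 u) \<or> s = Hs 0 u True \<or> s = Hs 0 u False)"
  by (auto simp: seeds_def)

lemma tile_cell_iff: "tile_cell (Rh p u) \<longleftrightarrow> u \<in> set dirs \<and> upper u" "tile_cell (Hs p u b) \<longleftrightarrow> u \<in> set dirs" "\<not> tile_cell (Sq p u)"
proof -
  have "tile_cell (Rh p u)" if "u \<in> set dirs" "upper u"
    unfolding tile_cell_def using that by (intro exI[of _ p] bexI[of _ "Rh 0 u"]) (auto simp: seeds_iff)
  then show "tile_cell (Rh p u) \<longleftrightarrow> u \<in> set dirs \<and> upper u"
    by (auto simp: tile_cell_def seeds_iff)
  have "tile_cell (Hs p u b)" if "u \<in> set dirs"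
    unfolding tile_cell_def using that by (intro exI[of _ p] bexI[of _ "Hs 0 u b"]) (cases b; auto simp: seeds_iff)+
  then show "tile_cell (Hs p u b) \<longleftrightarrow> u \<in> set dirs"
    by (auto simp: tile_cell_def seeds_iff)
  show "\<not> tile_cell (Sq p u)" by (auto simp: tile_cell_def seeds_iff)
qed

lemma upper_uminus: "u \<in> set dirs \<Longrightarrow> upper (- u) \<longleftrightarrow> \<not> upper u"
  by (auto simp: dirs_def)

lemma tile_cell_rh: "u \<in> set dirs \<Longrightarrow> tile_cell (rh p u)"
  by (auto simp: rh_def tile_cell_iff upper_uminus dirs_rot)

lemma tile_cell_inflate_cell:
  assumes c: "tile_cell c" and c': "c' \<in> set (inflate_cell c)"
  shows "tile_cell c'"
proof -
  show ?thesis
  proof (cases c)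
    case (Rh p u)
    then have "u \<in> set dirs" using c by (simp add: tile_cell_iff)
    then have d: "u \<in> set dirs" "- u \<in> set dirs" "rot (rot u) \<in> set dirs" "rot (rot (rot u)) \<in> set dirs"
      "- rot (rot u) \<in> set dirs" "- rot (rot (rot u)) \<in> set dirs"
      by (simp_all only: dirs_rot)
    show ?thesis using c' unfolding Rh inflate_cell.simps Let_def set_simps
      by (elim insertE emptyE; simp only: tile_cell_rh tile_cell_iff d)
  next
    case (Hs p u b)
    then have "u \<in> set dirs" using c by (simp add: tile_cell_iff)
    then have d: "u \<in> set dirs" "- rot u \<in> set dirs" "rot (rot u) \<in> set dirs" "rot (rot (rot u)) \<in> set dirs"
      "- rot (rot u) \<in> set dirs" "- rot (rot (rot u)) \<in> set dirs"
      by (simp_all only: dirs_rot)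
    show ?thesis using c' unfolding Hs inflate_cell.simps Let_def set_simps if_split
      by (cases b; simp only: if_True if_False set_simps; elim insertE emptyE; simp only: tile_cell_rh tile_cell_iff d)
  next
    case (Sq p u)
    then show ?thesis using c' by simp
  qed
qed

section \<open>The regions covered by cells\<close>

definition side_val :: "pt \<Rightarrow> pt \<Rightarrow> complex \<Rightarrow> real" where
  "side_val p u z = Im (cnj (emb u) * (z - emb p))"

text \<open>
  A cell as an intersection of half-planes. Containments and disjointness can then be read off from signs of lattice
  elements; \<open>cell_hull_eq_region\<close> reconciles this with the convex hull of the corners.
\<close>

definition region :: "cell \<Rightarrow> complex set" where
  "region c = {z. \<forall>(p, u, t) \<in> set (boundary c). 0 \<le> side_val p u z}"

lemma side_val_inner: "side_val p u z = (\<i> * emb u) \<bullet> z - (\<i> * emb u) \<bullet> emb p"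
  by (simp add: side_val_def inner_complex_def algebra_simps)

lemma side_val_emb: "side_val p u (emb z) = Im (cnj (emb u) * emb (z - p))"
  by (simp add: side_val_def emb_diff)

lemma nonneg_rt2_side: "nonneg_rt2 (cross u (z - p)) \<longleftrightarrow> 0 \<le> side_val p u (emb z)"
  by (simp add: nonneg_rt2_cross side_val_emb)

lemma convex_side: "convex {z. 0 \<le> side_val p u z}" "convex {z. side_val p u z \<le> 0}"
  using convex_halfspace_ge[of "(\<i> * emb u) \<bullet> emb p" "\<i> * emb u"] convex_halfspace_le[of "\<i> * emb u" "(\<i> * emb u) \<bullet> emb p"]
  by (simp_all add: side_val_inner)

lemma region_eq: "region c = (\<Inter>e\<in>set (boundary c). {z. 0 \<le> side_val (fst e) (fst (snd e)) z})"
  by (simp add: region_def set_eq_iff case_prod_unfold)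

lemma convex_region: "convex (region c)"
  unfolding region_eq by (intro convex_INT convex_side)

definition region0 :: "cell \<Rightarrow> complex set" where
  "region0 c = {z. \<forall>(p, u, t) \<in> set (boundary c). 0 < side_val p u z}"

lemma open_region0: "open (region0 c)"
proof -
  have "region0 c = (\<Inter>e\<in>set (boundary c). {z. 0 < side_val (fst e) (fst (snd e)) z})"
    by (simp add: region0_def set_eq_iff case_prod_unfold)
  also have "open \<dots>"
    unfolding side_val_inner by (intro open_INT ballI open_Collect_less continuous_intros) auto
  finally show ?thesis .
qed

lemma region0_interior: "region0 c \<subseteq> interior (region c)"
  by (rule interior_maximal[OF _ open_region0]) (auto simp: region0_def region_def intro: less_imp_le)

lemma parallelogram_hull:
  fixes P a b :: complex
  assumes "0 \<le> \<alpha>" "\<alpha> \<le> 1" "0 \<le> \<beta>" "\<beta> \<le> 1"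
  shows "P + \<alpha> *\<^sub>R a + \<beta> *\<^sub>R b \<in> convex hull {P, P + a, P + a + b, P + b}" (is "_ \<in> ?H")
proof -
  have c: "convex ?H" by simp
  have v: "P \<in> ?H" "P + a \<in> ?H" "P + a + b \<in> ?H" "P + b \<in> ?H" by (simp_all add: hull_inc)
  have 1: "(1 - \<alpha>) *\<^sub>R P + \<alpha> *\<^sub>R (P + a) \<in> ?H" by (rule convexD[OF c v(1,2)]) (use assms in auto)
  have 2: "(1 - \<alpha>) *\<^sub>R (P + b) + \<alpha> *\<^sub>R (P + a + b) \<in> ?H" by (rule convexD[OF c v(4,3)]) (use assms in auto)
  have "(1 - \<beta>) *\<^sub>R ((1 - \<alpha>) *\<^sub>R P + \<alpha> *\<^sub>R (P + a)) + \<beta> *\<^sub>R ((1 - \<alpha>) *\<^sub>R (P + b) + \<alpha> *\<^sub>R (P + a + b)) \<in> ?H"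
    by (rule convexD[OF c 1 2]) (use assms in auto)
  also have "(1 - \<beta>) *\<^sub>R ((1 - \<alpha>) *\<^sub>R P + \<alpha> *\<^sub>R (P + a)) + \<beta> *\<^sub>R ((1 - \<alpha>) *\<^sub>R (P + b) + \<alpha> *\<^sub>R (P + a + b))
     = P + \<alpha> *\<^sub>R a + \<beta> *\<^sub>R b" by (simp add: algebra_simps)
  finally show ?thesis .
qed

lemma triangle_hull:
  fixes P a b :: complex
  assumes "0 \<le> \<beta>" "\<beta> \<le> \<alpha>" "\<alpha> \<le> 1"
  shows "P + \<alpha> *\<^sub>R a + \<beta> *\<^sub>R b \<in> convex hull {P, P + a, P + a + b}"
proof -
  have "P + \<alpha> *\<^sub>R a + \<beta> *\<^sub>R b = (1 - \<alpha>) *\<^sub>R P + (\<alpha> - \<beta>) *\<^sub>R (P + a) + \<beta> *\<^sub>R (P + a + b)"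
    by (simp add: algebra_simps)
  then show ?thesis unfolding convex_hull_3 using assms by force
qed

definition cell_hull :: "cell \<Rightarrow> complex set" where "cell_hull c = convex hull (emb ` set (corners c))"

lemma cell_hull_simps:
  "cell_hull (Rh p u) = convex hull {emb p, emb p + emb u, emb p + emb u + emb (rot u), emb p + emb (rot u)}"
  "cell_hull (Sq p u) = convex hull {emb p, emb p + emb u, emb p + emb u + \<i> * emb u, emb p + \<i> * emb u}"
  "cell_hull (Hs p u True) = convex hull {emb p, emb p + emb u, emb p + emb u + \<i> * emb u}"
  "cell_hull (Hs p u False) = convex hull {emb p, emb p + emb u, emb p + emb u + - (\<i> * emb u)}"
     apply (simp_all add: cell_hull_def corners_def Let_def emb_add emb_diff emb_rot_rot insert_commute)
  done

definition unit_cell :: "cell \<Rightarrow> bool" where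
  "unit_cell c = (case c of Rh p u \<Rightarrow> u \<in> set dirs | Sq p u \<Rightarrow> u \<in> set dirs | Hs p u b \<Rightarrow> u \<in> set dirs)"

lemma tile_cell_unit_cell: "tile_cell c \<Longrightarrow> unit_cell c"
  by (cases c) (auto simp: tile_cell_iff unit_cell_def)

text \<open>
  In the frame with origin \<open>p\<close> and first axis \<open>u\<close> the half-planes of the three shapes do not depend on the direction \<open>u\<close>.
\<close>

lemma side_frame:
  assumes u: "u \<in> set dirs" and z: "z = emb p + emb u * Z"
  shows "side_val p u z = Im Z"
    "side_val (p + u) (rot u) z = (sqrt 2 / 2) * (Im Z - Re Z + 1)"
    "side_val (p + u + rot u) (- u) z = sqrt 2 / 2 - Im Z"
    "side_val (p + rot u) (- rot u) z = (sqrt 2 / 2) * (Re Z - Im Z)"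
    "side_val (p + u) (rot (rot u)) z = 1 - Re Z"
    "side_val (p + u + rot (rot u)) (- u) z = 1 - Im Z"
    "side_val (p + rot (rot u)) (- rot (rot u)) z = Re Z"
    "side_val (p + u + rot (rot u)) (- rot u) z = (sqrt 2 / 2) * (Re Z - Im Z)"
    "side_val p (- rot (rot (rot u))) z = (sqrt 2 / 2) * (Re Z + Im Z)"
    "side_val (p + u - rot (rot u)) (rot (rot u)) z = 1 - Re Z"
    "side_val (p + u) (- u) z = - Im Z"
proof -
  have one: "cnj (emb u) * emb u = 1"
    using emb_dir[OF u] complex_norm_square[of "emb u"] by (simp add: mult.commute)
  have c: "cnj (emb u) * (emb u * w) = w" for w
    using one by (simp add: mult.assoc[symmetric])
  have g: "cnj (w * emb u) * (emb p + emb u * Z - (emb p + emb u * y)) = cnj w * (Z - y)" for w y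
  proof -
    have "cnj (w * emb u) * (emb p + emb u * Z - (emb p + emb u * y)) = cnj w * (cnj (emb u) * (emb u * (Z - y)))"
      by (simp add: algebra_simps)
    then show ?thesis by (simp only: c)
  qed
  have f: "side_val q v z = Im (cnj w * (Z - y))" if "emb v = w * emb u" "emb q = emb p + emb u * y" for q v w y
    unfolding side_val_def that z g ..
  show "side_val p u z = Im Z"
    using f[of u 1 p 0] by simp
  show "side_val (p + u) (rot u) z = (sqrt 2 / 2) * (Im Z - Re Z + 1)"
    using f[of "rot u" zeta "p + u" 1] by (simp add: emb_rot emb_add zeta_def algebra_simps)
  show "side_val (p + u + rot u) (- u) z = sqrt 2 / 2 - Im Z"
    using f[of "- u" "-1" "p + u + rot u" "1 + zeta"]
    by (simp add: emb_rot emb_add emb_uminus zeta_def algebra_simps)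
  show "side_val (p + rot u) (- rot u) z = (sqrt 2 / 2) * (Re Z - Im Z)"
    using f[of "- rot u" "- zeta" "p + rot u" "zeta"]
    by (simp add: emb_rot emb_add emb_uminus zeta_def algebra_simps)
  show "side_val (p + u) (rot (rot u)) z = 1 - Re Z"
    using f[of "rot (rot u)" "\<i>" "p + u" "1"]
    by (simp add: emb_rot_rot emb_add emb_uminus algebra_simps)
  show "side_val (p + u + rot (rot u)) (- u) z = 1 - Im Z"
    using f[of "- u" "-1" "p + u + rot (rot u)" "1 + \<i>"]
    by (simp add: emb_rot_rot emb_add emb_uminus algebra_simps)
  show "side_val (p + rot (rot u)) (- rot (rot u)) z = Re Z"
    using f[of "- rot (rot u)" "- \<i>" "p + rot (rot u)" "\<i>"]
    by (simp add: emb_rot_rot emb_add emb_uminus algebra_simps)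
  show "side_val (p + u + rot (rot u)) (- rot u) z = (sqrt 2 / 2) * (Re Z - Im Z)"
  proof -
    have "emb (- rot u) = - zeta * emb u" by (simp add: emb_uminus emb_rot)
    moreover have "emb (p + u + rot (rot u)) = emb p + emb u * (1 + \<i>)"
      by (simp only: emb_add emb_rot_rot) (simp add: algebra_simps)
    ultimately show ?thesis using f[of "- rot u" "- zeta" "p + u + rot (rot u)" "1 + \<i>"]
      by (simp add: zeta_def algebra_simps)
  qed
  show "side_val p (- rot (rot (rot u))) z = (sqrt 2 / 2) * (Re Z + Im Z)"
    using f[of "- rot (rot (rot u))" "- (\<i> * zeta)" p 0]
    by (simp add: emb_rot_rot emb_uminus) (simp add: emb_rot zeta_def algebra_simps)
  show "side_val (p + u - rot (rot u)) (rot (rot u)) z = 1 - Re Z"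
    using f[of "rot (rot u)" "\<i>" "p + u - rot (rot u)" "1 - \<i>"]
    by (simp add: emb_rot_rot emb_add emb_diff emb_uminus algebra_simps)
  show "side_val (p + u) (- u) z = - Im Z"
    using f[of "- u" "-1" "p + u" "1"]
    by (simp add: emb_add emb_uminus algebra_simps)
qed

lemma cell_hull_eq_region:
  assumes "unit_cell c"
  shows "cell_hull c = region c"
proof
  show "region c \<subseteq> cell_hull c"
  proof
    fix z assume z: "z \<in> region c"
    obtain p u where pu: "(\<exists>b. c = Hs p u b) \<or> c = Rh p u \<or> c = Sq p u" by (cases c) auto
    then have u: "u \<in> set dirs" using assms by (auto simp: unit_cell_def)
    then have "emb u \<noteq> 0" using emb_dir by fastforce
    then obtain Z where Z: "z = emb p + emb u * Z"
      by (metis add.commute diff_add_cancel nonzero_mult_div_cancel_left times_divide_eq_right)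
    note f = side_frame[OF u Z]
    have Zf: "z = emb p + Re Z *\<^sub>R emb u + Im Z *\<^sub>R (\<i> * emb u)"
      by (simp add: Z scaleR_conv_of_real complex_eq_iff algebra_simps)
    have s2: "sqrt 2 / 2 > 0" by simp
    show "z \<in> cell_hull c"
    proof (cases c)
      case (Rh p' u')
      then have c: "c = Rh p u" using pu by auto
      have i: "0 \<le> Im Z" "Re Z - Im Z \<le> 1" "Im Z \<le> sqrt 2 / 2" "Im Z \<le> Re Z"
        using z s2 by (auto simp: c region_def f Let_def zero_le_mult_iff)
      have "z = emb p + (Re Z - Im Z) *\<^sub>R emb u + (sqrt 2 * Im Z) *\<^sub>R emb (rot u)"
        by (simp add: Zf emb_rot zeta_def scaleR_conv_of_real complex_eq_iff algebra_simps)
      moreover have "sqrt 2 * Im Z \<le> 1"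
        using i(3) mult_left_mono[of "Im Z" "sqrt 2 / 2" "sqrt 2"] by simp
      ultimately show ?thesis
        using i by (simp only: c cell_hull_simps) (intro parallelogram_hull, auto)
    next
      case (Sq p' u')
      then have c: "c = Sq p u" using pu by auto
      have i: "0 \<le> Im Z" "Re Z \<le> 1" "Im Z \<le> 1" "0 \<le> Re Z"
        using z by (auto simp: c region_def f Let_def)
      then show ?thesis by (simp only: c cell_hull_simps) (subst Zf, intro parallelogram_hull, auto)
    next
      case (Hs p' u' b)
      then have c: "c = Hs p u b" using pu by auto
      show ?thesis
      proof (cases b)
        case True
        then have i: "0 \<le> Im Z" "Re Z \<le> 1" "Im Z \<le> Re Z"
          using z s2 by (auto simp: c region_def f Let_def zero_le_mult_iff)
        then show ?thesis using True by (simp only: c cell_hull_simps) (subst Zf, intro triangle_hull, auto)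
      next
        case False
        then have i: "Im Z \<le> 0" "Re Z \<le> 1" "- Im Z \<le> Re Z"
          using z s2 by (auto simp: c region_def f Let_def zero_le_mult_iff)
        have "z = emb p + Re Z *\<^sub>R emb u + (- Im Z) *\<^sub>R (- (\<i> * emb u))" by (simp add: Zf)
        then show ?thesis using i False by (simp only: c cell_hull_simps) (intro triangle_hull, auto)
      qed
    qed
  qed
next
  have "emb ` set (corners c) \<subseteq> region c"
  proof -
    obtain p u where pu: "(\<exists>b. c = Hs p u b) \<or> c = Rh p u \<or> c = Sq p u" by (cases c) auto
    then have u: "u \<in> set dirs" using assms by (auto simp: unit_cell_def)
    have "emb (p + u) = emb p + emb u * 1" "emb p = emb p + emb u * 0"
      "emb (p + u + rot u) = emb p + emb u * (1 + zeta)" "emb (p + rot u) = emb p + emb u * zeta"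
      "emb (p + rot (rot u)) = emb p + emb u * \<i>" "emb (p + u + rot (rot u)) = emb p + emb u * (1 + \<i>)"
      "emb (p + u - rot (rot u)) = emb p + emb u * (1 - \<i>)"
      by (simp_all only: emb_add emb_diff emb_rot_rot) (simp_all add: emb_rot algebra_simps)
    note f = side_frame[OF u this(1)] side_frame[OF u this(2)] side_frame[OF u this(3)] side_frame[OF u this(4)]
      side_frame[OF u this(5)] side_frame[OF u this(6)] side_frame[OF u this(7)]
    show ?thesis
      using pu by (elim disjE exE) (simp_all add: region_def corners_def Let_def f zeta_def)
  qed
  then show "cell_hull c \<subseteq> region c"
    unfolding cell_hull_def by (rule hull_minimal) (rule convex_region)
qed

section \<open>The substitution preserves packings\<close>

lemma seeds_pieces_inside: "\<forall>c\<in>set seeds. pieces_inside c" by code_simp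
lemma seeds_separated: "\<forall>c\<in>set seeds. pairwise_separated (inflate_cell c)" by code_simp
lemma seeds_flags_ok: "\<forall>c\<in>set seeds. flags_ok c" by code_simp
lemma seeds_chain_ok: "\<forall>c\<in>set seeds. chain_ok c" by code_simp
lemma seeds_turn_ok: "\<forall>c\<in>set seeds. turn_ok c" by code_simp
lemma seeds_star_ok: "\<forall>c\<in>set seeds. star_ok c" by code_simp

lemma tile_cell_induct:
  assumes "tile_cell c" "\<forall>s\<in>set seeds. P s" "\<And>z s. P s \<Longrightarrow> P (shift z s)"
  shows "P c"
  using assms by (auto simp: tile_cell_def)

lemma pieces_inside: "tile_cell c \<Longrightarrow> pieces_inside c"
proof (erule tile_cell_induct[OF _ seeds_pieces_inside])
  fix z s assume "pieces_inside s"
  then show "pieces_inside (shift z s)"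
    by (simp add: pieces_inside_def inflate_cell_shift boundary_shift corners_shift sil_add case_prod_unfold)
qed

lemma separated_shift: "separated (shift z c) (shift z c') = separated c c'"
  by (simp add: separated_def boundary_shift corners_shift case_prod_unfold)

lemma pairwise_separated_shift: "pairwise_separated (map (shift z) cs) = pairwise_separated cs"
  by (induction cs) (simp_all add: separated_shift shift_inj)

lemma pairwise_separated_inflate_cell: "tile_cell c \<Longrightarrow> pairwise_separated (inflate_cell c)"
  by (erule tile_cell_induct[OF _ seeds_separated]) (simp add: inflate_cell_shift pairwise_separated_shift)

lemma pairwise_separatedD: "pairwise_separated cs \<Longrightarrow> c \<in> set cs \<Longrightarrow> c' \<in> set cs \<Longrightarrow> c \<noteq> c' \<Longrightarrow> separated c c' \<or> separated c' c"
  by (induction cs) auto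

lemma pairwise_separated_distinct: "pairwise_separated cs \<Longrightarrow> distinct cs"
  by (induction cs) auto

lemma flags_ok: "tile_cell c \<Longrightarrow> flags_ok c"
proof (erule tile_cell_induct[OF _ seeds_flags_ok])
  fix z s assume s: "flags_ok s"
  have e: "(p + z) + (p + z) + (p + z) + (p + z) - (y + z) - (y + z) - (y + z) - (y + z) - k - k' =
      p + p + p + p - y - y - y - y - k - k'" for p y k k' :: pt by (simp add: algebra_simps)
  show "flags_ok (shift z s)" using s
    unfolding flags_ok_def flags_shift boundary_shift set_map ball_simps case_prod_unfold fst_conv snd_conv e
    by simp
qed

lemma flags_shift_iff: "(y, k) \<in> set (flags (shift z c)) \<longleftrightarrow> (y - z, k) \<in> set (flags c)"
  unfolding flags_shift set_map by (force simp: image_iff)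

lemma boundary_shift_iff: "(p, u, t) \<in> set (boundary (shift z c)) \<longleftrightarrow> (p - z, u, t) \<in> set (boundary c)"
  unfolding boundary_shift set_map by (force simp: image_iff)

lemma turn_start: "tile_cell c \<Longrightarrow> (p, u, t) \<in> set (boundary c) \<Longrightarrow> (p, u) \<in> set (flags c)"
  using seeds_turn_ok unfolding tile_cell_def turn_ok_def by (fastforce simp only: boundary_shift_iff flags_shift_iff)

lemma turn_next:
  assumes "tile_cell c" "(y, k) \<in> set (flags c)"
  shows "(y, rot k) \<in> set (flags c) \<or> (\<exists>e\<in>set (boundary c). fst (rev_edge e) = y \<and> fst (snd (rev_edge e)) = rot k)"
proof -
  obtain z s where s: "s \<in> set seeds" "c = shift z s" using assms by (auto simp: tile_cell_def)
  have "turn_ok s" using seeds_turn_ok s by blast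
  moreover have "(y - z, k) \<in> set (flags s)" using assms by (simp only: s flags_shift_iff)
  ultimately consider "(y - z, rot k) \<in> set (flags s)"
    | e where "e \<in> set (boundary s)" "fst (rev_edge e) = y - z" "fst (snd (rev_edge e)) = rot k"
    unfolding turn_ok_def Let_def case_prod_unfold by (metis fst_conv snd_conv)
  then show ?thesis
  proof cases
    case 1
    then show ?thesis by (simp only: s flags_shift_iff simp_thms)
  next
    case 2
    obtain p u t where e: "e = (p, u, t)" by (cases e)
    have "(p + z, u, t) \<in> set (boundary c)" using 2(1) by (simp only: s boundary_shift_iff e add_diff_cancel)
    moreover have "fst (rev_edge (p + z, u, t)) = y" "fst (snd (rev_edge (p + z, u, t))) = rot k"
      using 2(2,3) by (simp_all add: e algebra_simps)
    ultimately show ?thesis by blast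
  qed
qed

text \<open>
  The substitution maps a sector at a vertex to the standard wedge, after two steps, independently of the cell.
\<close>

lemma wedge_in_inflate_cell:
  assumes "tile_cell c" "(y, k) \<in> set (flags c)" "t \<in> set (wedge k)"
  shows "shift (sil (sil y)) t \<in> set (inflate_cells (inflate_cell c))"
proof -
  obtain z s where s: "s \<in> set seeds" "c = shift z s" using assms by (auto simp: tile_cell_def)
  have a: "inflate_cells (map (shift y) cs) = map (shift (sil y)) (inflate_cells cs)" for y cs
    by (simp add: inflate_cells_def inflate_cell_shift map_concat comp_def)
  have "(y - z, k) \<in> set (flags s)" using assms by (simp only: s flags_shift_iff)
  then have "shift (sil (sil (y - z))) t \<in> set (inflate_cells (inflate_cell s))"
    using seeds_star_ok s assms(3) unfolding star_ok_def Let_def by fastforce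
  then have "shift (sil (sil z)) (shift (sil (sil (y - z))) t) \<in> set (inflate_cells (inflate_cell c))"
    by (simp add: s inflate_cell_shift a)
  moreover have "sil (sil (y - z)) + sil (sil z) = sil (sil y)"
    by (simp flip: sil_add)
  ultimately show ?thesis by (simp add: shift_shift)
qed

definition inflate :: "cell set \<Rightarrow> cell set" where "inflate A = (\<Union>c\<in>A. set (inflate_cell c))"

text \<open>
  Cells with disjoint interiors. Unlike a tiling of a region this is stable under substitution and does not
  mention the region covered.
\<close>

definition packed :: "cell set \<Rightarrow> bool" where
  "packed A \<longleftrightarrow> finite A \<and> (\<forall>c\<in>A. tile_cell c) \<and>
     (\<forall>c\<in>A. \<forall>c'\<in>A. c \<noteq> c' \<longrightarrow> interior (region c) \<inter> interior (region c') = {})"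

lemma region_inflate: assumes "tile_cell c" "c' \<in> set (inflate_cell c)" shows "region c' \<subseteq> (*\<^sub>R) silver ` region c"
proof
  have s: "silver > 0" using silver_gt by simp
  fix z assume "z \<in> region c'"
  then have z: "z \<in> convex hull (emb ` set (corners c'))"
    using cell_hull_eq_region[OF tile_cell_unit_cell[OF tile_cell_inflate_cell[OF assms]]] by (simp add: cell_hull_def)
  have "0 \<le> side_val (sil p) u z" if e: "(p, u, t) \<in> set (boundary c)" for p u t
  proof -
    have "emb ` set (corners c') \<subseteq> {z. 0 \<le> side_val (sil p) u z}"
      using pieces_inside[OF assms(1)] assms(2) e by (fastforce simp: pieces_inside_def nonneg_rt2_side)
    then have "convex hull (emb ` set (corners c')) \<subseteq> {z. 0 \<le> side_val (sil p) u z}"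
      by (rule hull_minimal) (rule convex_side)
    then show ?thesis using z by blast
  qed
  moreover have "side_val (sil p) u z = silver * side_val p u (z /\<^sub>R silver)" for p u
  proof -
    have "cnj (emb u) * (z - silver *\<^sub>R emb p) = silver *\<^sub>R (cnj (emb u) * (z /\<^sub>R silver - emb p))"
      using s by (simp add: scaleR_diff_right right_diff_distrib)
    then show ?thesis unfolding side_val_def emb_sil by simp
  qed
  ultimately have "z /\<^sub>R silver \<in> region c"
    using s unfolding region_def by (force simp: zero_le_mult_iff)
  then show "z \<in> (*\<^sub>R) silver ` region c"
    using s by (intro image_eqI[of _ _ "z /\<^sub>R silver"]) auto
qed

lemma interior_side:
  assumes "u \<in> set dirs"
  shows "interior {z. 0 \<le> side_val p u z} = {z. 0 < side_val p u z}"
    "interior {z. side_val p u z \<le> 0} = {z. side_val p u z < 0}"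
proof -
  have "\<i> * emb u \<noteq> 0" using emb_dir[OF assms] by auto
  from interior_halfspace_ge[OF this, of "(\<i> * emb u) \<bullet> emb p"] interior_halfspace_le[OF this, of "(\<i> * emb u) \<bullet> emb p"]
  show "interior {z. 0 \<le> side_val p u z} = {z. 0 < side_val p u z}"
    "interior {z. side_val p u z \<le> 0} = {z. side_val p u z < 0}"
    by (simp_all add: side_val_inner)
qed

lemma boundary_dirs: "tile_cell c \<Longrightarrow> (p, u, t) \<in> set (boundary c) \<Longrightarrow> u \<in> set dirs"
proof (cases c)
  case (Hs q v b)
  assume "tile_cell c" "(p, u, t) \<in> set (boundary c)"
  then show ?thesis by (cases b) (auto simp only: Hs tile_cell_iff boundary.simps Let_def if_True if_False set_simps insert_iff empty_iff prod.inject dirs_rot)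
next
  case (Rh q v)
  assume "tile_cell c" "(p, u, t) \<in> set (boundary c)"
  then show ?thesis by (auto simp only: Rh tile_cell_iff boundary.simps Let_def set_simps insert_iff empty_iff prod.inject dirs_rot)
qed (simp add: tile_cell_iff)

text \<open>
  An edge line of one cell separates the two.
\<close>

lemma separated_disjoint:
  assumes "tile_cell c" "tile_cell c'" "separated c c'"
  shows "interior (region c) \<inter> interior (region c') = {}"
proof -
  obtain p u t where e: "(p, u, t) \<in> set (boundary c)" and z: "\<forall>z\<in>set (corners c'). nonneg_rt2 (cross u (p - z))"
    using assms(3) by (auto simp: separated_def)
  have u: "u \<in> set dirs" using boundary_dirs[OF assms(1) e] .
  have "region c \<subseteq> {z. 0 \<le> side_val p u z}" using e by (auto simp: region_def)
  then have 1: "interior (region c) \<subseteq> {z. 0 < side_val p u z}"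
    using interior_mono interior_side(1)[OF u] by blast
  have "emb ` set (corners c') \<subseteq> {z. side_val p u z \<le> 0}"
  proof clarify
    fix x assume "x \<in> set (corners c')"
    then have "0 \<le> Im (cnj (emb u) * emb (p - x))" using z by (simp add: nonneg_rt2_cross)
    moreover have "emb (p - x) = - emb (x - p)" by (simp add: emb_diff)
    ultimately show "side_val p u (emb x) \<le> 0" by (simp add: side_val_emb)
  qed
  then have "cell_hull c' \<subseteq> {z. side_val p u z \<le> 0}" unfolding cell_hull_def by (rule hull_minimal) (rule convex_side)
  then have "interior (region c') \<subseteq> {z. side_val p u z < 0}"
    using cell_hull_eq_region[OF tile_cell_unit_cell[OF assms(2)]] interior_mono interior_side(2)[OF u] by blast
  then show ?thesis using 1 by fastforce
qed

definition mid :: "pt \<Rightarrow> pt \<Rightarrow> complex" where "mid y k = emb y + (emb k + emb (rot k)) /\<^sub>R 4"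

lemma mid_region0:
  assumes c: "tile_cell c" and f: "(y, k) \<in> set (flags c)"
  shows "mid y k \<in> region0 c"
proof -
  have "0 < side_val p u (mid y k)" if e: "(p, u, t) \<in> set (boundary c)" for p u t
  proof -
    define d where "d = p + p + p + p - y - y - y - y - k - rot k"
    have "\<not> nonneg_rt2 (cross u d)" using flags_ok[OF c] e f by (force simp: flags_ok_def d_def)
    then have "Im (cnj (emb u) * emb d) < 0" by (simp add: nonneg_rt2_cross)
    moreover have "emb d = - (4 *\<^sub>R (mid y k - emb p))"
      by (simp add: d_def mid_def emb_add emb_diff scaleR_add_right algebra_simps)
        (simp add: scaleR_conv_of_real)
    ultimately show ?thesis by (simp add: side_val_def)
  qed
  then show ?thesis by (auto simp: region0_def)
qed

lemma mid_interior: "tile_cell c \<Longrightarrow> (y, k) \<in> set (flags c) \<Longrightarrow> mid y k \<in> interior (region c)"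
  using mid_region0 region0_interior by blast

lemma flags_nonempty: "flags c \<noteq> []"
  by (cases c) (auto simp: Let_def)

lemma interior_region_nonempty: "tile_cell c \<Longrightarrow> interior (region c) \<noteq> {}"
  using flags_nonempty[of c] mid_interior[of c] by (cases "flags c") fastforce+

text \<open>
  The middle of the sector is an interior point of every cell with this flag.
\<close>

lemma packed_flag_unique:
  assumes "packed A" "c \<in> A" "c' \<in> A" "f \<in> set (flags c)" "f \<in> set (flags c')"
  shows "c = c'"
  using assms mid_interior[of c "fst f" "snd f"] mid_interior[of c' "fst f" "snd f"]
  unfolding packed_def by (metis IntI empty_iff prod.collapse)

lemma interior_scale: "silver > 0 \<Longrightarrow> interior ((*\<^sub>R) silver ` S) = (*\<^sub>R) silver ` interior (S :: complex set)"
  by (rule interior_injective_linear_image) (auto intro!: linear_cmul simp: inj_on_def linear_scale_self)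

lemma packed_inflate:
  assumes "packed A" shows "packed (inflate A)"
proof -
  have t: "\<And>c. c \<in> A \<Longrightarrow> tile_cell c" and f: "finite A" using assms by (auto simp: packed_def)
  have s: "silver > 0" using silver_gt by simp
  have disj: "interior (region c) \<inter> interior (region c') = {}"
    if d: "d \<in> A" "c \<in> set (inflate_cell d)" and d': "d' \<in> A" "c' \<in> set (inflate_cell d')" and ne: "c \<noteq> c'" for c c' d d'
  proof (cases "d = d'")
    case True
    have "separated c c' \<or> separated c' c" using pairwise_separatedD[OF pairwise_separated_inflate_cell[OF t[OF d(1)]]] d d' ne True by blast
    then show ?thesis using separated_disjoint tile_cell_inflate_cell t d d' by (metis inf_commute)
  next
    case False
    have "interior (region c) \<subseteq> (*\<^sub>R) silver ` interior (region d)"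
      "interior (region c') \<subseteq> (*\<^sub>R) silver ` interior (region d')"
      using interior_mono[OF region_inflate[OF t[OF d(1)] d(2)]] interior_mono[OF region_inflate[OF t[OF d'(1)] d'(2)]]
      by (simp_all add: interior_scale s)
    moreover have "interior (region d) \<inter> interior (region d') = {}"
      using assms False d d' by (auto simp: packed_def)
    moreover have "inj ((*\<^sub>R) silver :: complex \<Rightarrow> complex)" using s by (auto simp: inj_on_def)
    ultimately have "(*\<^sub>R) silver ` interior (region d) \<inter> (*\<^sub>R) silver ` interior (region d') = {}"
      by (simp add: image_Int[symmetric])
    then show ?thesis using \<open>interior (region c) \<subseteq> _\<close> \<open>interior (region c') \<subseteq> _\<close> by blast
  qed
  moreover have "finite (inflate A)" using f by (simp add: inflate_def)
  moreover have "\<forall>c\<in>inflate A. tile_cell c" using t tile_cell_inflate_cell by (auto simp: inflate_def)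
  moreover have "\<forall>c\<in>inflate A. \<forall>c'\<in>inflate A. c \<noteq> c' \<longrightarrow> interior (region c) \<inter> interior (region c') = {}"
    using disj unfolding inflate_def by blast
  ultimately show ?thesis unfolding packed_def by blast
qed

lemma packed_iterate: "packed A \<Longrightarrow> packed ((inflate ^^ n) A)"
  by (induction n) (auto intro: packed_inflate)

lemma packed_singleton: "tile_cell c \<Longrightarrow> packed {c}"
  by (simp add: packed_def)

lemma inflate_cell_disjoint:
  assumes "packed A" "c \<in> A" "d \<in> A" "c \<noteq> d"
  shows "set (inflate_cell c) \<inter> set (inflate_cell d) = {}"
proof (rule ccontr)
  assume "\<not> ?thesis"
  then obtain x where x: "x \<in> set (inflate_cell c)" "x \<in> set (inflate_cell d)" by blast
  have t: "tile_cell c" "tile_cell d" using assms by (auto simp: packed_def)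
  have s: "silver > 0" using silver_gt by simp
  have "interior (region x) \<subseteq> (*\<^sub>R) silver ` interior (region c)" "interior (region x) \<subseteq> (*\<^sub>R) silver ` interior (region d)"
    using interior_mono[OF region_inflate[OF t(1) x(1)]] interior_mono[OF region_inflate[OF t(2) x(2)]]
    by (simp_all add: interior_scale s)
  moreover have "interior (region x) \<noteq> {}" using interior_region_nonempty tile_cell_inflate_cell t x by blast
  moreover have "interior (region c) \<inter> interior (region d) = {}" using assms by (auto simp: packed_def)
  moreover have "inj ((*\<^sub>R) silver :: complex \<Rightarrow> complex)" using s by (auto simp: inj_on_def)
  ultimately have "interior (region x) \<subseteq> (*\<^sub>R) silver ` (interior (region c) \<inter> interior (region d))"
    unfolding image_Int[OF \<open>inj _\<close>] by blast
  then show False using \<open>interior (region x) \<noteq> {}\<close> \<open>interior (region c) \<inter> interior (region d) = {}\<close> by simp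
qed

lemma sum_inflate:
  fixes g :: "cell \<Rightarrow> 'b::comm_monoid_add"
  assumes "packed A"
  shows "(\<Sum>c\<in>inflate A. g c) = (\<Sum>c\<in>A. sum_list (map g (inflate_cell c)))"
proof -
  have "(\<Sum>c\<in>inflate A. g c) = (\<Sum>c\<in>A. \<Sum>x\<in>set (inflate_cell c). g x)"
    unfolding inflate_def using assms inflate_cell_disjoint[OF assms]
    by (intro sum.UNION_disjoint) (auto simp: packed_def)
  also have "\<dots> = (\<Sum>c\<in>A. sum_list (map g (inflate_cell c)))"
    using assms by (intro sum.cong refl sum_list_distinct_conv_sum_set[symmetric] pairwise_separated_distinct pairwise_separated_inflate_cell)
      (auto simp: packed_def)
  finally show ?thesis .
qed

lemma region_iterate:
  assumes "tile_cell s" "c \<in> (inflate ^^ n) {s}"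
  shows "region c \<subseteq> (*\<^sub>R) (silver ^ n) ` region s"
  using assms(2)
proof (induction n arbitrary: c)
  case (Suc n)
  then obtain d where d: "d \<in> (inflate ^^ n) {s}" "c \<in> set (inflate_cell d)" unfolding funpow.simps comp_def inflate_def[of "(inflate ^^ n) {s}"] by blast
  have "tile_cell d" using packed_iterate[OF packed_singleton[OF assms(1)]] d(1) by (auto simp: packed_def)
  then have "region c \<subseteq> (*\<^sub>R) silver ` region d" using d(2) by (rule region_inflate)
  also have "\<dots> \<subseteq> (*\<^sub>R) silver ` (*\<^sub>R) (silver ^ n) ` region s" using Suc.IH[OF d(1)] by (rule image_mono)
  finally show ?case by (simp add: image_image)
qed simp

section \<open>Vertices inside a supertile are surrounded by tiles\<close>

text \<open>
  Weights on directed edges that change sign under reversal detect boundaries: the total over a family of cells sees only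
  uncancelled edges. \<open>pull_back\<close> is dual to subdivision of edges.
\<close>

definition odd_weight :: "(edge \<Rightarrow> int) \<Rightarrow> bool" where "odd_weight w \<longleftrightarrow> (\<forall>e. w (rev_edge e) = - w e)"

lemma odd_weightD: "odd_weight w \<Longrightarrow> w (rev_edge e) = - w e"
  unfolding odd_weight_def by (rule spec)

lemma cancels_sum: "odd_weight w \<Longrightarrow> cancels es \<Longrightarrow> sum_list (map w es) = 0"
proof (induction es rule: cancels.induct)
  case (2 e es)
  then have "rev_edge e \<in> set es" "sum_list (map w (remove1 (rev_edge e) es)) = 0" by auto
  then show ?case using sum_list_map_remove1[of "rev_edge e" es w] odd_weightD[OF 2(2), of e] by simp
qed simp

definition boundary_sum :: "(edge \<Rightarrow> int) \<Rightarrow> cell \<Rightarrow> int" where "boundary_sum w c = sum_list (map w (boundary c))"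

definition pull_back :: "(edge \<Rightarrow> int) \<Rightarrow> edge \<Rightarrow> int" where "pull_back w e = sum_list (map w (subdiv e))"

lemma rt2_uminus: "rt2 (- u) = - rt2 u" by (simp add: rt2_def rot_add(2))

lemma rev_rev_edge: "rev_edge (rev_edge e) = e"
  by (cases e; cases "snd (snd e)") (auto simp: rt2_uminus)

lemma odd_weight_pull_back: "odd_weight w \<Longrightarrow> odd_weight (pull_back w)"
proof -
  assume w: "odd_weight w"
  have "pull_back w (rev_edge (p, u, t)) = - pull_back w (p, u, t)" for p u t
  proof -
    define r where "r = rt2 u"
    have s: "sil (p + u) = sil p + u + r" by (simp add: sil_add(1) add.assoc) (simp add: sil_def r_def)
    have ss: "sil (p + r) = sil p + u + r + u"
    proof -
      have "rt2 (rt2 u) = u + u" by (cases u) (simp add: rt2_def)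
      then show ?thesis by (simp only: sil_add(1)) (simp add: sil_def r_def algebra_simps)
    qed
    have c: "sil p + r + u = sil p + u + r" by (simp add: algebra_simps)
    note a = odd_weightD[OF w, of "(sil p, u, LF)"] odd_weightD[OF w, of "(sil p + u, u, HB)"] odd_weightD[OF w, of "(sil p, u, HF)"]
      odd_weightD[OF w, of "(sil p + r, u, LB)"] odd_weightD[OF w, of "(sil p + u, u, HF)"] odd_weightD[OF w, of "(sil p + u + r, u, LB)"]
    show ?thesis
      using a by (cases t) (simp_all add: pull_back_def Let_def s ss c rt2_uminus r_def[symmetric])
  qed
  then show ?thesis unfolding odd_weight_def by (metis prod.collapse)
qed

lemma sum_list_concat: "sum_list (concat xss) = sum_list (map sum_list xss)" for xss :: "int list list"
  by (induction xss) simp_all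

text \<open>
  Since interior edges cancel, the weight of the boundaries of the pieces is that of the subdivided boundary.
\<close>

lemma boundary_sum_inflate_cell:
  assumes c: "tile_cell c" and w: "odd_weight w"
  shows "sum_list (map (boundary_sum w) (inflate_cell c)) = boundary_sum (pull_back w) c"
proof -
  obtain z s where s: "s \<in> set seeds" and c: "c = shift z s" using c by (auto simp: tile_cell_def)
  define f :: "pt \<Rightarrow> edge \<Rightarrow> edge" where "f = (\<lambda>z (p, u, t). (p + z, u, t))"
  have f_rev: "rev_edge (f z e) = f z (rev_edge e)" for z e by (cases e) (simp add: f_def algebra_simps)
  have f_inflate: "subdiv (f z e) = map (f (sil z)) (subdiv e)" for e
    by (cases e; cases "snd (snd e)") (auto simp: f_def sil_add Let_def algebra_simps)
  have bs: "boundary (shift y x) = map (f y) (boundary x)" for y x by (simp add: boundary_shift f_def)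
  define w' where "w' = w \<circ> f (sil z)"
  have "odd_weight w'" unfolding odd_weight_def
  proof
    fix e show "w' (rev_edge e) = - w' e"
      using odd_weightD[OF w, of "f (sil z) e"] by (simp only: w'_def comp_def f_rev)
  qed
  moreover have "cancels (concat (map boundary (inflate_cell s)) @ map rev_edge (concat (map subdiv (boundary s))))"
    using seeds_chain_ok s by (simp add: chain_ok_def)
  ultimately have "sum_list (map w' (concat (map boundary (inflate_cell s)) @ map rev_edge (concat (map subdiv (boundary s))))) = 0"
    by (rule cancels_sum)
  moreover have "sum_list (map w' (map rev_edge es)) = - sum_list (map w' es)" for es
    by (induction es) (simp_all add: odd_weightD[OF \<open>odd_weight w'\<close>])
  ultimately have "sum_list (map w' (concat (map boundary (inflate_cell s)))) = sum_list (map w' (concat (map subdiv (boundary s))))" by simp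
  moreover have "sum_list (map w' (concat (map boundary (inflate_cell s)))) = sum_list (map (boundary_sum w) (inflate_cell c))"
    by (simp add: c inflate_cell_shift boundary_sum_def bs map_concat sum_list_concat comp_def w'_def)
  moreover have "sum_list (map w' (concat (map subdiv (boundary s)))) = boundary_sum (pull_back w) c"
    by (simp add: c boundary_sum_def bs pull_back_def f_inflate map_concat sum_list_concat comp_def w'_def)
  ultimately show ?thesis by simp
qed

lemma boundary_sum_iterate:
  assumes "packed A" "odd_weight w"
  shows "(\<Sum>c\<in>(inflate ^^ n) A. boundary_sum w c) = (\<Sum>c\<in>A. boundary_sum ((pull_back ^^ n) w) c)"
  using assms(2)
proof (induction n arbitrary: w)
  case (Suc n)
  have p: "packed ((inflate ^^ n) A)" using assms(1) by (rule packed_iterate)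
  have "(\<Sum>c\<in>(inflate ^^ Suc n) A. boundary_sum w c) = (\<Sum>c\<in>(inflate ^^ n) A. sum_list (map (boundary_sum w) (inflate_cell c)))"
    by (simp add: sum_inflate[OF p])
  also have "\<dots> = (\<Sum>c\<in>(inflate ^^ n) A. boundary_sum (pull_back w) c)"
    using p boundary_sum_inflate_cell[OF _ Suc.prems] by (intro sum.cong) (auto simp: packed_def)
  also have "\<dots> = (\<Sum>c\<in>A. boundary_sum ((pull_back ^^ n) (pull_back w)) c)" by (rule Suc.IH[OF odd_weight_pull_back[OF Suc.prems]])
  finally show ?case by (simp add: funpow_swap1)
qed simp

lemma side_val_along:
  assumes "u \<in> set dirs"
  shows "side_val p u (emb (q + u)) = side_val p u (emb q)" "side_val p u (emb (q + rt2 u)) = side_val p u (emb q)"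
  by (simp_all add: side_val_def emb_add emb_rt2 algebra_simps)

lemma side_val_sil: "side_val (sil p) u (emb (sil q)) = silver * side_val p u (emb q)"
proof -
  have "cnj (emb u) * (silver *\<^sub>R emb q - silver *\<^sub>R emb p) = silver *\<^sub>R (cnj (emb u) * (emb q - emb p))"
    by (simp add: scaleR_diff_right right_diff_distrib)
  then show ?thesis unfolding side_val_def emb_sil by simp
qed

text \<open>
  An edge of the supertile is subdivided along its own line, so a weight vanishing on a line pulls back to zero there.
\<close>

lemma pull_back_vanishes:
  assumes u: "u \<in> set dirs" and "\<And>q t. side_val ((sil ^^ n) p) u (emb q) = 0 \<Longrightarrow> w (q, u, t) = 0"
    and "side_val p u (emb q) = 0"
  shows "(pull_back ^^ n) w (q, u, t) = 0"
  using assms(2,3)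
proof (induction n arbitrary: w)
  case (Suc n)
  have "pull_back w (q, u, t) = 0" if "side_val ((sil ^^ n) p) u (emb q) = 0" for q t
  proof -
    have "side_val ((sil ^^ Suc n) p) u (emb (sil q)) = 0" using that by (simp add: side_val_sil)
    then show ?thesis using Suc.prems(1)
      by (cases t) (simp_all add: pull_back_def Let_def side_val_along[OF u])
  qed
  then show ?case using Suc.IH[of "pull_back w"] Suc.prems(2) by (simp add: funpow_swap1)
qed simp

definition star :: "cell set \<Rightarrow> pt \<Rightarrow> bool" where
  "star A y \<longleftrightarrow> (\<forall>k\<in>set dirs. \<exists>c\<in>A. (y, k) \<in> set (flags c))"

lemma emb_sil_pow: "emb ((sil ^^ n) p) = silver ^ n *\<^sub>R emb p"
  by (induction n) (simp_all add: emb_sil)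

lemma side_val_region_scaled:
  assumes "tile_cell s" "z \<in> (*\<^sub>R) r ` region s" "(p, u, t) \<in> set (boundary s)" "0 \<le> r" "emb q = r *\<^sub>R emb p"
  shows "0 \<le> side_val q u z"
proof -
  obtain x where x: "x \<in> region s" "z = r *\<^sub>R x" using assms by blast
  have "cnj (emb u) * (z - emb q) = r *\<^sub>R (cnj (emb u) * (x - emb p))"
    by (simp add: assms x scaleR_diff_right right_diff_distrib)
  then have "side_val q u z = r * side_val p u x" by (simp add: side_val_def)
  then show ?thesis using x assms by (auto simp: region_def)
qed

text \<open>
  Suppose that the turn leaves \<open>c\<close> through the edge \<open>e\<close>, and put weight 1 on \<open>e\<close> and -1 on its reverse. The lines of
  the boundary edges of the supertile avoid the interior point \<open>y\<close>, so the pulled back weight vanishes there and the total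
  over all cells is 0. Since \<open>c\<close> contributes at least 1, another cell has the reversed edge, and with it the next sector.
\<close>

lemma turn_step:
  assumes s: "tile_cell s" and c: "c \<in> (inflate ^^ n) {s}" and f: "(y, k) \<in> set (flags c)"
    and int: "emb y \<in> interior ((*\<^sub>R) (silver ^ n) ` region s)"
  shows "\<exists>c'\<in>(inflate ^^ n) {s}. (y, rot k) \<in> set (flags c')"
proof -
  define Y where "Y = (inflate ^^ n) {s}"
  have p: "packed Y" unfolding Y_def by (intro packed_iterate packed_singleton s)
  have t: "\<And>c. c \<in> Y \<Longrightarrow> tile_cell c" using p by (auto simp: packed_def)
  have tc: "tile_cell c" using t c Y_def by blast
  show ?thesis
  proof (cases "(y, rot k) \<in> set (flags c)")
    case True then show ?thesis using c by blast
  next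
    case False
    then obtain e where e: "e \<in> set (boundary c)" "fst (rev_edge e) = y" "fst (snd (rev_edge e)) = rot k"
      using turn_next[OF tc f] by blast
    \<comment> \<open>The odd weight concentrated on \<open>e\<close> and its reverse.\<close>
    define w :: "edge \<Rightarrow> int" where "w = (\<lambda>f. if f = e then 1 else if f = rev_edge e then - 1 else 0)"
    have fl: "snd (snd (rev_edge f)) \<noteq> snd (snd f)" for f
      by (cases f; cases "snd (snd f)") auto
    have ne: "rev_edge e \<noteq> e" using fl[of e] by metis
    have w: "odd_weight w" unfolding odd_weight_def
    proof
      fix f show "w (rev_edge f) = - w f"
        using ne rev_rev_edge[of f] rev_rev_edge[of e] by (auto simp: w_def)
    qed
    have "(pull_back ^^ n) w (q, u, h) = 0" if b: "(q, u, h) \<in> set (boundary s)" for q u h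
    proof (rule pull_back_vanishes)
      show u: "u \<in> set dirs" by (rule boundary_dirs[OF s b])
      show "side_val q u (emb q) = 0" by (simp add: side_val_def)
      fix q' h' assume z: "side_val ((sil ^^ n) q) u (emb q') = 0"
      show "w (q', u, h') = 0"
      proof (rule ccontr)
        assume "w (q', u, h') \<noteq> 0"
        then have "e = (q', u, h') \<or> rev_edge e = (q', u, h')" by (auto simp: w_def split: if_splits)
        then have "y = q' + u \<or> y = q' + rt2 u \<or> y = q'"
          using e(2) by (auto split: if_splits)
        then have y: "side_val ((sil ^^ n) q) u (emb y) = 0" using z by (auto simp: side_val_along[OF u])
        have "(*\<^sub>R) (silver ^ n) ` region s \<subseteq> {z. 0 \<le> side_val ((sil ^^ n) q) u z}"
          using side_val_region_scaled[OF s _ b _ emb_sil_pow] silver_gt by auto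
        then have "emb y \<in> {z. 0 < side_val ((sil ^^ n) q) u z}"
          using int interior_mono interior_side(1)[OF u] by blast
        then show False using y by simp
      qed
    qed
    then have "boundary_sum ((pull_back ^^ n) w) s = 0"
      unfolding boundary_sum_def by (intro sum_list_nonneg_eq_0_iff[THEN iffD2]) auto
    then have total: "(\<Sum>c\<in>Y. boundary_sum w c) = 0"
      using boundary_sum_iterate[OF packed_singleton[OF s] w, of n] by (simp add: Y_def)
    have "\<exists>c'\<in>Y. rev_edge e \<in> set (boundary c')"
    proof (rule ccontr)
      assume no: "\<not> ?thesis"
      have nonneg: "0 \<le> boundary_sum w c'" if "c' \<in> Y" for c'
        unfolding boundary_sum_def using no that by (intro sum_list_nonneg) (auto simp: w_def)
      moreover have "1 \<le> boundary_sum w c"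
      proof -
        have "sum_list (map w (boundary c)) = w e + sum_list (map w (remove1 e (boundary c)))"
          using e(1) by (rule sum_list_map_remove1)
        moreover have "0 \<le> sum_list (map w (remove1 e (boundary c)))"
          using no c Y_def by (intro sum_list_nonneg) (auto simp: w_def dest!: notin_set_remove1[THEN contrapos_nn, rotated])
        ultimately show ?thesis by (simp add: boundary_sum_def w_def)
      qed
      moreover have "boundary_sum w c \<le> (\<Sum>c\<in>Y. boundary_sum w c)"
        using p c Y_def nonneg by (intro member_le_sum) (auto simp: packed_def)
      ultimately show False using total by linarith
    qed
    then obtain c' where c': "c' \<in> Y" "rev_edge e \<in> set (boundary c')" by blast
    then have "(y, rot k) \<in> set (flags c')"
      using turn_start[OF t[OF c'(1)], of y "rot k" "snd (snd (rev_edge e))"] e by (metis prod.collapse)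
    then show ?thesis using c' Y_def by blast
  qed
qed

lemma flags_dirs: "tile_cell c \<Longrightarrow> (y, k) \<in> set (flags c) \<Longrightarrow> k \<in> set dirs"
proof (cases c)
  case (Hs q v b)
  assume "tile_cell c" "(y, k) \<in> set (flags c)"
  then show ?thesis by (cases b) (auto simp only: Hs tile_cell_iff flags.simps Let_def if_True if_False set_simps insert_iff empty_iff prod.inject dirs_rot)
next
  case (Rh q v)
  assume "tile_cell c" "(y, k) \<in> set (flags c)"
  then show ?thesis by (auto simp only: Rh tile_cell_iff flags.simps Let_def set_simps insert_iff empty_iff prod.inject dirs_rot)
qed (simp add: tile_cell_iff)

lemma dirs_orbit: "k \<in> set dirs \<Longrightarrow> l \<in> set dirs \<Longrightarrow> \<exists>j<8. (rot ^^ j) k = l"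
proof -
  have "\<forall>k\<in>set dirs. \<forall>l\<in>set dirs. \<exists>j\<in>set [0..<8]. (rot ^^ j) k = l" by code_simp
  then show "k \<in> set dirs \<Longrightarrow> l \<in> set dirs \<Longrightarrow> ?thesis" by force
qed

text \<open>
  Turn eight times.
\<close>

theorem interior_vertex_star:
  assumes s: "tile_cell s" and c: "c \<in> (inflate ^^ n) {s}" and f: "(y, k) \<in> set (flags c)"
    and int: "emb y \<in> interior ((*\<^sub>R) (silver ^ n) ` region s)"
  shows "star ((inflate ^^ n) {s}) y"
proof -
  have "\<exists>c'\<in>(inflate ^^ n) {s}. (y, (rot ^^ j) k) \<in> set (flags c')" for j
  proof (induction j)
    case (Suc j)
    then obtain c' where "c' \<in> (inflate ^^ n) {s}" "(y, (rot ^^ j) k) \<in> set (flags c')" by blast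
    from turn_step[OF s this int] show ?case by simp
  qed (use c f in auto)
  moreover have "k \<in> set dirs"
  proof (rule flags_dirs[OF _ f])
    show "tile_cell c" using packed_iterate[OF packed_singleton[OF s], of n] c by (simp add: packed_def)
  qed
  ultimately show ?thesis unfolding star_def using dirs_orbit by metis
qed

section \<open>Discs around surrounded vertices\<close>

text \<open>
  A point at distance at most \<open>\<surd>2 / 2\<close> from the corner does not reach the edge lines that miss the corner.
\<close>

lemma sector_in_region:
  assumes c: "tile_cell c" and f: "(y, k) \<in> set (flags c)" and ab: "0 \<le> \<alpha>" "0 \<le> \<beta>"
    and small: "cmod (\<alpha> *\<^sub>R emb k + \<beta> *\<^sub>R emb (rot k)) \<le> sqrt 2 / 2"
  shows "emb y + \<alpha> *\<^sub>R emb k + \<beta> *\<^sub>R emb (rot k) \<in> region c"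
proof -
  define v where "v = \<alpha> *\<^sub>R emb k + \<beta> *\<^sub>R emb (rot k)"
  have "0 \<le> side_val p u (emb y + v)" if e: "(p, u, t) \<in> set (boundary c)" for p u t
  proof -
    have split: "side_val p u (emb y + v) = side_val p u (emb y) + Im (cnj (emb u) * v)"
      by (simp add: side_val_def algebra_simps)
    obtain m n where mn: "cross u (y - p) = (m, n)" by fastforce
    have "(m = 0 \<and> n = 0 \<and> nonneg_rt2 (cross u k) \<and> nonneg_rt2 (cross u (rot k))) \<or> nonneg_rt2 (m - 1, n)"
      using flags_ok[OF c] e f mn unfolding flags_ok_def by fastforce
    then show ?thesis
    proof
      assume *: "m = 0 \<and> n = 0 \<and> nonneg_rt2 (cross u k) \<and> nonneg_rt2 (cross u (rot k))"
      then have "nonneg_rt2 (cross u (y - p))" by (simp add: mn)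
      then have "0 \<le> side_val p u (emb y)" by (simp only: nonneg_rt2_side)
      moreover have "0 \<le> \<alpha> * Im (cnj (emb u) * emb k)" "0 \<le> \<beta> * Im (cnj (emb u) * emb (rot k))"
        using * ab by (simp_all only: nonneg_rt2_cross mult_nonneg_nonneg)
      moreover have "Im (cnj (emb u) * v) = \<alpha> * Im (cnj (emb u) * emb k) + \<beta> * Im (cnj (emb u) * emb (rot k))"
        by (simp add: v_def algebra_simps)
      ultimately show ?thesis unfolding split by linarith
    next
      assume "nonneg_rt2 (m - 1, n)"
      then have "1 \<le> real_of_int m + n * sqrt 2" by (simp add: nonneg_rt2_iff del: nonneg_rt2.simps)
      then have "1 \<le> sqrt 2 * side_val p u (emb y)" using cross_emb[OF mn] by (simp add: side_val_emb)
      then have 1: "sqrt 2 / 2 \<le> side_val p u (emb y)"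
        using mult_left_mono[of 1 "sqrt 2 * side_val p u (emb y)" "sqrt 2 / 2"] by (simp add: mult.assoc[symmetric])
      have "\<bar>Im (cnj (emb u) * v)\<bar> \<le> cmod (cnj (emb u) * v)" by (rule abs_Im_le_cmod)
      also have "\<dots> = cmod v" using emb_dir[OF boundary_dirs[OF c e]] by (simp add: norm_mult)
      finally show ?thesis unfolding split using 1 small by (simp add: v_def)
    qed
  qed
  then show ?thesis by (auto simp: region_def v_def add.assoc)
qed

lemma sector_exists: "\<exists>k\<in>set dirs. \<exists>\<alpha> \<beta>. 0 \<le> \<alpha> \<and> 0 \<le> \<beta> \<and> w = \<alpha> *\<^sub>R emb k + \<beta> *\<^sub>R emb (rot k)"
proof -
  have q: "\<exists>k\<in>set dirs. \<exists>\<alpha> \<beta>. 0 \<le> \<alpha> \<and> 0 \<le> \<beta> \<and> w = \<alpha> *\<^sub>R emb k + \<beta> *\<^sub>R emb (rot k)"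
    if "0 \<le> Re w" "0 \<le> Im w" for w
  proof (cases "Im w \<le> Re w")
    case True
    have "w = (Re w - Im w) *\<^sub>R emb (1,0,0,0) + (sqrt 2 * Im w) *\<^sub>R emb (rot (1,0,0,0))"
      by (simp add: emb_def complex_eq_iff)
    then show ?thesis using that True by (intro bexI[of _ "(1,0,0,0)"] exI[of _ "Re w - Im w"] exI[of _ "sqrt 2 * Im w"]) (auto simp: dirs_def)
  next
    case False
    have "w = (sqrt 2 * Re w) *\<^sub>R emb (0,1,0,0) + (Im w - Re w) *\<^sub>R emb (rot (0,1,0,0))"
      by (simp add: emb_def complex_eq_iff)
    then show ?thesis using that False by (intro bexI[of _ "(0,1,0,0)"] exI[of _ "sqrt 2 * Re w"] exI[of _ "Im w - Re w"]) (auto simp: dirs_def)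
  qed
  have turn: "\<exists>k\<in>set dirs. \<exists>\<alpha> \<beta>. 0 \<le> \<alpha> \<and> 0 \<le> \<beta> \<and> w = \<alpha> *\<^sub>R emb k + \<beta> *\<^sub>R emb (rot k)"
    if w: "w = \<i> * w'" and w': "\<exists>k\<in>set dirs. \<exists>\<alpha> \<beta>. 0 \<le> \<alpha> \<and> 0 \<le> \<beta> \<and> w' = \<alpha> *\<^sub>R emb k + \<beta> *\<^sub>R emb (rot k)" for w w'
  proof -
    obtain k \<alpha> \<beta> where k: "k \<in> set dirs" "0 \<le> \<alpha>" "0 \<le> \<beta>" "w' = \<alpha> *\<^sub>R emb k + \<beta> *\<^sub>R emb (rot k)" using w' by blast
    have "w = \<alpha> *\<^sub>R emb (rot (rot k)) + \<beta> *\<^sub>R emb (rot (rot (rot k)))"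
      unfolding w k(4) emb_rot_rot[of k] emb_rot_rot[of "rot k"] by (simp add: algebra_simps)
    then show ?thesis using k dirs_rot(1)[OF dirs_rot(1)[OF k(1)]] by blast
  qed
  consider "0 \<le> Re w" "0 \<le> Im w" | "Re w \<le> 0" "0 \<le> Im w" | "Re w \<le> 0" "Im w \<le> 0" | "0 \<le> Re w" "Im w \<le> 0" by linarith
  then show ?thesis
  proof cases
    case 1 then show ?thesis by (rule q)
  next
    case 2
    show ?thesis by (rule turn[of w "- \<i> * w"], simp, rule q) (use 2 in auto)
  next
    case 3
    show ?thesis by (rule turn[of w "- \<i> * w"], simp, rule turn[of _ "- w"], simp, rule q) (use 3 in auto)
  next
    case 4
    show ?thesis
      by (rule turn[of w "- \<i> * w"], simp, rule turn[of _ "- w"], simp, rule turn[of _ "\<i> * w"], simp, rule q) (use 4 in auto)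
  qed
qed

text \<open>
  The eight sectors at a surrounded vertex cover the disc of radius \<open>\<surd>2 / 2\<close>.
\<close>

lemma star_ball:
  assumes A: "packed A" and y: "star A y" and z: "cmod (z - emb y) \<le> sqrt 2 / 2"
  shows "\<exists>k. \<exists>c\<in>A. (y, k) \<in> set (flags c) \<and> z \<in> region c"
proof -
  obtain k \<alpha> \<beta> where k: "k \<in> set dirs" "0 \<le> \<alpha>" "0 \<le> \<beta>" "z - emb y = \<alpha> *\<^sub>R emb k + \<beta> *\<^sub>R emb (rot k)"
    using sector_exists by blast
  obtain c where c: "c \<in> A" "(y, k) \<in> set (flags c)" using y k(1) by (auto simp: star_def)
  have "emb y + \<alpha> *\<^sub>R emb k + \<beta> *\<^sub>R emb (rot k) \<in> region c"
    using A c k z by (intro sector_in_region) (auto simp: packed_def)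
  moreover have "emb y + \<alpha> *\<^sub>R emb k + \<beta> *\<^sub>R emb (rot k) = z" using k(4) by (simp add: algebra_simps)
  ultimately show ?thesis using c by blast
qed

lemma overlap_eq:
  assumes A: "packed A" and c: "c \<in> A" "c' \<in> A" and z: "z \<in> interior (region c)" "z \<in> region c'"
  shows "c = c'"
proof (rule ccontr)
  assume "c \<noteq> c'"
  then have "interior (region c) \<inter> interior (region c') = {}" using A c by (auto simp: packed_def)
  then have "interior (region c) \<inter> closure (interior (region c')) = {}"
    by (simp add: open_Int_closure_eq_empty)
  moreover have "closure (interior (region c')) = closure (region c')"
    using A c by (intro convex_closure_interior convex_region interior_region_nonempty) (auto simp: packed_def)
  ultimately show False using z closure_subset by blast
qed

text \<open>
  Move from the vertex slightly towards an interior point of \<open>c\<close>; the point reached lies in a cell of the star, which must be \<open>c\<close>.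
\<close>

lemma star_corner:
  assumes A: "packed A" and y: "star A y" and c: "c \<in> A" "emb y \<in> region c"
  shows "\<exists>k. (y, k) \<in> set (flags c)"
proof -
  have "tile_cell c" using A c by (auto simp: packed_def)
  then obtain x where x: "x \<in> interior (region c)" using interior_region_nonempty by blast
  define n where "n = cmod (x - emb y)"
  define e where "e = 1 / (2 * (n + 1))"
  have n: "n \<ge> 0" by (simp add: n_def)
  have e: "0 < e" "e \<le> 1" using n by (auto simp: e_def)
  define z where "z = emb y - e *\<^sub>R (emb y - x)"
  have z: "z \<in> interior (region c)"
    unfolding z_def using e c x by (intro mem_interior_convex_shrink convex_region)
  have "cmod (z - emb y) = e * n" unfolding z_def n_def using e by (simp add: norm_minus_commute)
  also have "\<dots> \<le> 1 / 2" using n by (simp add: e_def divide_simps)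
  also have "\<dots> \<le> sqrt 2 / 2" by simp
  finally obtain k c' where "c' \<in> A" "(y, k) \<in> set (flags c')" "z \<in> region c'"
    using star_ball[OF A y] by blast
  then show ?thesis using overlap_eq[OF A c(1) _ z] by blast
qed

lemma corner_distance:
  assumes c: "tile_cell c" and f: "(y, k) \<in> set (flags c)" "(y', k') \<in> set (flags c)" and "y \<noteq> y'"
  shows "1 \<le> 2 * (cmod (emb y - emb y'))\<^sup>2"
proof -
  have "\<forall>s\<in>set seeds. \<forall>f\<in>set (flags s). \<forall>f'\<in>set (flags s). fst f = fst f' \<or> \<not> near (1, 0) (fst f - fst f')"
    by code_simp
  moreover obtain z s where s: "s \<in> set seeds" "c = shift z s" using c by (auto simp: tile_cell_def)
  moreover have "(y - z, k) \<in> set (flags s)" "(y' - z, k') \<in> set (flags s)"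
    using f by (simp_all only: s flags_shift_iff)
  ultimately have "\<not> near (1, 0) (y - y')" using \<open>y \<noteq> y'\<close> by fastforce
  moreover obtain a b where ab: "sqnorm (y - y') = (a, b)" by fastforce
  ultimately have "nonneg_rt2 (2 * a - 1, 2 * b)" by (simp add: near_def del: nonneg_rt2.simps)
  then have "0 \<le> real_of_int (2 * a - 1) + real_of_int (2 * b) * sqrt 2" by (simp only: nonneg_rt2_iff)
  then show ?thesis using sqnorm_emb[OF ab] by (simp add: emb_diff)
qed

text \<open>
  A second surrounded vertex within the covered disc would be a corner of a cell of the star, and two corners of one cell are at
  least \<open>\<surd>2 / 2\<close> apart.
\<close>

lemma star_distance:
  assumes A: "packed A" and y: "star A y" "star A y'" "y \<noteq> y'"
  shows "1 \<le> 2 * (cmod (emb y - emb y'))\<^sup>2"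
proof (rule ccontr)
  assume "\<not> ?thesis"
  then have "(cmod (emb y' - emb y))\<^sup>2 \<le> (sqrt 2 / 2)\<^sup>2" by (simp add: norm_minus_commute power_divide)
  then have "cmod (emb y' - emb y) \<le> sqrt 2 / 2" by (rule power2_le_imp_le) simp
  from star_ball[OF A y(1) this] obtain k c where c: "c \<in> A" "(y, k) \<in> set (flags c)" "emb y' \<in> region c" by blast
  obtain k' where k': "(y', k') \<in> set (flags c)" using star_corner[OF A y(2) c(1,3)] by blast
  then show False using corner_distance[OF _ c(2) k' y(3)] A c(1) \<open>\<not> 1 \<le> _\<close> by (auto simp: packed_def)
qed

section \<open>Counting corner sectors\<close>

text \<open>
  The number of flags of the \<open>m\<close>-fold substituted cell.
\<close>

fun flag_number :: "nat \<Rightarrow> cell \<Rightarrow> nat" where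
  "flag_number 0 c = length (flags c)"
| "flag_number (Suc m) c = sum_list (map (flag_number m) (inflate_cell c))"

lemma distinct_flags: "tile_cell c \<Longrightarrow> distinct (flags c)"
proof -
  have "\<forall>s\<in>set seeds. distinct (flags s)" by code_simp
  then show "tile_cell c \<Longrightarrow> ?thesis"
    by (auto simp: tile_cell_def flags_shift distinct_map inj_on_def)
qed

lemma funpow_inflate_swap: "(inflate ^^ m) (inflate A) = inflate ((inflate ^^ m) A)"
  by (simp add: funpow_swap1)

lemma inflate_mono: "A \<subseteq> B \<Longrightarrow> inflate A \<subseteq> inflate B"
  by (auto simp: inflate_def)

lemma inflate_iterate_mono: "A \<subseteq> B \<Longrightarrow> (inflate ^^ m) A \<subseteq> (inflate ^^ m) B"
  by (induction m) (auto intro: inflate_mono[THEN subsetD])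

lemma packed_subset: "packed B \<Longrightarrow> A \<subseteq> B \<Longrightarrow> packed A"
  unfolding packed_def by (meson finite_subset subsetD)

lemma flag_count_iterate: "packed A \<Longrightarrow> (\<Sum>c\<in>(inflate ^^ m) A. length (flags c)) = (\<Sum>c\<in>A. flag_number m c)"
proof (induction m arbitrary: A)
  case (Suc m)
  have "(\<Sum>c\<in>(inflate ^^ Suc m) A. length (flags c)) = (\<Sum>c\<in>(inflate ^^ m) (inflate A). length (flags c))"
    by (simp add: funpow_inflate_swap)
  also have "\<dots> = (\<Sum>c\<in>inflate A. flag_number m c)" by (rule Suc.IH[OF packed_inflate[OF Suc.prems]])
  also have "\<dots> = (\<Sum>c\<in>A. flag_number (Suc m) c)" by (simp add: sum_inflate[OF Suc.prems])
  finally show ?case .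
qed simp

lemma silver_nonzero [simp]: "silver \<noteq> 0"
  using silver_gt by simp

lemma silver_inverse: "1 / silver = sqrt 2 - 1"
proof -
  have "silver * (sqrt 2 - 1) = 1" by (simp add: silver_def algebra_simps)
  then show ?thesis using silver_gt by (simp add: field_simps)
qed

text \<open>
  The substitution acts on the numbers of flags by a matrix with the eigenvalues \<open>silver\<^sup>2\<close> and \<open>1 / silver\<^sup>2\<close>.
\<close>

lemma flag_number_formula:
  "flag_number m (Rh p u) = 2 * sqrt 2 * (silver ^ (2 * m + 1) + 1 / silver ^ (2 * m + 1)) \<and>
   flag_number m (Hs p u b) = 2 * (silver ^ (2 * m + 1) - 1 / silver ^ (2 * m + 1))"
proof (induction m arbitrary: p u b)
  case 0
  note silver_inverse
  then have "silver + 1 / silver = 2 * sqrt 2" "silver - 1 / silver = 2" by (simp_all add: silver_def)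
  then show ?case by (cases b) (simp_all add: Let_def)
next
  case (Suc m)
  define X where "X = silver ^ (2 * m + 1)"
  define Y where "Y = 1 / silver ^ (2 * m + 1)"
  have s2: "silver\<^sup>2 = 3 + 2 * sqrt 2" by (simp add: silver_def power2_eq_square algebra_simps)
  note i = silver_inverse
  have i2: "(1 / silver)\<^sup>2 = 3 - 2 * sqrt 2" unfolding i by (simp add: power2_eq_square algebra_simps)
  have X: "silver ^ (2 * Suc m + 1) = (3 + 2 * sqrt 2) * X"
    unfolding X_def s2[symmetric] by (simp add: power2_eq_square)
  have Y: "1 / silver ^ (2 * Suc m + 1) = (3 - 2 * sqrt 2) * Y"
    unfolding Y_def i2[symmetric] by (simp add: power2_eq_square)
  have r: "real (flag_number m (rh p u)) = 2 * sqrt 2 * (X + Y)" for p u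
    using Suc.IH by (simp add: rh_def X_def Y_def)
  have h: "real (flag_number m (Hs p u b)) = 2 * (X - Y)" for p u b
    using Suc.IH by (simp add: X_def Y_def)
  show ?case unfolding Y unfolding X
    by (cases b) (simp_all add: Let_def r h algebra_simps)
qed

lemma silver_pow_ge: "silver ^ n \<ge> 1" "silver ^ n > 0"
  using silver_gt by (simp_all add: one_le_power)

text \<open>
  Growth by the factor \<open>silver\<^sup>2\<close> per step, up to a relative error that is small in \<open>m\<close> and uniform in \<open>j\<close>.
\<close>

lemma flag_number_ratio:
  assumes "tile_cell c"
  shows "(1 - 1 / silver ^ (2 * m)) * flag_number (j + m) c \<le> silver ^ (2 * j) * flag_number m c"
proof -
  define X where "X = silver ^ (2 * m + 1)"
  define J where "J = silver ^ (2 * j)"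
  have X1: "X \<ge> 1" and J1: "J \<ge> 1" unfolding X_def J_def by (rule silver_pow_ge(1))+
  have XJ: "silver ^ (2 * (j + m) + 1) = J * X" by (simp add: X_def J_def power_add mult_ac distrib_left)
  define e where "e = 1 / silver ^ (2 * m)"
  have e: "0 < e" "e \<le> 1" using silver_pow_ge[of "2 * m"] by (simp_all add: e_def divide_simps)
  have "1 / X \<le> e" unfolding X_def e_def using silver_gt by (intro frac_le) (auto intro: power_increasing)
  then have eX: "1 \<le> e * X" using X1 by (simp add: divide_simps mult_ac)
  have JX: "1 / (J * X) \<le> 1 / X" using X1 J1 by (simp add: divide_simps mult_le_cancel_right1)
  have eX2: "1 / X \<le> e * X" using eX X1 by (smt (verit) divide_le_eq_1)
  show ?thesis
  proof (cases c)
    case (Rh p u)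
    have "(1 - e) * (J * X + 1 / (J * X)) \<le> J * X"
    proof -
      have "(1 - e) * (J * X + 1 / (J * X)) = J * X - e * (J * X) + (1 - e) * (1 / (J * X))"
        by (simp add: algebra_simps)
      also have "(1 - e) * (1 / (J * X)) \<le> 1 * (1 / (J * X))" using e X1 J1 by (intro mult_right_mono) auto
      also have "1 / (J * X) \<le> e * (J * X)"
      proof -
        have "1 / (J * X) \<le> 1 * (e * X)" using JX eX2 by simp
        also have "\<dots> \<le> J * (e * X)" using J1 e X1 by (intro mult_right_mono) auto
        finally show ?thesis by (simp add: mult_ac)
      qed
      finally show ?thesis by simp
    qed
    also have "J * X \<le> J * (X + 1 / X)" using J1 X1 by simp
    finally have "2 * sqrt 2 * ((1 - e) * (J * X + 1 / (J * X))) \<le> 2 * sqrt 2 * (J * (X + 1 / X))"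
      by (intro mult_left_mono) auto
    then show ?thesis
      unfolding Rh conjunct1[OF flag_number_formula] XJ X_def[symmetric] J_def[symmetric] e_def[symmetric]
      by (simp only: mult_ac)
  next
    case (Hs p u b)
    have "(1 - e) * (J * X - 1 / (J * X)) \<le> (1 - e) * (J * X)"
      using e X1 J1 by (intro mult_left_mono) auto
    also have "\<dots> = J * (X - e * X)" by (simp add: algebra_simps)
    also have "\<dots> \<le> J * (X - 1 / X)" using J1 eX2 by (intro mult_left_mono) auto
    finally have "2 * ((1 - e) * (J * X - 1 / (J * X))) \<le> 2 * (J * (X - 1 / X))"
      by (intro mult_left_mono) auto
    then show ?thesis
      unfolding Hs conjunct2[OF flag_number_formula] XJ X_def[symmetric] J_def[symmetric] e_def[symmetric]
      by (simp only: mult_ac)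
  qed (use assms in \<open>simp add: tile_cell_iff\<close>)
qed

lemma flag_number_bound:
  assumes "tile_cell c" shows "flag_number m c \<le> 8 * silver ^ (2 * m + 1)"
proof -
  have X: "1 \<le> silver ^ (2 * m + 1)" by (rule silver_pow_ge)
  then have Y: "1 / silver ^ (2 * m + 1) \<le> silver ^ (2 * m + 1)" "0 \<le> 1 / silver ^ (2 * m + 1)"
    by (smt (verit) divide_le_eq_1, simp)
  have "sqrt 2 \<le> 2" using sqrt2_less_2 by simp
  show ?thesis
  proof (cases c)
    case (Rh p u)
    have "sqrt 2 * (silver ^ (2 * m + 1) + 1 / silver ^ (2 * m + 1)) \<le> 2 * (silver ^ (2 * m + 1) + silver ^ (2 * m + 1))"
      using \<open>sqrt 2 \<le> 2\<close> Y X by (intro mult_mono) auto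
    then show ?thesis unfolding Rh conjunct1[OF flag_number_formula] by simp
  next
    case (Hs p u b)
    have "2 * (a - b) \<le> 8 * a" if "1 \<le> a" "0 \<le> b" for a b :: real using that by simp
    then show ?thesis unfolding Hs conjunct2[OF flag_number_formula] using X Y(2) by blast
  qed (use assms in \<open>simp add: tile_cell_iff\<close>)
qed

section \<open>Sizes of tiles\<close>

lemma region_diameter:
  assumes "tile_cell c" "z \<in> region c" "w \<in> region c"
  shows "dist z w \<le> 4"
proof -
  obtain p where p: "\<And>x. x \<in> set (corners c) \<Longrightarrow> dist (emb p) (emb x) \<le> 2"
  proof -
    obtain q u where qu: "(\<exists>b. c = Hs q u b) \<or> c = Rh q u" using assms(1) by (cases c) (auto simp: tile_cell_iff)
    then have u: "u \<in> set dirs" using assms(1) by (auto simp: tile_cell_iff)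
    have n: "cmod (emb u) = 1" "cmod (emb (rot u)) = 1" "cmod (emb (rot (rot u))) = 1"
      using emb_dir dirs_rot(1) u by blast+
    have t: "cmod (x + y) \<le> 2" "cmod (x - y) \<le> 2" if "cmod x = 1" "cmod y = 1" for x y :: complex
      using norm_triangle_ineq[of x y] norm_triangle_ineq4[of x y] that by auto
    have "dist (emb q) (emb x) = cmod (emb (x - q))" for x by (simp add: dist_norm norm_minus_commute emb_diff)
    then have "dist (emb q) (emb x) \<le> 2" if "x \<in> set (corners c)" for x
      using qu that n t by (elim disjE exE) (auto simp: corners_def Let_def emb_add emb_diff emb_0 split: if_splits)
    then show ?thesis by (rule that)
  qed
  have "region c \<subseteq> cball (emb p) 2"
    unfolding cell_hull_eq_region[OF tile_cell_unit_cell[OF assms(1)], symmetric] cell_hull_def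
    by (rule hull_minimal) (use p in auto)
  then have "dist (emb p) z \<le> 2" "dist (emb p) w \<le> 2" using assms by auto
  then show ?thesis using dist_triangle3[of z w "emb p"] by linarith
qed

text \<open>
  The radius 1/10 holds at the middle of a suitable sector; the numbers 3 and 2 are a rational lower bound for the distance to the
  edge lines, since \<open>2 / (12 * \<surd>2) > 1/10\<close>.
\<close>

lemma region_contains_ball:
  assumes "tile_cell c"
  shows "\<exists>x. ball x (1/10) \<subseteq> region c"
proof -
  have "\<forall>s\<in>set seeds. \<exists>(y, k)\<in>set (flags s). \<forall>(p, u, _)\<in>set (boundary s). \<not> nonneg_rt2 (case cross u (p + p + p + p - y - y - y - y - k - rot k) of (m, n) \<Rightarrow> (3 * m + 2, 3 * n))"
    by code_simp
  moreover obtain z s where s: "s \<in> set seeds" "c = shift z s" using assms by (auto simp: tile_cell_def)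
  ultimately obtain y k where yk: "(y, k) \<in> set (flags s)"
    and far: "\<And>p u t. (p, u, t) \<in> set (boundary s) \<Longrightarrow> \<not> nonneg_rt2 (case cross u (p + p + p + p - y - y - y - y - k - rot k) of (m, n) \<Rightarrow> (3 * m + 2, 3 * n))"
    by fastforce
  have "ball (mid (y + z) k) (1/10) \<subseteq> region c"
  proof
    fix x assume x: "x \<in> ball (mid (y + z) k) (1/10)"
    have "0 \<le> side_val p u x" if e: "(p, u, t) \<in> set (boundary c)" for p u t
    proof -
      have e': "(p - z, u, t) \<in> set (boundary s)" using e by (simp only: s boundary_shift_iff)
      define d where "d = (p - z) + (p - z) + (p - z) + (p - z) - y - y - y - y - k - rot k"
      obtain m n where mn: "cross u d = (m, n)" by fastforce
      have "\<not> nonneg_rt2 (3 * m + 2, 3 * n)" using far[OF e'] mn by (simp add: d_def)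
      then have "real_of_int (3 * m + 2) + real_of_int (3 * n) * sqrt 2 < 0" by (simp only: nonneg_rt2_iff not_le)
      then have "3 * (real_of_int m + n * sqrt 2) + 2 < 0" by (simp add: algebra_simps)
      then have "3 * (sqrt 2 * Im (cnj (emb u) * emb d)) + 2 < 0" using cross_emb[OF mn] by simp
      moreover have "emb d = - (4 *\<^sub>R (mid (y + z) k - emb p))"
        by (simp add: d_def mid_def emb_add emb_diff scaleR_add_right algebra_simps)
          (simp add: scaleR_conv_of_real)
      ultimately have 1: "2 < 12 * (sqrt 2 * side_val p u (mid (y + z) k))"
        by (simp add: side_val_def algebra_simps)
      have "sqrt 2 < 1.5" by (rule real_less_lsqrt) (auto simp: power2_eq_square)
      then have 2: "side_val p u (mid (y + z) k) > 1/10"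
      proof -
        have "0 < sqrt 2 * side_val p u (mid (y + z) k)" using 1 by linarith
        then have "side_val p u (mid (y + z) k) > 0" by (simp add: zero_less_mult_iff)
        then have "sqrt 2 * side_val p u (mid (y + z) k) \<le> 1.5 * side_val p u (mid (y + z) k)"
          using \<open>sqrt 2 < 1.5\<close> by (intro mult_right_mono) auto
        then show ?thesis using 1 by linarith
      qed
      have "\<bar>Im (cnj (emb u) * (x - mid (y + z) k))\<bar> \<le> cmod (cnj (emb u) * (x - mid (y + z) k))" by (rule abs_Im_le_cmod)
      also have "\<dots> = cmod (x - mid (y + z) k)" using emb_dir[OF boundary_dirs[OF assms e]] by (simp add: norm_mult)
      also have "\<dots> < 1/10" using x by (simp add: dist_norm norm_minus_commute)
      finally have "\<bar>Im (cnj (emb u) * (x - mid (y + z) k))\<bar> < 1/10" .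
      moreover have "side_val p u x = side_val p u (mid (y + z) k) + Im (cnj (emb u) * (x - mid (y + z) k))"
        by (simp add: side_val_def algebra_simps)
      ultimately show ?thesis using 2 by linarith
    qed
    then show "x \<in> region c" by (auto simp: region_def)
  qed
  then show ?thesis by blast
qed

definition disc_area :: real where "disc_area = measure lborel (ball (0::complex) 1)"

lemma disc_area_pos: "disc_area > 0"
  unfolding disc_area_def by (rule content_ball_pos) simp

lemma area_ball: "r \<ge> 0 \<Longrightarrow> measure lborel (ball (x::complex) r) = r\<^sup>2 * disc_area"
  "r \<ge> 0 \<Longrightarrow> measure lborel (cball (x::complex) r) = r\<^sup>2 * disc_area"
  using content_ball_conv_unit_ball[of r x] content_cball_conv_ball[of x r]
  by (simp_all add: disc_area_def)

section \<open>Windows and the frequency of vertices of each level\<close>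

lemma iterate_member: "x \<in> (inflate ^^ m) A \<Longrightarrow> \<exists>a\<in>A. x \<in> (inflate ^^ m) {a}"
proof (induction m arbitrary: x)
  case (Suc m)
  then obtain y where y: "y \<in> (inflate ^^ m) A" "x \<in> set (inflate_cell y)"
    unfolding funpow.simps comp_def inflate_def[of "(inflate ^^ m) A"] by blast
  then obtain a where "a \<in> A" "y \<in> (inflate ^^ m) {a}" using Suc.IH by blast
  moreover from this have "x \<in> inflate ((inflate ^^ m) {a})" using y(2) by (auto simp only: inflate_def)
  ultimately show ?case by auto
qed simp

text \<open>
  The region of the supertile of level \<open>j\<close> that \<open>c\<close> expands to.
\<close>

definition scaled :: "nat \<Rightarrow> cell \<Rightarrow> complex set" where "scaled j c = (*\<^sub>R) (silver ^ j) ` region c"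

lemma scaled_0: "scaled 0 c = region c" by (simp add: scaled_def)

lemma scaled_iterate: "tile_cell a \<Longrightarrow> c \<in> (inflate ^^ m) {a} \<Longrightarrow> scaled j c \<subseteq> scaled (j + m) a"
proof -
  assume "tile_cell a" "c \<in> (inflate ^^ m) {a}"
  then have "(*\<^sub>R) (silver ^ j) ` region c \<subseteq> (*\<^sub>R) (silver ^ j) ` (*\<^sub>R) (silver ^ m) ` region a"
    by (intro image_mono region_iterate)
  then show ?thesis by (simp add: scaled_def image_image power_add)
qed

lemma scaled_diameter:
  assumes "tile_cell c" "z \<in> scaled j c" "w \<in> scaled j c"
  shows "dist z w \<le> 4 * silver ^ j"
proof -
  obtain z' w' where "z' \<in> region c" "w' \<in> region c" "z = silver ^ j *\<^sub>R z'" "w = silver ^ j *\<^sub>R w'"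
    using assms by (auto simp: scaled_def)
  moreover from this have "dist z' w' \<le> 4" using region_diameter[OF assms(1)] by blast
  moreover have "dist (silver ^ j *\<^sub>R z') (silver ^ j *\<^sub>R w') = silver ^ j * dist z' w'"
    using silver_pow_ge[of j] by (simp add: dist_norm flip: scaleR_diff_right)
  ultimately show ?thesis using silver_pow_ge(2)[of j] by simp
qed

lemma scaled_contains_ball:
  assumes "tile_cell c" shows "\<exists>x. ball x (1/10) \<subseteq> scaled j c"
proof -
  obtain x where x: "ball x (1/10) \<subseteq> region c" using region_contains_ball[OF assms] by blast
  have "ball (silver ^ j *\<^sub>R x) (1/10) \<subseteq> scaled j c"
  proof
    fix z assume z: "z \<in> ball (silver ^ j *\<^sub>R x) (1/10)"
    define w where "w = z /\<^sub>R silver ^ j"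
    have zw: "z = silver ^ j *\<^sub>R w" by (simp add: w_def)
    have "silver ^ j * dist x w < 1/10"
      using z silver_pow_ge[of j] by (simp add: zw dist_norm flip: scaleR_diff_right)
    then have "dist x w < 1/10" using silver_pow_ge(1)[of j]
      by (smt (verit) mult_le_cancel_right1 zero_le_dist)
    then show "z \<in> scaled j c" using x zw by (auto simp: scaled_def)
  qed
  then show ?thesis by blast
qed

lemma interior_scaled: "interior (scaled j c) = (*\<^sub>R) (silver ^ j) ` interior (region c)"
  unfolding scaled_def using silver_pow_ge(2)[of j]
  by (intro interior_injective_linear_image) (auto intro!: linear_cmul simp: inj_on_def linear_scale_self)

lemma flag_in_region: "tile_cell c \<Longrightarrow> (y, k) \<in> set (flags c) \<Longrightarrow> emb y \<in> region c"
  using sector_in_region[of c y k 0 0] by simp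

lemma flag_total:
  assumes "packed A"
  shows "card (\<Union>c\<in>A. set (flags c)) = (\<Sum>c\<in>A. length (flags c))"
proof -
  have "card (\<Union>c\<in>A. set (flags c)) = (\<Sum>c\<in>A. card (set (flags c)))"
    using assms packed_flag_unique[OF assms] by (intro card_UN_disjoint) (auto simp: packed_def)
  also have "\<dots> = (\<Sum>c\<in>A. length (flags c))"
    using assms distinct_flags by (intro sum.cong) (auto simp: packed_def distinct_card)
  finally show ?thesis .
qed

text \<open>
  A disc inside the supertile of level \<open>N\<close> grown from the cell \<open>s\<close>.
\<close>

locale window =
  fixes s :: cell and N :: nat and \<beta> :: complex and R :: real
  assumes s: "tile_cell s" and cover: "cball \<beta> R \<subseteq> (\<Union>c\<in>(inflate ^^ N) {s}. region c)" and R: "R > 0"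
begin

text \<open>
  \<open>Y j\<close> are the supertiles of level \<open>j\<close> in the coordinates before their \<open>j\<close>-fold expansion; \<open>Y 0\<close> are the tiles themselves.
\<close>

definition Y :: "nat \<Rightarrow> cell set" where "Y j = (inflate ^^ (N - j)) {s}"

lemma packed_Y: "packed (Y j)"
  unfolding Y_def by (intro packed_iterate packed_singleton s)

lemma tile_cell_Y: "c \<in> Y j \<Longrightarrow> tile_cell c"
  using packed_Y by (auto simp: packed_def)

lemma finite_Y: "finite (Y j)"
  using packed_Y by (auto simp: packed_def)

lemma Y_add: "j + m \<le> N \<Longrightarrow> Y j = (inflate ^^ m) (Y (j + m))"
proof -
  assume "j + m \<le> N"
  then have "N - j = m + (N - (j + m))" by simp
  then show ?thesis unfolding Y_def by (simp add: funpow_add)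
qed

lemma cover_level: assumes "z \<in> cball \<beta> R" "j \<le> N" shows "\<exists>c\<in>Y j. z \<in> scaled j c"
proof -
  obtain c where c: "c \<in> Y 0" "z \<in> region c" using cover assms(1) by (auto simp: Y_def)
  then obtain a where a: "a \<in> Y j" "c \<in> (inflate ^^ j) {a}" using Y_add[of 0 j] assms(2) iterate_member by fastforce
  then show ?thesis using scaled_iterate[OF tile_cell_Y[OF a(1)] a(2), of 0] c(2) by (auto simp: scaled_0)
qed

text \<open>
  The disc fits into the supertile, whose diameter is at most \<open>4 * silver ^ N\<close>.
\<close>

lemma level_large: "R \<le> 2 * silver ^ N"
proof -
  have "Y N = {s}" by (simp add: Y_def)
  then have in_s: "z \<in> scaled N s" if "z \<in> cball \<beta> R" for z using cover_level[OF that, of N] by auto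
  have "dist (\<beta> + of_real R) (\<beta> - of_real R) \<le> 4 * silver ^ N"
    using R by (intro scaled_diameter[OF s] in_s) (auto simp: dist_norm)
  then show ?thesis using R by (simp add: dist_norm)
qed

definition verts :: "nat \<Rightarrow> real \<Rightarrow> pt set" where
  "verts j r = {x. \<exists>y k. \<exists>c\<in>Y j. (y, k) \<in> set (flags c) \<and> x = (sil ^^ j) y \<and> cmod (emb x - \<beta>) \<le> r}"

lemma finite_verts: "finite (verts j r)"
proof -
  have "verts j r \<subseteq> (\<lambda>f. (sil ^^ j) (fst f)) ` (\<Union>c\<in>Y j. set (flags c))"
    by (auto simp: verts_def image_iff) (metis fst_conv)
  then show ?thesis by (rule finite_subset) (simp add: finite_Y)
qed

lemma verts_star:
  assumes "x \<in> verts j r" "r < R" "j \<le> N"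
  shows "\<exists>y. x = (sil ^^ j) y \<and> star (Y j) y"
proof -
  obtain y k c where y: "c \<in> Y j" "(y, k) \<in> set (flags c)" "x = (sil ^^ j) y" "cmod (emb x - \<beta>) \<le> r"
    using assms(1) by (auto simp: verts_def)
  have sp: "silver ^ j > 0" by (rule silver_pow_ge)
  have "cball \<beta> R \<subseteq> scaled N s" using cover_level[of _ N] by (auto simp: Y_def)
  also have "\<dots> = (*\<^sub>R) (silver ^ j) ` (*\<^sub>R) (silver ^ (N - j)) ` region s"
    using assms(3) by (simp add: scaled_def image_image flip: power_add)
  finally have "interior (cball \<beta> R) \<subseteq> interior ((*\<^sub>R) (silver ^ j) ` (*\<^sub>R) (silver ^ (N - j)) ` region s)"
    by (rule interior_mono)
  also have "\<dots> = (*\<^sub>R) (silver ^ j) ` interior ((*\<^sub>R) (silver ^ (N - j)) ` region s)"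
    using sp by (intro interior_injective_linear_image) (auto intro!: linear_cmul simp: inj_on_def linear_scale_self)
  finally have "emb x \<in> (*\<^sub>R) (silver ^ j) ` interior ((*\<^sub>R) (silver ^ (N - j)) ` region s)"
    using y(4) assms(2) by (auto simp: dist_norm norm_minus_commute)
  then have "emb y \<in> interior ((*\<^sub>R) (silver ^ (N - j)) ` region s)"
    using sp by (auto simp: y(3) emb_sil_pow)
  then have "star (Y j) y"
    using interior_vertex_star[OF s _ y(2)] y(1) by (simp add: Y_def)
  then show ?thesis using y(3) by blast
qed

definition inner :: "nat \<Rightarrow> real \<Rightarrow> cell set" where "inner i r = {c \<in> Y i. scaled i c \<subseteq> cball \<beta> r}"

definition meeting :: "nat \<Rightarrow> real \<Rightarrow> cell set" where "meeting i r = {c \<in> Y i. scaled i c \<inter> cball \<beta> r \<noteq> {}}"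

lemma finite_inner: "finite (inner i r)" "finite (meeting i r)"
  using finite_Y by (auto simp: inner_def meeting_def)

lemma sil_pow_inj: "(sil ^^ j) y = (sil ^^ j) y' \<longleftrightarrow> y = y'"
proof -
  have "emb ((sil ^^ j) y) = emb ((sil ^^ j) y') \<longleftrightarrow> emb y = emb y'"
    using silver_pow_ge(2)[of j] by (simp add: emb_sil_pow)
  then show ?thesis by (simp add: emb_inj)
qed

lemma card_dirs: "card (set dirs) = 8"
  by code_simp

text \<open>
  Each vertex of level \<open>j\<close> carries at most eight flags of cells of \<open>Y j\<close>, and the flags of pieces of the inner
  supertiles belong to vertices in the disc.
\<close>

lemma verts_lower:
  assumes "j + m \<le> N"
  shows "(\<Sum>c\<in>inner (j + m) r. flag_number m c) \<le> 8 * card (verts j r)"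
proof -
  define F where "F = (inflate ^^ m) (inner (j + m) r)"
  have pG: "packed (inner (j + m) r)" by (rule packed_subset[OF packed_Y]) (auto simp: inner_def)
  have FY: "F \<subseteq> Y j" unfolding F_def Y_add[OF assms] by (rule inflate_iterate_mono) (auto simp: inner_def)
  have "(\<Sum>c\<in>inner (j + m) r. flag_number m c) = (\<Sum>c\<in>F. length (flags c))"
    using flag_count_iterate[OF pG] by (simp add: F_def)
  also have "\<dots> = card (\<Union>c\<in>F. set (flags c))"
    by (rule flag_total[symmetric]) (rule packed_subset[OF packed_Y FY])
  also have "\<dots> = card ((\<lambda>(y, k). ((sil ^^ j) y, k)) ` (\<Union>c\<in>F. set (flags c)))"
  proof (rule card_image[symmetric], rule inj_onI)
    fix f g :: "pt \<times> pt"
    assume "(\<lambda>(y, k). ((sil ^^ j) y, k)) f = (\<lambda>(y, k). ((sil ^^ j) y, k)) g"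
    then show "f = g" by (cases f; cases g) (simp only: prod.case prod.inject sil_pow_inj)
  qed
  also have "\<dots> \<le> card (verts j r \<times> set dirs)"
  proof (rule card_mono)
    show "(\<lambda>(y, k). ((sil ^^ j) y, k)) ` (\<Union>c\<in>F. set (flags c)) \<subseteq> verts j r \<times> set dirs"
    proof
      fix f assume "f \<in> (\<lambda>(y, k). ((sil ^^ j) y, k)) ` (\<Union>c\<in>F. set (flags c))"
      then obtain f0 c where f0: "f = (\<lambda>(y, k). ((sil ^^ j) y, k)) f0" "c \<in> F" "f0 \<in> set (flags c)"
        by blast
      obtain y k where "f0 = (y, k)" by (rule prod.exhaust)
      with f0 have f: "f = ((sil ^^ j) y, k)" "c \<in> F" "(y, k) \<in> set (flags c)"
        by simp_all
      obtain a where a: "a \<in> inner (j + m) r" "c \<in> (inflate ^^ m) {a}" using f(2) iterate_member unfolding F_def by blast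
      have tc: "tile_cell c" using f(2) FY tile_cell_Y by blast
      have "emb ((sil ^^ j) y) \<in> scaled j c"
        using flag_in_region[OF tc f(3)] by (auto simp: scaled_def emb_sil_pow)
      also have "\<dots> \<subseteq> scaled (j + m) a"
        using a tile_cell_Y by (intro scaled_iterate) (auto simp: inner_def)
      also have "\<dots> \<subseteq> cball \<beta> r" using a by (auto simp: inner_def)
      finally have "cmod (emb ((sil ^^ j) y) - \<beta>) \<le> r" by (simp add: dist_norm norm_minus_commute)
      then have "(sil ^^ j) y \<in> verts j r" unfolding verts_def mem_Collect_eq
        using f FY by (intro exI[of _ y] exI[of _ k] bexI[of _ c]) auto
      then show "f \<in> verts j r \<times> set dirs" using f(1) flags_dirs[OF tc f(3)] by simp
    qed
  qed (simp add: finite_verts)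
  also have "\<dots> = 8 * card (verts j r)" by (simp add: card_cartesian_product card_dirs)
  finally show ?thesis .
qed

lemma flags_upper:
  assumes "i \<le> N"
  shows "(\<Sum>c\<in>meeting 0 r. length (flags c)) \<le> (\<Sum>c\<in>meeting i r. flag_number i c)"
proof -
  have p: "packed (meeting i r)" by (rule packed_subset[OF packed_Y]) (auto simp: meeting_def)
  have "meeting 0 r \<subseteq> (inflate ^^ i) (meeting i r)"
  proof
    fix c assume c: "c \<in> meeting 0 r"
    then have "c \<in> (inflate ^^ i) (Y i)" using Y_add[of 0 i] assms by (auto simp: meeting_def)
    then obtain a where a: "a \<in> Y i" "c \<in> (inflate ^^ i) {a}" using iterate_member by blast
    have "scaled 0 c \<subseteq> scaled i a" using scaled_iterate[OF tile_cell_Y[OF a(1)] a(2), of 0] by simp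
    then have "a \<in> meeting i r" using c a by (auto simp: meeting_def)
    then show "c \<in> (inflate ^^ i) (meeting i r)" using a inflate_iterate_mono[of "{a}" "meeting i r" i] by blast
  qed
  then have "(\<Sum>c\<in>meeting 0 r. length (flags c)) \<le> (\<Sum>c\<in>(inflate ^^ i) (meeting i r). length (flags c))"
    using packed_iterate[OF p, of i] by (intro sum_mono2) (auto simp: packed_def)
  then show ?thesis using flag_count_iterate[OF p] by simp
qed

text \<open>
  Supertiles that meet the large disc but are not inside the small one contain disjoint discs of radius 1/10 in an annulus;
  compare areas.
\<close>

lemma annulus_count:
  assumes r: "4 * silver ^ i \<le> r" "r \<le> r'"
  shows "card (meeting i r' - inner i r) \<le> 100 * ((r' + 4 * silver ^ i)\<^sup>2 - (r - 4 * silver ^ i)\<^sup>2)"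
proof -
  define D where "D = 4 * silver ^ i"
  have D: "D > 0" using silver_pow_ge(2)[of i] by (simp add: D_def)
  define B where "B = meeting i r' - inner i r"
  have fB: "finite B" using finite_inner by (simp add: B_def)
  have tB: "c \<in> B \<Longrightarrow> tile_cell c" for c using tile_cell_Y by (auto simp: B_def meeting_def)
  define x where "x = (\<lambda>c. SOME x. ball x (1/10) \<subseteq> scaled i c)"
  have x: "ball (x c) (1/10) \<subseteq> scaled i c" if "c \<in> B" for c
    unfolding x_def using scaled_contains_ball[OF tB[OF that]] by (rule someI_ex)
  have int: "ball (x c) (1/10) \<subseteq> interior (scaled i c)" if "c \<in> B" for c
    using x[OF that] by (intro interior_maximal) auto
  have disj: "disjoint_family_on (\<lambda>c. ball (x c) (1/10)) B"
    unfolding disjoint_family_on_def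
  proof (intro ballI impI)
    fix c c' assume c: "c \<in> B" "c' \<in> B" "c \<noteq> c'"
    have "interior (region c) \<inter> interior (region c') = {}"
      using packed_Y[of i] c by (auto simp: packed_def B_def meeting_def)
    then have "interior (scaled i c) \<inter> interior (scaled i c') = {}"
      unfolding interior_scaled by auto
    then show "ball (x c) (1/10) \<inter> ball (x c') (1/10) = {}" using int c by blast
  qed
  have inflate: "(\<Union>c\<in>B. ball (x c) (1/10)) \<subseteq> cball \<beta> (r' + D) - ball \<beta> (r - D)"
  proof
    fix z assume "z \<in> (\<Union>c\<in>B. ball (x c) (1/10))"
    then obtain c where c: "c \<in> B" "z \<in> scaled i c" using x by blast
    obtain w where w: "w \<in> scaled i c" "dist \<beta> w \<le> r'" using c by (auto simp: B_def meeting_def)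
    obtain v where v: "v \<in> scaled i c" "dist \<beta> v > r" using c by (auto simp: B_def meeting_def inner_def not_le)
    have "dist z w \<le> D" "dist z v \<le> D" using scaled_diameter[OF tB[OF c(1)]] c w v by (auto simp: D_def)
    then show "z \<in> cball \<beta> (r' + D) - ball \<beta> (r - D)"
      using w(2) v(2) dist_triangle[of \<beta> z w] dist_triangle[of \<beta> v z] by (auto simp: dist_commute)
  qed
  have "card B * (1/100 * disc_area) = (\<Sum>c\<in>B. measure lborel (ball (x c) (1/10)))"
    by (simp add: area_ball power2_eq_square)
  also have "\<dots> = measure lborel (\<Union>c\<in>B. ball (x c) (1/10))"
    using fB disj emeasure_lborel_ball_finite
    by (intro measure_finite_Union[symmetric]) (auto simp: less_top[symmetric] simp del: mem_ball)
  also have "\<dots> \<le> measure lborel (cball \<beta> (r' + D) - ball \<beta> (r - D))"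
  proof (rule measure_mono_fmeasurable[OF inflate])
    show "(\<Union>c\<in>B. ball (x c) (1/10)) \<in> sets lborel" using fB by (simp add: sets.finite_UN)
    show "cball \<beta> (r' + D) - ball \<beta> (r - D) \<in> fmeasurable lborel"
      by (intro fmeasurable_Diff) (auto simp: fmeasurable_def emeasure_lborel_cball_finite[unfolded infinity_ennreal_def])
  qed
  also have "\<dots> = measure lborel (cball \<beta> (r' + D)) - measure lborel (ball \<beta> (r - D))"
  proof (rule measure_Diff)
    show "emeasure lborel (cball \<beta> (r' + D)) \<noteq> \<infinity>" using emeasure_lborel_cball_finite[of \<beta> "r' + D"] by simp
    show "ball \<beta> (r - D) \<subseteq> cball \<beta> (r' + D)" using r D by auto
  qed auto
  also have "\<dots> = ((r' + D)\<^sup>2 - (r - D)\<^sup>2) * disc_area"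
    using r D by (simp add: area_ball D_def algebra_simps)
  finally have "(card B * (1/100)) * disc_area \<le> ((r' + D)\<^sup>2 - (r - D)\<^sup>2) * disc_area" by (simp add: mult.assoc)
  then have "card B * (1/100) \<le> (r' + D)\<^sup>2 - (r - D)\<^sup>2" using disc_area_pos by simp
  then show ?thesis by (simp add: B_def D_def)
qed

lemma meeting_lower:
  shows "R\<^sup>2 \<le> 16 * card (meeting 0 R)"
proof -
  have "cball \<beta> R \<subseteq> (\<Union>c\<in>meeting 0 R. cball (SOME x. x \<in> region c) 4)"
  proof
    fix z assume z: "z \<in> cball \<beta> R"
    then obtain c where c: "c \<in> Y 0" "z \<in> region c" using cover_level[of z 0] by (auto simp: scaled_0)
    then have "(SOME x. x \<in> region c) \<in> region c" by (intro someI)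
    then have "dist (SOME x. x \<in> region c) z \<le> 4" using region_diameter[OF tile_cell_Y[OF c(1)]] c by blast
    then show "z \<in> (\<Union>c\<in>meeting 0 R. cball (SOME x. x \<in> region c) 4)" using c z by (auto simp: meeting_def scaled_0 intro!: exI[of _ c])
  qed
  then have "measure lborel (cball \<beta> R) \<le> measure lborel (\<Union>c\<in>meeting 0 R. cball (SOME x. x \<in> region c) 4)"
  proof (rule measure_mono_fmeasurable)
    show "(\<Union>c\<in>meeting 0 R. cball (SOME x. x \<in> region c) 4) \<in> fmeasurable lborel"
      by (intro fmeasurable.finite_UN finite_inner fmeasurableI) (auto simp: emeasure_lborel_cball_finite[unfolded infinity_ennreal_def])
  qed simp
  also have "\<dots> \<le> (\<Sum>c\<in>meeting 0 R. measure lborel (cball (SOME x. x \<in> region c) 4))"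
    by (rule measure_UNION_le) (auto simp: finite_inner)
  also have "\<dots> = (16 * card (meeting 0 R)) * disc_area" by (simp add: area_ball)
  finally have "R\<^sup>2 * disc_area \<le> (16 * card (meeting 0 R)) * disc_area" using R by (simp add: area_ball)
  then show ?thesis using disc_area_pos by simp
qed

lemma flags_lower: "R\<^sup>2 \<le> 16 * (\<Sum>c\<in>meeting 0 R. length (flags c))"
proof -
  have "card (meeting 0 R) \<le> (\<Sum>c\<in>meeting 0 R. length (flags c))"
    using sum_mono[of "meeting 0 R" "\<lambda>_. 1" "\<lambda>c. length (flags c)"] flags_nonempty by (simp add: Suc_leI)
  then have "real (16 * card (meeting 0 R)) \<le> real (16 * (\<Sum>c\<in>meeting 0 R. length (flags c)))"
    by (intro of_nat_mono mult_left_mono) auto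
  then show ?thesis using meeting_lower by linarith
qed

end

text \<open>
  Let \<open>i = j + m\<close>. Up to the supertiles of level \<open>i\<close> along the boundary circle, whose number is linear in \<open>R\<close>, the flags of
  \<open>Y 0\<close> and of \<open>Y j\<close> in the disc are those of the \<open>i\<close>-fold and the \<open>m\<close>-fold substituted cells of level \<open>i\<close>. Their ratio is \<open>silver ^ (2 * j)\<close>
  nearly, and the total number of flags is quadratic in \<open>R\<close>.
\<close>

lemma vertex_frequency:
  assumes "\<epsilon> > 0"
  shows "\<exists>R0. \<forall>s N \<beta> R. window s N \<beta> R \<longrightarrow> R0 \<le> R \<longrightarrow>
    (1 / silver ^ (2 * j) - \<epsilon>) * (\<Sum>c\<in>window.meeting s N \<beta> 0 R. length (flags c)) \<le> 8 * card (window.verts s N \<beta> j (R - 300))"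
proof -
  obtain m where m: "1 / silver ^ (2 * m) < \<epsilon> / 2"
  proof -
    have "1 / silver\<^sup>2 < 1" using silver_gt by (simp add: power2_eq_square divide_less_eq_1 less_1_mult)
    then have "\<exists>m. (1 / silver\<^sup>2) ^ m < \<epsilon> / 2" using assms silver_gt by (intro real_arch_pow_inv) auto
    then show ?thesis using that by (auto simp: power_mult power_one_over)
  qed
  define i where "i = j + m"
  define D where "D = 4 * silver ^ i"
  have D: "D \<ge> 4" using silver_pow_ge(1)[of i] by (simp add: D_def)
  define K where "K = 8 * silver ^ (2 * i + 1)"
  have K: "K > 0" using silver_pow_ge(2)[of "2 * i + 1"] by (simp add: K_def)
  \<comment> \<open>\<open>L * R\<close> bounds the flags in the supertiles of level \<open>i\<close> along the boundary circle.\<close>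
  define L where "L = K * (100 * (2 * (D + 150) * 2))"
  have L: "L > 0" using K D by (simp add: L_def)
  define R0 where "R0 = max (300 + D) (32 * L / \<epsilon>)"
  show ?thesis
  proof (intro exI[of _ R0] allI impI)
    fix s N \<beta> R assume w: "window s N \<beta> R" and RR: "R0 \<le> R"
    interpret window s N \<beta> R by (rule w)
    define F where "F = real (\<Sum>c\<in>meeting 0 R. length (flags c))"
    define q where "q = 1 / silver ^ (2 * j)"
    define e where "e = 1 / silver ^ (2 * m)"
    have q: "0 < q" "q \<le> 1" using silver_pow_ge[of "2 * j"] by (simp_all add: q_def)
    have e: "0 < e" "e \<le> 1" "e < \<epsilon> / 2" using silver_pow_ge[of "2 * m"] m by (simp_all add: e_def)
    have RD: "300 + D \<le> R" using RR by (simp add: R0_def)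
    have "i \<le> N"
    proof (rule ccontr)
      assume "\<not> i \<le> N"
      then have "silver ^ N \<le> silver ^ i" using silver_gt by (intro power_increasing) auto
      then show False using level_large RD D by (simp add: D_def)
    qed
    have FR: "R\<^sup>2 \<le> 16 * F" using flags_lower by (simp add: F_def)
    define G where "G = inner i (R - 300)"
    define G' where "G' = meeting i R"
    have fin: "finite G" "finite G'" using finite_inner by (auto simp: G_def G'_def)
    have t: "c \<in> G \<union> G' \<Longrightarrow> tile_cell c" for c using tile_cell_Y by (auto simp: G_def G'_def inner_def meeting_def)
    have "F \<le> real (\<Sum>c\<in>G'. flag_number i c)" unfolding F_def G'_def using flags_upper[OF \<open>i \<le> N\<close>] by (simp del: of_nat_sum)
    also have "\<dots> \<le> real (\<Sum>c\<in>G \<union> (G' - G). flag_number i c)"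
      using fin by (intro of_nat_mono sum_mono2) auto
    also have "\<dots> = (\<Sum>c\<in>G. real (flag_number i c)) + (\<Sum>c\<in>G' - G. real (flag_number i c))"
      using fin by (subst sum.union_disjoint) auto
    also have "(\<Sum>c\<in>G' - G. real (flag_number i c)) \<le> (\<Sum>c\<in>G' - G. K)"
      using flag_number_bound t unfolding K_def by (intro sum_mono) auto
    also have "\<dots> = K * card (G' - G)" by simp
    also have "\<dots> \<le> K * (100 * ((R + D)\<^sup>2 - (R - 300 - D)\<^sup>2))"
      using annulus_count[of i "R - 300" R] RD K unfolding G_def G'_def D_def by (intro mult_left_mono) auto
    also have "(R + D)\<^sup>2 - (R - 300 - D)\<^sup>2 = (2 * R - 300) * (2 * (D + 150))"
      by (simp add: power2_eq_square algebra_simps)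
    also have "K * (100 * ((2 * R - 300) * (2 * (D + 150)))) \<le> K * (100 * ((2 * R) * (2 * (D + 150))))"
      using K D by (intro mult_left_mono mult_right_mono) auto
    also have "\<dots> = L * R" by (simp add: L_def mult_ac)
    finally have up: "F - L * R \<le> (\<Sum>c\<in>G. real (flag_number i c))" by simp
    have "(1 - e) * (F - L * R) \<le> (1 - e) * (\<Sum>c\<in>G. real (flag_number i c))"
      using up e by (intro mult_left_mono) auto
    also have "\<dots> = (\<Sum>c\<in>G. (1 - e) * flag_number (j + m) c)" by (simp add: sum_distrib_left i_def)
    also have "\<dots> \<le> (\<Sum>c\<in>G. silver ^ (2 * j) * flag_number m c)"
      using flag_number_ratio t unfolding e_def by (intro sum_mono) auto
    also have "\<dots> = silver ^ (2 * j) * real (\<Sum>c\<in>G. flag_number m c)" by (simp add: sum_distrib_left)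
    also have "\<dots> \<le> silver ^ (2 * j) * real (8 * card (verts j (R - 300)))"
      using verts_lower[of j m "R - 300"] \<open>i \<le> N\<close> silver_pow_ge(2)[of "2 * j"] unfolding G_def i_def
      by (intro mult_left_mono of_nat_mono) auto
    finally have "q * ((1 - e) * (F - L * R)) \<le> q * (silver ^ (2 * j) * real (8 * card (verts j (R - 300))))"
      using q by (intro mult_left_mono) auto
    also have "\<dots> = 8 * card (verts j (R - 300))" using silver_pow_ge(2)[of "2 * j"] by (simp add: q_def)
    finally have low: "q * ((1 - e) * (F - L * R)) \<le> 8 * card (verts j (R - 300))" .
    have F0: "0 \<le> F" unfolding F_def by (rule of_nat_0_le_iff)
    have LR: "L * R \<le> (\<epsilon> / 2) * F"
    proof -
      have "32 * L / \<epsilon> \<le> R" using RR by (simp add: R0_def)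
      then have "32 * L \<le> \<epsilon> * R" using assms by (simp add: divide_le_eq mult.commute)
      then have "32 * L * R \<le> \<epsilon> * R * R" using R by (intro mult_right_mono) auto
      also have "\<dots> = \<epsilon> * R\<^sup>2" by (simp add: power2_eq_square)
      also have "\<dots> \<le> \<epsilon> * (16 * F)" using FR assms by (intro mult_left_mono) auto
      finally show ?thesis by (simp add: mult_ac)
    qed
    have "(q - \<epsilon>) * F \<le> q * ((1 - e) * (F - L * R))"
    proof -
      have "q * (e * F) \<le> 1 * ((\<epsilon> / 2) * F)" using q e F0 by (intro mult_mono mult_right_mono) auto
      moreover have "q * ((1 - e) * (L * R)) \<le> 1 * (1 * (L * R))"
        using q e L R by (intro mult_mono) auto
      ultimately have "q * (e * F) + q * ((1 - e) * (L * R)) \<le> \<epsilon> * F" using LR by linarith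
      then show ?thesis by (simp add: algebra_simps)
    qed
    then show "(1 / silver ^ (2 * j) - \<epsilon>) * real (\<Sum>c\<in>meeting 0 R. length (flags c)) \<le> real (8 * card (verts j (R - 300)))"
      using low by (simp add: F_def q_def)
  qed
qed

section \<open>Rotations and sides of cells\<close>

lemma rh_flip: "u \<in> set dirs \<Longrightarrow> rh (p + u + rot u) (- u) = rh p u"
  by (auto simp: rh_def upper_uminus rot_add(2))

lemma sqr_turn: "u \<in> set dirs \<Longrightarrow> sqr (p + u) (rot (rot u)) = sqr p u"
  unfolding dirs_induct by (cases p; elim insertE emptyE; simp add: sqr_def Let_def)

lemma rot_cell_rh: "u \<in> set dirs \<Longrightarrow> rot_cell (rh p u) = rh (rot p) (rot u)"
  using rh_flip[of "rot u" "rot p"] by (auto simp: rh_def[of p u] rot_add dirs_rot simp del: rot.simps)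

lemma rot_cell_sqr: "u \<in> set dirs \<Longrightarrow> rot_cell (sqr p u) = sqr (rot p) (rot u)"
  unfolding dirs_induct by (elim insertE emptyE) (simp_all add: sqr_def Let_def, (cases p; simp)+)

lemma rot_pow_add: "(rot ^^ j) (p + q) = (rot ^^ j) p + (rot ^^ j) q" "(rot ^^ j) (- p) = - (rot ^^ j) p"
  by (induction j) (simp_all add: rot_add del: rot.simps)

lemma rot_pow_8: "(rot ^^ 8) p = p"
proof -
  have "(8::nat) = Suc (Suc (Suc (Suc (Suc (Suc (Suc (Suc 0)))))))" by simp
  then have "(rot ^^ 8) p = rot (rot (rot (rot (rot (rot (rot (rot p)))))))" by (simp only: funpow.simps comp_def id_apply)
  then show ?thesis by (simp add: rot8 del: rot.simps)
qed

lemma rot_cell_shift_tile: "tile_cell c \<Longrightarrow> rot_cell (shift z c) = shift (rot z) (rot_cell c)"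
  by (cases c) (simp_all add: shift_rh rot_add tile_cell_iff del: rot.simps)

definition poly_cell :: "cell \<Rightarrow> bool" where
  "poly_cell c = (case c of Rh p u \<Rightarrow> u \<in> set dirs \<and> upper u | Sq p u \<Rightarrow> u \<in> set dirs \<and> upper u \<and> rightish u | Hs p u b \<Rightarrow> False)"

lemma poly_cell_simps [simp]: "poly_cell (Rh p u) \<longleftrightarrow> u \<in> set dirs \<and> upper u"
  "poly_cell (Sq p u) \<longleftrightarrow> u \<in> set dirs \<and> upper u \<and> rightish u" "\<not> poly_cell (Hs p u b)"
  by (simp_all add: poly_cell_def)

lemma poly_cell_rh: "u \<in> set dirs \<Longrightarrow> poly_cell (rh p u)"
  by (auto simp: rh_def upper_uminus dirs_rot)

lemma poly_cell_sqr: "u \<in> set dirs \<Longrightarrow> poly_cell (sqr p u)"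
  unfolding dirs_induct by (elim insertE emptyE) (simp_all add: sqr_def Let_def dirs_def)

lemma poly_cases:
  assumes "poly_cell c"
  obtains p u where "u \<in> set dirs" "c = rh p u" | p u where "u \<in> set dirs" "c = sqr p u"
proof (cases c)
  case (Rh p u)
  then show ?thesis using assms that(1)[of u p] by (simp add: rh_def)
next
  case (Sq p u)
  then show ?thesis using assms that(2)[of u p] by (simp add: sqr_def Let_def)
qed (use assms in simp)

lemma poly_cell_shift: "poly_cell (shift z c) = poly_cell c"
  by (cases c) simp_all

lemma rot_cell_pow_rh: "u \<in> set dirs \<Longrightarrow> (rot_cell ^^ j) (rh p u) = rh ((rot ^^ j) p) ((rot ^^ j) u) \<and> (rot ^^ j) u \<in> set dirs"
  by (induction j) (simp_all add: rot_cell_rh dirs_rot del: rot.simps)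

lemma rot_cell_pow_sqr: "u \<in> set dirs \<Longrightarrow> (rot_cell ^^ j) (sqr p u) = sqr ((rot ^^ j) p) ((rot ^^ j) u) \<and> (rot ^^ j) u \<in> set dirs"
  by (induction j) (simp_all add: rot_cell_sqr dirs_rot del: rot.simps)

lemma rot_cell_pow_8: "poly_cell c \<Longrightarrow> (rot_cell ^^ 8) c = c"
  by (erule poly_cases) (simp_all only: rot_cell_pow_rh rot_cell_pow_sqr rot_pow_8)

lemma rot_cell_pow_mod: "poly_cell c \<Longrightarrow> (rot_cell ^^ (j mod 8)) c = (rot_cell ^^ j) c"
proof -
  assume c: "poly_cell c"
  have "(rot_cell ^^ (8 * m)) c = c" for m
    by (induction m) (simp_all add: funpow_add rot_cell_pow_8[OF c])
  then have "(rot_cell ^^ (j mod 8 + 8 * (j div 8))) c = (rot_cell ^^ (j mod 8)) c" by (simp only: funpow_add comp_def)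
  then show ?thesis by simp
qed

definition raw_rh :: "pt \<Rightarrow> pt \<Rightarrow> (pt \<times> pt) set" where
  "raw_rh p u = {(p, u), (p + u, rot u), (p + u + rot u, - u), (p + rot u, - rot u)}"

definition raw_sq :: "pt \<Rightarrow> pt \<Rightarrow> (pt \<times> pt) set" where
  "raw_sq p u = {(p, u), (p + u, rot (rot u)), (p + u + rot (rot u), - u), (p + rot (rot u), - rot (rot u))}"

lemma sides_rh: "u \<in> set dirs \<Longrightarrow> set (sides (rh p u)) = raw_rh p u"
  by (auto simp: rh_def raw_rh_def Let_def rot_add simp del: rot.simps)

lemma sides_sqr: "u \<in> set dirs \<Longrightarrow> set (sides (sqr p u)) = raw_sq p u"
  unfolding dirs_induct
  by (elim insertE emptyE; simp add: sqr_def raw_sq_def Let_def; cases p; simp; blast)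

definition move_side :: "nat \<Rightarrow> pt \<Rightarrow> pt \<times> pt \<Rightarrow> pt \<times> pt" where
  "move_side j z x = ((rot ^^ j) (fst x) + z, (rot ^^ j) (snd x))"

lemma sides_move:
  assumes "poly_cell c"
  shows "set (sides (shift z ((rot_cell ^^ j) c))) = move_side j z ` set (sides c)"
proof -
  have comm: "(rot ^^ j) (rot u) = rot ((rot ^^ j) u)" for u by (simp add: funpow_swap1 del: rot.simps)
  have "set (sides ((rot_cell ^^ j) c)) = move_side j 0 ` set (sides c)"
    using assms
  proof (cases rule: poly_cases)
    case (1 p u)
    then have "set (sides ((rot_cell ^^ j) c)) = raw_rh ((rot ^^ j) p) ((rot ^^ j) u)"
      using rot_cell_pow_rh[OF 1(1)] by (simp add: sides_rh)
    also have "\<dots> = move_side j 0 ` raw_rh p u"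
      by (simp add: raw_rh_def move_side_def rot_pow_add comm del: rot.simps)
    finally show ?thesis using 1 by (simp add: sides_rh)
  next
    case (2 p u)
    then have "set (sides ((rot_cell ^^ j) c)) = raw_sq ((rot ^^ j) p) ((rot ^^ j) u)"
      using rot_cell_pow_sqr[OF 2(1)] by (simp add: sides_sqr)
    also have "\<dots> = move_side j 0 ` raw_sq p u"
      by (simp add: raw_sq_def move_side_def rot_pow_add comm del: rot.simps)
    finally show ?thesis using 2 by (simp add: sides_sqr)
  qed
  then show ?thesis by (simp add: sides_shift image_image move_side_def case_prod_unfold)
qed

lemma rev_side_eq: "rev_side x = (fst x + snd x, - snd x)"
  by (cases x) simp

lemma rev_move: "rev_side (move_side j z x) = move_side j z (rev_side x)"
  by (simp add: rev_side_eq move_side_def rot_pow_add add_ac del: rot.simps)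

lemma move_move: "move_side j z (move_side i 0 x) = move_side (j + i) z x"
  by (simp add: move_side_def funpow_add)

lemma rev_rev_side: "rev_side (rev_side x) = x"
  by (simp only: rev_side_eq fst_conv snd_conv add.inverse_inverse add.assoc right_minus add_0_right prod.collapse)

definition polyseeds :: "cell list" where
  "polyseeds = map (Rh 0) (filter upper dirs) @ map (Sq 0) (filter (\<lambda>u. upper u \<and> rightish u) dirs)"

lemma poly_cell_seed: "poly_cell c \<longleftrightarrow> (\<exists>z. \<exists>s\<in>set polyseeds. c = shift z s)"
proof
  assume "poly_cell c"
  then show "\<exists>z. \<exists>s\<in>set polyseeds. c = shift z s"
    by (cases c) (force simp: polyseeds_def)+
qed (auto simp: polyseeds_def poly_cell_shift)

lemma sides_shift_iff: "x \<in> set (sides (shift z c)) \<longleftrightarrow> (fst x - z, snd x) \<in> set (sides c)"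
  unfolding sides_shift set_map by (force simp: image_iff)

lemma side_flag: "poly_cell c \<Longrightarrow> set (sides c) \<subseteq> set (flags c)"
  by (cases c) (auto simp: Let_def simp del: rot.simps)

lemma sides_distinct: "poly_cell c \<Longrightarrow> distinct (sides c) \<and> length (sides c) = 4"
proof -
  have "\<forall>s\<in>set polyseeds. distinct (sides s) \<and> length (sides s) = 4" by code_simp
  then show "poly_cell c \<Longrightarrow> ?thesis"
    by (auto simp: poly_cell_seed sides_shift distinct_map inj_on_def)
qed

definition adj :: "cell \<Rightarrow> cell \<Rightarrow> bool" where
  "adj w v \<longleftrightarrow> (\<exists>x\<in>set (sides w). rev_side x \<in> set (sides v))"

lemma adj_sym: "adj w v \<Longrightarrow> adj v w"
  unfolding adj_def using rev_rev_side by metis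

text \<open>
  Aligning the common side \<open>x\<close> fixes the relative position of the two cells, which leaves finitely many pairs to inspect.
\<close>

lemma single_side:
  assumes "poly_cell w" "poly_cell v" "x \<in> set (sides w)" "x' \<in> set (sides w)"
    "rev_side x \<in> set (sides v)" "rev_side x' \<in> set (sides v)"
  shows "x = x'"
proof -
  have chk: "\<forall>s\<in>set polyseeds. \<forall>x\<in>set (sides s). \<forall>t\<in>set polyseeds. \<forall>y\<in>set (sides t).
     snd y = snd (rev_side x) \<longrightarrow> (\<forall>x'\<in>set (sides s). x' \<noteq> x \<longrightarrow> rev_side x' \<notin> set (sides (shift (fst (rev_side x) - fst y) t)))"
    by code_simp
  obtain a s where s: "s \<in> set polyseeds" "w = shift a s" using assms(1) poly_cell_seed by blast
  obtain b t where t: "t \<in> set polyseeds" "v = shift b t" using assms(2) poly_cell_seed by blast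
  define x0 x0' where "x0 = (fst x - a, snd x)" and "x0' = (fst x' - a, snd x')"
  have x0: "x0 \<in> set (sides s)" "x0' \<in> set (sides s)"
    using assms(3,4) by (simp_all only: s sides_shift_iff x0_def x0'_def)
  define y where "y = (fst (rev_side x) - b, snd (rev_side x))"
  have y: "y \<in> set (sides t)" using assms(5) by (simp only: t sides_shift_iff y_def)
  have r: "rev_side x0 = (fst (rev_side x) - a, snd (rev_side x))" "rev_side x0' = (fst (rev_side x') - a, snd (rev_side x'))"
    by (cases x; cases x'; simp add: x0_def x0'_def)+
  have "fst (rev_side x0) - fst y = b - a" by (simp add: r y_def)
  moreover have "rev_side x0' \<in> set (sides (shift (b - a) t))"
    using assms(6) by (simp add: t sides_shift_iff r)
  moreover have "snd y = snd (rev_side x0)" by (simp only: r y_def snd_conv)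
  ultimately have "x0' = x0" using chk[rule_format, OF s(1) x0(1) t(1) y _ x0(2)] by metis
  then show ?thesis by (simp add: x0_def x0'_def prod_eq_iff)
qed

section \<open>Local eigenfunctions\<close>

text \<open>
  The function recorded by \<open>L\<close> with sign \<open>e\<close>, placed at the vertex \<open>z\<close>. Summing over the eight rotations instead of looking up a cell
  avoids the question of which representative is listed, and a cell in a shorter orbit is counted with multiplicity.
\<close>

definition psi :: "int \<Rightarrow> entry list \<Rightarrow> pt \<Rightarrow> cell \<Rightarrow> int" where
  "psi e L z v = (\<Sum>i<length L. \<Sum>j<8. if shift z ((rot_cell ^^ j) (fst (L ! i))) = v then e ^ j * fst (snd (L ! i)) else 0)"

lemma bij_betw_shift_mod: "bij_betw (\<lambda>j. (s + j) mod 8) {..<8} {..<8::nat}"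
proof -
  have le: "a = b" if "a \<le> b" "b < 8" "(s + a) mod 8 = (s + b) mod 8" for a b :: nat
  proof -
    have "8 dvd (s + b) - (s + a)" using that by (subst mod_eq_dvd_iff_nat[symmetric]) auto
    then show ?thesis using that by (auto dest: dvd_imp_le)
  qed
  have "inj_on (\<lambda>j. (s + j) mod 8) {..<8::nat}"
  proof (rule inj_onI)
    fix a b :: nat assume "a \<in> {..<8}" "b \<in> {..<8}" "(s + a) mod 8 = (s + b) mod 8"
    then show "a = b" using le[of a b] le[of b a] by (cases "a \<le> b") auto
  qed
  then show ?thesis by (simp add: bij_betw_def endo_inj_surj image_subset_iff)
qed

text \<open>
  A set of cells, with at most one cell at each flag, that contains the support of the function and its listed neighbours.
\<close>

locale patch_in =
  fixes V :: "cell set" and L :: "entry list" and lam e :: int and z :: pt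
  assumes fin: "finite V" and poly: "\<And>c. c \<in> V \<Longrightarrow> poly_cell c"
    and uniq: "\<And>c c' f. c \<in> V \<Longrightarrow> c' \<in> V \<Longrightarrow> f \<in> set (flags c) \<Longrightarrow> f \<in> set (flags c') \<Longrightarrow> c = c'"
    and eig: "local_eigen lam e L" and e: "e * e = 1"
    and mem: "\<And>i j. i < length L \<Longrightarrow> shift z ((rot_cell ^^ j) (fst (L ! i))) \<in> V"
begin

abbreviation "ce i j \<equiv> shift z ((rot_cell ^^ j) (fst (L ! i)))"
abbreviation "va i \<equiv> fst (snd (L ! i))"
abbreviation "ns i \<equiv> snd (snd (L ! i))"
abbreviation "n \<equiv> length L"

lemma base_poly: "i < n \<Longrightarrow> poly_cell (fst (L ! i))"
  using poly[OF mem[of i 0]] by (simp add: poly_cell_shift)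

lemma ce_mod: "i < n \<Longrightarrow> ce i (j mod 8) = ce i j"
  by (simp add: rot_cell_pow_mod[OF base_poly])

lemma nsD:
  assumes "i < n" "va i \<noteq> 0" "a < 4"
  shows "length (ns i) = 4" "fst (ns i ! a) < n"
    "rev_side (sides (fst (L ! i)) ! a) \<in> set (sides ((rot_cell ^^ snd (ns i ! a)) (fst (L ! fst (ns i ! a)))))"
proof -
  have "L ! i \<in> set L" using assms by simp
  then have *: "length (ns i) = 4 \<and> (\<forall>(s, i', j) \<in> set (zip (sides (fst (L ! i))) (ns i)). i' < n \<and>
           rev_side s \<in> set (sides ((rot_cell ^^ j) (fst (L ! i')))))"
    using eig assms(2) unfolding local_eigen_def by (fastforce simp: case_prod_unfold)
  then show l: "length (ns i) = 4" by blast
  have "zip (sides (fst (L ! i))) (ns i) ! a \<in> set (zip (sides (fst (L ! i))) (ns i))"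
    using sides_distinct[OF base_poly[OF assms(1)]] l assms(3) by (intro nth_mem) simp
  then have "(sides (fst (L ! i)) ! a, ns i ! a) \<in> set (zip (sides (fst (L ! i))) (ns i))"
    using sides_distinct[OF base_poly[OF assms(1)]] l assms(3) by simp
  then show "fst (ns i ! a) < n"
    "rev_side (sides (fst (L ! i)) ! a) \<in> set (sides ((rot_cell ^^ snd (ns i ! a)) (fst (L ! fst (ns i ! a)))))"
    using * by (auto simp: case_prod_unfold)
qed

definition side_of :: "nat \<Rightarrow> nat \<Rightarrow> nat \<Rightarrow> pt \<times> pt" where
  "side_of i j a = move_side j z (sides (fst (L ! i)) ! a)"

definition nb :: "nat \<Rightarrow> nat \<Rightarrow> nat \<Rightarrow> cell" where
  "nb i j a = ce (fst (ns i ! a)) (snd (ns i ! a) + j)"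

lemma side_of_sides: "i < n \<Longrightarrow> set (sides (ce i j)) = side_of i j ` {..<4}"
proof -
  assume i: "i < n"
  have "set (sides (fst (L ! i))) = (\<lambda>a. sides (fst (L ! i)) ! a) ` {..<4}"
    using sides_distinct[OF base_poly[OF i]] by (auto simp: set_conv_nth image_iff)
  then show ?thesis unfolding sides_move[OF base_poly[OF i]] by (simp add: side_of_def image_image)
qed

lemma nb_side:
  assumes "i < n" "va i \<noteq> 0" "a < 4"
  shows "rev_side (side_of i j a) \<in> set (sides (nb i j a))" "nb i j a \<in> V"
proof -
  let ?c = "fst (L ! fst (ns i ! a))"
  have p: "poly_cell ?c" using base_poly nsD(2)[OF assms] by blast
  have "rev_side (sides (fst (L ! i)) ! a) \<in> move_side (snd (ns i ! a)) 0 ` set (sides ?c)"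
    using nsD(3)[OF assms] sides_move[OF p, of 0 "snd (ns i ! a)"] by (simp add: shift_0)
  then have "rev_side (side_of i j a) \<in> move_side j z ` move_side (snd (ns i ! a)) 0 ` set (sides ?c)"
    unfolding side_of_def rev_move by (rule imageI)
  also have "\<dots> = set (sides (nb i j a))"
    unfolding nb_def sides_move[OF p] by (simp add: image_image move_move add.commute)
  finally show "rev_side (side_of i j a) \<in> set (sides (nb i j a))" .
  show "nb i j a \<in> V" unfolding nb_def using mem nsD(2)[OF assms] by blast
qed

lemma has_side_iff:
  assumes "i < n" "va i \<noteq> 0" "a < 4" "v \<in> V"
  shows "rev_side (side_of i j a) \<in> set (sides v) \<longleftrightarrow> v = nb i j a"
proof
  assume "rev_side (side_of i j a) \<in> set (sides v)"
  then show "v = nb i j a"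
    using uniq[OF assms(4) nb_side(2)[OF assms(1-3)]] side_flag[OF poly[OF assms(4)]]
      side_flag[OF poly[OF nb_side(2)[OF assms(1-3)]]] nb_side(1)[OF assms(1-3)] by blast
qed (use nb_side[OF assms(1-3)] in blast)

lemma side_of_inj:
  assumes "i < n" "a < 4" "a' < 4" "side_of i j a = side_of i j a'"
  shows "a = a'"
proof -
  have "card (side_of i j ` {..<4}) = card (set (sides (ce i j)))" by (simp add: side_of_sides[OF assms(1)])
  also have "\<dots> = 4" using sides_distinct[OF poly[OF mem[OF assms(1)]], of j] by (simp add: distinct_card)
  finally have "inj_on (side_of i j) {..<4}" by (intro eq_card_imp_inj_on) auto
  then show ?thesis using assms by (auto dest: inj_onD)
qed

lemma adj_count:
  assumes "i < n" "va i \<noteq> 0" "v \<in> V"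
  shows "(\<Sum>a<4. if nb i j a = v then c else 0) = (if adj (ce i j) v then c else (0::int))"
proof -
  show ?thesis
  proof (cases "adj (ce i j) v")
    case True
    then obtain a where a: "a < 4" "rev_side (side_of i j a) \<in> set (sides v)"
      unfolding adj_def side_of_sides[OF assms(1)] by blast
    have "nb i j b = v \<longleftrightarrow> b = a" if "b < 4" for b
    proof
      assume "nb i j b = v"
      then have b: "rev_side (side_of i j b) \<in> set (sides v)" using has_side_iff[OF assms(1,2) that assms(3)] by blast
      have "side_of i j b = side_of i j a"
        by (rule single_side[OF poly[OF mem[OF assms(1)]] poly[OF assms(3)] _ _ b a(2)])
          (use side_of_sides[OF assms(1)] that a in auto)
      then show "b = a" by (rule side_of_inj[OF assms(1) that a(1)])
    qed (use has_side_iff[OF assms(1,2) a(1) assms(3)] a in auto)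
    then have "(\<Sum>b<4. if nb i j b = v then c else 0) = (\<Sum>b<4. if b = a then c else 0)" by (intro sum.cong) auto
    then show ?thesis using True a by simp
  next
    case False
    then have "nb i j a \<noteq> v" if "a < 4" for a
      using has_side_iff[OF assms(1,2) that assms(3)] side_of_sides[OF assms(1)] that unfolding adj_def by blast
    then show ?thesis using False by simp
  qed
qed

lemma e_pow: "e ^ (j mod 8) = e ^ j" "e ^ s * e ^ s = 1"
proof -
  have "e\<^sup>2 = 1" using e by (simp add: power2_eq_square)
  then have e8: "e ^ (8 * m) = 1" for m using power_mult[of e 2 "4 * m"] by simp
  have "e ^ j = e ^ (j mod 8 + 8 * (j div 8))" by simp
  also have "\<dots> = e ^ (j mod 8)" by (simp only: power_add e8 mult_1_right)
  finally show "e ^ (j mod 8) = e ^ j" by simp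
  show "e ^ s * e ^ s = 1" using e by (simp flip: power_mult_distrib)
qed

text \<open>
  The certificate lists neighbours from the side of the support. Collecting the entries that point at orbit \<open>i0\<close> gives the neighbour
  sum at that orbit.
\<close>

lemma incoming:
  assumes "i0 < n"
  shows "(\<Sum>i<n. \<Sum>a<4. if va i \<noteq> 0 \<and> fst (ns i ! a) = i0 then e ^ snd (ns i ! a) * va i else 0) = lam * va i0"
proof -
  have "(\<Sum>i<n. sum_list (map (\<lambda>(i', j). if i' = i0 then e ^ j * va i else 0) (ns i))) = lam * va i0"
    using eig assms unfolding local_eigen_def
    by (auto simp: sum_list_sum_nth case_prod_unfold atLeast0LessThan)
  moreover have "sum_list (map (\<lambda>(i', j). if i' = i0 then e ^ j * va i else 0) (ns i)) =
     (\<Sum>a<4. if va i \<noteq> 0 \<and> fst (ns i ! a) = i0 then e ^ snd (ns i ! a) * va i else 0)" if "i < n" for i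
  proof (cases "va i = 0")
    case True
    have "sum_list (map (\<lambda>(i', j). if i' = i0 then e ^ j * va i else 0) xs) = 0" for xs
      by (induction xs) (auto simp: True)
    then show ?thesis using True by simp
  next
    case False
    then have "length (ns i) = 4" using nsD(1)[OF that, of 0] by simp
    then show ?thesis using False by (simp add: sum_list_sum_nth case_prod_unfold atLeast0LessThan)
  qed
  ultimately show ?thesis by simp
qed

lemma psi_sum: "psi e L z v = (\<Sum>i<n. \<Sum>j<8. if ce i j = v then e ^ j * va i else 0)"
  by (simp add: psi_def)

text \<open>
  Exchange summation: a cell of the support sends its value across its four sides, so the sum received at \<open>v\<close> can be collected by
  orbits and is \<open>lam\<close> times the value by \<open>incoming\<close>. Cells that are not listed receive nothing.
\<close>

lemma neighbour_sum:
  assumes v: "v \<in> V"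
  shows "(\<Sum>w | w \<in> V \<and> adj w v. psi e L z w) = lam * psi e L z v"
proof -
  have "(\<Sum>w | w \<in> V \<and> adj w v. psi e L z w) =
      (\<Sum>i<n. \<Sum>j<8. \<Sum>w | w \<in> V \<and> adj w v. if ce i j = w then e ^ j * va i else 0)"
    unfolding psi_sum by (subst sum.swap) (intro sum.cong refl sum.swap)
  also have "\<dots> = (\<Sum>i<n. \<Sum>j<8. if adj (ce i j) v then e ^ j * va i else 0)"
    using fin mem by (intro sum.cong refl) (auto simp: sum.delta')
  also have "\<dots> = (\<Sum>i<n. \<Sum>j<8. \<Sum>a<4. if va i \<noteq> 0 \<and> nb i j a = v then e ^ j * va i else 0)"
  proof (intro sum.cong refl)
    fix i j assume "i \<in> {..<n}"
    then show "(if adj (ce i j) v then e ^ j * va i else 0) =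
       (\<Sum>a<4. if va i \<noteq> 0 \<and> nb i j a = v then e ^ j * va i else 0)"
      using adj_count[of i v j "e ^ j * va i"] v by (cases "va i = 0") auto
  qed
  also have "\<dots> = (\<Sum>i<n. \<Sum>a<4. \<Sum>j<8. if va i \<noteq> 0 \<and> nb i j a = v then e ^ j * va i else 0)"
    by (intro sum.cong refl sum.swap)
  also have "\<dots> = (\<Sum>i<n. \<Sum>a<4. \<Sum>j<8. if va i \<noteq> 0 \<and> ce (fst (ns i ! a)) j = v
      then e ^ j * (e ^ snd (ns i ! a) * va i) else 0)"
  proof (rule sum.cong[OF refl], rule sum.cong[OF refl])
    fix i a assume i: "i \<in> {..<n}" and a: "a \<in> {..<4::nat}"
    define s where "s = snd (ns i ! a)"
    show "(\<Sum>j<8. if va i \<noteq> 0 \<and> nb i j a = v then e ^ j * va i else 0) =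
      (\<Sum>j<8. if va i \<noteq> 0 \<and> ce (fst (ns i ! a)) j = v then e ^ j * (e ^ snd (ns i ! a) * va i) else 0)"
    proof (cases "va i = 0")
      case False
      have n': "fst (ns i ! a) < n" using nsD(2) i a False by auto
      have bij: "bij_betw (\<lambda>j. (s + j) mod 8) {..<8} {..<8::nat}"
        by (rule bij_betw_shift_mod)
      have "(\<Sum>j<8. if ce (fst (ns i ! a)) j = v then e ^ j * (e ^ s * va i) else 0) =
        (\<Sum>j<8. if ce (fst (ns i ! a)) ((s + j) mod 8) = v then e ^ ((s + j) mod 8) * (e ^ s * va i) else 0)"
        by (rule sum.reindex_bij_betw[OF bij, symmetric])
      also have "\<dots> = (\<Sum>j<8. if nb i j a = v then e ^ j * va i else 0)"
      proof (intro sum.cong refl)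
        fix j
        have "e ^ (s + j) * (e ^ s * va i) = e ^ j * va i"
          using e_pow(2)[of s] by (simp add: power_add mult_ac)
        then show "(if ce (fst (ns i ! a)) ((s + j) mod 8) = v then e ^ ((s + j) mod 8) * (e ^ s * va i) else 0) =
           (if nb i j a = v then e ^ j * va i else 0)"
          by (simp only: ce_mod[OF n'] e_pow(1) nb_def s_def)
      qed
      finally have "(\<Sum>j<8. if ce (fst (ns i ! a)) j = v then e ^ j * (e ^ s * va i) else 0) =
        (\<Sum>j<8. if nb i j a = v then e ^ j * va i else 0)" .
      from this[symmetric] False show ?thesis unfolding s_def by simp
    qed simp
  qed
  also have "\<dots> = (\<Sum>i<n. \<Sum>a<4. \<Sum>j<8. \<Sum>i0<n. if ce i0 j = v then
      e ^ j * (if va i \<noteq> 0 \<and> fst (ns i ! a) = i0 then e ^ snd (ns i ! a) * va i else 0) else 0)"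
  proof (intro sum.cong refl)
    fix i a j assume i: "i \<in> {..<n}" and a: "a \<in> {..<4::nat}"
    show "(if va i \<noteq> 0 \<and> ce (fst (ns i ! a)) j = v then e ^ j * (e ^ snd (ns i ! a) * va i) else 0) =
      (\<Sum>i0<n. if ce i0 j = v then e ^ j * (if va i \<noteq> 0 \<and> fst (ns i ! a) = i0 then e ^ snd (ns i ! a) * va i else 0) else 0)"
    proof (cases "va i = 0")
      case False
      have n': "fst (ns i ! a) < n" using nsD(2) i a False by auto
      have "(\<Sum>i0<n. if ce i0 j = v then e ^ j * (if va i \<noteq> 0 \<and> fst (ns i ! a) = i0 then e ^ snd (ns i ! a) * va i else 0) else 0) =
        (\<Sum>i0<n. if fst (ns i ! a) = i0 then (if ce i0 j = v then e ^ j * (e ^ snd (ns i ! a) * va i) else 0) else 0)"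
        using False by (intro sum.cong) auto
      then show ?thesis using False n' by simp
    next
      case True
      then have "(\<Sum>i0<n. if ce i0 j = v then e ^ j * (if va i \<noteq> 0 \<and> fst (ns i ! a) = i0 then e ^ snd (ns i ! a) * va i else 0) else 0) = 0"
        by (intro sum.neutral) auto
      then show ?thesis using True by (simp cong: if_cong)
    qed
  qed
  also have "\<dots> = (\<Sum>i0<n. \<Sum>j<8. \<Sum>i<n. \<Sum>a<4. if ce i0 j = v then
      e ^ j * (if va i \<noteq> 0 \<and> fst (ns i ! a) = i0 then e ^ snd (ns i ! a) * va i else 0) else 0)"
    (is "(\<Sum>i<n. \<Sum>a<4. \<Sum>j<8. \<Sum>i0<n. ?f i a j i0) = _")
  proof -
    have "(\<Sum>i<n. \<Sum>a<4. \<Sum>j<8. \<Sum>i0<n. ?f i a j i0) = (\<Sum>i<n. \<Sum>a<4. \<Sum>i0<n. \<Sum>j<8. ?f i a j i0)"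
      by (intro sum.cong refl sum.swap)
    also have "\<dots> = (\<Sum>i<n. \<Sum>i0<n. \<Sum>a<4. \<Sum>j<8. ?f i a j i0)" by (intro sum.cong refl sum.swap)
    also have "\<dots> = (\<Sum>i0<n. \<Sum>i<n. \<Sum>a<4. \<Sum>j<8. ?f i a j i0)" by (rule sum.swap)
    also have "\<dots> = (\<Sum>i0<n. \<Sum>i<n. \<Sum>j<8. \<Sum>a<4. ?f i a j i0)" by (intro sum.cong refl sum.swap)
    also have "\<dots> = (\<Sum>i0<n. \<Sum>j<8. \<Sum>i<n. \<Sum>a<4. ?f i a j i0)" by (intro sum.cong refl sum.swap)
    finally show ?thesis .
  qed
  also have "\<dots> = (\<Sum>i0<n. \<Sum>j<8. if ce i0 j = v then e ^ j * (lam * va i0) else 0)"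
  proof (intro sum.cong refl)
    fix i0 j assume "i0 \<in> {..<n}"
    then have "i0 < n" by simp
    show "(\<Sum>i<n. \<Sum>a<4. if ce i0 j = v then e ^ j * (if va i \<noteq> 0 \<and> fst (ns i ! a) = i0 then e ^ snd (ns i ! a) * va i else 0) else 0) =
       (if ce i0 j = v then e ^ j * (lam * va i0) else 0)"
    proof (cases "ce i0 j = v")
      case True
      then show ?thesis by (simp only: if_True sum_distrib_left[symmetric] incoming[OF \<open>i0 < n\<close>] refl)
    qed simp
  qed
  also have "\<dots> = lam * psi e L z v"
    unfolding psi_sum sum_distrib_left by (intro sum.cong) auto
  finally show ?thesis .
qed

text \<open>
  Each cell of the support has its four neighbours inside \<open>V\<close>; hence the boundary of \<open>V\<close> is not felt.
\<close>

lemma degree_four: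
  assumes v: "v \<in> V" and nz: "psi e L z v \<noteq> 0"
  shows "card {w. w \<in> V \<and> adj w v} = 4"
proof -
  have "\<exists>i<n. \<exists>j. ce i j = v \<and> va i \<noteq> 0"
  proof (rule ccontr)
    assume "\<not> ?thesis"
    then have "psi e L z v = 0" unfolding psi_sum by (intro sum.neutral ballI) auto
    then show False using nz by simp
  qed
  then obtain i j where ij: "i < n" "ce i j = v" "va i \<noteq> 0" by blast
  have "{w. w \<in> V \<and> adj w v} = nb i j ` {..<4}"
  proof
    show "{w. w \<in> V \<and> adj w v} \<subseteq> nb i j ` {..<4}"
    proof
      fix w assume w: "w \<in> {w. w \<in> V \<and> adj w v}"
      then have "adj v w" using adj_sym by blast
      then obtain a where "a < 4" "rev_side (side_of i j a) \<in> set (sides w)"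
        unfolding adj_def ij(2)[symmetric] side_of_sides[OF ij(1)] by blast
      then show "w \<in> nb i j ` {..<4}" using has_side_iff[OF ij(1,3)] w by blast
    qed
    show "nb i j ` {..<4} \<subseteq> {w. w \<in> V \<and> adj w v}"
    proof clarify
      fix a :: nat assume a: "a < 4"
      have "adj v (nb i j a)" unfolding adj_def ij(2)[symmetric] side_of_sides[OF ij(1)]
        using nb_side(1)[OF ij(1,3) a] a by blast
      then show "nb i j a \<in> V \<and> adj (nb i j a) v" using nb_side(2)[OF ij(1,3) a] adj_sym by blast
    qed
  qed
  moreover have "inj_on (nb i j) {..<4}"
  proof (rule inj_onI)
    fix a b :: nat assume ab: "a \<in> {..<4}" "b \<in> {..<4}" "nb i j a = nb i j b"
    have "side_of i j a = side_of i j b"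
    proof (rule single_side)
      show "poly_cell (ce i j)" by (rule poly[OF mem[OF ij(1)]])
      show "poly_cell (nb i j a)" using poly nb_side(2)[OF ij(1,3)] ab by simp
      show "rev_side (side_of i j a) \<in> set (sides (nb i j a))" by (rule nb_side(1)[OF ij(1,3)]) (use ab in simp)
      show "rev_side (side_of i j b) \<in> set (sides (nb i j a))" unfolding ab(3) by (rule nb_side(1)[OF ij(1,3)]) (use ab in simp)
    qed (use side_of_sides[OF ij(1)] ab in auto)
    then show "a = b" using side_of_inj[OF ij(1)] ab by simp
  qed
  ultimately show ?thesis by (simp add: card_image)
qed

theorem eigenfunction:
  assumes v: "v \<in> V"
  shows "(\<Sum>w | w \<in> V \<and> adj w v. psi e L z v - psi e L z w) = (4 - lam) * psi e L z v"
proof -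
  have "(\<Sum>w | w \<in> V \<and> adj w v. psi e L z v - psi e L z w) =
     int (card {w. w \<in> V \<and> adj w v}) * psi e L z v - lam * psi e L z v"
    by (simp add: sum_subtractf neighbour_sum[OF v])
  also have "\<dots> = (4 - lam) * psi e L z v"
    using degree_four[OF v] by (cases "psi e L z v = 0") (auto simp: algebra_simps)
  finally show ?thesis .
qed

end

lemma psi_occurrences:
  assumes "psi e L z (shift x v) \<noteq> 0"
  shows "\<exists>d\<in>set (occurrences v L). z = x + d"
proof -
  have "\<exists>i<length L. \<exists>j<8. shift z ((rot_cell ^^ j) (fst (L ! i))) = shift x v \<and> fst (snd (L ! i)) \<noteq> 0"
  proof (rule ccontr)
    assume "\<not> ?thesis"
    then have "psi e L z (shift x v) = 0" unfolding psi_def by (intro sum.neutral ballI) auto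
    then show False using assms by simp
  qed
  then obtain i j where i: "i < length L" and j: "j < 8" and eq: "shift z ((rot_cell ^^ j) (fst (L ! i))) = shift x v"
    and nz: "fst (snd (L ! i)) \<noteq> 0" by blast
  define c where "c = (rot_cell ^^ j) (fst (L ! i))"
  have ps: "pos (shift y c) = pos c + y" for y c by (cases c) simp_all
  define d where "d = pos v - pos c"
  have "pos c + z = pos v + x" using arg_cong[OF eq, of pos] by (simp only: ps c_def)
  then have d: "z = x + d" by (simp add: d_def algebra_simps)
  then have "shift x (shift d c) = shift x v" using eq by (simp add: c_def shift_shift add.commute)
  then have "shift d c = v" by (simp add: shift_inj)
  have "d \<in> set (occurrences v L)"
    unfolding occurrences_def set_concat set_map
  proof (rule UN_I)
    show "(\<lambda>(c, x, _). if x = 0 then [] else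
       concat (map (\<lambda>j. let c' = (rot_cell ^^ j) c; z = pos v - pos c' in if shift z c' = v then [z] else []) [0..<8])) (L ! i)
      \<in> (\<lambda>(c, x, _). if x = 0 then [] else
       concat (map (\<lambda>j. let c' = (rot_cell ^^ j) c; z = pos v - pos c' in if shift z c' = v then [z] else []) [0..<8])) ` set L"
      using i by (intro imageI nth_mem)
    show "d \<in> set ((\<lambda>(c, x, _). if x = 0 then [] else
       concat (map (\<lambda>j. let c' = (rot_cell ^^ j) c; z = pos v - pos c' in if shift z c' = v then [z] else []) [0..<8])) (L ! i))"
      using nz j \<open>shift d c = v\<close> by (auto simp: case_prod_unfold Let_def d_def c_def intro!: bexI[of _ j])
  qed
  then show ?thesis using d by blast
qed

lemma psi_at: "psi e L x (shift x v) = val_at e L v"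
proof -
  have "psi e L x (shift x v) = (\<Sum>i<length L. \<Sum>j<8. if (rot_cell ^^ j) (fst (L ! i)) = v then e ^ j * fst (snd (L ! i)) else 0)"
    by (simp add: psi_def shift_inj)
  also have "\<dots> = val_at e L v"
  proof -
    have u: "sum_list (map f [0..<8]) = (\<Sum>j<8. f j)" for f :: "nat \<Rightarrow> int"
      by (simp only: interv_sum_list_conv_sum_set_nat set_upt atLeast0LessThan)
    have w: "sum_list (map f L) = (\<Sum>i<length L. f (L ! i))" for f :: "entry \<Rightarrow> int"
      by (simp add: sum_list_sum_nth atLeast0LessThan)
    show ?thesis unfolding val_at_def u w
      by (intro sum.cong) (auto simp: case_prod_unfold intro!: sum.neutral)
  qed
  finally show ?thesis .
qed

section \<open>Verification of the six functions\<close>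

definition one :: pt where "one = (1, 0, 0, 0)"

text \<open>
  The cells near a vertex of level \<open>m + 2\<close> in one of its eight sectors.
\<close>

definition patch :: "nat \<Rightarrow> cell list" where "patch m = (inflate_cells ^^ m) (wedge one)"

text \<open>
  A cell of the support can lie across the border of two neighbouring sectors, so two are needed.
\<close>

definition two_wedges :: "cell list \<Rightarrow> cell list" where "two_wedges T = T @ map rot_cell T"

lemma patch_code: "patch 0 = wedge (1,0,0,0)" "patch 1 = inflate_cells (wedge (1,0,0,0))" "patch 2 = inflate_cells (inflate_cells (wedge (1,0,0,0)))"
  by (simp_all add: patch_def one_def numeral_2_eq_2)

lemma eigen_f4: "local_eigen 0 (-1) f4_data" by code_simp
lemma eigen_f6: "local_eigen (-2) (-1) f6_data" by code_simp
lemma eigen_h4: "local_eigen 0 (-1) h4_data" by code_simp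
lemma eigen_h6: "local_eigen (-2) 1 h6_data" by code_simp
lemma eigen_p: "local_eigen 0 (-1) p_data" by code_simp
lemma eigen_q: "local_eigen 0 (-1) q_data" by code_simp

lemma present_f4: "all_present (two_wedges (patch 0)) f4_data" unfolding patch_code by code_simp
lemma present_f6: "all_present (two_wedges (patch 0)) f6_data" unfolding patch_code by code_simp
lemma present_h4: "all_present (two_wedges (patch 1)) h4_data" unfolding patch_code by code_simp
lemma present_h6: "all_present (two_wedges (patch 1)) h6_data" unfolding patch_code by code_simp
lemma present_p: "all_present (two_wedges (patch 2)) p_data" unfolding patch_code by code_simp
lemma present_q: "all_present (two_wedges (patch 2)) q_data" unfolding patch_code by code_simp

text \<open>
  Each pivot is a cell that a copy of an earlier function can reach only from positions where no vertex of its level can be.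
\<close>

definition "f4_pivot = fst (f4_data ! 0)"
definition "f6_pivot = fst (f6_data ! 0)"
definition "h4_pivot = fst (h4_data ! 2)"
definition "h6_pivot = fst (h6_data ! 0)"
definition "p_pivot = fst (p_data ! 12)"
definition "q_pivot = fst (q_data ! 8)"

lemma value_f4: "val_at (-1) f4_data f4_pivot \<noteq> 0" by code_simp
lemma value_f6: "val_at (-1) f6_data f6_pivot \<noteq> 0" by code_simp
lemma value_h4: "val_at (-1) h4_data h4_pivot \<noteq> 0" by code_simp
lemma value_h6: "val_at 1 h6_data h6_pivot \<noteq> 0" by code_simp
lemma value_p: "val_at (-1) p_data p_pivot \<noteq> 0" by code_simp
lemma value_q: "val_at (-1) q_data q_pivot \<noteq> 0" by code_simp

lemma near_f4: "\<forall>d\<in>set (occurrences f4_pivot f4_data). near (17, 12) d" by code_simp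
lemma near_f6: "\<forall>d\<in>set (occurrences f6_pivot f6_data). near (17, 12) d" by code_simp
lemma near_h4: "\<forall>d\<in>set (occurrences h4_pivot h4_data). near (99, 70) d" by code_simp
lemma near_h6: "\<forall>d\<in>set (occurrences h6_pivot h6_data). near (99, 70) d" by code_simp
lemma near_p: "\<forall>d\<in>set (occurrences p_pivot p_data). near (577, 408) d" by code_simp
lemma near_q: "\<forall>d\<in>set (occurrences q_pivot q_data). near (577, 408) d" by code_simp
lemma near_q_p: "\<forall>d\<in>set (occurrences q_pivot p_data). d \<noteq> 0 \<and> near (577, 408) d" by code_simp

lemma apart_h4_f4: "occurrences h4_pivot f4_data = []" by code_simp
lemma apart_h6_f6: "occurrences h6_pivot f6_data = []" by code_simp
lemma apart_q_f4: "occurrences q_pivot f4_data = []" by code_simp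
lemma refuted_p_f4: "\<forall>d\<in>set (occurrences p_pivot f4_data). refuted witnesses d" by code_simp
lemma refuted_p_h4: "\<forall>d\<in>set (occurrences p_pivot h4_data). refuted witnesses d" by code_simp
lemma refuted_q_h4: "\<forall>d\<in>set (occurrences q_pivot h4_data). refuted witnesses d" by code_simp
lemma witnesses_patch: "\<forall>(i, t)\<in>set witnesses. t \<in> set (patch 2)" unfolding patch_code by code_simp

lemma wedge_rot: "\<forall>k\<in>set dirs. wedge (rot k) = map rot_cell (wedge k)" by code_simp
lemma star_rhombus: "\<forall>k\<in>set dirs. rh 0 k \<in> set (wedge k) \<and> rh 0 k \<in> set (inflate_cells (wedge k)) \<and> (0, k) \<in> set (flags (rh 0 k))" by code_simp
lemma inflate_cell_rot_seeds: "\<forall>s\<in>set seeds. set (inflate_cell (rot_cell s)) = set (map rot_cell (inflate_cell s))" by code_simp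
lemma merge_seeds: "\<forall>s\<in>set seeds. set (flags (merge s)) = set (flags s @ flags (mirror s)) \<and> merge (mirror s) = merge s \<and> mirror (mirror s) = s \<and>
   rot_cell (mirror s) = mirror (rot_cell s) \<and> rot_cell (merge s) = merge (rot_cell s)" by code_simp
lemma poly_flags: "\<forall>s\<in>set polyseeds. distinct (flags s) \<and> length (flags s) = 8" by code_simp

section \<open>Copies of the six functions in a window\<close>

lemma inflate_cell_rot: "tile_cell t \<Longrightarrow> set (inflate_cell (rot_cell t)) = rot_cell ` set (inflate_cell t)"
proof -
  assume "tile_cell t"
  then obtain z s where s: "s \<in> set seeds" "t = shift z s" by (auto simp: tile_cell_def)
  have ts: "tile_cell s" unfolding tile_cell_def using s(1) shift_0[of s] by (intro exI[of _ 0] bexI[of _ s]) simp_all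
  have sr: "sil (rot z) = rot (sil z)" by (simp add: sil_def rt2_def rot_add del: rot.simps)
  have "set (inflate_cell (rot_cell t)) = shift (rot (sil z)) ` set (inflate_cell (rot_cell s))"
    by (simp add: s rot_cell_shift_tile[OF ts] inflate_cell_shift sr)
  also have "\<dots> = shift (rot (sil z)) ` rot_cell ` set (inflate_cell s)"
    using inflate_cell_rot_seeds s(1) by simp
  also have "\<dots> = rot_cell ` shift (sil z) ` set (inflate_cell s)"
    using tile_cell_inflate_cell[OF ts] by (auto simp: rot_cell_shift_tile image_image)
  finally show ?thesis by (simp add: s inflate_cell_shift)
qed

lemma tile_cell_rot: "tile_cell t \<Longrightarrow> tile_cell (rot_cell t)"
  by (cases t) (simp_all add: tile_cell_rh tile_cell_iff dirs_rot del: rot.simps)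

lemma tile_cell_rot_pow: "tile_cell t \<Longrightarrow> tile_cell ((rot_cell ^^ i) t)"
  by (induction i) (simp_all add: tile_cell_rot)

lemma inflate_cell_rot_pow: "tile_cell t \<Longrightarrow> set (inflate_cell ((rot_cell ^^ i) t)) = (rot_cell ^^ i) ` set (inflate_cell t)"
  by (induction i) (simp_all add: inflate_cell_rot tile_cell_rot_pow image_image)

lemma tile_cell_wedge: "k \<in> set dirs \<Longrightarrow> t \<in> set (wedge k) \<Longrightarrow> tile_cell t"
  using tile_cell_inflate_cell[of "Hs 0 k True" t] set_take_subset[of 4 "inflate_cell (Hs 0 k True)"]
  by (auto simp: wedge_def tile_cell_iff)

lemma wedge_rot_pow: "wedge ((rot ^^ i) one) = map (rot_cell ^^ i) (wedge one) \<and> (rot ^^ i) one \<in> set dirs"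
proof (induction i)
  case (Suc i)
  then show ?case using wedge_rot dirs_rot(1) by (simp add: comp_def del: rot.simps)
qed (simp add: one_def dirs_def id_def)

lemma tile_cell_patch: "t \<in> set (patch m) \<Longrightarrow> tile_cell t"
proof (induction m arbitrary: t)
  case 0
  then show ?case using tile_cell_wedge[of one t] by (simp add: patch_def one_def dirs_def)
next
  case (Suc m)
  then obtain t' where "t' \<in> set (patch m)" "t \<in> set (inflate_cell t')" by (auto simp: patch_def inflate_cells_def)
  then show ?case using Suc.IH tile_cell_inflate_cell by blast
qed

lemma inflate_cell_member: "c \<in> A \<Longrightarrow> t \<in> set (inflate_cell c) \<Longrightarrow> t \<in> inflate A"
  by (auto simp: inflate_def)

lemma patch_grow:
  assumes "\<And>t. t \<in> set (patch 0) \<Longrightarrow> shift z ((rot_cell ^^ i) t) \<in> A"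
  shows "t \<in> set (patch m) \<Longrightarrow> shift ((sil ^^ m) z) ((rot_cell ^^ i) t) \<in> (inflate ^^ m) A"
proof (induction m arbitrary: t)
  case (Suc m)
  then obtain t' where t': "t' \<in> set (patch m)" "t \<in> set (inflate_cell t')" by (auto simp: patch_def inflate_cells_def)
  have "(rot_cell ^^ i) t \<in> set (inflate_cell ((rot_cell ^^ i) t'))"
    using t' tile_cell_patch by (simp add: inflate_cell_rot_pow)
  then have "shift (sil ((sil ^^ m) z)) ((rot_cell ^^ i) t) \<in> set (inflate_cell (shift ((sil ^^ m) z) ((rot_cell ^^ i) t')))"
    by (simp add: inflate_cell_shift)
  then show ?case using inflate_cell_member[OF Suc.IH[OF t'(1)]] by simp
qed (use assms in simp)

lemma merge_flags: "tile_cell t \<Longrightarrow> set (flags (merge t)) = set (flags t) \<union> set (flags (mirror t))"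
  "tile_cell t \<Longrightarrow> merge (mirror t) = merge t" "tile_cell t \<Longrightarrow> mirror (mirror t) = t"
  "tile_cell t \<Longrightarrow> rot_cell (mirror t) = mirror (rot_cell t)" "tile_cell t \<Longrightarrow> rot_cell (merge t) = merge (rot_cell t)"
proof -
  assume "tile_cell t"
  then obtain z s where s: "s \<in> set seeds" "t = shift z s" by (auto simp: tile_cell_def)
  have m: "set (flags (merge s)) = set (flags s) \<union> set (flags (mirror s))" "merge (mirror s) = merge s" "mirror (mirror s) = s"
    using merge_seeds s(1) by auto
  show "set (flags (merge t)) = set (flags t) \<union> set (flags (mirror t))"
    unfolding s merge_shift mirror_shift flags_shift set_map m by (simp add: image_Un)
  show "merge (mirror t) = merge t" "mirror (mirror t) = t"
    unfolding s merge_shift mirror_shift m by simp_all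
next
  assume t: "tile_cell t"
  show "rot_cell (mirror t) = mirror (rot_cell t)"
    using t by (cases t) (auto simp: tile_cell_iff rot_add rh_def simp del: rot.simps)
  show "rot_cell (merge t) = merge (rot_cell t)"
    using t by (cases t) (auto simp: tile_cell_iff rot_add rh_def rot_cell_sqr dirs_rot simp del: rot.simps)
qed

lemma merge_rot_pow: "tile_cell t \<Longrightarrow> merge ((rot_cell ^^ i) t) = (rot_cell ^^ i) (merge t) \<and> mirror ((rot_cell ^^ i) t) = (rot_cell ^^ i) (mirror t)"
  by (induction i) (simp_all add: merge_flags(4,5)[symmetric] tile_cell_rot_pow)

lemma tile_cell_mirror: "tile_cell t \<Longrightarrow> tile_cell (mirror t)"
  by (cases t) (simp_all add: tile_cell_iff dirs_rot del: rot.simps)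

lemma poly_cell_merge: "tile_cell t \<Longrightarrow> poly_cell (merge t)"
  by (cases t) (simp_all add: tile_cell_iff poly_cell_sqr dirs_rot del: rot.simps)

lemma poly_data: "\<forall>(c, _)\<in>set (f4_data @ f6_data @ h4_data @ h6_data @ p_data @ q_data). poly_cell c"
  by code_simp

lemma sqr_sides: "poly_cell (Sq p u) \<Longrightarrow> (V, k) \<in> set (sides (Sq p u)) \<Longrightarrow> sqr V k = Sq p u"
proof -
  assume c: "poly_cell (Sq p u)" and "(V, k) \<in> set (sides (Sq p u))"
  then have u: "u \<in> set dirs" by simp
  define w where "w = rot (rot u)"
  have w: "w \<in> set dirs" "- u \<in> set dirs" unfolding w_def by (simp_all only: dirs_rot u)
  have rw: "rot (rot w) = - u" "rot (rot (- u)) = - w" by (simp_all add: w_def rot8 rot_add del: rot.simps)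
  have 0: "sqr p u = Sq p u" using c by (simp add: sqr_def Let_def)
  have 1: "sqr (p + u) w = sqr p u" unfolding w_def by (rule sqr_turn[OF u])
  have 2: "sqr (p + u + w) (- u) = sqr (p + u) w" using sqr_turn[OF w(1), of "p + u"] by (simp add: rw)
  have 3: "sqr (p + w) (- w) = sqr (p + u + w) (- u)" using sqr_turn[OF w(2), of "p + u + w"] by (simp add: rw algebra_simps)
  have "set (sides (Sq p u)) = {(p, u), (p + u, w), (p + u + w, - u), (p + w, - w)}" by (simp add: w_def Let_def)
  then show ?thesis using \<open>(V, k) \<in> _\<close> 0 1 2 3 by auto
qed

lemma presentD:
  assumes "present T c" "\<And>t. t \<in> set T \<Longrightarrow> tile_cell t" "poly_cell c"
  shows "\<exists>t\<in>set T. mirror t \<in> set T \<and> merge t = c"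
proof (cases c)
  case (Rh p u)
  then show ?thesis using assms by (intro bexI[of _ c]) auto
next
  case (Sq p u)
  obtain V k where V: "(V, k) \<in> set (sides (Sq p u))" "Hs V k True \<in> set T" "Hs V (rot (rot k)) False \<in> set T"
    using assms(1) unfolding Sq present.simps by blast
  have "merge (Hs V k True) = c" using sqr_sides[OF _ V(1)] assms(3) Sq by simp
  then show ?thesis using V by (intro bexI[of _ "Hs V k True"]) auto
qed (use assms in simp)

lemma cell_hull_sqr: "u \<in> set dirs \<Longrightarrow> cell_hull (sqr p u) = cell_hull (Sq p u)"
proof -
  assume u: "u \<in> set dirs"
  have c: "set (corners (Sq p u)) = fst ` raw_sq p u" for p u
    by (auto simp: corners_def raw_sq_def Let_def simp del: rot.simps)
  have "fst ` raw_sq p u = fst ` set (sides (sqr p u))" by (simp add: sides_sqr u)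
  also obtain p' u' where "sqr p u = Sq p' u'" unfolding sqr_def Let_def by metis
  then have "fst ` set (sides (sqr p u)) = set (corners (sqr p u))" by (auto simp: corners_def Let_def)
  finally show ?thesis by (simp add: cell_hull_def c)
qed

lemma region_square: "u \<in> set dirs \<Longrightarrow> region (Sq p u) = region (Hs p u True) \<union> region (Hs p (rot (rot u)) False)"
proof -
  assume u: "u \<in> set dirs"
  then have u': "rot (rot u) \<in> set dirs" by (simp only: dirs_rot)
  have s2: "sqrt 2 / 2 > 0" by simp
  have "z \<in> region (Sq p u) \<longleftrightarrow> z \<in> region (Hs p u True) \<union> region (Hs p (rot (rot u)) False)" for z
  proof -
    have "emb u \<noteq> 0" using emb_dir[OF u] by fastforce
    then obtain Z where Z: "z = emb p + emb u * Z"
      by (metis add.commute diff_add_cancel nonzero_mult_div_cancel_left times_divide_eq_right)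
    then have Z': "z = emb p + emb (rot (rot u)) * (- \<i> * Z)" by (simp add: emb_rot_rot complex_eq_iff)
    have 1: "z \<in> region (Sq p u) \<longleftrightarrow> 0 \<le> Im Z \<and> Re Z \<le> 1 \<and> Im Z \<le> 1 \<and> 0 \<le> Re Z"
      by (auto simp: region_def Let_def side_frame[OF u Z] simp del: rot.simps)
    have 2: "z \<in> region (Hs p u True) \<longleftrightarrow> 0 \<le> Im Z \<and> Re Z \<le> 1 \<and> Im Z \<le> Re Z"
      using s2 by (auto simp: region_def Let_def side_frame[OF u Z] zero_le_mult_iff simp del: rot.simps)
    have 3: "z \<in> region (Hs p (rot (rot u)) False) \<longleftrightarrow> Re Z \<le> Im Z \<and> Im Z \<le> 1 \<and> 0 \<le> Re Z"
      using s2 by (auto simp: region_def Let_def side_frame[OF u' Z'] zero_le_mult_iff simp del: rot.simps)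
    show ?thesis using 1 2 3 by auto
  qed
  then show ?thesis by blast
qed

lemma cell_hull_merge: "tile_cell t \<Longrightarrow> cell_hull (merge t) = region t \<union> region (mirror t)"
proof (cases t)
  case (Rh p u)
  assume "tile_cell t"
  then show ?thesis using cell_hull_eq_region[OF tile_cell_unit_cell] Rh by simp
next
  case (Hs p u b)
  assume "tile_cell t"
  then have u: "u \<in> set dirs" using Hs by (simp add: tile_cell_iff)
  then have u': "- rot (rot u) \<in> set dirs" by (simp only: dirs_rot)
  have r: "rot (rot (- rot (rot u))) = u" by (simp add: rot_add rot8 del: rot.simps)
  show ?thesis
  proof (cases b)
    case True
    then show ?thesis using Hs u cell_hull_sqr[OF u] region_square[OF u] cell_hull_eq_region[of "Sq p u"] by (simp add: unit_cell_def)
  next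
    case False
    then show ?thesis using Hs cell_hull_sqr[OF u'] region_square[OF u', unfolded r] cell_hull_eq_region[of "Sq p (- rot (rot u))"] u'
      by (auto simp: unit_cell_def simp del: rot.simps)
  qed
qed (simp add: tile_cell_iff)

lemma mirror_flag: "tile_cell t \<Longrightarrow> \<exists>y k l. (y, k) \<in> set (flags t) \<and> (y, l) \<in> set (flags (mirror t))"
proof (cases t)
  case (Hs p u b)
  have "(p, u) \<in> set (flags (Hs p u True)) \<and> (p, - rot (rot (rot (rot (rot u))))) \<in> set (flags (mirror (Hs p u True)))"
    "(p, - rot (rot (rot u))) \<in> set (flags (Hs p u False)) \<and> (p, - rot (rot u)) \<in> set (flags (mirror (Hs p u False)))"
    by (simp_all add: Let_def del: rot.simps)
  moreover consider "t = Hs p u True" | "t = Hs p u False" using Hs by (cases b) simp_all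
  ultimately show ?thesis by cases (simp only:, blast)+
next
  case (Rh p u)
  have "(p, u) \<in> set (flags (Rh p u)) \<and> (p, u) \<in> set (flags (mirror (Rh p u)))" by (simp add: Let_def del: rot.simps)
  then show ?thesis using Rh by blast
qed (simp add: tile_cell_iff)

context window
begin

text \<open>
  Two substitutions produce the wedge in every sector at the vertex, and the others make the patch out of it.
\<close>

lemma star_patch:
  assumes y: "star (Y (j + 2)) y" and j: "j + 2 \<le> N" and t: "t \<in> set (patch j)"
  shows "shift ((sil ^^ (j + 2)) y) ((rot_cell ^^ i) t) \<in> Y 0"
proof -
  have base: "shift (sil (sil y)) ((rot_cell ^^ i) t) \<in> Y j" if "t \<in> set (patch 0)" for t
  proof -
    define k where "k = (rot ^^ i) one"
    have k: "k \<in> set dirs" "wedge k = map (rot_cell ^^ i) (wedge one)" using wedge_rot_pow k_def by auto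
    obtain c where c: "c \<in> Y (j + 2)" "(y, k) \<in> set (flags c)" using y k by (auto simp: star_def)
    have "(rot_cell ^^ i) t \<in> set (wedge k)" using that k(2) by (simp add: patch_def)
    then have "shift (sil (sil y)) ((rot_cell ^^ i) t) \<in> set (inflate_cells (inflate_cell c))"
      by (rule wedge_in_inflate_cell[OF tile_cell_Y[OF c(1)] c(2)])
    then obtain d where "d \<in> set (inflate_cell c)" "shift (sil (sil y)) ((rot_cell ^^ i) t) \<in> set (inflate_cell d)"
      by (auto simp: inflate_cells_def)
    then have "shift (sil (sil y)) ((rot_cell ^^ i) t) \<in> inflate (inflate (Y (j + 2)))"
      using inflate_cell_member c(1) by blast
    moreover have "Y j = inflate (inflate (Y (j + 2)))" using Y_add[of j 2] j by (simp add: numeral_2_eq_2)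
    ultimately show ?thesis by simp
  qed
  have "shift ((sil ^^ j) (sil (sil y))) ((rot_cell ^^ i) t) \<in> (inflate ^^ j) (Y j)"
    by (rule patch_grow[OF base t])
  then show ?thesis using Y_add[of 0 j] j by (simp add: funpow_swap1)
qed

text \<open>
  Rhombi and merged squares, that is the vertices of the graph of the tiling near the disc. The half-square at the rim of the supertile whose
  mirror image is missing yields no polygon.
\<close>

definition polys :: "real \<Rightarrow> cell set" where
  "polys r = {merge t |t. t \<in> Y 0 \<and> mirror t \<in> Y 0 \<and> cell_hull (merge t) \<inter> cball \<beta> r \<noteq> {}}"

lemma finite_polys: "finite (polys r)"
  by (rule finite_subset[of _ "merge ` Y 0"]) (auto simp: polys_def finite_Y)

lemma poly_cell_polys: "c \<in> polys r \<Longrightarrow> poly_cell c"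
  using poly_cell_merge tile_cell_Y by (auto simp: polys_def)

lemma polys_flags_unique:
  assumes "c \<in> polys r" "c' \<in> polys r'" "f \<in> set (flags c)" "f \<in> set (flags c')"
  shows "c = c'"
proof -
  obtain t where t: "t \<in> Y 0" "mirror t \<in> Y 0" "c = merge t" using assms by (auto simp: polys_def)
  obtain t' where t': "t' \<in> Y 0" "mirror t' \<in> Y 0" "c' = merge t'" using assms by (auto simp: polys_def)
  obtain u where u: "u \<in> Y 0" "f \<in> set (flags u)" "merge u = c"
    using assms(3) t merge_flags(1,2)[OF tile_cell_Y[OF t(1)]] by blast
  obtain u' where u': "u' \<in> Y 0" "f \<in> set (flags u')" "merge u' = c'"
    using assms(4) t' merge_flags(1,2)[OF tile_cell_Y[OF t'(1)]] by blast
  have "u = u'" using packed_flag_unique[OF packed_Y u(1) u'(1) u(2) u'(2)] .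
  then show ?thesis using u u' by simp
qed

text \<open>
  Every polygon has eight flags and no flag belongs to two polygons.
\<close>

lemma polys_count: "8 * card (polys r) \<le> (\<Sum>c\<in>meeting 0 (r + 4). length (flags c))"
proof -
  have c8: "card (set (flags c)) = 8" if pc: "poly_cell c" for c
  proof -
    obtain z s where s: "s \<in> set polyseeds" "c = shift z s" using pc poly_cell_seed by blast
    have "distinct (flags s) \<and> length (flags s) = 8" using poly_flags s by blast
    then have "distinct (flags c)" "length (flags c) = 8" by (auto simp: s flags_shift distinct_map inj_on_def)
    then show ?thesis by (simp add: distinct_card)
  qed
  have "8 * card (polys r) = (\<Sum>c\<in>polys r. card (set (flags c)))"
    using c8 poly_cell_polys by simp
  also have "\<dots> = card (\<Union>c\<in>polys r. set (flags c))"
    using finite_polys polys_flags_unique by (intro card_UN_disjoint[symmetric]) auto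
  also have "\<dots> \<le> card (\<Union>c\<in>meeting 0 (r + 4). set (flags c))"
  proof (rule card_mono)
    show "(\<Union>c\<in>polys r. set (flags c)) \<subseteq> (\<Union>c\<in>meeting 0 (r + 4). set (flags c))"
    proof
      fix f assume "f \<in> (\<Union>c\<in>polys r. set (flags c))"
      then obtain t where t: "t \<in> Y 0" "mirror t \<in> Y 0" "cell_hull (merge t) \<inter> cball \<beta> r \<noteq> {}" "f \<in> set (flags (merge t))"
        unfolding polys_def by blast
      have tc: "tile_cell t" "tile_cell (mirror t)" using t tile_cell_Y by auto
      obtain z where z: "z \<in> region t \<or> z \<in> region (mirror t)" "dist \<beta> z \<le> r"
        using t(3) unfolding cell_hull_merge[OF tc(1)] mem_cball[symmetric] by blast
      obtain y k l where y: "(y, k) \<in> set (flags t)" "(y, l) \<in> set (flags (mirror t))" using mirror_flag[OF tc(1)] by blast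
      have ry: "emb y \<in> region t" "emb y \<in> region (mirror t)" using flag_in_region tc y by blast+
      have "dist z (emb y) \<le> 4" using z(1) region_diameter tc ry by blast
      then have "dist \<beta> (emb y) \<le> r + 4" using z(2) dist_triangle[of \<beta> "emb y" z] by linarith
      then have "emb y \<in> scaled 0 t \<inter> cball \<beta> (r + 4)" "emb y \<in> scaled 0 (mirror t) \<inter> cball \<beta> (r + 4)"
        using ry by (simp_all add: scaled_0)
      then have "t \<in> meeting 0 (r + 4)" "mirror t \<in> meeting 0 (r + 4)"
        using t(1,2) unfolding meeting_def by blast+
      then show "f \<in> (\<Union>c\<in>meeting 0 (r + 4). set (flags c))" using t(4) merge_flags(1)[OF tc(1)] by blast
    qed
  qed (simp add: finite_inner)
  also have "\<dots> = (\<Sum>c\<in>meeting 0 (r + 4). length (flags c))"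
    by (rule flag_total, rule packed_subset[OF packed_Y]) (auto simp: meeting_def)
  finally show ?thesis .
qed

text \<open>
  A cell of a copy lies in the supertile of some sector at \<open>x\<close>, of level at most 4, so it is near \<open>x\<close> and hence meets the larger disc.
\<close>

lemma present_in_polys:
  assumes x: "x \<in> verts (j + 2) r" and r: "r + 300 \<le> R" "r + 290 \<le> r'" and j: "j + 2 \<le> N" "j \<le> 2"
    and L: "all_present (two_wedges (patch j)) L" "\<forall>(c, _)\<in>set L. poly_cell c" and l: "l < length L"
  shows "shift x ((rot_cell ^^ i) (fst (L ! l))) \<in> polys r'"
proof -
  obtain y where y: "x = (sil ^^ (j + 2)) y" "star (Y (j + 2)) y"
    using verts_star[OF x _ j(1)] r(1) by auto
  define c where "c = fst (L ! l)"
  have tp: "t \<in> set (two_wedges (patch j)) \<Longrightarrow> tile_cell t" for t using tile_cell_patch tile_cell_rot by (auto simp: two_wedges_def)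
  have "L ! l \<in> set L" using l by simp
  then have "present (two_wedges (patch j)) c" "poly_cell c" using L by (auto simp: all_present_def c_def case_prod_unfold)
  then obtain t where t: "t \<in> set (two_wedges (patch j))" "mirror t \<in> set (two_wedges (patch j))" "merge t = c"
    using presentD[OF _ tp] by blast
  have inY: "shift x ((rot_cell ^^ i) t) \<in> Y 0" if t: "t \<in> set (two_wedges (patch j))" for t
  proof -
    consider "t \<in> set (patch j)" | t' where "t' \<in> set (patch j)" "t = rot_cell t'" using t by (auto simp: two_wedges_def)
    then show ?thesis
    proof cases
      case 1 then show ?thesis using star_patch[OF y(2) j(1)] y(1) by simp
    next
      case 2
      then have "(rot_cell ^^ i) t = (rot_cell ^^ Suc i) t'" by (simp add: funpow_swap1)
      then show ?thesis using star_patch[OF y(2) j(1) 2(1), of "Suc i"] y(1) by simp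
    qed
  qed
  define T where "T = shift x ((rot_cell ^^ i) t)"
  have tt: "tile_cell t" using tp t by blast
  have T: "T \<in> Y 0" "mirror T \<in> Y 0" "merge T = shift x ((rot_cell ^^ i) c)"
    using inY[OF t(1)] inY[OF t(2)] merge_rot_pow[OF tt, of i] t(3) by (simp_all add: T_def mirror_shift merge_shift)
  have "\<exists>z\<in>region T. dist (emb x) z \<le> 4 * silver ^ (j + 2)"
  proof -
    have "T \<in> (inflate ^^ (j + 2)) {a} \<Longrightarrow> a \<in> Y (j + 2) \<Longrightarrow> emb x \<in> scaled (j + 2) a \<Longrightarrow> ?thesis" for a
    proof -
      assume a: "T \<in> (inflate ^^ (j + 2)) {a}" "a \<in> Y (j + 2)" "emb x \<in> scaled (j + 2) a"
      obtain z where z: "z \<in> region T" using interior_region_nonempty[OF tile_cell_Y[OF T(1)]] interior_subset by blast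
      have "z \<in> scaled (j + 2) a" using scaled_iterate[OF tile_cell_Y[OF a(2)] a(1), of 0] z by (auto simp: scaled_0)
      then show ?thesis using scaled_diameter[OF tile_cell_Y[OF a(2)] a(3)] z by blast
    qed
    moreover have "\<exists>a\<in>Y (j + 2). T \<in> (inflate ^^ (j + 2)) {a} \<and> emb x \<in> scaled (j + 2) a"
    proof -
      obtain t' m where t': "t' \<in> set (patch j)" "T = shift x ((rot_cell ^^ m) t')"
      proof -
        consider "t \<in> set (patch j)" | t' where "t' \<in> set (patch j)" "t = rot_cell t'" using t(1) by (auto simp: two_wedges_def)
        then show ?thesis
        proof cases
          case 1 then show ?thesis using that[of t i] by (simp add: T_def)
        next
          case 2 then show ?thesis using that[of t' "Suc i"] by (simp add: T_def funpow_swap1)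
        qed
      qed
      define k where "k = (rot ^^ m) one"
      have k: "k \<in> set dirs" "wedge k = map (rot_cell ^^ m) (wedge one)" using wedge_rot_pow k_def by auto
      obtain a where a: "a \<in> Y (j + 2)" "(y, k) \<in> set (flags a)" using y k by (auto simp: star_def)
      have "shift (sil (sil y)) ((rot_cell ^^ m) t'') \<in> (inflate ^^ 2) {a}" if "t'' \<in> set (patch 0)" for t''
      proof -
        have "(rot_cell ^^ m) t'' \<in> set (wedge k)" using that k(2) by (simp add: patch_def)
        then have "shift (sil (sil y)) ((rot_cell ^^ m) t'') \<in> set (inflate_cells (inflate_cell a))"
          by (rule wedge_in_inflate_cell[OF tile_cell_Y[OF a(1)] a(2)])
        then obtain d where "d \<in> set (inflate_cell a)" "shift (sil (sil y)) ((rot_cell ^^ m) t'') \<in> set (inflate_cell d)"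
          by (auto simp: inflate_cells_def)
        then have "shift (sil (sil y)) ((rot_cell ^^ m) t'') \<in> inflate (inflate {a})" using inflate_cell_member by blast
        then show ?thesis by (simp add: numeral_2_eq_2)
      qed
      from patch_grow[OF this t'(1)] have "shift ((sil ^^ j) (sil (sil y))) ((rot_cell ^^ m) t') \<in> (inflate ^^ j) ((inflate ^^ 2) {a})" .
      moreover have "(sil ^^ j) (sil (sil y)) = x" unfolding y(1)
        by (simp only: funpow_add comp_apply numeral_2_eq_2 funpow.simps id_apply)
      ultimately have "T \<in> (inflate ^^ (j + 2)) {a}" by (simp only: t'(2) funpow_add comp_apply)
      moreover have "emb x \<in> scaled (j + 2) a"
        using flag_in_region[OF tile_cell_Y[OF a(1)] a(2)] unfolding y(1) scaled_def emb_sil_pow by (rule imageI)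
      ultimately show ?thesis using a(1) by blast
    qed
    ultimately show ?thesis by blast
  qed
  then obtain z where z: "z \<in> region T" "dist (emb x) z \<le> 4 * silver ^ (j + 2)" by blast
  \<comment> \<open>The cells of a copy are within \<open>4 * silver ^ 4 < 140\<close> of its vertex.\<close>
  have "silver ^ (j + 2) \<le> silver ^ 4" using j(2) silver_gt by (intro power_increasing) auto
  also have "silver ^ 4 \<le> 3 ^ 4" using sqrt2_less_2 by (intro power_mono) (auto simp: silver_def)
  finally have "dist (emb x) z \<le> 324" using z(2) by simp
  have s4: "silver ^ 4 = 17 + 12 * sqrt 2" by (simp add: silver_def eval_nat_numeral algebra_simps)
  have "sqrt 2 < 1.5" by (rule real_less_lsqrt) (auto simp: power2_eq_square)
  then have "dist (emb x) z \<le> 140" using z(2) \<open>silver ^ (j + 2) \<le> silver ^ 4\<close> s4 by linarith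
  moreover have "dist \<beta> (emb x) \<le> r" using x by (auto simp: verts_def dist_norm norm_minus_commute)
  ultimately have "dist \<beta> z \<le> r'" using dist_triangle[of \<beta> z "emb x"] r(2) by linarith
  then have "cell_hull (merge T) \<inter> cball \<beta> r' \<noteq> {}" using cell_hull_merge[OF tile_cell_Y[OF T(1)]] z(1) by auto
  then have "merge T \<in> polys r'" using T(1,2) by (auto simp: polys_def)
  then show ?thesis by (simp add: T(3) c_def)
qed

text \<open>
  Vertices of level \<open>j\<close> are \<open>silver ^ j\<close> times surrounded vertices.
\<close>

lemma vert_distance:
  assumes "x \<in> verts j r" "x' \<in> verts j r" "x \<noteq> x'" "r < R" "j \<le> N"
  shows "silver ^ (2 * j) \<le> 2 * (cmod (emb x - emb x'))\<^sup>2"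
proof -
  obtain y where y: "x = (sil ^^ j) y" "star (Y j) y" using verts_star assms by blast
  obtain y' where y': "x' = (sil ^^ j) y'" "star (Y j) y'" using verts_star assms by blast
  have "1 \<le> 2 * (cmod (emb y - emb y'))\<^sup>2" using star_distance[OF packed_Y y(2) y'(2)] y y' assms(3) by auto
  moreover have "emb x - emb x' = silver ^ j *\<^sub>R (emb y - emb y')" by (simp add: y y' emb_sil_pow scaleR_diff_right)
  then have "(cmod (emb x - emb x'))\<^sup>2 = silver ^ (2 * j) * (cmod (emb y - emb y'))\<^sup>2"
    using silver_pow_ge(2)[of j] by (simp add: power_mult_distrib power_mult[symmetric] mult.commute)
  ultimately show ?thesis using silver_pow_ge(2)[of "2 * j"] by (simp add: mult_le_cancel_left1)
qed

lemma near_same: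
  assumes "near (a, b) d" "silver ^ (2 * j) = real_of_int a + b * sqrt 2"
    "x \<in> verts j r" "x + d \<in> verts j r" "r < R" "j \<le> N"
  shows "d = 0"
proof (rule ccontr)
  assume "d \<noteq> 0"
  obtain m n where mn: "sqnorm d = (m, n)" by fastforce
  have "silver ^ (2 * j) \<le> 2 * (cmod (emb x - emb (x + d)))\<^sup>2" using vert_distance[OF assms(3,4) _ assms(5,6)] \<open>d \<noteq> 0\<close> by simp
  also have "emb x - emb (x + d) = - emb d" by (simp add: emb_add)
  finally have "real_of_int a + b * sqrt 2 \<le> 2 * (m + n * sqrt 2)" using sqnorm_emb[OF mn] assms(2) by simp
  then have "nonneg_rt2 (2 * m - a, 2 * n - b)" by (simp only: nonneg_rt2_iff) (simp add: algebra_simps)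
  then show False using assms(1) mn by (simp add: near_def del: nonneg_rt2.simps)
qed

text \<open>
  A vertex of level two or three is surrounded by eight rhombi with an acute corner there. The witness is a cell of the
  patch at \<open>x\<close> that contains \<open>x + d\<close>, so it would be one of them.
\<close>

lemma refuted_contradiction:
  assumes "refuted witnesses d" "x \<in> verts 4 r" "x + d \<in> verts j r" "j \<in> {2, 3}" "r < R" "4 \<le> N"
  shows False
proof -
  obtain i t where it: "(i, t) \<in> set witnesses" "inside d ((rot_cell ^^ i) t)" "\<forall>k\<in>set dirs. (rot_cell ^^ i) t \<noteq> rh d k"
    using assms(1) by (auto simp: refuted_def Let_def)
  define c where "c = shift x ((rot_cell ^^ i) t)"
  obtain y where y: "x = (sil ^^ (2 + 2)) y" "star (Y (2 + 2)) y" using verts_star[OF assms(2,5)] assms(6) by auto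
  have "t \<in> set (patch 2)" using witnesses_patch it by blast
  then have c: "c \<in> Y 0" using star_patch[OF y(2)] assms(6) y(1) by (simp add: c_def)
  define z where "z = x + d"
  have "emb z \<in> region c"
    using it(2) by (auto simp: c_def region_def inside_def boundary_shift z_def nonneg_rt2_side[symmetric] algebra_simps simp del: nonneg_rt2.simps)
  obtain m where m: "j = m + 2" "m \<in> {0, 1}" using assms(4) by auto
  obtain y' where y': "z = (sil ^^ (m + 2)) y'" "star (Y (m + 2)) y'"
    using verts_star[OF assms(3,5)] assms(4,6) m by (auto simp: z_def)
  have rhY: "rh z k \<in> Y 0 \<and> (z, k) \<in> set (flags (rh z k))" if "k \<in> set dirs" for k
  proof -
    have "one \<in> set dirs" by (simp add: one_def dirs_def)
    then have "\<exists>j<8. (rot ^^ j) one = k" using that by (rule dirs_orbit)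
    then obtain l where l: "l < 8" "(rot ^^ l) one = k" by blast
    have r1: "rh 0 one \<in> set (patch m)"
      using m(2) star_rhombus by (auto simp: patch_def one_def dirs_def simp del: rot.simps)
    have "(rot_cell ^^ l) (rh 0 one) = rh 0 k"
    proof -
      have "(rot ^^ l) 0 = 0" by (induction l) (simp_all add: rot_add del: rot.simps)
      then show ?thesis using rot_cell_pow_rh[OF \<open>one \<in> set dirs\<close>, of l 0] l by simp
    qed
    then have "shift z (rh 0 k) \<in> Y 0" using star_patch[OF y'(2) _ r1, of l] assms(6) m y'(1) by auto
    moreover have "(z, k) \<in> set (flags (shift z (rh 0 k)))" using star_rhombus that by (auto simp: flags_shift_iff)
    ultimately show ?thesis by (simp add: shift_rh)
  qed
  then have "star (Y 0) z" unfolding star_def by blast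
  then obtain k where k: "(z, k) \<in> set (flags c)" using star_corner[OF packed_Y _ c \<open>emb z \<in> region c\<close>] by blast
  have kd: "k \<in> set dirs" using flags_dirs[OF tile_cell_Y[OF c] k] .
  have "c = rh z k" using packed_flag_unique[OF packed_Y c _ k] rhY[OF kd] by blast
  then have "shift x ((rot_cell ^^ i) t) = shift x (rh d k)" by (simp add: c_def z_def shift_rh add.commute)
  then show False using it(3) kd by (simp add: shift_inj)
qed

definition level_norm :: "nat \<Rightarrow> int \<times> int" where
  "level_norm l = (if l = 2 then (17, 12) else if l = 3 then (99, 70) else (577, 408))"

lemma level_norm: "l \<in> {2, 3, 4} \<Longrightarrow> silver ^ (2 * l) = real_of_int (fst (level_norm l)) + snd (level_norm l) * sqrt 2"
proof -
  have s2: "silver\<^sup>2 = 3 + 2 * sqrt 2" by (simp add: silver_def power2_eq_square algebra_simps)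
  have s4: "silver ^ 4 = 17 + 12 * sqrt 2"
  proof -
    have "silver ^ 4 = (silver\<^sup>2)\<^sup>2" by simp
    then show ?thesis unfolding s2 by (simp add: power2_eq_square algebra_simps)
  qed
  have s6: "silver ^ 6 = 99 + 70 * sqrt 2"
  proof -
    have "silver ^ 6 = silver ^ 4 * silver\<^sup>2" by (simp flip: power_add)
    then show ?thesis unfolding s2 s4 by (simp add: algebra_simps)
  qed
  have s8: "silver ^ 8 = 577 + 408 * sqrt 2"
  proof -
    have "silver ^ 8 = silver ^ 4 * silver ^ 4" by (simp flip: power_add)
    then show ?thesis unfolding s4 by (simp add: algebra_simps)
  qed
  assume "l \<in> {2, 3, 4}"
  then show ?thesis using s4 s6 s8 by (auto simp: level_norm_def)
qed

text \<open>
  All copies of functions of \<open>m\<close> kinds at the vertices of the respective levels, ranked by kind. An overlap with the pivot of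
  another copy fixes the difference of the two vertices to one of finitely many lattice vectors, and the last hypothesis excludes each of
  them, by distance or by a witness.
\<close>

lemma triangular_family:
  fixes m :: nat and lev :: "nat \<Rightarrow> nat" and dat :: "nat \<Rightarrow> entry list" and sgn :: "nat \<Rightarrow> int" and piv :: "nat \<Rightarrow> cell"
  assumes N: "4 \<le> N" and r: "\<rho> + 300 \<le> R" "\<rho> + 290 \<le> r"
    and lev: "\<And>i. i < m \<Longrightarrow> lev i \<in> {2, 3, 4}"
    and eig: "\<And>i. i < m \<Longrightarrow> local_eigen lam (sgn i) (dat i)"
    and sgn: "\<And>i. i < m \<Longrightarrow> sgn i * sgn i = 1"
    and pres: "\<And>i. i < m \<Longrightarrow> all_present (two_wedges (patch (lev i - 2))) (dat i)"
    and poly: "\<And>i. i < m \<Longrightarrow> \<forall>(c, _)\<in>set (dat i). poly_cell c"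
    and piv: "\<And>i. i < m \<Longrightarrow> \<exists>l<length (dat i). piv i = fst (dat i ! l)"
    and val: "\<And>i. i < m \<Longrightarrow> val_at (sgn i) (dat i) (piv i) \<noteq> 0"
    and tri: "\<And>i j d. i < m \<Longrightarrow> j \<le> i \<Longrightarrow> d \<in> set (occurrences (piv i) (dat j)) \<Longrightarrow>
       (lev j = lev i \<and> near (level_norm (lev i)) d \<and> (j \<noteq> i \<longrightarrow> d \<noteq> 0)) \<or>
       (refuted witnesses d \<and> lev i = 4 \<and> lev j \<in> {2, 3})"
  defines "I \<equiv> (SIGMA i:{..<m}. verts (lev i) \<rho>)"
  defines "\<psi> \<equiv> \<lambda>(i, x). psi (sgn i) (dat i) x"
  defines "pivot \<equiv> \<lambda>(i, x). shift x (piv i)"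
  shows "finite I" "card I = (\<Sum>i<m. card (verts (lev i) \<rho>))"
    "\<And>i v. i \<in> I \<Longrightarrow> v \<in> polys r \<Longrightarrow> (\<Sum>w | w \<in> polys r \<and> adj w v. \<psi> i v - \<psi> i w) = (4 - lam) * \<psi> i v"
    "\<And>i. i \<in> I \<Longrightarrow> pivot i \<in> polys r \<and> \<psi> i (pivot i) \<noteq> 0"
    "\<And>i j. i \<in> I \<Longrightarrow> j \<in> I \<Longrightarrow> i \<noteq> j \<Longrightarrow> fst j \<le> fst i \<Longrightarrow> \<psi> j (pivot i) = 0"
proof -
  show "finite I" unfolding I_def using finite_verts by (intro finite_SigmaI) auto
  show "card I = (\<Sum>i<m. card (verts (lev i) \<rho>))" unfolding I_def using finite_verts by (intro card_SigmaI) auto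
  have inV: "shift x ((rot_cell ^^ j) (fst (dat i ! l))) \<in> polys r" if "i < m" "x \<in> verts (lev i) \<rho>" "l < length (dat i)" for i x j l
  proof -
    have l2: "lev i - 2 + 2 = lev i" "lev i - 2 \<le> 2" "lev i \<le> 4" using lev[OF that(1)] by auto
    have x2: "x \<in> verts (lev i - 2 + 2) \<rho>" using that(2) l2 by simp
    show ?thesis
      by (rule present_in_polys[OF x2 r _ l2(2) pres[OF that(1)] poly[OF that(1)] that(3)]) (use l2 N in auto)
  qed
  fix i assume "i \<in> I"
  then obtain a x where i: "i = (a, x)" "a < m" "x \<in> verts (lev a) \<rho>" by (auto simp: I_def simp del: split_paired_Ex split_paired_All)
  interpret P: patch_in "polys r" "dat a" lam "sgn a" x
    using finite_polys poly_cell_polys polys_flags_unique eig[OF i(2)] sgn[OF i(2)] inV[OF i(2,3)]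
    by unfold_locales auto
  show "(\<Sum>w | w \<in> polys r \<and> adj w v. \<psi> i v - \<psi> i w) = (4 - lam) * \<psi> i v" if "v \<in> polys r" for v
    using P.eigenfunction[OF that] by (simp add: \<psi>_def i)
  obtain l where l: "l < length (dat a)" "piv a = fst (dat a ! l)" using piv[OF i(2)] by blast
  show "pivot i \<in> polys r \<and> \<psi> i (pivot i) \<noteq> 0"
    using inV[OF i(2,3) l(1), of 0] val[OF i(2)] l(2) by (simp add: \<psi>_def pivot_def i psi_at)
  fix j assume "j \<in> I" "i \<noteq> j" "fst j \<le> fst i"
  obtain b z where jz: "j = (b, z)" by (rule prod.exhaust)
  have j: "j = (b, z)" "b < m" "z \<in> verts (lev b) \<rho>" "b \<le> a" "\<not> (b = a \<and> z = x)"
    using jz i(1) \<open>j \<in> I\<close> \<open>i \<noteq> j\<close> \<open>fst j \<le> fst i\<close> by (auto simp: I_def)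
  show "\<psi> j (pivot i) = 0"
  proof (rule ccontr)
    assume "\<psi> j (pivot i) \<noteq> 0"
    then have "psi (sgn b) (dat b) z (shift x (piv a)) \<noteq> 0" by (simp add: \<psi>_def pivot_def i j)
    then obtain d where d: "d \<in> set (occurrences (piv a) (dat b))" "z = x + d" using psi_occurrences by blast
    have rR: "\<rho> < R" using r by simp
    from tri[OF i(2) j(4) d(1)] show False
    proof (elim disjE conjE)
      assume *: "lev b = lev a" "near (level_norm (lev a)) d" "b \<noteq> a \<longrightarrow> d \<noteq> 0"
      have "near (fst (level_norm (lev a)), snd (level_norm (lev a))) d" using *(2) by simp
      then have "d = 0"
      proof (rule near_same[where j = "lev a" and r = \<rho> and x = x])
        show "silver ^ (2 * lev a) = real_of_int (fst (level_norm (lev a))) + snd (level_norm (lev a)) * sqrt 2"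
          by (rule level_norm[OF lev[OF i(2)]])
        show "x \<in> verts (lev a) \<rho>" by (rule i(3))
        show "x + d \<in> verts (lev a) \<rho>" using j(3) d(2) *(1) by simp
        show "lev a \<le> N" using lev[OF i(2)] N by auto
      qed (rule rR)
      then show False using *(3) d(2) j(5) by auto
    next
      assume *: "refuted witnesses d" "lev a = 4" "lev b \<in> {2, 3}"
      have "x \<in> verts 4 \<rho>" using i(3) *(2) by simp
      moreover have "x + d \<in> verts (lev b) \<rho>" using j(3) d(2) by simp
      ultimately show False by (rule refuted_contradiction[OF *(1) _ _ *(3) rR N])
    qed
  qed
qed

end

section \<open>Lattice cells as tiles\<close>

text \<open>
  Squares are unions of two tiles, so \<open>Sq\<close> gets a default value.
\<close>

fun tile_of :: "cell \<Rightarrow> tile" where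
  "tile_of (Rh p u) = rhombus (emb p) (emb (p + u)) (emb (p + u + rot u)) (emb (p + rot u))"
| "tile_of (Hs p u b) = HalfSquare (emb p) (emb (p + u)) (emb (p + u + (if b then rot (rot u) else - rot (rot u))))"
| "tile_of (Sq p u) = undefined"

lemma tile_of_rh: "u \<in> set dirs \<Longrightarrow> tile_of (rh p u) = rhombus (emb p) (emb (p + u)) (emb (p + u + rot u)) (emb (p + rot u))"
  by (auto simp: rh_def rhombus_def rot_add algebra_simps insert_commute simp del: rot.simps)

lemma support_tile_of: "tile_cell c \<Longrightarrow> support (tile_of c) = region c"
proof -
  assume c: "tile_cell c"
  have "support (tile_of c) = cell_hull c"
  proof (cases c)
    case (Rh p u)
    have "{emb p, emb (p + u + rot u)} \<union> {emb (p + u), emb (p + rot u)} =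
       {emb p, emb p + emb u, emb p + emb u + emb (rot u), emb p + emb (rot u)}"
      by (auto simp: emb_add)
    then show ?thesis by (simp add: Rh cell_hull_simps rhombus_def del: rot.simps)
  next
    case (Hs p u b)
    then show ?thesis by (cases b) (simp_all add: cell_hull_simps emb_add emb_rot_rot emb_uminus emb_diff del: rot.simps)
  qed (use c in \<open>simp add: tile_cell_iff\<close>)
  then show ?thesis using cell_hull_eq_region[OF tile_cell_unit_cell[OF c]] by simp
qed

lemma is_rhombus_tile_of:
  assumes "u \<in> set dirs"
  shows "is_rhombus (emb p) (emb (p + u)) (emb (p + u + rot u)) (emb (p + rot u))"
proof -
  have one: "cmod (emb u) = 1" "cmod (emb (rot u)) = 1" using emb_dir dirs_rot assms by blast+
  have "emb u \<bullet> emb (rot u) = sqrt 2 / 2 * (cmod (emb u))\<^sup>2"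
    unfolding cmod_power2 by (simp add: emb_rot zeta_def inner_complex_def power2_eq_square algebra_simps)
  then show ?thesis using one by (simp add: is_rhombus_def emb_add dist_norm cos_45)
qed

definition move :: "complex \<Rightarrow> complex \<Rightarrow> tile \<Rightarrow> tile" where "move a b = map_tile (\<lambda>z. a * z + b)"

lemma map_tile_comp: "map_tile f (map_tile g t) = map_tile (f \<circ> g) t"
  by (cases t) (simp_all add: image_image comp_def)

lemma map_tile_id: "(\<And>z. f z = z) \<Longrightarrow> map_tile f t = t"
  by (cases t) simp_all

lemma move_compose: "move a b (move a' b' t) = move (a * a') (a * b' + b) t"
  by (simp add: move_def map_tile_comp comp_def algebra_simps)

lemma move_id: "move 1 0 t = t"
  by (simp add: move_def map_tile_id)

lemma move_rhombus: "move a b (rhombus A B C D) = rhombus (a * A + b) (a * B + b) (a * C + b) (a * D + b)"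
  by (simp add: move_def rhombus_def)

lemma rhombus_pieces_move:
  "rhombus_pieces (a * A + b) (a * B + b) (a * C + b) (a * D + b) = move a b ` rhombus_pieces A B C D"
proof -
  have s: "(a * X + b - (a * Y + b)) /\<^sub>R silver = a * ((X - Y) /\<^sub>R silver)" for X Y
    by (simp add: scaleR_conv_of_real algebra_simps)
  show ?thesis
    unfolding rhombus_pieces_def Let_def s image_insert image_empty move_rhombus
    by (simp add: move_def algebra_simps)
qed

lemma half_square_pieces_move:
  "half_square_pieces (a * V + b) (a * S + b) (a * W + b) = move a b ` half_square_pieces V S W"
proof -
  have s: "(a * X + b - (a * Y + b)) /\<^sub>R silver = a * ((X - Y) /\<^sub>R silver)" for X Y
    by (simp add: scaleR_conv_of_real algebra_simps)
  have t: "(a * X + a * Y) /\<^sub>R sqrt 2 = a * ((X + Y) /\<^sub>R sqrt 2)" for X Y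
    by (simp add: scaleR_conv_of_real algebra_simps)
  show ?thesis
    unfolding half_square_pieces_def Let_def s t image_insert image_empty move_rhombus
    by (simp add: move_def algebra_simps)
qed

lemma is_rhombus_iff:
  "is_rhombus A B C D \<longleftrightarrow> B - A = C - D \<and> cmod (B - A) = 1 \<and> cmod (D - A) = 1 \<and> (B - A) \<bullet> (D - A) = sqrt 2 / 2"
  unfolding is_rhombus_def dist_norm cos_45 norm_minus_commute[of A] ..

lemma is_rhombus_move:
  assumes "cmod a = 1" "is_rhombus A B C D"
  shows "is_rhombus (a * A + b) (a * B + b) (a * C + b) (a * D + b)"
proof -
  have i: "(a * x) \<bullet> (a * y) = x \<bullet> y" for x y
  proof -
    have "(a * x) \<bullet> (a * y) = (cmod a)\<^sup>2 * (x \<bullet> y)"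
      unfolding cmod_power2 by (simp add: inner_complex_def power2_eq_square algebra_simps)
    then show ?thesis by (simp add: assms)
  qed
  have d: "a * X + b - (a * Y + b) = a * (X - Y)" for X Y by (simp add: algebra_simps)
  have r: "B - A = C - D" "cmod (B - A) = 1" "cmod (D - A) = 1" "(B - A) \<bullet> (D - A) = sqrt 2 / 2"
    using assms(2) unfolding is_rhombus_iff by blast+
  show ?thesis unfolding is_rhombus_iff d
    by (intro conjI) (simp_all only: norm_mult i assms(1) mult_1 r(2-4), simp only: r(1))
qed

lemma sil_diff: "sil (p - q) = sil p - sil q"
  by (simp add: sil_def rt2_def rot_add algebra_simps del: rot.simps)

text \<open>
  \<open>inflate_cell\<close> is the substitution in lattice coordinates. Points obtained by dividing by \<open>silver\<close> become lattice points after
  the expansion.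
\<close>

lemma dissect_tile_of: "tile_cell c \<Longrightarrow> (\<lambda>t. map_tile ((*\<^sub>R) silver) t) ` dissect (tile_of c) = tile_of ` set (inflate_cell c)"
proof (cases c)
  case (Rh p u)
  assume "tile_cell c"
  then have u: "u \<in> set dirs" using Rh by (simp add: tile_cell_iff)
  define v w x where "v = rot u" "w = rot v" "x = rot w"
  note vwx = this
  have d: "u \<in> set dirs" "- u \<in> set dirs" "w \<in> set dirs" unfolding vwx by (simp_all only: dirs_rot u)
  have r: "rot u = v" "rot v = w" "rot w = x" "rot (- u) = - v" unfolding vwx by (simp_all only: rot_add)
  have sl: "sil u = u + v - x" "sil v = v + w + u" "sil w = w + x + v"
    by (simp_all add: sil_def rt2_def vwx rot8 rot_add del: rot.simps)
  have minus_r: "rot x = - u" by (simp add: vwx rot8 del: rot.simps)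
  have q: "silver *\<^sub>R (emb y + emb u /\<^sub>R silver + emb v /\<^sub>R silver) = emb (sil y + u + v)"
    "silver *\<^sub>R (emb y + emb u /\<^sub>R silver) = emb (sil y + u)"
    "silver *\<^sub>R (emb y + emb v /\<^sub>R silver) = emb (sil y + v)"
    "silver *\<^sub>R (emb y - emb u /\<^sub>R silver - emb v /\<^sub>R silver) = emb (sil y - u - v)"
    "silver *\<^sub>R (emb y - emb u /\<^sub>R silver) = emb (sil y - u)"
    "silver *\<^sub>R (emb y - emb v /\<^sub>R silver) = emb (sil y - v)"
    "silver *\<^sub>R (emb y) = emb (sil y)" for y
    using silver_gt by (simp_all add: emb_add emb_diff emb_sil scaleR_add_right scaleR_diff_right)
  have map_rhombus: "map_tile ((*\<^sub>R) silver) (rhombus A B C D) = rhombus (silver *\<^sub>R A) (silver *\<^sub>R B) (silver *\<^sub>R C) (silver *\<^sub>R D)" for A B C D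
    by (simp add: rhombus_def)
  have "dissect (tile_of c) = rhombus_pieces (emb p) (emb (p + u)) (emb (p + u + v)) (emb (p + v))"
    unfolding Rh tile_of.simps vwx by (rule dissect_rhombus[OF is_rhombus_tile_of[OF u]])
  moreover have "emb (p + u) - emb p = emb u" "emb (p + v) - emb p = emb v" by (simp_all add: emb_add)
  ultimately have "(\<lambda>t. map_tile ((*\<^sub>R) silver) t) ` dissect (tile_of c) =
     {rhombus (emb (sil p)) (emb (sil p + u)) (emb (sil p + u + v)) (emb (sil p + v)),
      rhombus (emb (sil (p + u + v))) (emb (sil (p + u + v) - u)) (emb (sil (p + u + v) - u - v)) (emb (sil (p + u + v) - v)),
      rhombus (emb (sil (p + u))) (emb (sil p + u + v)) (emb (sil (p + v))) (emb (sil (p + u + v) - u - v)),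
      HalfSquare (emb (sil (p + u))) (emb (sil p + u + v)) (emb (sil p + u)),
      HalfSquare (emb (sil (p + v))) (emb (sil p + u + v)) (emb (sil p + v)),
      HalfSquare (emb (sil (p + u))) (emb (sil (p + u + v) - u - v)) (emb (sil (p + u + v) - v)),
      HalfSquare (emb (sil (p + v))) (emb (sil (p + u + v) - u - v)) (emb (sil (p + u + v) - u))}"
    by (simp only: rhombus_pieces_def Let_def image_insert image_empty map_rhombus map_tile.simps q)
  also have "\<dots> = tile_of ` set (inflate_cell c)"
    unfolding Rh inflate_cell.simps Let_def set_simps image_insert image_empty r tile_of_rh[OF d(1)] tile_of_rh[OF d(2)] tile_of_rh[OF d(3)] tile_of.simps
    by (intro arg_cong2[where f = insert] refl)
      (simp_all add: sil_add sl rhombus_def doubleton_eq_iff emb_inj rot_add r minus_r algebra_simps del: rot.simps)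
  finally show ?thesis .
next
  case (Hs p u b)
  assume "tile_cell c"
  then have u: "u \<in> set dirs" using Hs by (simp add: tile_cell_iff)
  define v w x where "v = rot u" "w = rot v" "x = rot w"
  note vwx = this
  have d: "u \<in> set dirs" "w \<in> set dirs" "- x \<in> set dirs" "- v \<in> set dirs" unfolding vwx by (simp_all only: dirs_rot u)
  have r: "rot u = v" "rot v = w" "rot w = x" "rot x = - u" "rot (- x) = u" "rot (- v) = - w" "rot (- w) = - x" "rot (- u) = - v"
    unfolding vwx by (simp_all only: rot_add rot8 minus_minus)
  have sl: "sil u = u + v - x" "sil v = v + w + u" "sil w = w + x + v" "sil (- w) = - w - x - v"
    by (simp_all add: sil_def rt2_def rot_add r del: rot.simps)
  have map_rhombus: "map_tile ((*\<^sub>R) silver) (rhombus A B C D) = rhombus (silver *\<^sub>R A) (silver *\<^sub>R B) (silver *\<^sub>R C) (silver *\<^sub>R D)" for A B C D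
    by (simp add: rhombus_def)
  define w' where "w' = (if b then w else - w)"
  define m where "m = (if b then v else - x)"
  have m: "rt2 m = u + w'" by (cases b) (simp_all add: m_def w'_def rt2_def rot_add r del: rot.simps)
  have "emb u /\<^sub>R silver + emb w' /\<^sub>R silver = (sqrt 2 * emb m) /\<^sub>R silver"
    using arg_cong[OF m, of emb] by (simp add: emb_rt2 emb_add scaleR_add_right)
  then have mm: "(emb u /\<^sub>R silver + emb w' /\<^sub>R silver) /\<^sub>R sqrt 2 = emb m /\<^sub>R silver"
    by (simp add: scaleR_conv_of_real)
  have q: "silver *\<^sub>R (y' + z') = silver *\<^sub>R y' + silver *\<^sub>R z'" "silver *\<^sub>R (emb y /\<^sub>R silver) = emb y" "silver *\<^sub>R emb y = emb (sil y)" for y' z' :: complex and y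
    using silver_gt by (simp_all add: emb_sil scaleR_add_right)
  have "dissect (tile_of c) = half_square_pieces (emb p) (emb (p + u)) (emb (p + u + w'))"
    by (simp add: Hs w'_def r del: rot.simps)
  moreover have "emb (p + u) - emb p = emb u" "emb (p + u + w') - emb (p + u) = emb w'" by (simp_all add: emb_add)
  ultimately have "(\<lambda>t. map_tile ((*\<^sub>R) silver) t) ` dissect (tile_of c) =
     {rhombus (emb (sil p)) (emb (sil p + u)) (emb (sil p + u + m)) (emb (sil p + m)),
      rhombus (emb (sil (p + u))) (emb (sil (p + u) + w')) (emb (sil p + u + w' + m)) (emb (sil p + u + m)),
      HalfSquare (emb (sil p + u + w' + m)) (emb (sil p + u + m)) (emb (sil p + m)),
      HalfSquare (emb (sil (p + u))) (emb (sil p + u + m)) (emb (sil p + u)),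
      HalfSquare (emb (sil (p + u + w'))) (emb (sil p + u + w' + m)) (emb (sil (p + u) + w'))}"
    by (simp only: half_square_pieces_def Let_def image_insert image_empty map_rhombus map_tile.simps mm q emb_add[symmetric])
  also have "\<dots> = tile_of ` set (inflate_cell c)"
  proof (cases b)
    case True
    then show ?thesis
      unfolding Hs inflate_cell.simps Let_def set_simps image_insert image_empty r if_P[OF True] tile_of_rh[OF d(1)] tile_of_rh[OF d(2)] tile_of.simps
      by (intro arg_cong2[where f = insert] refl)
        (simp_all add: sil_add sil_diff sl rhombus_def doubleton_eq_iff emb_inj m_def w'_def rot_add r algebra_simps del: rot.simps)
  next
    case False
    then have "\<not> b" by simp
    then show ?thesis
      unfolding Hs inflate_cell.simps Let_def if_not_P[OF \<open>\<not> b\<close>] set_simps image_insert image_empty r tile_of_rh[OF d(3)] tile_of_rh[OF d(4)] tile_of.simps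
      by (intro arg_cong2[where f = insert] refl)
        (simp_all add: sil_add sil_diff sl rhombus_def doubleton_eq_iff emb_inj m_def w'_def rot_add r algebra_simps del: rot.simps)
  qed
  finally show ?thesis .
qed (simp add: tile_cell_iff)

lemma substitution_place:
  assumes "\<And>c. c \<in> A \<Longrightarrow> tile_cell c" "cmod a = 1"
  shows "substitution ((\<lambda>c. move a b (tile_of c)) ` A) = (\<lambda>c. move a (silver *\<^sub>R b) (tile_of c)) ` inflate A"
proof -
  have one: "map_tile ((*\<^sub>R) silver) ` dissect (move a b (tile_of c)) = (\<lambda>c. move a (silver *\<^sub>R b) (tile_of c)) ` set (inflate_cell c)"
    if "c \<in> A" for c
  proof -
    have c: "tile_cell c" by (rule assms(1)[OF that])
    have "dissect (move a b (tile_of c)) = move a b ` dissect (tile_of c)"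
    proof (cases c)
      case (Rh p u)
      then have u: "u \<in> set dirs" using c by (simp add: tile_cell_iff)
      show ?thesis
        unfolding Rh tile_of.simps move_rhombus dissect_rhombus[OF is_rhombus_tile_of[OF u]]
          dissect_rhombus[OF is_rhombus_move[OF assms(2) is_rhombus_tile_of[OF u]]] rhombus_pieces_move ..
    next
      case (Hs p u b')
      have "move a b (HalfSquare V S W) = HalfSquare (a * V + b) (a * S + b) (a * W + b)" for V S W by (simp add: move_def)
      then show ?thesis by (simp only: Hs tile_of.simps dissect.simps half_square_pieces_move)
    qed (use c in \<open>simp add: tile_cell_iff\<close>)
    moreover have "map_tile ((*\<^sub>R) silver) (move a b t) = move a (silver *\<^sub>R b) (map_tile ((*\<^sub>R) silver) t)" for t
      by (simp add: move_def map_tile_comp comp_def scaleR_conv_of_real algebra_simps)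
    ultimately have "map_tile ((*\<^sub>R) silver) ` dissect (move a b (tile_of c)) =
        move a (silver *\<^sub>R b) ` ((\<lambda>t. map_tile ((*\<^sub>R) silver) t) ` dissect (tile_of c))" by (simp add: image_image)
    then show ?thesis unfolding dissect_tile_of[OF c] by (simp add: image_image)
  qed
  have "substitution ((\<lambda>c. move a b (tile_of c)) ` A) = (\<Union>c\<in>A. map_tile ((*\<^sub>R) silver) ` dissect (move a b (tile_of c)))"
    by (auto simp: substitution_def)
  also have "\<dots> = (\<Union>c\<in>A. (\<lambda>c. move a (silver *\<^sub>R b) (tile_of c)) ` set (inflate_cell c))" using one by simp
  finally show ?thesis by (auto simp: inflate_def)
qed

lemma substitution_iterate_place:
  assumes "tile_cell c" "cmod a = 1"
  shows "(substitution ^^ n) {move a b (tile_of c)} = (\<lambda>c. move a (silver ^ n *\<^sub>R b) (tile_of c)) ` (inflate ^^ n) {c}"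
proof (induction n)
  case (Suc n)
  have "tile_cell c'" if "c' \<in> (inflate ^^ n) {c}" for c'
    using that packed_iterate[OF packed_singleton[OF assms(1)]] by (auto simp: packed_def)
  from substitution_place[OF this assms(2), of _ "silver ^ n *\<^sub>R b"] Suc show ?case by simp
qed simp

lemma one_dirs: "one \<in> set dirs" "upper one" "emb one = 1" "emb 0 = 0"
  "emb (rot one) = zeta" "emb (rot (rot one)) = \<i>"
  by (simp_all add: one_def dirs_def emb_def zeta_def complex_eq_iff zero_prod_def)

text \<open>
  The side next to a given vertex determines the rotation. For a rhombus, the two namings by its acute corner differ by exchanging
  the neighbours, so that the second side is reached by a left turn.
\<close>

lemma tiles_place:
  assumes "t \<in> tiles"
  shows "\<exists>a b c. cmod a = 1 \<and> tile_cell c \<and> t = move a b (tile_of c)"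
proof -
  have t0: "tile_cell (Rh 0 one)" "tile_cell (Hs 0 one b)" for b using one_dirs by (simp_all add: tile_cell_iff)
  from assms consider A B C D where "is_rhombus A B C D" "t = rhombus A B C D" | V S W where "is_half_square V S W" "t = HalfSquare V S W"
    unfolding tiles_def by blast
  then show ?thesis
  proof cases
    case 1
    have rh: "\<exists>a b c. cmod a = 1 \<and> tile_cell c \<and> rhombus A B C D = move a b (tile_of c)"
      if B: "B - A = C - D" "cmod (B - A) = 1" "D - A = (B - A) * zeta" for A B C D
    proof -
      have "rhombus A B C D = move (B - A) A (tile_of (Rh 0 one))"
      proof -
        have "(B - A) * zeta + A = D" by (simp flip: B(3))
        moreover have "(B - A) * (1 + zeta) + A = B - A + D" by (simp add: distrib_left flip: B(3))
        then have "(B - A) * (1 + zeta) + A = C" by (simp add: B(1))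
        ultimately have "(B - A) * zeta + A = D" "(B - A) * (1 + zeta) + A = C" by blast+
        then show ?thesis by (simp add: move_rhombus one_dirs emb_add del: rot.simps)
      qed
      then show ?thesis using B(2) t0(1) by blast
    qed
    define u v where "u = B - A" and "v = D - A"
    have uv: "cmod u = 1" "cmod v = 1" "u \<bullet> v = sqrt 2 / 2" "B - A = C - D"
      using 1(1) unfolding is_rhombus_iff u_def v_def by blast+
    define q where "q = v * cnj u"
    have uu: "u * cnj u = 1" "v * cnj v = 1" using uv(1,2) by (simp_all add: complex_norm_square[symmetric])
    have "Re q = sqrt 2 / 2" using uv(3) by (simp add: q_def inner_complex_def algebra_simps)
    moreover have "(Re q)\<^sup>2 + (Im q)\<^sup>2 = 1"
    proof -
      have "cmod q = 1" by (simp add: q_def norm_mult uv)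
      then show ?thesis by (metis cmod_power2 one_power2)
    qed
    moreover have "(sqrt 2 / 2)\<^sup>2 = (1 / 2 :: real)" by (simp add: power_divide)
    ultimately have "(Im q)\<^sup>2 = (sqrt 2 / 2)\<^sup>2" by (simp only:)
    then have "Im q = sqrt 2 / 2 \<or> Im q = - (sqrt 2 / 2)" by (simp only: power2_eq_iff)
    then have q: "q = zeta \<or> q = cnj zeta" using \<open>Re q = _\<close> by (auto simp: zeta_def complex_eq_iff)
    have v: "v = u * q" using uu(1) by (simp add: q_def algebra_simps)
    have u: "u = v * cnj q"
    proof -
      have "v * cnj q = u * (v * cnj v)" by (simp add: q_def algebra_simps)
      then show ?thesis using uu(2) by simp
    qed
    from q show ?thesis
    proof
      assume "q = zeta"
      then show ?thesis using rh[of B A C D] uv(1,4) v 1(2) by (simp add: u_def v_def)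
    next
      assume "q = cnj zeta"
      then have "B - A = (D - A) * zeta" using u by (simp add: u_def v_def)
      moreover have "D - A = C - B" using uv(4) by (simp add: algebra_simps)
      ultimately show ?thesis using rh[of D A C B] uv(2) 1(2) rhombus_relabel(1)[of A D C B] by (simp add: v_def)
    qed
  next
    case 2
    define u v where "u = S - V" and "v = W - S"
    have uv: "cmod u = 1" "cmod v = 1" "u \<bullet> v = 0"
      using 2 by (auto simp: is_half_square_def u_def v_def dist_norm norm_minus_commute inner_diff_left inner_diff_right)
    define q where "q = v * cnj u"
    have uu: "u * cnj u = 1" using uv(1) by (simp add: complex_norm_square[symmetric])
    have "Re q = 0" using uv(3) by (simp add: q_def inner_complex_def algebra_simps)
    moreover have "(Re q)\<^sup>2 + (Im q)\<^sup>2 = 1"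
    proof -
      have "cmod q = 1" by (simp add: q_def norm_mult uv)
      then show ?thesis by (metis cmod_power2 one_power2)
    qed
    ultimately have "(Im q)\<^sup>2 = 1\<^sup>2" by simp
    then have "Im q = 1 \<or> Im q = - 1" by (simp only: power2_eq_iff)
    then have q: "q = \<i> \<or> q = - \<i>" using \<open>Re q = 0\<close> by (auto simp: complex_eq_iff)
    have v: "v = u * q" using uu(1) by (simp add: q_def algebra_simps)
    define b where "b \<longleftrightarrow> q = \<i>"
    have "u * 1 + V = S" "u * (1 + q) + V = W" using v by (simp_all add: u_def v_def algebra_simps)
    moreover have "emb (0 + one + (if b then rot (rot one) else - rot (rot one))) = 1 + q"
      using q by (auto simp: b_def emb_add emb_diff one_dirs emb_uminus complex_eq_iff simp del: rot.simps)
    ultimately have "t = move u V (tile_of (Hs 0 one b))"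
      using 2(2) by (simp add: move_def one_dirs emb_0 del: rot.simps)
    then show ?thesis using uv(1) t0(2) by blast
  qed
qed

lemma support_move: "support (move a b t) = (\<lambda>z. a * z + b) ` support t"
proof -
  have h: "(\<lambda>z. a * z + b) ` (convex hull S) = convex hull ((\<lambda>z. a * z + b) ` S)" for S
  proof -
    have "(\<lambda>z. a * z + b) ` X = (+) b ` ((*) a ` X)" for X by (auto simp: image_image add.commute)
    moreover have "linear ((*) a)" by (rule linear_times)
    ultimately show ?thesis by (simp add: convex_hull_translation convex_hull_linear_image)
  qed
  show ?thesis by (cases t) (simp_all add: move_def h image_Un)
qed

text \<open>
  The definition of an associated tiling, with the rotation and translation transferred from the patch to the supertile.
\<close>

lemma patch_in_supertile:
  assumes X: "associated_tiling X" and P: "finite P" "P \<subseteq> X"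
  obtains a b N c where "cmod a = 1" "tile_cell c" "P \<subseteq> (\<lambda>c. move a b (tile_of c)) ` (inflate ^^ N) {c}"
proof -
  obtain t n where t: "t \<in> tiles" "occurs_in P ((substitution ^^ n) {t})"
    using X P unfolding associated_tiling_def by blast
  obtain a0 b0 where 0: "cmod a0 = 1" "move a0 b0 ` P \<subseteq> (substitution ^^ n) {t}"
    using t(2) unfolding occurs_in_def move_def by blast
  obtain a1 b1 c where 1: "cmod a1 = 1" "tile_cell c" "t = move a1 b1 (tile_of c)" using tiles_place[OF t(1)] by blast
  define b2 where "b2 = silver ^ n *\<^sub>R b1"
  have in2: "move a0 b0 ` P \<subseteq> (\<lambda>c. move a1 b2 (tile_of c)) ` (inflate ^^ n) {c}"
    using 0(2) substitution_iterate_place[OF 1(2,1), of n b1] 1(3) by (simp add: b2_def)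
  have inv: "cnj a0 * a0 = 1" using 0(1) by (simp add: complex_norm_square[symmetric] mult.commute)
  have "P \<subseteq> (\<lambda>c. move (cnj a0 * a1) (cnj a0 * b2 - cnj a0 * b0) (tile_of c)) ` (inflate ^^ n) {c}"
  proof
    fix p assume "p \<in> P"
    then obtain d where d: "d \<in> (inflate ^^ n) {c}" "move a0 b0 p = move a1 b2 (tile_of d)" using in2 by blast
    have "move (cnj a0) (- cnj a0 * b0) (move a0 b0 p) = p" by (simp add: move_compose inv move_id)
    then have "p = move (cnj a0 * a1) (cnj a0 * b2 - cnj a0 * b0) (tile_of d)" by (simp add: d(2) move_compose)
    then show "p \<in> (\<lambda>c. move (cnj a0 * a1) (cnj a0 * b2 - cnj a0 * b0) (tile_of c)) ` (inflate ^^ n) {c}" using d(1) by blast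
  qed
  moreover have "cmod (cnj a0 * a1) = 1" by (simp add: norm_mult 0 1)
  ultimately show ?thesis using that 1(2) by blast
qed

text \<open>
  Tiles contain disjoint discs of a fixed size, so a bounded region meets only finitely many.
\<close>

lemma finite_meeting_ball:
  assumes "tiles_plane X"
  shows "finite {t \<in> X. support t \<inter> cball 0 r \<noteq> {}}"
proof -
  define P where "P = {t \<in> X. support t \<inter> cball 0 r \<noteq> {}}"
  have P: "t \<in> tiles" "support t \<inter> cball 0 r \<noteq> {}" if "t \<in> P" for t using that assms by (auto simp: P_def tiles_plane_def)
  have "\<exists>x. ball x (1/10) \<subseteq> support t \<and> x \<in> cball 0 (r + 4)" if t: "t \<in> P" for t
  proof -
    obtain a b c where a: "cmod a = 1" "tile_cell c" "t = move a b (tile_of c)" using tiles_place[OF P(1)[OF t]] by blast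
    have st: "support t = (\<lambda>z. a * z + b) ` region c" by (simp add: a support_move support_tile_of)
    obtain x where x: "ball x (1/10) \<subseteq> region c" using region_contains_ball[OF a(2)] by blast
    have dist: "dist (a * y + b) (a * z + b) = dist y z" for y z
      using a(1) by (simp add: dist_norm norm_mult flip: right_diff_distrib)
    have dist': "dist (a * y) (a * z) = dist y z" for y z using dist[of y z] by simp
    have "ball (a * x + b) (1/10) \<subseteq> support t"
    proof
      fix w assume w: "w \<in> ball (a * x + b) (1/10)"
      define z where "z = (w - b) / a"
      have "w = a * z + b" using a(1) by (auto simp: z_def)
      then show "w \<in> support t" using w x by (auto simp: dist' st)
    qed
    moreover obtain y where y: "y \<in> region c" "cmod (a * y + b) \<le> r" using P(2)[OF t] by (auto simp: st)
    have "x \<in> region c" using x by auto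
    then have "dist (a * x + b) (a * y + b) \<le> 4" using region_diameter[OF a(2) _ y(1)] by (simp add: dist')
    then have "cmod (a * x + b) \<le> r + 4" using y(2) norm_triangle_sub[of "a * x + b" "a * y + b"] by (simp add: dist_norm)
    ultimately show ?thesis by (intro exI[of _ "a * x + b"]) simp
  qed
  then obtain x where x: "\<And>t. t \<in> P \<Longrightarrow> ball (x t) (1/10) \<subseteq> support t \<and> x t \<in> cball 0 (r + 4)" by metis
  have far: "t = t'" if "t \<in> P" "t' \<in> P" "dist (x t) (x t') < 1/10" for t t'
  proof (rule ccontr)
    assume "t \<noteq> t'"
    have "ball (x t) (1/10) \<subseteq> interior (support t)" "ball (x t') (1/10) \<subseteq> interior (support t')"
      using x[OF that(1)] x[OF that(2)] by (simp_all add: interior_maximal)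
    moreover have "x t \<in> ball (x t) (1/10)" "x t \<in> ball (x t') (1/10)" using that(3) by (auto simp: dist_commute)
    moreover have "interior (support t) \<inter> interior (support t') = {}"
      using assms that(1,2) \<open>t \<noteq> t'\<close> by (auto simp: tiles_plane_def P_def)
    ultimately show False by blast
  qed
  have "\<exists>K. finite K \<and> cball 0 (r + 4) \<subseteq> (\<Union>k\<in>K. ball (k::complex) (1/20))"
    using compact_cball[of "0::complex" "r + 4"] unfolding compact_eq_totally_bounded by simp
  then obtain K where K: "finite K" "cball 0 (r + 4) \<subseteq> (\<Union>k\<in>K. ball (k::complex) (1/20))" by blast
  then have "\<And>t. t \<in> P \<Longrightarrow> \<exists>k\<in>K. x t \<in> ball k (1/20)" using x by blast
  then obtain f where f: "\<And>t. t \<in> P \<Longrightarrow> f t \<in> K \<and> x t \<in> ball (f t) (1/20)" by metis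
  have "inj_on f P"
  proof (rule inj_onI)
    fix t t' assume tt: "t \<in> P" "t' \<in> P" "f t = f t'"
    then have "dist (f t) (x t) < 1/20" "dist (f t) (x t') < 1/20" using f by fastforce+
    then have "dist (x t) (x t') < 1/10" using dist_triangle2[of "x t" "x t'" "f t"] by (simp add: dist_commute)
    then show "t = t'" using far tt by blast
  qed
  then show ?thesis unfolding P_def[symmetric] using f K(1) by (meson finite_imageD finite_subset image_subsetI)
qed

section \<open>Edges of parallelograms\<close>

text \<open>
  The line through the side is a supporting line, and it contains no other vertex.
\<close>

lemma parallelogram_side_face:
  fixes P U V :: complex
  assumes UV: "Im (cnj U * V) > 0"
  shows "closed_segment P (P + U) face_of convex hull {P, P + U, P + U + V, P + V}"
proof -
  define S where "S = convex hull {P, P + U, P + U + V, P + V}"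
  define n where "n = \<i> * U"
  have n: "n \<bullet> (P + s) = n \<bullet> P + Im (cnj U * s)" for s
    by (simp add: n_def inner_complex_def algebra_simps)
  have nU: "Im (cnj U * U) = 0" by simp
  have nUV: "Im (cnj U * (U + V)) = Im (cnj U * V)" by (simp add: distrib_left nU)
  have vals: "n \<bullet> (P + U) = n \<bullet> P" "n \<bullet> (P + U + V) = n \<bullet> P + Im (cnj U * V)" "n \<bullet> (P + V) = n \<bullet> P + Im (cnj U * V)"
    using n[of U] n[of "U + V"] n[of V] nU nUV by (simp_all add: add.assoc)
  have ge: "n \<bullet> z \<ge> n \<bullet> P" if "z \<in> S" for z
  proof -
    have "S \<subseteq> {z. n \<bullet> z \<ge> n \<bullet> P}"
      unfolding S_def by (rule hull_minimal) (use vals UV in \<open>auto simp: convex_halfspace_ge\<close>)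
    then show ?thesis using that by blast
  qed
  define F where "F = S \<inter> {z. n \<bullet> z = n \<bullet> P}"
  have F: "F face_of S"
    unfolding F_def by (rule face_of_Int_supporting_hyperplane_ge) (use ge in \<open>auto simp: S_def\<close>)
  then obtain W where W: "W \<subseteq> {P, P + U, P + U + V, P + V}" "F = convex hull W"
    unfolding S_def using face_of_convex_hull_subset[of "{P, P + U, P + U + V, P + V}" F]
    by (metis finite.emptyI finite_imp_compact finite_insert)
  have "W \<subseteq> {P, P + U}"
  proof
    fix z assume z: "z \<in> W"
    then have "n \<bullet> z = n \<bullet> P" using W(2) hull_inc[OF z, of convex] by (auto simp: F_def)
    then show "z \<in> {P, P + U}" using z W(1) vals UV by auto
  qed
  then have "F \<subseteq> closed_segment P (P + U)" unfolding W(2) segment_convex_hull by (rule hull_mono)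
  moreover have "P \<in> F" "P + U \<in> F" using vals(1) by (auto simp: F_def S_def hull_inc)
  then have "closed_segment P (P + U) \<subseteq> F" using W(2) by (simp add: closed_segment_subset)
  ultimately show ?thesis using F by (simp add: S_def)
qed

text \<open>
  An edge is the hull of a set of vertices. If it contained opposite vertices, it would contain the midpoint of the parallelogram, hence
  also the other two vertices, and would be two-dimensional. So it is the hull of two adjacent vertices.
\<close>

lemma parallelogram_edges:
  fixes P U V :: complex
  assumes UV: "Im (cnj U * V) > 0"
  shows "e edge_of convex hull {P, P + U, P + U + V, P + V} \<longleftrightarrow>
    e \<in> {closed_segment P (P + U), closed_segment (P + U) (P + U + V),
         closed_segment (P + U + V) (P + V), closed_segment (P + V) P}" (is "e edge_of ?S \<longleftrightarrow> e \<in> ?E")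
proof
  have UV0: "U \<noteq> 0" "V \<noteq> 0" using UV by auto
  have neg: "Im (cnj V * (- U)) > 0" "Im (cnj (- U) * (- V)) > 0" "Im (cnj (- V) * U) > 0" using UV by (simp_all add: algebra_simps)
  have "closed_segment (P + U) (P + U + V) face_of ?S"
    using parallelogram_side_face[OF neg(1), of "P + U"] by (simp add: insert_commute algebra_simps)
  moreover have "closed_segment (P + U + V) (P + V) face_of ?S"
    using parallelogram_side_face[OF neg(2), of "P + U + V"] by (simp add: insert_commute algebra_simps)
  moreover have "closed_segment (P + V) P face_of ?S"
    using parallelogram_side_face[OF neg(3), of "P + V"] by (simp add: insert_commute algebra_simps)
  moreover note parallelogram_side_face[OF UV, of P]
  moreover assume "e \<in> ?E"
  ultimately have "e face_of ?S" by auto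
  moreover have "aff_dim e = 1"
    using \<open>e \<in> ?E\<close> UV0 by (auto simp: segment_convex_hull aff_dim_convex_hull)
  ultimately show "e edge_of ?S" by (simp add: edge_of_def)
next
  assume "e edge_of ?S"
  then have e: "e face_of ?S" "aff_dim e = 1" by (auto simp: edge_of_def)
  let ?V = "{P, P + U, P + U + V, P + V}"
  obtain W where W: "W \<subseteq> ?V" "e = convex hull W"
    using face_of_convex_hull_subset[OF _ e(1)] by (metis finite.emptyI finite_imp_compact finite_insert)
  have dW: "aff_dim W = 1" using e(2) W(2) by (simp add: aff_dim_convex_hull)
  have in_e: "z \<in> e" if "z \<in> W" for z using that by (simp add: W(2) hull_inc)
  have UV0: "U \<noteq> 0" "V \<noteq> 0" "U + V \<noteq> 0" "U \<noteq> V"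
  proof -
    show "U \<noteq> 0" "V \<noteq> 0" "U \<noteq> V" using UV by (auto simp: algebra_simps)
    show "U + V \<noteq> 0"
    proof
      assume "U + V = 0"
      then have "V = - U" by (simp add: add_eq_0_iff)
      then show False using UV by simp
    qed
  qed
  have not_all: False if all: "?V \<subseteq> e"
  proof -
    have "aff_dim {P, P + U, P + V} \<le> aff_dim e" using all by (intro aff_dim_subset) auto
    moreover have "\<not> collinear {P, P + U, P + V}"
    proof
      assume "collinear {P, P + U, P + V}"
      then obtain w where w: "\<And>x y. x \<in> {P, P + U, P + V} \<Longrightarrow> y \<in> {P, P + U, P + V} \<Longrightarrow> \<exists>c. x - y = c *\<^sub>R w"
        unfolding collinear_def by blast
      obtain c d where "U = c *\<^sub>R w" "V = d *\<^sub>R w" using w[of "P + U" P] w[of "P + V" P] by auto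
      then have "cnj U * V = complex_of_real (c * d) * (cnj w * w)" by (simp add: scaleR_conv_of_real)
      then show False using UV by simp
    qed
    ultimately show False using e(2) by (simp add: collinear_aff_dim)
  qed
  have mid: "x \<in> e \<and> y \<in> e" if "a \<in> e" "b \<in> e" "x \<in> ?S" "y \<in> ?S" "x \<noteq> y" "a + b = x + y" for a b x y
  proof -
    have "midpoint a b \<in> e" using face_of_imp_convex[OF e(1)] that(1,2) by (meson convex_contains_segment midpoint_in_closed_segment subsetD)
    moreover have "midpoint a b = midpoint x y" using that(6) by (simp add: midpoint_def)
    ultimately have "midpoint x y \<in> e" by simp
    moreover have "midpoint x y \<in> open_segment x y" using that(5) by simp
    ultimately show ?thesis using face_ofD[OF e(1) _ that(3,4)] by blast
  qed
  have VS: "P \<in> ?S" "P + U \<in> ?S" "P + U + V \<in> ?S" "P + V \<in> ?S" by (simp_all add: hull_inc)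
  have diag: "\<not> (P \<in> W \<and> P + U + V \<in> W)" "\<not> (P + U \<in> W \<and> P + V \<in> W)"
  proof -
    show "\<not> (P \<in> W \<and> P + U + V \<in> W)"
      using mid[OF in_e in_e VS(2,4)] not_all in_e UV0 by (auto simp: algebra_simps)
    show "\<not> (P + U \<in> W \<and> P + V \<in> W)"
      using mid[OF in_e in_e VS(1,3)] not_all in_e UV0 by (auto simp: algebra_simps)
  qed
  have two: "W = {x, y}" if "W \<subseteq> {x, y}" for x y
  proof -
    have "W \<noteq> {}" "W \<noteq> {x}" "W \<noteq> {y}" using dW by auto
    then show ?thesis using that by blast
  qed
  have "W \<subseteq> {P, P + U} \<or> W \<subseteq> {P + U, P + U + V} \<or> W \<subseteq> {P + U + V, P + V} \<or> W \<subseteq> {P + V, P}"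
    using W(1) diag by blast
  then show "e \<in> ?E" unfolding W(2) segment_convex_hull using two by blast
qed

lemma cell_edges:
  assumes c: "poly_cell c" and a: "cmod a = 1"
  shows "e edge_of (\<lambda>z. a * z + b) ` cell_hull c \<longleftrightarrow>
    (\<exists>(p, u)\<in>set (sides c). e = closed_segment (a * emb p + b) (a * emb (p + u) + b))"
proof -
  have h: "(\<lambda>z. a * z + b) ` (convex hull S) = convex hull ((\<lambda>z. a * z + b) ` S)" for S
  proof -
    have "(\<lambda>z. a * z + b) ` X = (+) b ` ((*) a ` X)" for X by (auto simp: image_image add.commute)
    then show ?thesis by (simp add: convex_hull_translation convex_hull_linear_image linear_times)
  qed
  obtain p u v where pu: "u \<in> set dirs" "cell_hull c = convex hull {emb p, emb p + emb u, emb p + emb u + emb v, emb p + emb v}"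
    "sides c = [(p, u), (p + u, v), (p + u + v, - u), (p + v, - v)]" "v = rot u \<or> v = rot (rot u)"
  proof (cases c)
    case (Rh p u)
    then show ?thesis using that[of u p "rot u"] c by (simp add: cell_hull_simps Let_def del: rot.simps)
  next
    case (Sq p u)
    then show ?thesis using that[of u p "rot (rot u)"] c by (simp add: cell_hull_simps emb_rot_rot Let_def del: rot.simps)
  qed (use c in simp)
  have aa: "cnj a * a = 1" using a by (simp add: complex_norm_square[symmetric] mult.commute)
  have uu: "cnj (emb u) * emb u = 1" using emb_dir[OF pu(1)] by (simp add: complex_norm_square[symmetric] mult.commute)
  have "cnj (a * emb u) * (a * emb v) = (cnj a * a) * (cnj (emb u) * emb v)" by (simp add: algebra_simps)
  then have eq: "cnj (a * emb u) * (a * emb v) = cnj (emb u) * emb v" by (simp only: aa mult_1)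
  have "cnj (emb u) * emb v = zeta \<or> cnj (emb u) * emb v = \<i>"
    using pu(4)
  proof
    assume "v = rot u"
    then have "cnj (emb u) * emb v = zeta * (cnj (emb u) * emb u)" by (simp add: emb_rot algebra_simps del: rot.simps)
    then show ?thesis by (simp add: uu)
  next
    assume "v = rot (rot u)"
    then have "cnj (emb u) * emb v = \<i> * (cnj (emb u) * emb u)" by (simp add: emb_rot_rot algebra_simps del: rot.simps)
    then show ?thesis by (simp add: uu)
  qed
  then have pos: "Im (cnj (a * emb u) * (a * emb v)) > 0" unfolding eq by (elim disjE) (simp_all only:, simp_all add: zeta_def)
  define P where "P = a * emb p + b"
  have H: "(\<lambda>z. a * z + b) ` cell_hull c = convex hull {P, P + a * emb u, P + a * emb u + a * emb v, P + a * emb v}"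
    unfolding pu(2) h by (simp add: P_def algebra_simps)
  show ?thesis
    unfolding H parallelogram_edges[OF pos, of e P] pu(3)
    by (simp add: P_def emb_add emb_uminus algebra_simps)
qed

lemma reversed_vector: "x = y + v \<Longrightarrow> x + u = y \<Longrightarrow> v = - u" for x y u v :: "'a::ab_group_add"
  by (metis add_diff_cancel_left' minus_diff_eq)

lemma same_vector: "x = y \<Longrightarrow> x + u = y + v \<Longrightarrow> v = u" for x y u v :: "'a::ab_group_add"
  by simp

lemma no_opposite_sides: "poly_cell c \<Longrightarrow> x \<in> set (sides c) \<Longrightarrow> rev_side x \<notin> set (sides c)"
proof -
  have "\<forall>s\<in>set polyseeds. \<forall>x\<in>set (sides s). rev_side x \<notin> set (sides s)" by code_simp
  moreover assume "poly_cell c" "x \<in> set (sides c)"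
  moreover from this(1) obtain z s where "s \<in> set polyseeds" "c = shift z s" using poly_cell_seed by blast
  moreover have "fst x + snd x - z = fst x - z + snd x" by simp
  ultimately show ?thesis by (simp only: sides_shift_iff rev_side_eq fst_conv snd_conv) (metis fst_conv snd_conv)
qed

lemma move_cell_mirror:
  assumes "tile_cell (Hs p u b)" "move a d (tile_of (Hs p u b)) = HalfSquare V S W"
  shows "move a d (tile_of (mirror (Hs p u b))) = HalfSquare V (V + W - S) W"
proof -
  have r: "rot (rot (- u)) = - rot (rot u)" "rot (rot (rot (rot u))) = - u" "- rot (rot (- rot (rot u))) = - u"
    by (simp_all add: rot_add rot8 del: rot.simps)
  show ?thesis using assms(2)
    by (cases b) (auto simp: move_def emb_add emb_diff emb_uminus rot_add rot8 algebra_simps simp del: rot.simps)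
qed

lemma Hs_tile_inj:
  assumes "tile_cell (Hs p u b)" "tile_cell c" "tile_of c = tile_of (Hs p u b)"
  shows "c = Hs p u b"
proof (cases c)
  case (Hs p' u' b')
  have u: "u \<in> set dirs" using assms(1) by (simp add: tile_cell_iff)
  then have "rot (rot u) \<noteq> - rot (rot u)" by (auto simp: dirs_def)
  then have ne: "q + rot (rot u) \<noteq> q - rot (rot u)" for q by (metis add_left_cancel diff_conv_add_uminus)
  have eq0: "p' = p \<and> p' + u' = p + u \<and> p' + u' + (if b' then rot (rot u') else - rot (rot u')) = p + u + (if b then rot (rot u) else - rot (rot u))"
    using assms(3) unfolding Hs tile_of.simps tile.inject emb_inj .
  then have "p' = p" "p' + u' = p + u" by blast+
  then have eq: "p' = p" "u' = u" by simp_all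
  have eq3: "p' + u' + (if b' then rot (rot u') else - rot (rot u')) = p + u + (if b then rot (rot u) else - rot (rot u))"
    using eq0 by blast
  have "b' = b" using eq3 ne[of "p + u"] ne[of "p + u", symmetric] unfolding eq(1,2) by (cases b; cases b') simp_all
  then show ?thesis using eq Hs by simp
qed (use assms in \<open>simp_all add: rhombus_def tile_cell_iff\<close>)

section \<open>The tiling seen through a window\<close>

text \<open>
  The tiling \<open>X\<close> agrees near the origin with the cells of a window, moved by \<open>z \<mapsto> a z + b\<close>; the centre \<open>\<beta>\<close> of the window is the point
  moved to the origin.
\<close>

locale placed = window s N \<beta> R for s N \<beta> R +
  fixes X a b
  assumes plane: "tiles_plane X" and a: "cmod a = 1" and b: "b = - (a * \<beta>)"
    and visible: "\<And>t. t \<in> X \<Longrightarrow> support t \<inter> cball 0 R \<noteq> {} \<Longrightarrow> \<exists>c\<in>Y 0. t = move a b (tile_of c)"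
begin

definition place :: "complex \<Rightarrow> complex" where "place z = a * z + b"

lemma place_norm: "cmod (place z) = dist \<beta> z"
proof -
  have "place z = a * (z - \<beta>)" unfolding place_def by (simp add: b algebra_simps)
  then show ?thesis by (simp add: norm_mult a dist_norm norm_minus_commute)
qed

lemma place_inj: "place z = place w \<longleftrightarrow> z = w"
  using a by (auto simp: place_def)

lemma place_image: "place ` A \<inter> cball 0 r \<noteq> {} \<longleftrightarrow> A \<inter> cball \<beta> r \<noteq> {}"
  by (auto simp: place_norm)

lemma support_placed: "c \<in> Y 0 \<Longrightarrow> support (move a b (tile_of c)) = place ` region c"
  by (simp add: support_move support_tile_of tile_cell_Y place_def image_def)

text \<open>
  An interior point of the cell lies in some tile of \<open>X\<close>, which is itself a cell of the window; cells of a packing that overlap are equal. The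
  margin 4 is the bound for the diameter of a tile.
\<close>

lemma placed_in_tiling:
  assumes c: "c \<in> Y 0" "region c \<inter> cball \<beta> (R - 4) \<noteq> {}"
  shows "move a b (tile_of c) \<in> X"
proof -
  obtain z where z: "z \<in> interior (region c)" using interior_region_nonempty[OF tile_cell_Y[OF c(1)]] by blast
  obtain w where w: "w \<in> region c" "dist \<beta> w \<le> R - 4" using c(2) by auto
  have "dist w z \<le> 4" using region_diameter[OF tile_cell_Y[OF c(1)] w(1)] z interior_subset by blast
  then have zR: "dist \<beta> z \<le> R" using w(2) dist_triangle[of \<beta> z w] by linarith
  have "place z \<in> (\<Union>t\<in>X. support t)" using plane by (simp add: tiles_plane_def)
  then obtain t where t: "t \<in> X" "place z \<in> support t" by blast
  moreover have "place z \<in> cball 0 R" using zR by (simp add: place_norm)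
  ultimately obtain c' where c': "c' \<in> Y 0" "t = move a b (tile_of c')" using visible[of t] by blast
  have "z \<in> region c'" using t(2) place_inj by (auto simp: c'(2) support_placed[OF c'(1)])
  then have "c = c'" using overlap_eq[OF packed_Y c(1) c'(1) z] by blast
  then show ?thesis using t c' by simp
qed

lemma near_mirror:
  assumes "t \<in> Y 0" "mirror t \<in> Y 0" "cell_hull (merge t) \<inter> cball \<beta> r \<noteq> {}"
  shows "region t \<inter> cball \<beta> (r + 4) \<noteq> {}" "region (mirror t) \<inter> cball \<beta> (r + 4) \<noteq> {}"
proof -
  have tc: "tile_cell t" "tile_cell (mirror t)" using assms tile_cell_Y by auto
  obtain z where z: "z \<in> region t \<or> z \<in> region (mirror t)" "dist \<beta> z \<le> r"
    using assms(3) unfolding cell_hull_merge[OF tc(1)] mem_cball[symmetric] by blast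
  obtain y k l where y: "(y, k) \<in> set (flags t)" "(y, l) \<in> set (flags (mirror t))" using mirror_flag[OF tc(1)] by blast
  have ry: "emb y \<in> region t" "emb y \<in> region (mirror t)" using flag_in_region tc y by blast+
  have "dist z (emb y) \<le> 4" using z(1) region_diameter tc ry by blast
  then have "dist \<beta> (emb y) \<le> r + 4" using z(2) dist_triangle[of \<beta> "emb y" z] by linarith
  then show "region t \<inter> cball \<beta> (r + 4) \<noteq> {}" "region (mirror t) \<inter> cball \<beta> (r + 4) \<noteq> {}" using ry by auto
qed

text \<open>
  Both sides are described by half-squares and their mirror images. The margin 8 pays for two diameters: from the disc to the
  mirror image, and from there to the boundary of the region where \<open>placed_in_tiling\<close> applies.
\<close>

lemma exhaustion_eq:
  assumes n: "real n + 8 \<le> R"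
  shows "exhaustion (merge_half_squares X) n = (\<lambda>c. place ` cell_hull c) ` polys n"
proof
  show "(\<lambda>c. place ` cell_hull c) ` polys n \<subseteq> exhaustion (merge_half_squares X) n"
  proof
    fix T assume "T \<in> (\<lambda>c. place ` cell_hull c) ` polys n"
    then obtain t where t: "t \<in> Y 0" "mirror t \<in> Y 0" "cell_hull (merge t) \<inter> cball \<beta> n \<noteq> {}" "T = place ` cell_hull (merge t)"
      by (auto simp: polys_def)
    have "cball \<beta> (real n + 4) \<subseteq> cball \<beta> (R - 4)" using n by (simp add: subset_cball)
    then have near: "region t \<inter> cball \<beta> (R - 4) \<noteq> {}" "region (mirror t) \<inter> cball \<beta> (R - 4) \<noteq> {}"
      using near_mirror[OF t(1-3)] by blast+
    have inX: "move a b (tile_of t) \<in> X" "move a b (tile_of (mirror t)) \<in> X"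
      using placed_in_tiling[OF t(1) near(1)] placed_in_tiling[OF t(2) near(2)] .
    have T: "T = support (move a b (tile_of t)) \<union> support (move a b (tile_of (mirror t)))"
      by (simp add: t support_placed cell_hull_merge[OF tile_cell_Y[OF t(1)]] image_Un)
    have "T \<in> merge_half_squares X"
    proof (cases t)
      case (Rh p u)
      then obtain A B C D where "move a b (tile_of t) = rhombus A B C D" by (simp add: move_rhombus)
      moreover have "T = support (move a b (tile_of t))" using T Rh by simp
      ultimately show ?thesis unfolding merge_half_squares_def using inX(1) by auto
    next
      case (Hs p u b')
      obtain V S W where V: "move a b (tile_of t) = HalfSquare V S W" by (simp add: Hs move_def)
      have "move a b (tile_of (mirror t)) = HalfSquare V (V + W - S) W"
        using move_cell_mirror[of p u b' a b V S W] tile_cell_Y[OF t(1)] V Hs by simp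
      then show ?thesis unfolding merge_half_squares_def using inX T V by auto
    qed (use tile_cell_Y[OF t(1)] in \<open>simp add: tile_cell_iff\<close>)
    moreover have "T \<inter> cball 0 n \<noteq> {}" using t(3,4) place_image by blast
    ultimately show "T \<in> exhaustion (merge_half_squares X) n" by (simp add: exhaustion_def)
  qed
next
  show "exhaustion (merge_half_squares X) n \<subseteq> (\<lambda>c. place ` cell_hull c) ` polys n"
  proof
    fix T assume "T \<in> exhaustion (merge_half_squares X) n"
    then have T: "T \<in> merge_half_squares X" "T \<inter> cball 0 n \<noteq> {}" by (auto simp: exhaustion_def)
    from T(1) consider A B C D where "rhombus A B C D \<in> X" "T = support (rhombus A B C D)"
      | V S W where "HalfSquare V S W \<in> X" "HalfSquare V (V + W - S) W \<in> X"
          "T = support (HalfSquare V S W) \<union> support (HalfSquare V (V + W - S) W)"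
      unfolding merge_half_squares_def by blast
    then show "T \<in> (\<lambda>c. place ` cell_hull c) ` polys n"
    proof cases
      case 1
      have "cball (0::complex) n \<subseteq> cball 0 R" using n by (simp add: subset_cball)
      then obtain c where c: "c \<in> Y 0" "rhombus A B C D = move a b (tile_of c)" using visible[OF 1(1)] T(2) 1(2) by blast
      obtain p u where Rh: "c = Rh p u"
        using c tile_cell_Y[OF c(1)] by (cases c) (simp_all add: rhombus_def move_def tile_cell_iff)
      have TT: "T = place ` cell_hull (merge c)"
        using 1(2) c support_placed[OF c(1)] cell_hull_merge[OF tile_cell_Y[OF c(1)]] Rh by simp
      moreover from this have "cell_hull (merge c) \<inter> cball \<beta> n \<noteq> {}" using T(2) place_image by blast
      moreover have "mirror c \<in> Y 0" using c(1) Rh by simp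
      ultimately have "merge c \<in> polys n" unfolding polys_def using c(1) by blast
      then show ?thesis using TT by blast
    next
      case 2
      have half: "\<exists>c\<in>Y 0. t = move a b (tile_of c)" if t: "t = HalfSquare V S W \<or> t = HalfSquare V (V + W - S) W" for t
      proof -
        have tX: "t \<in> X" using t 2 by blast
        obtain z where z: "z \<in> support (HalfSquare V S W) \<or> z \<in> support (HalfSquare V (V + W - S) W)" "cmod z \<le> n"
          using T(2) unfolding 2(3) by (metis Int_emptyI UnE mem_cball_0)
        have diam: "dist z V \<le> 4" if t': "t' \<in> X" "z \<in> support t'" "V \<in> support t'" for t'
        proof -
          obtain a' b' c where c: "cmod a' = 1" "tile_cell c" "t' = move a' b' (tile_of c)"
            using tiles_place[of t'] t'(1) plane by (auto simp: tiles_plane_def)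
          obtain z' V' where zV: "z = a' * z' + b'" "z' \<in> region c" "V = a' * V' + b'" "V' \<in> region c"
            using t'(2,3) by (auto simp: c support_move support_tile_of)
          have "dist z V = dist z' V'" using c(1) by (simp add: zV dist_norm norm_mult flip: right_diff_distrib)
          then show ?thesis using region_diameter[OF c(2) zV(2,4)] by simp
        qed
        have Vs: "V \<in> support (HalfSquare V S W)" "V \<in> support (HalfSquare V (V + W - S) W)" by (simp_all add: hull_inc)
        have "dist z V \<le> 4" using z(1) diam 2(1,2) Vs by blast
        then have "cmod V \<le> R" using z(2) n norm_triangle_sub[of V z] by (simp add: dist_norm norm_minus_commute)
        moreover have "V \<in> support t" using t Vs by blast
        ultimately have "V \<in> support t \<inter> cball 0 R" by simp
        then show ?thesis using visible[OF tX] by blast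
      qed
      obtain c where c: "c \<in> Y 0" "HalfSquare V S W = move a b (tile_of c)" using half by blast
      obtain c' where c': "c' \<in> Y 0" "HalfSquare V (V + W - S) W = move a b (tile_of c')" using half by blast
      obtain p u b' where Hs: "c = Hs p u b'"
        using c tile_cell_Y[OF c(1)] by (cases c) (simp_all add: rhombus_def move_def tile_cell_iff)
      have m: "move a b (tile_of (mirror c)) = HalfSquare V (V + W - S) W"
        using move_cell_mirror[of p u b' a b V S W] tile_cell_Y[OF c(1)] c(2) Hs by simp
      have inv: "cnj a * a = 1" using a by (simp add: complex_norm_square[symmetric] mult.commute)
      have "tile_of (mirror c) = tile_of c'"
      proof -
        have "move (cnj a) (- cnj a * b) (move a b t) = t" for t by (simp add: move_compose inv move_id)
        then show ?thesis using m c'(2) by metis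
      qed
      then have "c' = mirror c"
        using Hs_tile_inj tile_cell_Y[OF c'(1)] tile_cell_mirror[OF tile_cell_Y[OF c(1)]] Hs by (metis mirror.simps(1))
      then have TT: "T = place ` cell_hull (merge c)"
        using 2(3) c c' support_placed cell_hull_merge[OF tile_cell_Y[OF c(1)]] by (simp add: image_Un)
      moreover from this have "cell_hull (merge c) \<inter> cball \<beta> n \<noteq> {}" using T(2) place_image by blast
      moreover have "mirror c \<in> Y 0" using c'(1) \<open>c' = mirror c\<close> by simp
      ultimately have "merge c \<in> polys n" unfolding polys_def using c(1) by blast
      then show ?thesis using TT by blast
    qed
  qed
qed

text \<open>
  Merged cells can have the same region only if they share a tile.
\<close>

lemma placed_cells_inj:
  assumes c: "c \<in> polys r" "c' \<in> polys r" "place ` cell_hull c = place ` cell_hull c'"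
  shows "c = c'"
proof -
  have eq: "cell_hull c = cell_hull c'"
    using c(3) place_inj by (simp add: inj_image_eq_iff inj_def)
  obtain t where t: "t \<in> Y 0" "mirror t \<in> Y 0" "c = merge t" using c by (auto simp: polys_def)
  obtain t' where t': "t' \<in> Y 0" "mirror t' \<in> Y 0" "c' = merge t'" using c by (auto simp: polys_def)
  obtain z where z: "z \<in> interior (region t)" using interior_region_nonempty[OF tile_cell_Y[OF t(1)]] by blast
  then have "z \<in> cell_hull c" using interior_subset cell_hull_merge[OF tile_cell_Y[OF t(1)]] t(3) by blast
  then have "z \<in> region t' \<or> z \<in> region (mirror t')" using eq cell_hull_merge[OF tile_cell_Y[OF t'(1)]] t'(3) by blast
  then have "t = t' \<or> t = mirror t'" using overlap_eq[OF packed_Y t(1) _ z] t'(1,2) by blast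
  then show ?thesis using t(3) t'(3) merge_flags(2)[OF tile_cell_Y[OF t'(1)]] by auto
qed

text \<open>
  A common edge is a side of both cells. If it had the same direction in both, the cells would share a flag and be equal.
\<close>

lemma placed_adjacent:
  assumes c: "c \<in> polys r" "c' \<in> polys r"
  shows "tile_adjacent (place ` cell_hull c) (place ` cell_hull c') \<longleftrightarrow> adj c c'"
proof -
  have pl: "place ` cell_hull d = (\<lambda>z. a * z + b) ` cell_hull d" for d by (simp add: place_def image_def)
  have pc: "poly_cell c" "poly_cell c'" using c poly_cell_polys by auto
  have edges: "(\<exists>e. e edge_of place ` cell_hull c \<and> e edge_of place ` cell_hull c') \<longleftrightarrow>
      (\<exists>x\<in>set (sides c). \<exists>y\<in>set (sides c').
         closed_segment (place (emb (fst x))) (place (emb (fst x + snd x))) = closed_segment (place (emb (fst y))) (place (emb (fst y + snd y))))"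
    unfolding pl cell_edges[OF pc(1) a] cell_edges[OF pc(2) a] place_def split_def by blast
  show ?thesis
  proof
    assume "tile_adjacent (place ` cell_hull c) (place ` cell_hull c')"
    then have ne: "c \<noteq> c'" and "\<exists>e. e edge_of place ` cell_hull c \<and> e edge_of place ` cell_hull c'"
      unfolding tile_adjacent_def by blast+
    then obtain x y where s: "x \<in> set (sides c)" "y \<in> set (sides c')"
      "closed_segment (place (emb (fst x))) (place (emb (fst x + snd x))) = closed_segment (place (emb (fst y))) (place (emb (fst y + snd y)))"
      unfolding edges by blast
    from s(3) have "{place (emb (fst x)), place (emb (fst x + snd x))} = {place (emb (fst y)), place (emb (fst y + snd y))}"
      by (simp only: closed_segment_eq)
    then have "(fst x = fst y \<and> fst x + snd x = fst y + snd y) \<or> (fst x = fst y + snd y \<and> fst x + snd x = fst y)"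
      unfolding doubleton_eq_iff place_inj emb_inj .
    then have "y = x \<or> y = rev_side x"
    proof
      assume *: "fst x = fst y \<and> fst x + snd x = fst y + snd y"
      then have "snd y = snd x" using same_vector by blast
      then have "y = x" using * by (simp only: prod_eq_iff)
      then show ?thesis ..
    next
      assume *: "fst x = fst y + snd y \<and> fst x + snd x = fst y"
      then have "snd y = - snd x" using reversed_vector by blast
      then have "y = rev_side x" using * by (simp only: rev_side_eq prod_eq_iff fst_conv snd_conv)
      then show ?thesis ..
    qed
    then show "adj c c'"
    proof
      assume "y = x"
      then have "c = c'" using polys_flags_unique[OF c, of x] s(1,2) side_flag[OF pc(1)] side_flag[OF pc(2)] by blast
      then show ?thesis using ne by simp
    next
      assume "y = rev_side x"
      then show ?thesis using s(1,2) unfolding adj_def by blast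
    qed
  next
    assume "adj c c'"
    then obtain x where s: "x \<in> set (sides c)" "rev_side x \<in> set (sides c')" unfolding adj_def by blast
    then have "c \<noteq> c'" using no_opposite_sides[OF pc(1)] by blast
    then have "place ` cell_hull c \<noteq> place ` cell_hull c'" using placed_cells_inj[OF c] by blast
    moreover have r: "fst (rev_side x) = fst x + snd x" "fst (rev_side x) + snd (rev_side x) = fst x"
      by (simp_all only: rev_side_eq fst_conv snd_conv add.assoc right_minus add_0_right)
    have "\<exists>e. e edge_of place ` cell_hull c \<and> e edge_of place ` cell_hull c'"
      unfolding edges by (rule bexI[OF bexI[OF _ s(2)] s(1)], subst r(2), subst r(1), rule closed_segment_commute)
    ultimately show "tile_adjacent (place ` cell_hull c) (place ` cell_hull c')" unfolding tile_adjacent_def by blast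
  qed
qed

text \<open>
  The functions are transported along the bijection between cells and polygons.
\<close>

lemma eigenvalue_count:
  fixes I :: "'i set" and \<psi> :: "'i \<Rightarrow> cell \<Rightarrow> int" and rank :: "'i \<Rightarrow> nat"
  assumes n: "real n + 8 \<le> R" and "finite I"
    and eigen: "\<And>i v. i \<in> I \<Longrightarrow> v \<in> polys n \<Longrightarrow> (\<Sum>w | w \<in> polys n \<and> adj w v. \<psi> i v - \<psi> i w) = E * \<psi> i v"
    and pivot: "\<And>i. i \<in> I \<Longrightarrow> pivot i \<in> polys n \<and> \<psi> i (pivot i) \<noteq> 0"
    and triangular: "\<And>i j. i \<in> I \<Longrightarrow> j \<in> I \<Longrightarrow> i \<noteq> j \<Longrightarrow> rank j \<le> rank i \<Longrightarrow> \<psi> j (pivot i) = 0"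
  shows "card I \<le> spectral_trace (exhaustion (merge_half_squares X) n) tile_adjacent {real_of_int E}"
proof -
  define \<Phi> where "\<Phi> c = place ` cell_hull c" for c
  define V where "V = \<Phi> ` polys n"
  define \<psi>' where "\<psi>' i v = real_of_int (\<psi> i (inv_into (polys n) \<Phi> v))" for i v
  have inj: "inj_on \<Phi> (polys n)" using placed_cells_inj by (auto simp: \<Phi>_def inj_on_def)
  have val: "\<psi>' i (\<Phi> c) = real_of_int (\<psi> i c)" if "c \<in> polys n" for i c
    using that inj by (simp add: \<psi>'_def)
  interpret G: finite_graph V tile_adjacent
    using finite_polys tile_adjacent_sym by unfold_locales (auto simp: V_def)
  have "graph_laplacian V tile_adjacent (\<psi>' i) v = real_of_int E * \<psi>' i v" if i: "i \<in> I" and v: "v \<in> V" for i v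
  proof -
    obtain c where c: "c \<in> polys n" "v = \<Phi> c" using v by (auto simp: V_def)
    have nb: "{u. u \<in> V \<and> tile_adjacent u v} = \<Phi> ` {w. w \<in> polys n \<and> adj w c}"
      using placed_adjacent[OF _ c(1)] by (auto simp: V_def c \<Phi>_def)
    have "graph_laplacian V tile_adjacent (\<psi>' i) v = (\<Sum>w | w \<in> polys n \<and> adj w c. \<psi>' i (\<Phi> c) - \<psi>' i (\<Phi> w))"
      unfolding graph_laplacian_def nb c(2)[symmetric] by (subst sum.reindex) (auto intro: inj_on_subset[OF inj])
    also have "\<dots> = (\<Sum>w | w \<in> polys n \<and> adj w c. real_of_int (\<psi> i c - \<psi> i w))"
      by (rule sum.cong) (auto simp: val c)
    also have "\<dots> = real_of_int (\<Sum>w | w \<in> polys n \<and> adj w c. \<psi> i c - \<psi> i w)" by simp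
    also have "\<dots> = real_of_int E * \<psi>' i v" using eigen[OF i c(1)] by (simp add: val c)
    finally show ?thesis .
  qed
  then have "card I \<le> spectral_trace V tile_adjacent {real_of_int E}"
    by (rule G.triangular_eigenfunctions_le_trace[OF \<open>finite I\<close>, where rank = rank and pivot = "\<lambda>i. \<Phi> (pivot i)"])
      (use pivot triangular in \<open>auto simp: val V_def\<close>)
  then show ?thesis by (simp add: exhaustion_eq[OF n] V_def \<Phi>_def)
qed

end

text \<open>
  The finite patch of tiles that meet the disc lies in a supertile, and since the tiles cover the disc, so do the cells of the supertile.
\<close>

lemma ex_placed:
  assumes X: "associated_tiling X" and R: "R > 0"
  obtains s N \<beta> a b where "placed s N \<beta> R X a b"
proof -
  have plane: "tiles_plane X" using X by (simp add: associated_tiling_def)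
  define P where "P = {t \<in> X. support t \<inter> cball 0 R \<noteq> {}}"
  have "finite P" "P \<subseteq> X" using finite_meeting_ball[OF plane] by (auto simp: P_def)
  then obtain a b N s where sup: "cmod a = 1" "tile_cell s" "P \<subseteq> (\<lambda>c. move a b (tile_of c)) ` (inflate ^^ N) {s}"
    using patch_in_supertile[OF X] by metis
  define \<beta> where "\<beta> = - (cnj a * b)"
  have aa: "a * cnj a = 1" using sup(1) by (simp add: complex_norm_square[symmetric])
  have b: "b = - (a * \<beta>)" using aa by (simp add: \<beta>_def flip: mult.assoc)
  have "cball \<beta> R \<subseteq> (\<Union>c\<in>(inflate ^^ N) {s}. region c)"
  proof
    fix z assume "z \<in> cball \<beta> R"
    moreover have "a * z + b = a * (z - \<beta>)" by (simp add: b algebra_simps)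
    ultimately have zR: "a * z + b \<in> cball 0 R" using sup(1) by (simp add: norm_mult dist_norm norm_minus_commute)
    have "a * z + b \<in> (\<Union>t\<in>X. support t)" using plane by (simp add: tiles_plane_def)
    then obtain t where t: "t \<in> X" "a * z + b \<in> support t" by blast
    then have "t \<in> P" using zR by (auto simp: P_def)
    then obtain c where c: "c \<in> (inflate ^^ N) {s}" "t = move a b (tile_of c)" using sup(3) by blast
    have "tile_cell c" using c(1) packed_iterate[OF packed_singleton[OF sup(2)]] by (auto simp: packed_def)
    then obtain z' where "z' \<in> region c" "a * z + b = a * z' + b" using t(2) by (auto simp: c support_move support_tile_of)
    then have "z \<in> region c" using sup(1) by auto
    then show "z \<in> (\<Union>c\<in>(inflate ^^ N) {s}. region c)" using c(1) by blast
  qed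
  then interpret window s N \<beta> R using sup(2) R by unfold_locales
  have "placed s N \<beta> R X a b"
  proof unfold_locales
    show "\<exists>c\<in>Y 0. t = move a b (tile_of c)" if "t \<in> X" "support t \<inter> cball 0 R \<noteq> {}" for t
      using that sup(3) by (auto simp: P_def Y_def)
  qed (use plane sup(1) b in auto)
  then show ?thesis using that by blast
qed

section \<open>Counting eigenfunctions\<close>

lemma pivot_entries:
  "\<exists>l<length f4_data. f4_pivot = fst (f4_data ! l)" "\<exists>l<length h4_data. h4_pivot = fst (h4_data ! l)"
  "\<exists>l<length p_data. p_pivot = fst (p_data ! l)" "\<exists>l<length q_data. q_pivot = fst (q_data ! l)"
  "\<exists>l<length f6_data. f6_pivot = fst (f6_data ! l)" "\<exists>l<length h6_data. h6_pivot = fst (h6_data ! l)"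
proof -
  have "0 < length f4_data" "0 < length f6_data" "2 < length h4_data" "0 < length h6_data" "12 < length p_data" "8 < length q_data"
    by code_simp+
  then show "\<exists>l<length f4_data. f4_pivot = fst (f4_data ! l)" "\<exists>l<length h4_data. h4_pivot = fst (h4_data ! l)"
    "\<exists>l<length p_data. p_pivot = fst (p_data ! l)" "\<exists>l<length q_data. q_pivot = fst (q_data ! l)"
    "\<exists>l<length f6_data. f6_pivot = fst (f6_data ! l)" "\<exists>l<length h6_data. h6_pivot = fst (h6_data ! l)"
    unfolding f4_pivot_def h4_pivot_def p_pivot_def q_pivot_def f6_pivot_def h6_pivot_def by blast+
qed

lemma poly_data_all: "\<forall>(c, _)\<in>set f4_data. poly_cell c" "\<forall>(c, _)\<in>set f6_data. poly_cell c" "\<forall>(c, _)\<in>set h4_data. poly_cell c"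
  "\<forall>(c, _)\<in>set h6_data. poly_cell c" "\<forall>(c, _)\<in>set p_data. poly_cell c" "\<forall>(c, _)\<in>set q_data. poly_cell c"
  using poly_data unfolding set_append by blast+

lemma less_4: "i < 4 \<longleftrightarrow> i = 0 \<or> i = 1 \<or> i = 2 \<or> i = (3::nat)" by auto

lemma less_2: "i < 2 \<longleftrightarrow> i = 0 \<or> i = (1::nat)" by auto

context window
begin

text \<open>
  Existential quantification hides the index set, whose description differs between the two energies.
\<close>

definition eigen_system :: "real \<Rightarrow> int \<Rightarrow> nat \<Rightarrow> bool" where
  "eigen_system r E k \<longleftrightarrow> (\<exists>(I :: (nat \<times> pt) set) \<psi> pivot. finite I \<and> card I = k \<and>
     (\<forall>i\<in>I. \<forall>v\<in>polys r. (\<Sum>w | w \<in> polys r \<and> adj w v. \<psi> i v - \<psi> i w) = E * \<psi> i v) \<and>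
     (\<forall>i\<in>I. pivot i \<in> polys r \<and> \<psi> i (pivot i) \<noteq> 0) \<and>
     (\<forall>i\<in>I. \<forall>j\<in>I. i \<noteq> j \<longrightarrow> fst j \<le> fst i \<longrightarrow> \<psi> j (pivot i) = 0))"

text \<open>
  The order of the kinds is that of \<open>[f4_data, h4_data, p_data, q_data]\<close>. The two kinds at level 4 are kept apart by distance and by the choice of the
  pivot of \<open>q_data\<close> outside the support of the copy of \<open>p_data\<close> at the same vertex.
\<close>

lemma eigen_system_4:
  assumes N: "4 \<le> N" and r: "\<rho> + 300 \<le> R" "\<rho> + 290 \<le> r"
  shows "eigen_system r 4 (\<Sum>i<4. card (verts ([2, 3, 4, 4] ! i) \<rho>))"
proof -
  let ?lev = "\<lambda>i. [2, 3, 4, 4] ! i" and ?dat = "\<lambda>i. [f4_data, h4_data, p_data, q_data] ! i"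
    and ?piv = "\<lambda>i. [f4_pivot, h4_pivot, p_pivot, q_pivot] ! i" and ?sgn = "\<lambda>i. - 1"
  have lev: "?lev i \<in> {2, 3, 4}" if "i < 4" for i using that by (auto simp: less_4)
  have eig: "local_eigen 0 (?sgn i) (?dat i)" if "i < 4" for i
    using that eigen_f4 eigen_h4 eigen_p eigen_q by (auto simp only: less_4) simp_all
  have sgn: "?sgn i * ?sgn i = (1::int)" for i :: nat by simp
  have pres: "all_present (two_wedges (patch (?lev i - 2))) (?dat i)" if "i < 4" for i
    using that present_f4 present_h4 present_p present_q by (auto simp only: less_4) simp_all
  have poly: "\<forall>(c, _)\<in>set (?dat i). poly_cell c" if "i < 4" for i
    using that poly_data_all unfolding less_4 by (elim disjE) simp_all
  have piv: "\<exists>l<length (?dat i). ?piv i = fst (?dat i ! l)" if "i < 4" for i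
    using that pivot_entries unfolding less_4 by (elim disjE) simp_all
  have val: "val_at (?sgn i) (?dat i) (?piv i) \<noteq> 0" if "i < 4" for i
    using that value_f4 value_h4 value_p value_q by (auto simp: less_4)
  have tri: "(?lev j = ?lev i \<and> near (level_norm (?lev i)) d \<and> (j \<noteq> i \<longrightarrow> d \<noteq> 0)) \<or>
      (refuted witnesses d \<and> ?lev i = 4 \<and> ?lev j \<in> {2, 3})"
    if "i < 4" "j \<le> i" and d: "d \<in> set (occurrences (?piv i) (?dat j))" for i j d
  proof -
    have n: "level_norm 2 = (17, 12)" "level_norm 3 = (99, 70)" "level_norm 4 = (577, 408)" by (simp_all add: level_norm_def)
    consider "i = 0" "j = 0" | "i = 1" "j = 0" | "i = 1" "j = 1" | "i = 2" "j = 0" | "i = 2" "j = 1" | "i = 2" "j = 2"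
      | "i = 3" "j = 0" | "i = 3" "j = 1" | "i = 3" "j = 2" | "i = 3" "j = 3"
      using \<open>i < 4\<close> \<open>j \<le> i\<close> less_4[of i] less_4[of j] by force
    then show ?thesis
    proof cases
      case 1 then show ?thesis using d near_f4 by (simp add: n)
    next
      case 2 then show ?thesis using d apart_h4_f4 by simp
    next
      case 3 then show ?thesis using d near_h4 by (simp add: n)
    next
      case 4 then show ?thesis using d refuted_p_f4 by simp
    next
      case 5 then show ?thesis using d refuted_p_h4 by simp
    next
      case 6 then show ?thesis using d near_p by (simp add: n)
    next
      case 7 then show ?thesis using d apart_q_f4 by simp
    next
      case 8 then show ?thesis using d refuted_q_h4 by simp
    next
      case 9 then show ?thesis using d near_q_p by (simp add: n)
    next
      case 10 then show ?thesis using d near_q by (simp add: n)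
    qed
  qed
  note F = triangular_family[where m = 4 and lev = ?lev and dat = ?dat and piv = ?piv and sgn = ?sgn, OF N r lev eig sgn pres poly piv val tri]
  have lam: "4 - 0 = (4::int)" by simp
  show ?thesis
    unfolding eigen_system_def
  proof (rule exI[of _ "SIGMA i:{..<4}. verts (?lev i) \<rho>"], rule exI[of _ "\<lambda>(i, x). psi (?sgn i) (?dat i) x"],
      rule exI[of _ "\<lambda>(i, x). shift x (?piv i)"], intro conjI ballI impI)
  qed ((rule F(1) F(2) F(3)[unfolded lam] F(4)[THEN conjunct1] F(4)[THEN conjunct2] F(5); assumption)+)
qed

lemma eigen_system_6:
  assumes N: "4 \<le> N" and r: "\<rho> + 300 \<le> R" "\<rho> + 290 \<le> r"
  shows "eigen_system r 6 (\<Sum>i<2. card (verts ([2, 3] ! i) \<rho>))"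
proof -
  let ?lev = "\<lambda>i. [2, 3] ! i" and ?dat = "\<lambda>i. [f6_data, h6_data] ! i"
    and ?piv = "\<lambda>i. [f6_pivot, h6_pivot] ! i" and ?sgn = "\<lambda>i. [- 1, 1] ! i"
  have lev: "?lev i \<in> {2, 3, 4}" if "i < 2" for i using that by (auto simp: less_2)
  have eig: "local_eigen (- 2) (?sgn i) (?dat i)" if "i < 2" for i
    using that eigen_f6 eigen_h6 by (auto simp only: less_2) simp_all
  have sgn: "?sgn i * ?sgn i = (1::int)" if "i < 2" for i using that by (auto simp: less_2)
  have pres: "all_present (two_wedges (patch (?lev i - 2))) (?dat i)" if "i < 2" for i
    using that present_f6 present_h6 by (auto simp only: less_2) simp_all
  have poly: "\<forall>(c, _)\<in>set (?dat i). poly_cell c" if "i < 2" for i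
    using that poly_data_all unfolding less_2 by (elim disjE) simp_all
  have piv: "\<exists>l<length (?dat i). ?piv i = fst (?dat i ! l)" if "i < 2" for i
    using that pivot_entries unfolding less_2 by (elim disjE) simp_all
  have val: "val_at (?sgn i) (?dat i) (?piv i) \<noteq> 0" if "i < 2" for i
    using that value_f6 value_h6 by (auto simp: less_2)
  have tri: "(?lev j = ?lev i \<and> near (level_norm (?lev i)) d \<and> (j \<noteq> i \<longrightarrow> d \<noteq> 0)) \<or>
      (refuted witnesses d \<and> ?lev i = 4 \<and> ?lev j \<in> {2, 3})"
    if "i < 2" "j \<le> i" and d: "d \<in> set (occurrences (?piv i) (?dat j))" for i j d
  proof -
    have n: "level_norm 2 = (17, 12)" "level_norm 3 = (99, 70)" by (simp_all add: level_norm_def)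
    consider "i = 0" "j = 0" | "i = 1" "j = 0" | "i = 1" "j = 1"
      using \<open>i < 2\<close> \<open>j \<le> i\<close> less_2[of i] less_2[of j] by force
    then show ?thesis
    proof cases
      case 1 then show ?thesis using d near_f6 by (simp add: n)
    next
      case 2 then show ?thesis using d apart_h6_f6 by simp
    next
      case 3 then show ?thesis using d near_h6 by (simp add: n)
    qed
  qed
  note F = triangular_family[where m = 2 and lev = ?lev and dat = ?dat and piv = ?piv and sgn = ?sgn, OF N r lev eig sgn pres poly piv val tri]
  have lam: "4 - (- 2) = (6::int)" by simp
  show ?thesis
    unfolding eigen_system_def
  proof (rule exI[of _ "SIGMA i:{..<2}. verts (?lev i) \<rho>"], rule exI[of _ "\<lambda>(i, x). psi (?sgn i) (?dat i) x"],
      rule exI[of _ "\<lambda>(i, x). shift x (?piv i)"], intro conjI ballI impI)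
  qed ((rule F(1) F(2) F(3)[unfolded lam] F(4)[THEN conjunct1] F(4)[THEN conjunct2] F(5); assumption)+)
qed

end

text \<open>
  For large \<open>n\<close> the exhausting set is that of a window of radius slightly larger than \<open>n\<close>, where the copies are
  independent eigenfunctions and are as frequent as the vertices that carry them.
\<close>

lemma eigenvalue_frequency:
  fixes m :: nat and lev :: "nat \<Rightarrow> nat" and E :: int
  defines "c \<equiv> (\<Sum>i<m. 1 / silver ^ (2 * lev i))"
  assumes X: "associated_tiling X" and m: "m > 0" and \<epsilon>: "\<epsilon> > 0"
    and sys: "\<And>s N \<beta> R \<rho> r. window s N \<beta> R \<Longrightarrow> 4 \<le> N \<Longrightarrow> \<rho> + 300 \<le> R \<Longrightarrow> \<rho> + 290 \<le> r \<Longrightarrow>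
      window.eigen_system s N \<beta> r E (\<Sum>i<m. card (window.verts s N \<beta> (lev i) \<rho>))"
  shows "eventually (\<lambda>n. finite (exhaustion (merge_half_squares X) n) \<and> exhaustion (merge_half_squares X) n \<noteq> {} \<and>
    (c - \<epsilon>) * card (exhaustion (merge_half_squares X) n) \<le>
      spectral_trace (exhaustion (merge_half_squares X) n) tile_adjacent {real_of_int E}) sequentially"
proof -
  have c0: "c > 0" unfolding c_def using m silver_pow_ge(2) by (intro sum_pos) auto
  \<comment> \<open>With \<open>c - \<delta>\<close> positive there is at least one copy, so the graph is not empty.\<close>
  define \<delta> where "\<delta> = min \<epsilon> (c / 2)"
  have \<delta>: "\<delta> > 0" "\<delta> \<le> \<epsilon>" "c - \<delta> > 0" using \<epsilon> c0 by (auto simp: \<delta>_def)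
  have dm: "\<delta> / m > 0" using \<delta> m by simp
  obtain R0 where R0: "\<And>i s N \<beta> R. window s N \<beta> R \<Longrightarrow> R0 i \<le> R \<Longrightarrow>
    (1 / silver ^ (2 * lev i) - \<delta> / m) * (\<Sum>c\<in>window.meeting s N \<beta> 0 R. length (flags c)) \<le> 8 * card (window.verts s N \<beta> (lev i) (R - 300))"
    using vertex_frequency[OF dm, of "lev _"] by metis
  \<comment> \<open>The summand 60 forces four levels, because \<open>60 > 2 * silver ^ 3\<close>.\<close>
  define n0 where "n0 = nat \<lceil>60 + (\<Sum>i<m. \<bar>R0 i\<bar>)\<rceil>"
  have "finite (exhaustion (merge_half_squares X) n) \<and> exhaustion (merge_half_squares X) n \<noteq> {} \<and>
    (c - \<epsilon>) * card (exhaustion (merge_half_squares X) n) \<le>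
      spectral_trace (exhaustion (merge_half_squares X) n) tile_adjacent {real_of_int E}" if n: "n \<ge> n0" for n
  proof -
    define R where "R = real n + 8"
    have R: "R > 0" "R \<ge> 60 + (\<Sum>i<m. \<bar>R0 i\<bar>)" using n by (auto simp: R_def n0_def)
    have Ri: "R0 i \<le> R" if "i < m" for i
      using R(2) member_le_sum[of i "{..<m}" "\<lambda>i. \<bar>R0 i\<bar>"] that by auto
    have "0 \<le> (\<Sum>i<m. \<bar>R0 i\<bar>)" by (simp add: sum_nonneg)
    then have R60: "R \<ge> 60" using R(2) by linarith
    obtain s N \<beta> a b where "placed s N \<beta> R X a b" using ex_placed[OF X R(1)] .
    then interpret placed s N \<beta> R X a b .
    have w: "window s N \<beta> R" by (rule window_axioms)
    have N: "4 \<le> N"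
    proof (rule ccontr)
      assume "\<not> 4 \<le> N"
      then have "silver ^ N \<le> silver ^ 3" using silver_gt by (intro power_increasing) auto
      also have "silver ^ 3 \<le> 3 ^ 3" using sqrt2_less_2 by (intro power_mono) (auto simp: silver_def)
      finally show False using level_large R60 by simp
    qed
    define S where "S = (\<Sum>c\<in>meeting 0 R. length (flags c))"
    define K where "K = (\<Sum>i<m. card (verts (lev i) (R - 300)))"
    have "(\<Sum>i<m. (1 / silver ^ (2 * lev i) - \<delta> / m) * S) \<le> (\<Sum>i<m. 8 * real (card (verts (lev i) (R - 300))))"
      using R0[OF w Ri] by (intro sum_mono) (simp add: S_def)
    moreover have "(\<Sum>i<m. (1 / silver ^ (2 * lev i) - \<delta> / m) * S) = (c - \<delta>) * S"
      using m by (simp add: c_def sum_distrib_right[symmetric] sum_subtractf)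
    ultimately have KS: "(c - \<delta>) * S \<le> 8 * real K" by (simp add: K_def sum_distrib_left)
    have "8 * card (polys n) \<le> (\<Sum>c\<in>meeting 0 (real n + 4). length (flags c))" by (rule polys_count)
    also have "\<dots> \<le> S"
      unfolding S_def using finite_inner by (intro sum_mono2) (auto simp: meeting_def R_def)
    finally have PS: "8 * card (polys n) \<le> S" .
    have "0 < R\<^sup>2" using R(1) by simp
    moreover have "R\<^sup>2 \<le> 16 * real S" using flags_lower by (simp only: S_def of_nat_mult of_nat_numeral)
    ultimately have "S > 0" by (cases "S = 0") auto
    then have "0 < (c - \<delta>) * S" using \<delta>(3) by simp
    then have "K > 0" using KS by (cases K) auto
    have "eigen_system n E K" unfolding K_def by (rule sys[OF w N]) (simp_all add: R_def)
    then obtain I :: "(nat \<times> pt) set" and \<psi> pivot where I: "finite I" "card I = K"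
      and sys':
      "\<forall>i\<in>I. \<forall>v\<in>polys n. (\<Sum>w | w \<in> polys n \<and> adj w v. \<psi> i v - \<psi> i w) = E * \<psi> i v"
      "\<forall>i\<in>I. pivot i \<in> polys n \<and> \<psi> i (pivot i) \<noteq> 0"
      "\<forall>i\<in>I. \<forall>j\<in>I. i \<noteq> j \<longrightarrow> fst j \<le> fst i \<longrightarrow> \<psi> j (pivot i) = 0"
      unfolding eigen_system_def by (elim exE conjE) (rule that; assumption)
    have nR: "real n + 8 \<le> R" by (simp add: R_def)
    have tr: "K \<le> spectral_trace (exhaustion (merge_half_squares X) n) tile_adjacent {real_of_int E}"
      using eigenvalue_count[OF nR I(1) sys'[rule_format]] I(2) by simp
    have ex: "exhaustion (merge_half_squares X) n = (\<lambda>c. place ` cell_hull c) ` polys n" by (rule exhaustion_eq[OF nR])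
    have "card ((\<lambda>c. place ` cell_hull c) ` polys n) = card (polys n)"
      using placed_cells_inj by (intro card_image) (auto simp: inj_on_def)
    then have card: "card (exhaustion (merge_half_squares X) n) = card (polys n)" by (simp add: ex)
    have "(c - \<epsilon>) * card (polys n) \<le> (c - \<delta>) * card (polys n)" using \<delta> by (intro mult_right_mono) auto
    also have "8 * \<dots> \<le> (c - \<delta>) * S"
    proof -
      have "8 * real (card (polys n)) \<le> S" using PS by linarith
      from mult_left_mono[OF this, of "c - \<delta>"] show ?thesis using \<delta>(3) by (simp add: algebra_simps)
    qed
    finally have "(c - \<epsilon>) * card (polys n) \<le> K" using KS by simp
    moreover have "polys n \<noteq> {}" using sys'(2) I(2) \<open>K > 0\<close> by (metis card.empty empty_iff equals0I less_numeral_extra(3))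
    moreover have "finite (exhaustion (merge_half_squares X) n)" by (simp add: ex finite_polys)
    moreover have "exhaustion (merge_half_squares X) n \<noteq> {}" using \<open>polys n \<noteq> {}\<close> by (simp add: ex)
    ultimately show ?thesis using tr card by simp
  qed
  then show ?thesis unfolding eventually_sequentially by blast
qed

theorem theorem1p6:
  fixes \<T> :: "complex set set" and \<nu> :: "real measure" and k :: "real \<Rightarrow> real"
  assumes "ammann_beenker_tiling \<T>"
    and "density_of_states \<T> \<nu>"
    and "k = cdf \<nu>"
  shows "right_limit k 4 - left_limit k 4 \<ge> 1270 - 898 * sqrt 2 \<and>
         right_limit k 6 - left_limit k 6 \<ge> 116 - 82 * sqrt 2"
proof -
  obtain X where X: "associated_tiling X" "\<T> = merge_half_squares X" using assms(1) by (auto simp: ammann_beenker_tiling_def)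
  define t :: real where "t = sqrt 2 - 1"
  have pw: "1 / silver ^ n = t ^ n" for n
    using silver_inverse by (simp add: t_def power_one_over[symmetric])
  have t2: "t\<^sup>2 = 3 - 2 * sqrt 2" by (simp add: t_def power2_eq_square algebra_simps)
  have t4: "t ^ 4 = 17 - 12 * sqrt 2"
  proof -
    have "t ^ 4 = (t\<^sup>2)\<^sup>2" by simp
    then show ?thesis unfolding t2 by (simp add: power2_eq_square algebra_simps)
  qed
  have t6: "t ^ 6 = 99 - 70 * sqrt 2"
  proof -
    have "t ^ 6 = t ^ 4 * t\<^sup>2" by (simp flip: power_add)
    then show ?thesis unfolding t2 t4 by (simp add: algebra_simps)
  qed
  have t8: "t ^ 8 = 577 - 408 * sqrt 2"
  proof -
    have "t ^ 8 = t ^ 4 * t ^ 4" by (simp flip: power_add)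
    then show ?thesis unfolding t4 by (simp add: algebra_simps)
  qed
  have sum4: "(\<Sum>i<4. f i) = f 0 + f 1 + f 2 + f 3" and sum2: "(\<Sum>i<2. f i) = f 0 + f 1" for f :: "nat \<Rightarrow> real"
    by (simp_all add: eval_nat_numeral)
  have four: "(\<Sum>i<4. 1 / silver ^ (2 * ([2, 3, 4, 4] ! i))) = 1270 - 898 * sqrt 2"
    by (simp only: pw sum4) (simp add: t4 t6 t8)
  have six: "(\<Sum>i<2. 1 / silver ^ (2 * ([2, 3] ! i))) = 116 - 82 * sqrt 2"
    by (simp only: pw sum2) (simp add: t4 t6 t8)
  have "1270 - 898 * sqrt 2 \<le> right_limit (cdf \<nu>) 4 - left_limit (cdf \<nu>) 4"
  proof (rule jump_ge_of_eigenvalue_frequency[OF assms(2)])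
    fix \<epsilon> :: real assume "\<epsilon> > 0"
    from eigenvalue_frequency[where m = 4 and lev = "\<lambda>i. [2, 3, 4, 4] ! i" and E = 4, OF X(1) _ this window.eigen_system_4]
    show "eventually (\<lambda>n. finite (exhaustion \<T> n) \<and> exhaustion \<T> n \<noteq> {} \<and>
      (1270 - 898 * sqrt 2 - \<epsilon>) * card (exhaustion \<T> n) \<le> spectral_trace (exhaustion \<T> n) tile_adjacent {4}) sequentially"
      unfolding four X(2) by simp
  qed
  moreover have "116 - 82 * sqrt 2 \<le> right_limit (cdf \<nu>) 6 - left_limit (cdf \<nu>) 6"
  proof (rule jump_ge_of_eigenvalue_frequency[OF assms(2)])
    fix \<epsilon> :: real assume "\<epsilon> > 0"
    from eigenvalue_frequency[where m = 2 and lev = "\<lambda>i. [2, 3] ! i" and E = 6, OF X(1) _ this window.eigen_system_6]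
    show "eventually (\<lambda>n. finite (exhaustion \<T> n) \<and> exhaustion \<T> n \<noteq> {} \<and>
      (116 - 82 * sqrt 2 - \<epsilon>) * card (exhaustion \<T> n) \<le> spectral_trace (exhaustion \<T> n) tile_adjacent {6}) sequentially"
      unfolding six X(2) by simp
  qed
  ultimately show ?thesis using assms(3) by simp
qed

end
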